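(* Let $(M,g)$ be an oriented Riemannian four-manifold which is generalized $m$-quasi-Einstein, i.e. there are $f,\lambda\in C^\infty(M)$ and $m\in(\mathbb{R}\setminus\{0\})\cup\{\pm\infty\}$ such that $$\mathrm{Ric}_f^m:=\mathrm{Ric}+\nabla^2f-\frac1m\,df\otimes df=\lambda g$$ (with $\frac1m=0$ if $m=\pm\infty$). Then, for each choice of sign $\pm$ (the same throughout), $$\Delta_f|W^{\pm}|^2=2|\nabla W^{\pm}|^2+\Big(4\lambda+\frac2m|\nabla f|^2\Big)|W^{\pm}|^2-36\det W^{\pm}-\Big(1+\frac2m\Big)\big\langle(\nabla^2f\circ\nabla^2f)^{\pm},W^{\pm}\big\rangle .$$
   Context: Curvature sign convention: $K(e_i,e_j)=R_{ijij}$ for orthonormal $e_i,e_j$, $R_{ik}=g^{jl}R_{ijkl}$, $R=g^{ij}R_{ij}$. $W$ is the Weyl tensor, viewed as a $(0,4)$-tensor and as the symmetric operator on $\wedge^2TM$ with $\langle W(e_i\wedge e_j),e_k\wedge e_l\rangle=W_{ijkl}$, where $\{e_i\wedge e_j\}_{i<j}$ is orthonormal for an orthonormal frame $\{e_i\}$. The Hodge star gives $\wedge^2TM=\wedge^+M\oplus\wedge^-M$ ($\pm1$ eigenbundles); $\alpha^{\pm}$ denotes the projection of $\alpha$ to $\wedge^{\pm}M$. For a $(0,4)$-tensor $T$ antisymmetric in its first two and in its last two indices (a bilinear form on 2-forms), $T^{\pm}(\alpha,\beta)=T(\alpha^{\pm},\beta^{\pm})$. $W^{\pm}$ are the self-dual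 and anti-self-dual parts of $W$; $\det W^{\pm}$ is the determinant of $W^{\pm}$ as an endomorphism of the rank-3 bundle $\wedge^{\pm}M$. Inner product of $(0,4)$-tensors: $\langle S,T\rangle=\frac14S_{ijkl}T^{ijkl}$, $|T|^2=\langle T,T\rangle$, and $|\nabla T|^2=\frac14\nabla_pT_{ijkl}\nabla^pT^{ijkl}$. Also $\Delta_f=\Delta-\langle\nabla f,\nabla\,\cdot\,\rangle$, where $\Delta=\nabla^p\nabla_p$. For symmetric $(0,2)$-tensors $\alpha,\beta$, $(\alpha\circ\beta)_{ijkl}=\alpha_{ik}\beta_{jl}+\alpha_{jl}\beta_{ik}-\alpha_{il}\beta_{jk}-\alpha_{jk}\beta_{il}$. *)

theory Defs
  imports "HOL-Analysis.Analysis"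
begin

section \<open>Smooth functions between normed spaces\<close>

text \<open>
  Used only on open subsets of finite-dimensional spaces, where \<open>C_k_on k S f\<close> says that \<open>f\<close> is
  of class $C^k$ on \<open>S\<close>: the iterated directional derivatives exist and are continuous.
\<close>

primrec C_k_on ::
    "nat \<Rightarrow> 'a::real_normed_vector set \<Rightarrow> ('a \<Rightarrow> 'b::real_normed_vector) \<Rightarrow> bool" where
  "C_k_on 0 S f \<longleftrightarrow> continuous_on S f"
| "C_k_on (Suc k) S f \<longleftrightarrow>
     (\<forall>x\<in>S. f differentiable (at x)) \<and> (\<forall>v. C_k_on k S (\<lambda>x. frechet_derivative f (at x) v))"

definition smooth_on ::
    "'a::real_normed_vector set \<Rightarrow> ('a \<Rightarrow> 'b::real_normed_vector) \<Rightarrow> bool" where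
  "smooth_on S f \<longleftrightarrow> (\<forall>k. C_k_on k S f)"


section \<open>Oriented Riemannian manifolds\<close>

text \<open>A chart is a pair of its domain and its coordinate map (irrelevant off the domain).\<close>

type_synonym ('a, 'n) chart = "'a set \<times> ('a \<Rightarrow> real^'n)"

abbreviation chart_image :: "('a, 'n) chart \<Rightarrow> (real^'n) set" where
  "chart_image c \<equiv> snd c ` fst c"

definition coord_rep :: "('a, 'n) chart \<Rightarrow> ('a \<Rightarrow> 'b) \<Rightarrow> real^'n \<Rightarrow> 'b" where
  "coord_rep c u = u \<circ> inv_into (fst c) (snd c)"

definition transition :: "('a, 'n) chart \<Rightarrow> ('a, 'n) chart \<Rightarrow> real^'n \<Rightarrow> real^'n" where
  "transition c d = coord_rep c (snd d)"

text \<open>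
  The atlas is not required to be maximal; every maximal (oriented) smooth atlas is an instance.
\<close>

locale smooth_manifold =
  fixes X :: "'a topology" and A :: "('a, 'n::finite) chart set"
  assumes hausdorff: "Hausdorff_space X"
    and second_countable: "second_countable X"
    and atlas_covers: "(\<Union>c\<in>A. fst c) = topspace X"
    and chart_domain_open: "c \<in> A \<Longrightarrow> openin X (fst c)"
    and chart_image_open: "c \<in> A \<Longrightarrow> open (chart_image c)"
    and chart_homeomorphic:
      "c \<in> A \<Longrightarrow> homeomorphic_map (subtopology X (fst c)) (top_of_set (chart_image c)) (snd c)"
    and transition_smooth:
      "c \<in> A \<Longrightarrow> d \<in> A \<Longrightarrow> smooth_on (snd c ` (fst c \<inter> fst d)) (transition c d)"

definition smooth_fun :: "('a, 'n::finite) chart set \<Rightarrow> ('a \<Rightarrow> real) \<Rightarrow> bool" where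
  "smooth_fun A u \<longleftrightarrow> (\<forall>c\<in>A. smooth_on (chart_image c) (coord_rep c u))"

text \<open>
  A tensor field is given by its components in each chart, as functions of the coordinates of
  that chart. For the metric, \<open>g c x $ i $ j\<close> is the component $g_{ij}$ in the chart \<open>c\<close> at the
  point with coordinates \<open>x\<close>, and \<open>metric_transforms\<close> is the tensor transformation law.
\<close>

locale riemannian_manifold = smooth_manifold X A
  for X :: "'a topology" and A :: "('a, 'n::finite) chart set" +
  fixes g :: "('a, 'n) chart \<Rightarrow> real^'n \<Rightarrow> real^'n^'n"
  assumes metric_smooth: "c \<in> A \<Longrightarrow> smooth_on (chart_image c) (g c)"
    and metric_symmetric: "c \<in> A \<Longrightarrow> x \<in> chart_image c \<Longrightarrow> transpose (g c x) = g c x"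
    and metric_positive: "c \<in> A \<Longrightarrow> x \<in> chart_image c \<Longrightarrow> v \<noteq> 0 \<Longrightarrow> v \<bullet> (g c x *v v) > 0"
    and metric_transforms:
      "c \<in> A \<Longrightarrow> d \<in> A \<Longrightarrow> p \<in> fst c \<inter> fst d \<Longrightarrow>
         g c (snd c p) = transpose (jacobian (transition c d) (at (snd c p)))
                         ** g d (snd d p) ** jacobian (transition c d) (at (snd c p))"

locale oriented_riemannian_manifold = riemannian_manifold X A g
  for X :: "'a topology" and A :: "('a, 'n::finite) chart set" and g +
  assumes oriented_atlas:
    "c \<in> A \<Longrightarrow> d \<in> A \<Longrightarrow> p \<in> fst c \<inter> fst d \<Longrightarrow>
       det (jacobian (transition c d) (at (snd c p))) > 0"


section \<open>Tensor calculus in a chart\<close>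

text \<open>
  In this section \<open>G\<close> is the matrix of metric components of one chart, and \<open>x\<close> is a point of the
  image of that chart.
\<close>

type_synonym 'n tensor2 = "'n \<Rightarrow> 'n \<Rightarrow> real"
type_synonym 'n tensor4 = "'n \<Rightarrow> 'n \<Rightarrow> 'n \<Rightarrow> 'n \<Rightarrow> real"
type_synonym 'n metric = "real^'n \<Rightarrow> real^'n^'n"

definition partial :: "'n::finite \<Rightarrow> (real^'n \<Rightarrow> real) \<Rightarrow> real^'n \<Rightarrow> real" where
  "partial i u x = frechet_derivative u (at x) (axis i 1)"

definition ginv :: "'n::finite metric \<Rightarrow> real^'n \<Rightarrow> 'n tensor2" where
  "ginv G x i j = matrix_inv (G x) $ i $ j"

text \<open>\<open>christoffel G x k i j\<close> is $\Gamma^k_{ij}$.\<close>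

definition christoffel :: "'n::finite metric \<Rightarrow> real^'n \<Rightarrow> 'n \<Rightarrow> 'n \<Rightarrow> 'n \<Rightarrow> real" where
  "christoffel G x k i j =
     (\<Sum>l\<in>UNIV. ginv G x k l *
        (partial i (\<lambda>y. G y $ j $ l) x + partial j (\<lambda>y. G y $ i $ l) x
         - partial l (\<lambda>y. G y $ i $ j) x)) / 2"

text \<open>
  \<open>curvature_op G x p i j l\<close> is the $\partial_p$-component of $R(\partial_i,\partial_j)\partial_l$,
  where $R(X,Y) = \nabla_X\nabla_Y - \nabla_Y\nabla_X - \nabla_{[X,Y]}$. Below
  $R_{ijkl} = g(R(\partial_i,\partial_j)\partial_l, \partial_k)$, so that in an orthonormal frame
  $R_{ijij}$ is the sectional curvature.
\<close>

definition curvature_op :: "'n::finite metric \<Rightarrow> real^'n \<Rightarrow> 'n tensor4" where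
  "curvature_op G x p i j l =
     partial i (\<lambda>y. christoffel G y p j l) x - partial j (\<lambda>y. christoffel G y p i l) x
     + (\<Sum>q\<in>UNIV. christoffel G x p i q * christoffel G x q j l
                - christoffel G x p j q * christoffel G x q i l)"

definition riemann :: "'n::finite metric \<Rightarrow> real^'n \<Rightarrow> 'n tensor4" where
  "riemann G x i j k l = (\<Sum>p\<in>UNIV. G x $ k $ p * curvature_op G x p i j l)"

definition ricci :: "'n::finite metric \<Rightarrow> real^'n \<Rightarrow> 'n tensor2" where
  "ricci G x i k = (\<Sum>j\<in>UNIV. \<Sum>l\<in>UNIV. ginv G x j l * riemann G x i j k l)"

definition scalar_curvature :: "'n::finite metric \<Rightarrow> real^'n \<Rightarrow> real" where
  "scalar_curvature G x = (\<Sum>i\<in>UNIV. \<Sum>j\<in>UNIV. ginv G x i j * ricci G x i j)"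

text \<open>The product of symmetric \<open>(0,2)\<close>-tensors written $\alpha\circ\beta$ (Kulkarni--Nomizu).\<close>

definition kulkarni_nomizu :: "'n tensor2 \<Rightarrow> 'n tensor2 \<Rightarrow> 'n tensor4" where
  "kulkarni_nomizu \<alpha> \<beta> i j k l = \<alpha> i k * \<beta> j l + \<alpha> j l * \<beta> i k - \<alpha> i l * \<beta> j k - \<alpha> j k * \<beta> i l"

text \<open>
  From the orthogonal decomposition
  $\mathrm{Rm} = W + \frac{1}{n-2}\mathrm{Ric}\circ g - \frac{R}{2(n-1)(n-2)}\, g\circ g$.
\<close>

definition weyl :: "'n::finite metric \<Rightarrow> real^'n \<Rightarrow> 'n tensor4" where
  "weyl G x i j k l =
     (let n = real CARD('n); \<gamma> = (\<lambda>i j. G x $ i $ j)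
      in riemann G x i j k l
         - kulkarni_nomizu (ricci G x) \<gamma> i j k l / (n - 2)
         + scalar_curvature G x / (2 * (n - 1) * (n - 2)) * kulkarni_nomizu \<gamma> \<gamma> i j k l)"

definition hessian :: "'n::finite metric \<Rightarrow> (real^'n \<Rightarrow> real) \<Rightarrow> real^'n \<Rightarrow> 'n tensor2" where
  "hessian G u x i j =
     partial i (partial j u) x - (\<Sum>k\<in>UNIV. christoffel G x k i j * partial k u x)"

definition laplacian :: "'n::finite metric \<Rightarrow> (real^'n \<Rightarrow> real) \<Rightarrow> real^'n \<Rightarrow> real" where
  "laplacian G u x = (\<Sum>i\<in>UNIV. \<Sum>j\<in>UNIV. ginv G x i j * hessian G u x i j)"

definition grad_inner ::
    "'n::finite metric \<Rightarrow> (real^'n \<Rightarrow> real) \<Rightarrow> (real^'n \<Rightarrow> real) \<Rightarrow> real^'n \<Rightarrow> real" where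
  "grad_inner G u v x = (\<Sum>i\<in>UNIV. \<Sum>j\<in>UNIV. ginv G x i j * partial i u x * partial j v x)"

definition weighted_laplacian ::
    "'n::finite metric \<Rightarrow> (real^'n \<Rightarrow> real) \<Rightarrow> (real^'n \<Rightarrow> real) \<Rightarrow> real^'n \<Rightarrow> real" where
  "weighted_laplacian G f u x = laplacian G u x - grad_inner G f u x"

text \<open>\<open>cov_deriv G T x p i j k l\<close> is $\nabla_p T_{ijkl}$.\<close>

definition cov_deriv ::
    "'n::finite metric \<Rightarrow> (real^'n \<Rightarrow> 'n tensor4) \<Rightarrow> real^'n \<Rightarrow> 'n \<Rightarrow> 'n tensor4" where
  "cov_deriv G T x p i j k l =
     partial p (\<lambda>y. T y i j k l) x
     - (\<Sum>q\<in>UNIV. christoffel G x q p i * T x q j k l + christoffel G x q p j * T x i q k l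
                 + christoffel G x q p k * T x i j q l + christoffel G x q p l * T x i j k q)"

text \<open>The inner product carries the factor $\frac14$.\<close>

definition tensor_inner ::
    "'n::finite metric \<Rightarrow> real^'n \<Rightarrow> 'n tensor4 \<Rightarrow> 'n tensor4 \<Rightarrow> real" where
  "tensor_inner G x S T =
     (\<Sum>i\<in>UNIV. \<Sum>j\<in>UNIV. \<Sum>k\<in>UNIV. \<Sum>l\<in>UNIV. \<Sum>a\<in>UNIV. \<Sum>b\<in>UNIV. \<Sum>c\<in>UNIV. \<Sum>d\<in>UNIV.
        S i j k l * ginv G x i a * ginv G x j b * ginv G x k c * ginv G x l d * T a b c d) / 4"

definition tensor_norm2 :: "'n::finite metric \<Rightarrow> real^'n \<Rightarrow> 'n tensor4 \<Rightarrow> real" where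
  "tensor_norm2 G x T = tensor_inner G x T T"

definition cov_deriv_norm2 ::
    "'n::finite metric \<Rightarrow> (real^'n \<Rightarrow> 'n tensor4) \<Rightarrow> real^'n \<Rightarrow> real" where
  "cov_deriv_norm2 G T x =
     (\<Sum>p\<in>UNIV. \<Sum>q\<in>UNIV.
        ginv G x p q * tensor_inner G x (cov_deriv G T x p) (cov_deriv G T x q))"


section \<open>Two-vectors in dimension four\<close>

text \<open>
  An element $\alpha$ of $\wedge^2 T_xM$ is represented by its antisymmetric component matrix
  $\alpha^{ij}$, with $\alpha = \frac12\alpha^{ij}\,\partial_i\wedge\partial_j$.
\<close>

type_synonym bivector = "real^4^4"

definition wedge :: "real^4 \<Rightarrow> real^4 \<Rightarrow> bivector" where
  "wedge u v = (\<chi> i j. u $ i * v $ j - u $ j * v $ i)"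

definition levi_civita :: "4 tensor4" where
  "levi_civita i j k l = det (vector [axis i 1, axis j 1, axis k 1, axis l 1] :: real^4^4)"

text \<open>
  $(\star\alpha)^{ij} = \frac{1}{2\sqrt{\det g}}\,\epsilon_{ijkl}\,g_{ka}g_{lb}\,\alpha^{ab}$, with
  $\epsilon$ the permutation symbol; so $\star(e_1\wedge e_2) = e_3\wedge e_4$ for a positively
  oriented orthonormal frame. The charts of an oriented atlas are the positively oriented ones.
\<close>

definition hodge :: "4 metric \<Rightarrow> real^4 \<Rightarrow> bivector \<Rightarrow> bivector" where
  "hodge G x \<alpha> = (\<chi> i j.
     (\<Sum>k\<in>UNIV. \<Sum>l\<in>UNIV. \<Sum>a\<in>UNIV. \<Sum>b\<in>UNIV.
        levi_civita i j k l * G x $ k $ a * G x $ l $ b * \<alpha> $ a $ b) / (2 * sqrt (det (G x))))"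

text \<open>
  The sign \<open>s\<close> is \<open>1\<close> (self-dual) or \<open>-1\<close> (anti-self-dual).
\<close>

definition half_bivectors :: "real \<Rightarrow> 4 metric \<Rightarrow> real^4 \<Rightarrow> bivector set" where
  "half_bivectors s G x = {\<alpha>. transpose \<alpha> = - \<alpha> \<and> hodge G x \<alpha> = s *\<^sub>R \<alpha>}"

definition half_part :: "real \<Rightarrow> 4 metric \<Rightarrow> real^4 \<Rightarrow> bivector \<Rightarrow> bivector" where
  "half_part s G x \<alpha> = (1/2) *\<^sub>R (\<alpha> + s *\<^sub>R hodge G x \<alpha>)"

text \<open>
  The bilinear form on two-vectors with
  $T(\partial_i\wedge\partial_j, \partial_k\wedge\partial_l) = T_{ijkl}$.
\<close>

definition bivector_form :: "4 tensor4 \<Rightarrow> bivector \<Rightarrow> bivector \<Rightarrow> real" where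
  "bivector_form T \<alpha> \<beta> =
     (\<Sum>i\<in>UNIV. \<Sum>j\<in>UNIV. \<Sum>k\<in>UNIV. \<Sum>l\<in>UNIV. T i j k l * \<alpha> $ i $ j * \<beta> $ k $ l) / 4"

definition tensor_half :: "real \<Rightarrow> 4 metric \<Rightarrow> real^4 \<Rightarrow> 4 tensor4 \<Rightarrow> 4 tensor4" where
  "tensor_half s G x T i j k l =
     bivector_form T (half_part s G x (wedge (axis i 1) (axis j 1)))
                     (half_part s G x (wedge (axis k 1) (axis l 1)))"

definition weyl_half :: "real \<Rightarrow> 4 metric \<Rightarrow> real^4 \<Rightarrow> 4 tensor4" where
  "weyl_half s G x = tensor_half s G x (weyl G x)"

text \<open>
  The operator on two-vectors with $\langle T\alpha,\beta\rangle = T(\alpha,\beta)$, where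
  $\langle\alpha,\beta\rangle = \frac12 g_{ik}g_{jl}\alpha^{ij}\beta^{kl}$ makes the
  $e_i\wedge e_j$, $i<j$, orthonormal:
  $(T\alpha)^{kl} = \frac12 T_{ijab}\,\alpha^{ij}g^{ak}g^{bl}$.
\<close>

definition bivector_op :: "4 metric \<Rightarrow> real^4 \<Rightarrow> 4 tensor4 \<Rightarrow> bivector \<Rightarrow> bivector" where
  "bivector_op G x T \<alpha> = (\<chi> k l.
     (\<Sum>i\<in>UNIV. \<Sum>j\<in>UNIV. \<Sum>a\<in>UNIV. \<Sum>b\<in>UNIV.
        T i j a b * \<alpha> $ i $ j * ginv G x a k * ginv G x b l) / 2)"

text \<open>
  Determinant of an endomorphism \<open>\<Phi>\<close> of a three-dimensional subspace \<open>V\<close>: the determinant of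
  its matrix in any basis of \<open>V\<close>.
\<close>

definition endo_det3 :: "'v::real_vector set \<Rightarrow> ('v \<Rightarrow> 'v) \<Rightarrow> real" where
  "endo_det3 V \<Phi> = (THE d. \<exists>(b :: 3 \<Rightarrow> 'v) (M :: real^3^3).
     inj b \<and> independent (range b) \<and> span (range b) = V \<and>
     (\<forall>j. \<Phi> (b j) = (\<Sum>i\<in>UNIV. M $ i $ j *\<^sub>R b i)) \<and> d = det M)"

definition det_weyl_half :: "real \<Rightarrow> 4 metric \<Rightarrow> real^4 \<Rightarrow> real" where
  "det_weyl_half s G x = endo_det3 (half_bivectors s G x) (bivector_op G x (weyl_half s G x))"


section \<open>Generalized quasi-Einstein manifolds\<close>

text \<open>$\frac1m$, which is \<open>0\<close> for \<open>m = \<plusminus>\<infinity>\<close> by the conventions of \<open>ereal\<close>.\<close>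

definition recip :: "ereal \<Rightarrow> real" where
  "recip m = real_of_ereal (1 / m)"

definition generalized_quasi_einstein ::
    "('a, 'n::finite) chart set \<Rightarrow> (('a, 'n) chart \<Rightarrow> 'n metric) \<Rightarrow>
     ereal \<Rightarrow> ('a \<Rightarrow> real) \<Rightarrow> ('a \<Rightarrow> real) \<Rightarrow> bool" where
  "generalized_quasi_einstein A g m f lam \<longleftrightarrow>
     m \<noteq> 0 \<and> smooth_fun A f \<and> smooth_fun A lam \<and>
     (\<forall>c\<in>A. \<forall>p\<in>fst c. \<forall>i j.
        ricci (g c) (snd c p) i j + hessian (g c) (coord_rep c f) (snd c p) i j
        - recip m * partial i (coord_rep c f) (snd c p) * partial j (coord_rep c f) (snd c p)
        = lam p * g c (snd c p) $ i $ j)"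

end

theory Submission
  imports Defs
begin

text \<open>
  Over the ring of germs of smooth functions at a point, Gram--Schmidt turns the coordinate frame
  into an orthonormal one. There indices need not be raised, covariant derivatives are derivations
  corrected by a skew-symmetric connection, and constant tensors built from the symbols
  $\delta$ and $\epsilon$ are parallel, so that $W^\pm$ is a constant linear expression in the
  curvature.

  Since $W^\pm$ is trace-free, pairing it with $\Delta W^\pm$ only sees $\Delta\mathrm{Rm}$.
  Commuting derivatives and using the second Bianchi identity expresses the latter by second
  derivatives of the Ricci tensor and a quadratic curvature term. The quasi-Einstein equation turns
  the Ricci derivatives into third derivatives of $f$, whose commutators are again curvature terms,
  and produces the drift term.

  What remains is algebra at a point. In the splitting $\wedge^2=\wedge^+\oplus\wedge^-$ the
  curvature operator is a block matrix whose diagonal blocks are trace-free up to a multiple of the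
  identity and whose off-diagonal block is the trace-free Ricci tensor. The quadratic terms reduce to
  $A\mapsto\mathrm{tr}\,A^3=3\det A$ for the trace-free symmetric $3\times3$ matrix $A$ of
  $W^\pm$ and to the cofactors of the off-diagonal block, which the quasi-Einstein equation rewrites
  in terms of the Hessian of $f$.
\<close>

section \<open>Smooth functions\<close>

text \<open>Normal coordinates or a frame that is parallel at a point simplify formulas at that
  point only, and the result cannot be differentiated again. Equality of germs is equality near the
  point, so identities of germs can be differentiated, and \<open>germ_value\<close> is a
  homomorphism to the reals for the final algebra. The price is a ring with zero divisors, where
  only real scalars may be cancelled, and abstract derivations that need not be independent, for
  which torsion-freeness does not yield the first Bianchi identity.

  The constants: \<open>pairing\<close> is four times the inner product, and the half Weyl operator
  has a matrix that is twice \<open>A0\<close> up to transposition, so its determinant is 8 det A0.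
  The quadratic curvature term contributes -288 det A0, which is -36 times that determinant. In 1 +
  2/m, the 1 is what survives of the product of Ric with itself, and 2/m comes from the products of
  Hessians in the second derivative of df \<otimes> df / m.\<close>

lemma frechet_derivative_cong_open:
  assumes "open S" "x \<in> S" "\<And>y. y \<in> S \<Longrightarrow> f y = g y" "f differentiable at x"
  shows "g differentiable at x" "frechet_derivative g (at x) = frechet_derivative f (at x)"
proof -
  have "(f has_derivative frechet_derivative f (at x)) (at x)"
    using assms(4) frechet_derivative_works by blast
  then have g: "(g has_derivative frechet_derivative f (at x)) (at x)"
    using has_derivative_transform_within_open assms(1-3) by blast
  then show "g differentiable at x" by (auto simp: differentiable_def)
  show "frechet_derivative g (at x) = frechet_derivative f (at x)"
    using frechet_derivative_at[OF g] by simp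
qed

lemma C_k_on_cong:
  assumes "open S" "\<And>x. x \<in> S \<Longrightarrow> f x = g x" "C_k_on k S f"
  shows "C_k_on k S g"
  using assms(2,3)
proof (induction k arbitrary: f g)
  case 0
  then show ?case by (metis C_k_on.simps(1) continuous_on_cong)
next
  case (Suc k)
  have d: "f differentiable at x" if "x \<in> S" for x
    using Suc.prems(2) that by simp
  note c = frechet_derivative_cong_open[OF assms(1) _ Suc.prems(1) d]
  have "C_k_on k S (\<lambda>x. frechet_derivative g (at x) v)" for v
    by (rule Suc.IH[of "\<lambda>x. frechet_derivative f (at x) v"]) (use c Suc.prems(2) in auto)
  then show ?case using c by simp
qed

lemma C_k_on_subset: "C_k_on k S f \<Longrightarrow> T \<subseteq> S \<Longrightarrow> C_k_on k T f"
  by (induction k arbitrary: f) (auto intro: continuous_on_subset)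

lemma smooth_on_subset: "smooth_on S f \<Longrightarrow> T \<subseteq> S \<Longrightarrow> smooth_on T f"
  unfolding smooth_on_def using C_k_on_subset by blast

lemma C_k_on_SucD: "C_k_on (Suc k) S f \<Longrightarrow> C_k_on k S f"
proof (induction k arbitrary: f)
  case 0
  then show ?case
    by (simp add: continuous_at_imp_continuous_on differentiable_imp_continuous_within)
next
  case (Suc k)
  then show ?case by (metis C_k_on.simps(2))
qed

lemma C_k_on_const: "C_k_on k S (\<lambda>x. c)"
  by (induction k arbitrary: c) auto

text \<open>Any family of derivatives may replace the chosen \<open>frechet_derivative\<close>, so
  the induction steps below only need the usual rules of differentiation.\<close>

lemma C_k_on_SucI:
  assumes "open S" "\<And>x. x \<in> S \<Longrightarrow> (f has_derivative D x) (at x)" "\<And>v. C_k_on k S (\<lambda>x. D x v)"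
  shows "C_k_on (Suc k) S f"
proof -
  have "D x v = frechet_derivative f (at x) v" if "x \<in> S" for x v
    using frechet_derivative_at[OF assms(2)[OF that]] by simp
  then have "C_k_on k S (\<lambda>x. frechet_derivative f (at x) v)" for v
    by (rule C_k_on_cong[OF assms(1) _ assms(3)])
  then show ?thesis using assms(2) by (auto simp: differentiable_def)
qed

lemma C_k_on_SucE:
  assumes "C_k_on (Suc k) S f"
  shows "\<And>x. x \<in> S \<Longrightarrow> (f has_derivative frechet_derivative f (at x)) (at x)"
    and "\<And>v. C_k_on k S (\<lambda>x. frechet_derivative f (at x) v)"
  using assms by (simp_all flip: frechet_derivative_works)

lemma C_k_on_add:
  assumes "open S" "C_k_on k S f" "C_k_on k S g"
  shows "C_k_on k S (\<lambda>x. f x + g x)"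
  using assms(2,3)
proof (induction k arbitrary: f g)
  case 0
  then show ?case by (simp add: continuous_on_add)
next
  case (Suc k)
  note f = C_k_on_SucE[OF Suc.prems(1)] and g = C_k_on_SucE[OF Suc.prems(2)]
  show ?case
    by (rule C_k_on_SucI[OF assms(1) has_derivative_add[OF f(1) g(1)] Suc.IH[OF f(2) g(2)]])
qed

lemma C_k_on_bounded_linear:
  assumes "open S" "bounded_linear L" "C_k_on k S f"
  shows "C_k_on k S (\<lambda>x. L (f x))"
  using assms(3)
proof (induction k arbitrary: f)
  case 0
  then show ?case by (simp add: assms(2) bounded_linear.continuous_on)
next
  case (Suc k)
  note f = C_k_on_SucE[OF Suc.prems]
  show ?case
    by (rule C_k_on_SucI[OF assms(1) bounded_linear.has_derivative[OF assms(2) f(1)] Suc.IH[OF f(2)]])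
qed

lemma C_k_on_mult:
  fixes f g :: "'a::real_normed_vector \<Rightarrow> real"
  assumes "open S" "C_k_on k S f" "C_k_on k S g"
  shows "C_k_on k S (\<lambda>x. f x * g x)"
  using assms(2,3)
proof (induction k arbitrary: f g)
  case 0
  then show ?case by (simp add: continuous_on_mult)
next
  case (Suc k)
  note f = C_k_on_SucE[OF Suc.prems(1)] and g = C_k_on_SucE[OF Suc.prems(2)]
  show ?case
    by (rule C_k_on_SucI[OF assms(1) has_derivative_mult[OF f(1) g(1)]])
       (assumption | intro C_k_on_add[OF assms(1)] Suc.IH f(2) g(2) Suc.prems[THEN C_k_on_SucD])+
qed

text \<open>The induction treats all exponents at once, because differentiating replaces r by r - 1.
  The exponent -1/2 will normalise vectors in Gram--Schmidt.\<close>

lemma C_k_on_powr: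
  fixes f :: "'a::real_normed_vector \<Rightarrow> real"
  assumes "open S" "\<And>x. x \<in> S \<Longrightarrow> f x > 0" "C_k_on k S f"
  shows "C_k_on k S (\<lambda>x. f x powr r)"
  using assms(3)
proof (induction k arbitrary: r)
  case 0
  then show ?case
    using assms(2) by (force intro!: continuous_on_powr continuous_on_const)
next
  case (Suc k)
  note f = C_k_on_SucE[OF Suc.prems]
  let ?D = "\<lambda>x v. r * (f x powr (r - 1)) * frechet_derivative f (at x) v"
  have D: "((\<lambda>x. f x powr r) has_derivative ?D x) (at x)" if "x \<in> S" for x
  proof -
    note has_derivative_powr[OF f(1)[OF that] has_derivative_const[of r] assms(2)[OF that] UNIV_I]
    then show ?thesis
      by (rule has_derivative_eq_rhs) (use assms(2)[OF that] in \<open>auto simp: powr_diff fun_eq_iff\<close>)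
  qed
  show ?case
    by (rule C_k_on_SucI[OF assms(1) D])
       (assumption | intro C_k_on_mult[OF assms(1)] C_k_on_const Suc.IH C_k_on_SucD[OF Suc.prems] f(2))+
qed

text \<open>Schwarz's theorem by second differences: two applications of the mean value theorem turn
  the increment of f over a small parallelogram into r^2 times a mixed derivative at a nearby point.
  The increment is symmetric in u and v, and both mixed derivatives are continuous, so the
  intermediate points may tend to x.\<close>

lemma second_frechet_derivative_symmetric:
  fixes f :: "'a::real_normed_vector \<Rightarrow> real"
  assumes S: "open S" "x \<in> S" and f: "C_k_on 2 S f"
  shows "frechet_derivative (\<lambda>y. frechet_derivative f (at y) v) (at x) u
       = frechet_derivative (\<lambda>y. frechet_derivative f (at y) u) (at x) v"
proof -
  let ?d = "\<lambda>w y. frechet_derivative f (at y) w"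
  let ?dd = "\<lambda>w w' y. frechet_derivative (?d w) (at y) w'"
  have f1: "(f has_derivative frechet_derivative f (at y)) (at y)" if "y \<in> S" for y
    using f that by (auto simp: numeral_2_eq_2 simp flip: frechet_derivative_works)
  have f2: "(?d w has_derivative frechet_derivative (?d w) (at y)) (at y)" if "y \<in> S" for y w
    using f that by (auto simp: numeral_2_eq_2 simp flip: frechet_derivative_works)
  have c2: "continuous_on S (?dd w w')" for w w'
    using f by (auto simp: numeral_2_eq_2)
  obtain e where e: "e > 0" "ball x e \<subseteq> S" using S open_contains_ball by blast
  \<comment> \<open>With this K the point x + s u + t v stays in the ball whenever s and t are below
    e / K in absolute value; the summand 1 keeps K positive if u and v vanish.\<close>
  define K where "K = norm u + norm v + 1"
  have K: "K > 0" unfolding K_def by (smt (verit) norm_ge_zero)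
  have inb: "x + s *\<^sub>R u + t *\<^sub>R v \<in> S"
    if "\<bar>s\<bar> < e / K" "\<bar>t\<bar> < e / K" for s t
  proof -
    have "norm (s *\<^sub>R u + t *\<^sub>R v) \<le> \<bar>s\<bar> * norm u + \<bar>t\<bar> * norm v"
      by (metis norm_scaleR norm_triangle_ineq)
    also have "\<dots> \<le> (e / K) * norm u + (e / K) * norm v"
      using that by (intro add_mono mult_right_mono) auto
    also have "\<dots> = e / K * (norm u + norm v)" by (simp add: distrib_left)
    also have "\<dots> < e / K * K"
      using e K by (intro mult_strict_left_mono) (auto simp: K_def)
    also have "\<dots> = e" using K by simp
    finally have "dist (x + s *\<^sub>R u + t *\<^sub>R v) x < e"
      by (simp add: dist_norm add.assoc)
    then show ?thesis using e by (auto simp: subset_iff dist_commute)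
  qed
  have dline: "((\<lambda>s. h (y + s *\<^sub>R w)) has_real_derivative frechet_derivative h (at (y + s *\<^sub>R w)) w) (at s)"
    if "(h has_derivative frechet_derivative h (at (y + s *\<^sub>R w))) (at (y + s *\<^sub>R w))"
    for h :: "'a \<Rightarrow> real" and y w s
  proof -
    have "((\<lambda>s. y + s *\<^sub>R w) has_derivative (\<lambda>r. r *\<^sub>R w)) (at s)"
      by (auto intro!: derivative_eq_intros)
    from has_derivative_compose[OF this that]
    have "((\<lambda>s. h (y + s *\<^sub>R w)) has_derivative
        (\<lambda>r. frechet_derivative h (at (y + s *\<^sub>R w)) (r *\<^sub>R w))) (at s)" .
    moreover have "linear (frechet_derivative h (at (y + s *\<^sub>R w)))"
      using that by (intro linear_frechet_derivative) (auto simp: differentiable_def)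
    ultimately show ?thesis
      by (simp add: has_field_derivative_def linear_cmul mult.commute[of _ "frechet_derivative h _ w"])
  qed
  \<comment> \<open>Allowing (a, b) to be (u, v) or (v, u) gives both orders of differentiation for
    the same second difference.\<close>
  have key: "\<exists>s t. 0 < s \<and> s < r \<and> 0 < t \<and> t < r \<and>
       f (x + r *\<^sub>R a + r *\<^sub>R b) - f (x + r *\<^sub>R a) - f (x + r *\<^sub>R b) + f x
       = r * r * ?dd a b (x + s *\<^sub>R a + t *\<^sub>R b)"
    if r: "0 < r" "r < e / K" and ab: "(a, b) = (u, v) \<or> (a, b) = (v, u)" for r a b
  proof -
    have inS: "x + s *\<^sub>R a + t *\<^sub>R b \<in> S" if "\<bar>s\<bar> < e / K" "\<bar>t\<bar> < e / K" for s t
      using ab inb[of s t] inb[of t s] that by (auto simp: algebra_simps)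
    let ?\<phi> = "\<lambda>s. f (x + r *\<^sub>R b + s *\<^sub>R a) - f (x + s *\<^sub>R a)"
    let ?\<phi>' = "\<lambda>s. ?d a (x + r *\<^sub>R b + s *\<^sub>R a) - ?d a (x + s *\<^sub>R a)"
    have "DERIV ?\<phi> s :> ?\<phi>' s" if "0 \<le> s" "s \<le> r" for s
      using inS[of s r] inS[of s 0] r that
      by (intro derivative_intros dline f1) (auto simp: algebra_simps)
    from MVT2[OF r(1) this] obtain s where s: "0 < s" "s < r" "?\<phi> r - ?\<phi> 0 = (r - 0) * ?\<phi>' s"
      by blast
    have "DERIV (\<lambda>t. ?d a (x + s *\<^sub>R a + t *\<^sub>R b)) t :> ?dd a b (x + s *\<^sub>R a + t *\<^sub>R b)"
      if "0 \<le> t" "t \<le> r" for t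
      using inS[of s t] r s that by (intro dline f2) auto
    from MVT2[OF r(1) this] obtain t where t: "0 < t" "t < r"
      "?d a (x + s *\<^sub>R a + r *\<^sub>R b) - ?d a (x + s *\<^sub>R a + 0 *\<^sub>R b)
       = (r - 0) * ?dd a b (x + s *\<^sub>R a + t *\<^sub>R b)" by blast
    show ?thesis using s t
      by (intro exI[of _ s] exI[of _ t]) (auto simp: algebra_simps)
  qed
  have lim: "(\<lambda>n. ?dd a b (p n)) \<longlonglongrightarrow> ?dd a b x" if "p \<longlonglongrightarrow> x" for p :: "nat \<Rightarrow> 'a" and a b
    using c2[of a b] S that continuous_on_eq_continuous_at[OF S(1)] isCont_tendsto_compose by blast
  define r where "r = (\<lambda>n. e / K / 2 * inverse (real (Suc n)))"
  have r: "0 < r n" "r n < e / K" for n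
  proof -
    show "0 < r n" using e K by (simp add: r_def)
    have half: "q / 2 * 1 < q" if "q > 0" for q :: real
      using that by simp
    have "r n \<le> e / K / 2 * 1"
      unfolding r_def using e K by (intro mult_left_mono) (auto simp: inverse_le_1_iff)
    also have "\<dots> < e / K" by (rule half[OF divide_pos_pos[OF e(1) K]])
    finally show "r n < e / K" .
  qed
  have r0: "r \<longlonglongrightarrow> 0"
    unfolding r_def by (rule tendsto_mult_right_zero[OF LIMSEQ_inverse_real_of_nat])
  have "\<exists>s t s' t'. 0 < s \<and> s < r n \<and> 0 < t \<and> t < r n \<and> 0 < s' \<and> s' < r n \<and> 0 < t' \<and> t' < r n \<and>
      ?dd u v (x + s *\<^sub>R u + t *\<^sub>R v) = ?dd v u (x + s' *\<^sub>R v + t' *\<^sub>R u)" for n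
  proof -
    obtain s t where 1: "0 < s \<and> s < r n \<and> 0 < t \<and> t < r n"
      "f (x + r n *\<^sub>R u + r n *\<^sub>R v) - f (x + r n *\<^sub>R u) - f (x + r n *\<^sub>R v) + f x
       = r n * r n * ?dd u v (x + s *\<^sub>R u + t *\<^sub>R v)" using key[OF r, of u v] by blast
    obtain s' t' where 2: "0 < s' \<and> s' < r n \<and> 0 < t' \<and> t' < r n"
      "f (x + r n *\<^sub>R v + r n *\<^sub>R u) - f (x + r n *\<^sub>R v) - f (x + r n *\<^sub>R u) + f x
       = r n * r n * ?dd v u (x + s' *\<^sub>R v + t' *\<^sub>R u)" using key[OF r, of v u] by blast
    have "r n * r n * ?dd u v (x + s *\<^sub>R u + t *\<^sub>R v) = r n * r n * ?dd v u (x + s' *\<^sub>R v + t' *\<^sub>R u)"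
      unfolding 1(2)[symmetric] 2(2)[symmetric] by (simp add: algebra_simps)
    then have "?dd u v (x + s *\<^sub>R u + t *\<^sub>R v) = ?dd v u (x + s' *\<^sub>R v + t' *\<^sub>R u)"
      using r(1)[of n] by simp
    then show ?thesis using 1 2 by blast
  qed
  then obtain s t s' t' where st: "\<And>n. 0 < s n \<and> s n < r n \<and> 0 < t n \<and> t n < r n
      \<and> 0 < s' n \<and> s' n < r n \<and> 0 < t' n \<and> t' n < r n"
    "\<And>n. ?dd u v (x + s n *\<^sub>R u + t n *\<^sub>R v) = ?dd v u (x + s' n *\<^sub>R v + t' n *\<^sub>R u)"
    by metis
  have z: "q \<longlonglongrightarrow> 0" if "\<And>n. 0 < q n \<and> q n < r n" for q :: "nat \<Rightarrow> real"
    by (rule tendsto_sandwich[OF _ _ tendsto_const r0]) (use that in \<open>auto intro!: always_eventually simp: less_imp_le\<close>)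
  have p: "(\<lambda>n. x + q n *\<^sub>R a + q' n *\<^sub>R b) \<longlonglongrightarrow> x"
    if "q \<longlonglongrightarrow> 0" "q' \<longlonglongrightarrow> 0" for q q' :: "nat \<Rightarrow> real" and a b
  proof -
    have "(\<lambda>n. x + q n *\<^sub>R a + q' n *\<^sub>R b) \<longlonglongrightarrow> x + 0 *\<^sub>R a + 0 *\<^sub>R b"
      using that by (intro tendsto_intros)
    then show ?thesis by simp
  qed
  have "s \<longlonglongrightarrow> 0" "t \<longlonglongrightarrow> 0" "s' \<longlonglongrightarrow> 0" "t' \<longlonglongrightarrow> 0"
    using st(1) z by simp_all
  from lim[OF p[OF this(1,2)], of u u v v] lim[OF p[OF this(3,4)], of v v u u]
  show ?thesis
    unfolding st(2) by (rule LIMSEQ_unique[symmetric])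
qed

text \<open>All germs are taken at the origin, so a function near another base point has to be moved
  there.\<close>

lemma C_k_on_translate:
  assumes "open S" "C_k_on k S f"
  shows "C_k_on k ((\<lambda>y. y - a) ` S) (\<lambda>y. f (a + y))"
  using assms(2)
proof (induction k arbitrary: f)
  case 0
  then show ?case
    by (auto intro!: continuous_on_compose2[of S f] continuous_intros)
next
  case (Suc k)
  note f = C_k_on_SucE[OF Suc.prems]
  have D: "((\<lambda>y. f (a + y)) has_derivative frechet_derivative f (at (a + y))) (at y)"
    if "y \<in> (\<lambda>y. y - a) ` S" for y
  proof -
    have "(f has_derivative frechet_derivative f (at (a + y))) (at (a + y))"
      by (rule f(1)) (use that in auto)
    moreover have "((\<lambda>y. a + y) has_derivative (\<lambda>h. h)) (at y)"
      by (auto intro!: derivative_eq_intros)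
    ultimately show ?thesis using has_derivative_compose by blast
  qed
  have "open ((\<lambda>y. y - a) ` S)"
    using open_translation_subtract[OF assms(1), of a] by simp
  then show ?case
    by (rule C_k_on_SucI[OF _ D Suc.IH[OF f(2)]])
qed

section \<open>Smoothness near a point and partial derivatives\<close>

definition smooth_at :: "'a::real_normed_vector \<Rightarrow> ('a \<Rightarrow> real) \<Rightarrow> bool" where
  "smooth_at x u \<longleftrightarrow> (\<exists>S. open S \<and> x \<in> S \<and> smooth_on S u)"

lemma smooth_at_cong:
  assumes "smooth_at x u" "\<forall>\<^sub>F y in nhds x. u y = v y"
  shows "smooth_at x v"
proof -
  obtain S where S: "open S" "x \<in> S" "smooth_on S u"
    using assms(1) unfolding smooth_at_def by blast
  obtain T where T: "open T" "x \<in> T" "\<And>y. y \<in> T \<Longrightarrow> u y = v y"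
    using assms(2) unfolding eventually_nhds by blast
  have ST: "open (S \<inter> T)" "x \<in> S \<inter> T" using S T by (simp_all add: open_Int)
  have "C_k_on k (S \<inter> T) u" for k
    using smooth_on_subset[OF S(3) Int_lower1] unfolding smooth_on_def by blast
  then have "C_k_on k (S \<inter> T) v" for k
    by (rule C_k_on_cong[OF ST(1), rotated]) (rule T(3), erule IntD2)
  then have "smooth_on (S \<inter> T) v" unfolding smooth_on_def by blast
  then show ?thesis unfolding smooth_at_def using ST by blast
qed

lemma smooth_at_obtain2:
  assumes "smooth_at x u" "smooth_at x v"
  obtains S where "open S" "x \<in> S" "smooth_on S u" "smooth_on S v"
proof -
  obtain S T where "open S" "x \<in> S" "smooth_on S u" "open T" "x \<in> T" "smooth_on T v"
    using assms unfolding smooth_at_def by blast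
  then show ?thesis
    using that[of "S \<inter> T"] smooth_on_subset[of S u "S \<inter> T"] smooth_on_subset[of T v "S \<inter> T"]
    by (simp add: open_Int)
qed

lemma smooth_at_const [simp]: "smooth_at x (\<lambda>y. c)"
  unfolding smooth_at_def smooth_on_def by (auto intro!: exI[of _ UNIV] C_k_on_const)

lemma smooth_at_add [simp]: "smooth_at x u \<Longrightarrow> smooth_at x v \<Longrightarrow> smooth_at x (\<lambda>y. u y + v y)"
  by (erule (1) smooth_at_obtain2) (auto simp: smooth_at_def smooth_on_def intro!: C_k_on_add)

lemma smooth_at_mult [simp]: "smooth_at x u \<Longrightarrow> smooth_at x v \<Longrightarrow> smooth_at x (\<lambda>y. u y * v y)"
  by (erule (1) smooth_at_obtain2) (auto simp: smooth_at_def smooth_on_def intro!: C_k_on_mult)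

lemma smooth_at_uminus [simp]: "smooth_at x u \<Longrightarrow> smooth_at x (\<lambda>y. - u y)"
  using smooth_at_mult[of x "\<lambda>y. -1" u] by simp

lemma smooth_at_diff [simp]: "smooth_at x u \<Longrightarrow> smooth_at x v \<Longrightarrow> smooth_at x (\<lambda>y. u y - v y)"
  using smooth_at_add[of x u "\<lambda>y. - v y"] by simp

lemma smooth_at_divide [simp]: "smooth_at x u \<Longrightarrow> smooth_at x (\<lambda>y. u y / c)"
  using smooth_at_mult[of x u "\<lambda>y. inverse c"] by (simp add: field_simps)

lemma smooth_at_sum [simp]:
  "(\<And>i. i \<in> I \<Longrightarrow> smooth_at x (u i)) \<Longrightarrow> smooth_at x (\<lambda>y. \<Sum>i\<in>I. u i y)"
  by (induction I rule: infinite_finite_induct) auto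

lemma smooth_at_powr:
  assumes "smooth_at x u" "u x > 0"
  shows "smooth_at x (\<lambda>y. u y powr r)"
proof -
  obtain S where S: "open S" "x \<in> S" "smooth_on S u"
    using assms(1) unfolding smooth_at_def by blast
  let ?T = "S \<inter> u -` {0<..}"
  have "C_k_on 0 S u" using S(3) unfolding smooth_on_def by blast
  then have "continuous_on S u" by simp
  then have T: "open ?T"
    using continuous_open_preimage[OF _ S(1), of u "{0<..}"] by simp
  have "C_k_on k ?T (\<lambda>y. u y powr r)" for k
    by (rule C_k_on_powr[OF T _ C_k_on_subset[of k S]]) (use S(3) in \<open>auto simp: smooth_on_def\<close>)
  then show ?thesis
    unfolding smooth_at_def smooth_on_def using T S(2) assms(2) by (intro exI[of _ ?T]) auto
qed

lemma smooth_at_translate: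
  assumes "smooth_at (a + x) u"
  shows "smooth_at x (\<lambda>y. u (a + y))"
proof -
  obtain S where S: "open S" "a + x \<in> S" "smooth_on S u"
    using assms unfolding smooth_at_def by blast
  let ?T = "(\<lambda>y. y - a) ` S"
  have "open ?T"
    using open_translation_subtract[OF S(1), of a] by simp
  moreover have "x \<in> ?T" using S(2) by (intro image_eqI[of _ _ "a + x"]) auto
  moreover have "C_k_on k ?T (\<lambda>y. u (a + y))" for k
    using S by (intro C_k_on_translate) (auto simp: smooth_on_def)
  ultimately show ?thesis
    unfolding smooth_at_def smooth_on_def by (intro exI[of _ ?T]) auto
qed

lemma smooth_at_nhds:
  assumes "smooth_at x u"
  shows "\<forall>\<^sub>F y in nhds x. smooth_at y u"
  using assms unfolding smooth_at_def eventually_nhds by blast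

lemma smooth_at_differentiable:
  assumes "smooth_at x u"
  shows "u differentiable at x"
proof -
  obtain S where "x \<in> S" "C_k_on (Suc 0) S u"
    using assms unfolding smooth_at_def smooth_on_def by blast
  then show ?thesis by simp
qed

lemma partial_cong:
  assumes "smooth_at x u" "\<forall>\<^sub>F y in nhds x. u y = v y"
  shows "partial i u x = partial i v x"
proof -
  obtain S where "open S" "x \<in> S" "\<And>y. y \<in> S \<Longrightarrow> u y = v y"
    using assms(2) unfolding eventually_nhds by blast
  from frechet_derivative_cong_open(2)[OF this smooth_at_differentiable[OF assms(1)]]
  show ?thesis by (simp add: partial_def)
qed

text \<open>Functions equal near x are equal near every point close to x. This makes partial
  derivatives well defined on germs.\<close>

lemma partial_cong_nhds:
  assumes "smooth_at x u" "\<forall>\<^sub>F y in nhds x. u y = v y"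
  shows "\<forall>\<^sub>F y in nhds x. partial i u y = partial i v y"
proof -
  have "\<forall>\<^sub>F z in nhds x. \<forall>\<^sub>F y in nhds z. u y = v y"
    using assms(2) by (simp add: eventually_eventually)
  with smooth_at_nhds[OF assms(1)] show ?thesis
    by eventually_elim (rule partial_cong)
qed

lemma smooth_at_partial [simp]:
  assumes "smooth_at x u"
  shows "smooth_at x (partial i u)"
proof -
  obtain S where S: "open S" "x \<in> S" "smooth_on S u"
    using assms unfolding smooth_at_def by blast
  have "partial i u = (\<lambda>y. frechet_derivative u (at y) (axis i 1))"
    by (simp add: fun_eq_iff partial_def)
  then have "C_k_on k S (partial i u)" for k
    using C_k_on_SucE(2)[of k S u] S(3) unfolding smooth_on_def by simp
  then show ?thesis using S unfolding smooth_at_def smooth_on_def by blast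
qed

lemma partial_const [simp]: "partial i (\<lambda>y. c) x = 0"
  by (simp add: partial_def)

lemma smooth_at_has_derivative:
  "smooth_at x u \<Longrightarrow> (u has_derivative frechet_derivative u (at x)) (at x)"
  using smooth_at_differentiable frechet_derivative_works by blast

lemma partial_add:
  assumes "smooth_at x u" "smooth_at x v"
  shows "partial i (\<lambda>y. u y + v y) x = partial i u x + partial i v x"
  unfolding partial_def
    frechet_derivative_at[OF has_derivative_add[OF assms[THEN smooth_at_has_derivative]], symmetric] ..

lemma partial_mult:
  assumes "smooth_at x u" "smooth_at x v"
  shows "partial i (\<lambda>y. u y * v y) x = u x * partial i v x + partial i u x * v x"
  unfolding partial_def
    frechet_derivative_at[OF has_derivative_mult[OF assms[THEN smooth_at_has_derivative]], symmetric] ..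

lemma partial_commute:
  assumes "smooth_at x u"
  shows "partial i (partial j u) x = partial j (partial i u) x"
proof -
  obtain S where "open S" "x \<in> S" "C_k_on 2 S u"
    using assms unfolding smooth_at_def smooth_on_def by blast
  from second_frechet_derivative_symmetric[OF this] show ?thesis
    unfolding partial_def by simp
qed

lemma partial_translate:
  assumes "smooth_at (a + x) u"
  shows "partial i (\<lambda>y. u (a + y)) x = partial i u (a + x)"
proof -
  have "((\<lambda>y. a + y) has_derivative (\<lambda>h. h)) (at x)"
    by (auto intro!: derivative_eq_intros)
  from has_derivative_compose[OF this smooth_at_has_derivative[OF assms]]
  show ?thesis
    unfolding partial_def by (subst frechet_derivative_at[symmetric]) auto
qed

section \<open>Germs of smooth functions\<close>

text \<open>A partial equivalence: it is reflexive exactly on the functions smooth at 0, so the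
  quotient contains germs of smooth functions only. Fixing the base point 0 keeps the point out of
  the type; \<open>germ_at\<close> translates other points to it.\<close>

definition germ_eq :: "(real^'n \<Rightarrow> real) \<Rightarrow> (real^'n \<Rightarrow> real) \<Rightarrow> bool" where
  "germ_eq u v \<longleftrightarrow> smooth_at 0 u \<and> smooth_at 0 v \<and> (\<forall>\<^sub>F y in nhds 0. u y = v y)"

quotient_type 'n germ = "real^'n \<Rightarrow> real" / partial: germ_eq
proof (rule part_equivpI)
  show "\<exists>u::real^'n \<Rightarrow> real. germ_eq u u"
    by (rule exI[of _ "\<lambda>y. 0"]) (simp add: germ_eq_def)
  show "symp (germ_eq :: (real^'n \<Rightarrow> real) \<Rightarrow> _)"
    by (auto simp: symp_def germ_eq_def elim!: eventually_mono)
  show "transp (germ_eq :: (real^'n \<Rightarrow> real) \<Rightarrow> _)"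
    by (auto simp: transp_def germ_eq_def elim: eventually_elim2)
qed

lemma germ_eqI:
  assumes "smooth_at 0 u" "smooth_at 0 v" "\<forall>\<^sub>F y in nhds 0. u y = v y"
  shows "germ_eq u v"
  using assms by (simp add: germ_eq_def)

lemma germ_eqE:
  assumes "germ_eq u v"
  shows "smooth_at 0 u" "smooth_at 0 v" "\<forall>\<^sub>F y in nhds 0. u y = v y"
  using assms by (simp_all add: germ_eq_def)

instantiation germ :: (finite) "{comm_ring_1, real_algebra_1}"
begin

lift_definition zero_germ :: "'a germ" is "\<lambda>y. 0" by (simp add: germ_eq_def)

lift_definition one_germ :: "'a germ" is "\<lambda>y. 1" by (simp add: germ_eq_def)

lift_definition plus_germ :: "'a germ \<Rightarrow> 'a germ \<Rightarrow> 'a germ" is "\<lambda>u v y. u y + v y"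
  by (auto simp: germ_eq_def elim: eventually_elim2)

lift_definition minus_germ :: "'a germ \<Rightarrow> 'a germ \<Rightarrow> 'a germ" is "\<lambda>u v y. u y - v y"
  by (auto simp: germ_eq_def elim: eventually_elim2)

lift_definition times_germ :: "'a germ \<Rightarrow> 'a germ \<Rightarrow> 'a germ" is "\<lambda>u v y. u y * v y"
  by (auto simp: germ_eq_def elim: eventually_elim2)

lift_definition uminus_germ :: "'a germ \<Rightarrow> 'a germ" is "\<lambda>u y. - u y"
  by (auto simp: germ_eq_def elim: eventually_mono)

lift_definition scaleR_germ :: "real \<Rightarrow> 'a germ \<Rightarrow> 'a germ" is "\<lambda>r u y. r * u y"
  by (auto simp: germ_eq_def elim: eventually_mono)

instance
proof
  fix a b c :: "'a germ" and r s :: real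
  show "(0::'a germ) \<noteq> 1"
    by transfer (auto simp: germ_eq_def dest: eventually_nhds_x_imp_x)
qed (transfer; rule germ_eqI; simp add: germ_eqE algebra_simps)+

end

lift_definition germ_deriv :: "'n::finite \<Rightarrow> 'n germ \<Rightarrow> 'n germ" is partial
  by (auto simp: germ_eq_def intro: partial_cong_nhds)

lift_definition germ_value :: "'n::finite germ \<Rightarrow> real" is "\<lambda>u :: real^'n \<Rightarrow> real. u 0"
  by (auto simp: germ_eq_def dest: eventually_nhds_x_imp_x)

definition germ_at :: "real^'n::finite \<Rightarrow> (real^'n \<Rightarrow> real) \<Rightarrow> 'n germ" where
  "germ_at x u = abs_germ (\<lambda>y. u (x + y))"

lemma germ_deriv_add:
  fixes u v :: "'n::finite germ"
  shows "germ_deriv i (u + v) = germ_deriv i u + germ_deriv i v"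
proof (transfer, rule germ_eqI)
  fix i :: 'n and u v :: "real^'n::finite \<Rightarrow> real" assume a: "germ_eq u u" "germ_eq v v"
  show "\<forall>\<^sub>F y in nhds 0. partial i (\<lambda>y. u y + v y) y = partial i u y + partial i v y"
    using smooth_at_nhds[OF germ_eqE(1)[OF a(1)]] smooth_at_nhds[OF germ_eqE(1)[OF a(2)]]
    by eventually_elim (rule partial_add)
qed (simp_all add: germ_eqE)

lemma germ_deriv_mult:
  fixes u v :: "'n::finite germ"
  shows "germ_deriv i (u * v) = u * germ_deriv i v + germ_deriv i u * v"
proof (transfer, rule germ_eqI)
  fix i :: 'n and u v :: "real^'n::finite \<Rightarrow> real" assume a: "germ_eq u u" "germ_eq v v"
  show "\<forall>\<^sub>F y in nhds 0. partial i (\<lambda>y. u y * v y) y = u y * partial i v y + partial i u y * v y"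
    using smooth_at_nhds[OF germ_eqE(1)[OF a(1)]] smooth_at_nhds[OF germ_eqE(1)[OF a(2)]]
    by eventually_elim (rule partial_mult)
qed (simp_all add: germ_eqE)

lemma germ_deriv_scaleR:
  fixes u :: "'n::finite germ"
  shows "germ_deriv i (r *\<^sub>R u) = r *\<^sub>R germ_deriv i u"
proof (transfer, rule germ_eqI)
  fix i :: 'n and u :: "real^'n::finite \<Rightarrow> real" and r :: real assume a: "germ_eq u u"
  show "\<forall>\<^sub>F y in nhds 0. partial i (\<lambda>y. r * u y) y = r * partial i u y"
    using smooth_at_nhds[OF germ_eqE(1)[OF a(1)]]
    by eventually_elim (simp add: partial_mult)
qed (simp_all add: germ_eqE)

lemma germ_deriv_commute:
  fixes u :: "'n::finite germ"
  shows "germ_deriv i (germ_deriv j u) = germ_deriv j (germ_deriv i u)"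
proof (transfer, rule germ_eqI)
  fix i j :: 'n and u :: "real^'n::finite \<Rightarrow> real" assume a: "germ_eq u u"
  show "\<forall>\<^sub>F y in nhds 0. partial i (partial j u) y = partial j (partial i u) y"
    using smooth_at_nhds[OF germ_eqE(1)[OF a(1)]]
    by eventually_elim (rule partial_commute)
qed (simp_all add: germ_eqE)

lemma germ_value_simps [simp]:
  "germ_value 0 = 0" "germ_value 1 = 1" "germ_value (u + v) = germ_value u + germ_value v"
  "germ_value (u - v) = germ_value u - germ_value v" "germ_value (u * v) = germ_value u * germ_value v"
  "germ_value (- u) = - germ_value u" "germ_value (r *\<^sub>R u) = r * germ_value u"
  by (transfer; simp)+

lemma germ_value_numeral [simp]: "germ_value (numeral k) = numeral k"
proof -
  have "germ_value (of_nat n) = real n" for n by (induction n) simp_all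
  from this[of "numeral k"] show ?thesis by simp
qed

lemma germ_value_sum [simp]: "germ_value (\<Sum>i\<in>I. u i) = (\<Sum>i\<in>I. germ_value (u i))"
  by (induction I rule: infinite_finite_induct) auto

lemma germ_eq_translate: "smooth_at x u \<Longrightarrow> germ_eq (\<lambda>y. u (x + y)) (\<lambda>y. u (x + y))"
  by (simp add: germ_eq_def smooth_at_translate)

lemma eventually_nhds_translate:
  "(\<forall>\<^sub>F y in nhds (0::'a::real_normed_vector). P (x + y)) \<longleftrightarrow> (\<forall>\<^sub>F y in nhds x. P y)"
proof -
  have "nhds x = filtermap (\<lambda>y. y + x) (nhds 0)"
    using filtermap_nhds_shift[of "- x" 0] by simp
  then show ?thesis by (simp add: eventually_filtermap add.commute)
qed

lemma germ_at_eq_iff: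
  assumes "smooth_at x u" "smooth_at x v"
  shows "germ_at x u = germ_at x v \<longleftrightarrow> (\<forall>\<^sub>F y in nhds x. u y = v y)"
proof -
  have "germ_at x u = germ_at x v \<longleftrightarrow> germ_eq (\<lambda>y. u (x + y)) (\<lambda>y. v (x + y))"
    using Quotient3_rel[OF Quotient3_germ, of "\<lambda>y. u (x + y)" "\<lambda>y. v (x + y)"]
      assms[THEN germ_eq_translate] by (auto simp: germ_at_def)
  also have "\<dots> \<longleftrightarrow> (\<forall>\<^sub>F y in nhds x. u y = v y)"
    using assms eventually_nhds_translate[of "\<lambda>y. u y = v y" x]
    by (simp add: germ_eq_def smooth_at_translate)
  finally show ?thesis .
qed

lemma germ_at_cong: "smooth_at x u \<Longrightarrow> \<forall>\<^sub>F y in nhds x. u y = v y \<Longrightarrow> germ_at x u = germ_at x v"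
  using germ_at_eq_iff smooth_at_cong by blast

lemma germ_at_const:
  "germ_at x (\<lambda>y. 0) = 0" "germ_at x (\<lambda>y. 1) = 1"
  by (simp_all add: germ_at_def zero_germ_def one_germ_def)

lemma germ_at_add:
  "smooth_at x u \<Longrightarrow> smooth_at x v \<Longrightarrow> germ_at x (\<lambda>y. u y + v y) = germ_at x u + germ_at x v"
  by (simp add: germ_at_def plus_germ.abs_eq germ_eq_translate)

lemma germ_at_diff:
  "smooth_at x u \<Longrightarrow> smooth_at x v \<Longrightarrow> germ_at x (\<lambda>y. u y - v y) = germ_at x u - germ_at x v"
  by (simp add: germ_at_def minus_germ.abs_eq germ_eq_translate)

lemma germ_at_mult:
  "smooth_at x u \<Longrightarrow> smooth_at x v \<Longrightarrow> germ_at x (\<lambda>y. u y * v y) = germ_at x u * germ_at x v"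
  by (simp add: germ_at_def times_germ.abs_eq germ_eq_translate)

lemma germ_at_scaleR: "smooth_at x u \<Longrightarrow> germ_at x (\<lambda>y. r * u y) = r *\<^sub>R germ_at x u"
  by (simp add: germ_at_def scaleR_germ.abs_eq germ_eq_translate)

lemma germ_at_divide: "smooth_at x u \<Longrightarrow> germ_at x (\<lambda>y. u y / r) = (1 / r) *\<^sub>R germ_at x u"
  using germ_at_scaleR[of x u "1 / r"] by simp

lemma germ_at_sum:
  assumes "\<And>i. i \<in> I \<Longrightarrow> smooth_at x (u i)"
  shows "germ_at x (\<lambda>y. \<Sum>i\<in>I. u i y) = (\<Sum>i\<in>I. germ_at x (u i))"
  using assms by (induction I rule: infinite_finite_induct) (simp_all add: germ_at_const germ_at_add)

lemma germ_at_partial: "smooth_at x u \<Longrightarrow> germ_at x (partial i u) = germ_deriv i (germ_at x u)"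
proof -
  assume u: "smooth_at x u"
  have "germ_deriv i (germ_at x u) = abs_germ (partial i (\<lambda>y. u (x + y)))"
    by (simp add: germ_at_def germ_deriv.abs_eq germ_eq_translate u)
  also have "\<dots> = abs_germ (\<lambda>y. partial i u (x + y))"
  proof (rule Quotient3_rel_abs[OF Quotient3_germ], rule germ_eqI)
    show "\<forall>\<^sub>F y in nhds 0. partial i (\<lambda>y. u (x + y)) y = partial i u (x + y)"
      using smooth_at_nhds[OF u] unfolding eventually_nhds_translate[symmetric, of _ x]
      by eventually_elim (rule partial_translate)
  qed (simp_all add: smooth_at_translate u)
  finally show ?thesis by (simp add: germ_at_def)
qed

lemma germ_value_at [simp]: "smooth_at x u \<Longrightarrow> germ_value (germ_at x u) = u x"
  by (simp add: germ_at_def germ_value.abs_eq germ_eq_translate)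

lemma germ_at_surj: "\<exists>u. smooth_at x u \<and> w = germ_at x u"
proof -
  obtain v where v: "germ_eq v v" "w = abs_germ v"
    by (metis Quotient3_abs_rep Quotient3_germ Quotient3_rep_reflp)
  have "smooth_at (- x + x) v" using v(1) by (simp add: germ_eq_def)
  then have "smooth_at x (\<lambda>y. v (- x + y))" by (rule smooth_at_translate)
  then show ?thesis
    by (intro exI[of _ "\<lambda>y. v (- x + y)"]) (simp add: germ_at_def v(2))
qed

text \<open>A representative stays positive near the point by continuity, so its power -1/2 is again
  a smooth germ. This is the scalar that normalises a vector.\<close>

lemma germ_rsqrt:
  fixes w :: "'n::finite germ"
  assumes "germ_value w > 0"
  obtains r where "r * r * w = 1"
proof -
  obtain u where u: "smooth_at 0 u" "w = germ_at 0 u" using germ_at_surj by blast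
  have pos: "u 0 > 0" using assms u by simp
  let ?r = "\<lambda>y. u y powr (- 1 / 2)"
  have r: "smooth_at 0 ?r" by (rule smooth_at_powr[OF u(1) pos])
  obtain S where S: "open S" "0 \<in> S" "smooth_on S u"
    using u(1) unfolding smooth_at_def by blast
  then have "isCont u 0"
    by (metis C_k_on.simps(1) continuous_on_eq_continuous_at smooth_on_def)
  then have "(u \<longlongrightarrow> u 0) (nhds 0)"
    by (simp add: continuous_at tendsto_at_iff_tendsto_nhds)
  then have "\<forall>\<^sub>F y in nhds 0. u y > 0"
    using pos order_tendstoD(1) by blast
  then have "\<forall>\<^sub>F y in nhds 0. ?r y * ?r y * u y = 1"
    by eventually_elim (simp add: powr_add[symmetric] powr_minus_divide)
  then have "germ_at 0 ?r * germ_at 0 ?r * w = 1"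
    using germ_at_eq_iff[of 0 "\<lambda>y. ?r y * ?r y * u y" "\<lambda>y. 1"] r u
    by (simp add: germ_at_mult germ_at_const)
  then show ?thesis using that by blast
qed

section \<open>Connections in a frame\<close>

text \<open>\<open>D a\<close> differentiates along the frame vector e_a, and the covariant
  derivative of e_b along e_a is the sum of \<omega> a b c e_c. The frame need not be holonomic:
  \<open>torsion_free\<close> expresses the bracket of e_a and e_b by \<omega>.\<close>

locale torsion_free_connection =
  fixes D :: "'n::finite \<Rightarrow> 'r::{comm_ring_1,real_algebra_1} \<Rightarrow> 'r"
    and \<omega> :: "'n \<Rightarrow> 'n \<Rightarrow> 'n \<Rightarrow> 'r"
  assumes D_add: "D a (u + v) = D a u + D a v"
    and D_mult: "D a (u * v) = u * D a v + D a u * v"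
    and D_scaleR: "D a (r *\<^sub>R u) = r *\<^sub>R D a u"
    and torsion_free: "D a (D b u) - D b (D a u) = (\<Sum>c\<in>UNIV. (\<omega> a b c - \<omega> b a c) * D c u)"
begin

lemma D_zero: "D a 0 = 0"
  using D_add[of a 0 0] by simp

lemma D_one: "D a 1 = 0"
  using D_mult[of a 1 1] by simp

lemma D_minus: "D a (- u) = - D a u"
  using D_add[of a u "- u"] by (simp add: D_zero eq_neg_iff_add_eq_0 add.commute)

lemma D_diff: "D a (u - v) = D a u - D a v"
  using D_add[of a u "- v"] by (simp add: D_minus)

lemma D_sum: "D a (\<Sum>i\<in>I. u i) = (\<Sum>i\<in>I. D a (u i))"
  by (induction I rule: infinite_finite_induct) (simp_all add: D_zero D_add)

lemmas D_simps = D_zero D_one D_add D_mult D_scaleR D_minus D_diff D_sum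

text \<open>
  A tensor with index slots \<open>K\<close> is a function of an index assignment. Each slot \<open>k\<close> may carry
  its own connection \<open>A k\<close>, so that a change of frame can be performed one slot at a time.
\<close>

definition cov :: "nat set \<Rightarrow> (nat \<Rightarrow> 'n \<Rightarrow> 'n \<Rightarrow> 'n \<Rightarrow> 'r) \<Rightarrow> 'n \<Rightarrow>
    ((nat \<Rightarrow> 'n) \<Rightarrow> 'r) \<Rightarrow> (nat \<Rightarrow> 'n) \<Rightarrow> 'r" where
  "cov K A a T I = D a (T I) - (\<Sum>k\<in>K. \<Sum>q\<in>UNIV. A k a (I k) q * T (I(k := q)))"

definition curv :: "'n \<Rightarrow> 'n \<Rightarrow> 'n \<Rightarrow> 'n \<Rightarrow> 'r" where
  "curv a b c d = D a (\<omega> b d c) - D b (\<omega> a d c)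
     + (\<Sum>q\<in>UNIV. \<omega> b d q * \<omega> a q c - \<omega> a d q * \<omega> b q c)
     - (\<Sum>q\<in>UNIV. (\<omega> a b q - \<omega> b a q) * \<omega> q d c)"

lemma cov_cov:
  fixes T :: "(nat \<Rightarrow> 'n) \<Rightarrow> 'r" and K :: "nat set"
  defines "X \<equiv> \<lambda>a b I. \<Sum>k\<in>K. \<Sum>q\<in>UNIV. \<Sum>l\<in>K. \<Sum>r\<in>UNIV.
      \<omega> a (I k) q * (\<omega> b ((I(k := q)) l) r * T (I(k := q, l := r)))"
  shows "cov K (\<lambda>_. \<omega>) a (cov K (\<lambda>_. \<omega>) b T) I
     = D a (D b (T I)) - (\<Sum>k\<in>K. \<Sum>q\<in>UNIV. D a (\<omega> b (I k) q) * T (I(k := q)))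
       - (\<Sum>k\<in>K. \<Sum>q\<in>UNIV. \<omega> b (I k) q * D a (T (I(k := q))))
       - (\<Sum>k\<in>K. \<Sum>q\<in>UNIV. \<omega> a (I k) q * D b (T (I(k := q)))) + X a b I"
  unfolding cov_def X_def
  by (simp add: D_diff D_sum D_mult sum.distrib sum_subtractf right_diff_distrib sum_distrib_left)

text \<open>When the two connections act on different slots, exchanging the slots exchanges the
  derivatives, and these terms cancel. Those acting twice on the same slot leave a commutator of
  matrices.\<close>

lemma cov_cov_quadratic:
  fixes T :: "(nat \<Rightarrow> 'n) \<Rightarrow> 'r" and K :: "nat set"
  defines "X \<equiv> \<lambda>a b I. \<Sum>k\<in>K. \<Sum>q\<in>UNIV. \<Sum>l\<in>K. \<Sum>r\<in>UNIV.
      \<omega> a (I k) q * (\<omega> b ((I(k := q)) l) r * T (I(k := q, l := r)))"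
  assumes K: "finite K"
  shows "X a b I - X b a I
    = (\<Sum>k\<in>K. \<Sum>r\<in>UNIV. (\<Sum>q\<in>UNIV. \<omega> a (I k) q * \<omega> b q r - \<omega> b (I k) q * \<omega> a q r) * T (I(k := r)))"
proof -
  define N where "N = (\<lambda>a b k l. \<Sum>q\<in>UNIV. \<Sum>r\<in>UNIV. \<omega> a (I k) q * (\<omega> b (I l) r * T (I(k := q, l := r))))"
  define Y where "Y = (\<lambda>a b k. \<Sum>r\<in>UNIV. (\<Sum>q\<in>UNIV. \<omega> a (I k) q * \<omega> b q r) * T (I(k := r)))"
  have X: "X a b I = (\<Sum>k\<in>K. Y a b k) + (\<Sum>k\<in>K. \<Sum>l\<in>K. if l = k then 0 else N a b k l)" for a b
  proof -
    have "(\<Sum>q\<in>UNIV. \<Sum>l\<in>K. \<Sum>r\<in>UNIV. \<omega> a (I k) q * (\<omega> b ((I(k := q)) l) r * T (I(k := q, l := r))))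
       = Y a b k + (\<Sum>l\<in>K. if l = k then 0 else N a b k l)" if k: "k \<in> K" for k
    proof -
      have "(\<Sum>q\<in>UNIV. \<Sum>l\<in>K. \<Sum>r\<in>UNIV. \<omega> a (I k) q * (\<omega> b ((I(k := q)) l) r * T (I(k := q, l := r))))
        = (\<Sum>l\<in>K. \<Sum>q\<in>UNIV. \<Sum>r\<in>UNIV. \<omega> a (I k) q * (\<omega> b ((I(k := q)) l) r * T (I(k := q, l := r))))"
        by (rule sum.swap)
      also have "\<dots> = (\<Sum>l\<in>K. (if l = k then Y a b k else 0) + (if l = k then 0 else N a b k l))"
      proof (rule sum.cong[OF refl])
        fix l assume "l \<in> K"
        show "(\<Sum>q\<in>UNIV. \<Sum>r\<in>UNIV. \<omega> a (I k) q * (\<omega> b ((I(k := q)) l) r * T (I(k := q, l := r))))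
          = (if l = k then Y a b k else 0) + (if l = k then 0 else N a b k l)"
        proof (cases "l = k")
          case True
          then show ?thesis unfolding Y_def
            by (simp add: sum_distrib_right mult.assoc) (rule sum.swap)
        qed (simp add: N_def)
      qed
      finally show ?thesis using K k by (simp add: sum.distrib)
    qed
    then show ?thesis unfolding X_def by (simp add: sum.distrib)
  qed
  have "N a b k l = N b a l k" if "k \<noteq> l" for k l
    unfolding N_def using that
    by (subst sum.swap) (simp add: fun_upd_twist mult.left_commute)
  then have "(\<Sum>k\<in>K. \<Sum>l\<in>K. if l = k then 0 else N a b k l) = (\<Sum>k\<in>K. \<Sum>l\<in>K. if l = k then 0 else N b a k l)"
    by (subst sum.swap) (intro sum.cong refl, auto)
  then have "X a b I - X b a I = (\<Sum>k\<in>K. Y a b k) - (\<Sum>k\<in>K. Y b a k)"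
    unfolding X by simp
  also have "\<dots> = (\<Sum>k\<in>K. \<Sum>r\<in>UNIV. (\<Sum>q\<in>UNIV. \<omega> a (I k) q * \<omega> b q r - \<omega> b (I k) q * \<omega> a q r) * T (I(k := r)))"
    unfolding Y_def by (simp add: sum_subtractf left_diff_distrib)
  finally show ?thesis .
qed

text \<open>\<open>cov\<close> does not treat its direction as an index. The terms with \<omega> a b
  c on the left supply the missing correction and complete each side to a second covariant
  derivative.\<close>

lemma cov_commute:
  assumes K: "finite K"
  shows "(cov K (\<lambda>_. \<omega>) a (cov K (\<lambda>_. \<omega>) b T) I - (\<Sum>c\<in>UNIV. \<omega> a b c * cov K (\<lambda>_. \<omega>) c T I))
       - (cov K (\<lambda>_. \<omega>) b (cov K (\<lambda>_. \<omega>) a T) I - (\<Sum>c\<in>UNIV. \<omega> b a c * cov K (\<lambda>_. \<omega>) c T I))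
       = - (\<Sum>k\<in>K. \<Sum>q\<in>UNIV. curv a b q (I k) * T (I(k := q)))"
proof -
  let ?S = "\<lambda>F. \<Sum>k\<in>K. \<Sum>q\<in>UNIV. F (I k) q * T (I(k := q))"
  have "(\<Sum>c\<in>UNIV. \<omega> a b c * cov K (\<lambda>_. \<omega>) c T I) - (\<Sum>c\<in>UNIV. \<omega> b a c * cov K (\<lambda>_. \<omega>) c T I)
      = (\<Sum>c\<in>UNIV. (\<omega> a b c - \<omega> b a c) * D c (T I))
        - (\<Sum>c\<in>UNIV. \<Sum>k\<in>K. \<Sum>q\<in>UNIV. (\<omega> a b c - \<omega> b a c) * (\<omega> c (I k) q * T (I(k := q))))"
    unfolding cov_def
    by (simp add: right_diff_distrib left_diff_distrib sum_subtractf sum_distrib_left)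
  also have "(\<Sum>c\<in>UNIV. \<Sum>k\<in>K. \<Sum>q\<in>UNIV. (\<omega> a b c - \<omega> b a c) * (\<omega> c (I k) q * T (I(k := q))))
      = ?S (\<lambda>i q. \<Sum>c\<in>UNIV. (\<omega> a b c - \<omega> b a c) * \<omega> c i q)"
    by (subst sum.swap, rule sum.cong[OF refl], subst sum.swap)
       (simp add: sum_distrib_right mult.assoc)
  finally have 1: "(\<Sum>c\<in>UNIV. \<omega> a b c * cov K (\<lambda>_. \<omega>) c T I) - (\<Sum>c\<in>UNIV. \<omega> b a c * cov K (\<lambda>_. \<omega>) c T I)
      = D a (D b (T I)) - D b (D a (T I)) - ?S (\<lambda>i q. \<Sum>c\<in>UNIV. (\<omega> a b c - \<omega> b a c) * \<omega> c i q)"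
    unfolding torsion_free .
  have 2: "cov K (\<lambda>_. \<omega>) a (cov K (\<lambda>_. \<omega>) b T) I - cov K (\<lambda>_. \<omega>) b (cov K (\<lambda>_. \<omega>) a T) I
      = D a (D b (T I)) - D b (D a (T I)) - ?S (\<lambda>i q. D a (\<omega> b i q)) + ?S (\<lambda>i q. D b (\<omega> a i q))
        + ?S (\<lambda>i r. \<Sum>q\<in>UNIV. \<omega> a i q * \<omega> b q r - \<omega> b i q * \<omega> a q r)"
    unfolding cov_cov cov_cov_quadratic[OF K, where a=a and b=b and I=I and T=T, symmetric] by (simp add: algebra_simps)
  have 3: "?S (\<lambda>i q. curv a b q i) = ?S (\<lambda>i q. D a (\<omega> b i q)) - ?S (\<lambda>i q. D b (\<omega> a i q))
        - ?S (\<lambda>i r. \<Sum>q\<in>UNIV. \<omega> a i q * \<omega> b q r - \<omega> b i q * \<omega> a q r)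
        - ?S (\<lambda>i q. \<Sum>c\<in>UNIV. (\<omega> a b c - \<omega> b a c) * \<omega> c i q)"
  proof -
    have "curv a b q i = D a (\<omega> b i q) - D b (\<omega> a i q)
        - (\<Sum>c\<in>UNIV. \<omega> a i c * \<omega> b c q - \<omega> b i c * \<omega> a c q)
        - (\<Sum>c\<in>UNIV. (\<omega> a b c - \<omega> b a c) * \<omega> c i q)" for i q
      unfolding curv_def by (simp add: sum_subtractf)
    then show ?thesis
      by (simp only: left_diff_distrib sum_subtractf)
  qed
  have "(cov K (\<lambda>_. \<omega>) a (cov K (\<lambda>_. \<omega>) b T) I - (\<Sum>c\<in>UNIV. \<omega> a b c * cov K (\<lambda>_. \<omega>) c T I))
       - (cov K (\<lambda>_. \<omega>) b (cov K (\<lambda>_. \<omega>) a T) I - (\<Sum>c\<in>UNIV. \<omega> b a c * cov K (\<lambda>_. \<omega>) c T I))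
     = (cov K (\<lambda>_. \<omega>) a (cov K (\<lambda>_. \<omega>) b T) I - cov K (\<lambda>_. \<omega>) b (cov K (\<lambda>_. \<omega>) a T) I)
       - ((\<Sum>c\<in>UNIV. \<omega> a b c * cov K (\<lambda>_. \<omega>) c T I) - (\<Sum>c\<in>UNIV. \<omega> b a c * cov K (\<lambda>_. \<omega>) c T I))"
    by simp
  also have "\<dots> = - ?S (\<lambda>i q. curv a b q i)"
    unfolding 1 2 3 by simp
  finally show ?thesis .
qed

text \<open>The hypothesis \<open>compat\<close> says that the vectors E, differentiated with the
  connection A k, have B as connection coefficients. The derivative of E in the Leibniz rule is then
  exactly what replaces A k by B in slot k, while the other slots are untouched.\<close>

lemma cov_change_frame:
  assumes compat: "\<And>b j. D a (E j b) + (\<Sum>i\<in>UNIV. E i b * A k a i j) = (\<Sum>c\<in>UNIV. B a b c * E j c)"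
    and K: "k \<in> K" "finite K"
  shows "cov K (A(k := B)) a (\<lambda>I. \<Sum>j\<in>UNIV. E j (I k) * T (I(k := j))) I
    = (\<Sum>j\<in>UNIV. E j (I k) * cov K A a T (I(k := j)))"
proof -
  have split: "(\<Sum>l\<in>K. F l) = F k + (\<Sum>l\<in>K - {k}. F l)" for F :: "nat \<Rightarrow> 'r"
    using K by (simp add: sum.remove)
  have off: "(\<Sum>q\<in>UNIV. A l a (I l) q * (\<Sum>j\<in>UNIV. E j (I k) * T (I(l := q, k := j))))
    = (\<Sum>j\<in>UNIV. E j (I k) * (\<Sum>q\<in>UNIV. A l a (I l) q * T (I(k := j, l := q))))" if "l \<noteq> k" for l
  proof -
    have "I(l := q, k := j) = I(k := j, l := q)" for q j using that by (simp add: fun_upd_twist)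
    then show ?thesis
      by (simp add: sum_distrib_left mult.left_commute) (rule sum.swap)
  qed
  have "(\<Sum>q\<in>UNIV. B a (I k) q * (\<Sum>j\<in>UNIV. E j q * T (I(k := j))))
      = (\<Sum>j\<in>UNIV. (\<Sum>q\<in>UNIV. B a (I k) q * E j q) * T (I(k := j)))"
    by (simp add: sum_distrib_left sum_distrib_right mult.assoc) (rule sum.swap)
  also have "\<dots> = (\<Sum>j\<in>UNIV. D a (E j (I k)) * T (I(k := j)))
      + (\<Sum>j\<in>UNIV. (\<Sum>i\<in>UNIV. E i (I k) * A k a i j) * T (I(k := j)))"
    unfolding compat[symmetric] by (simp add: distrib_right sum.distrib)
  also have "(\<Sum>j\<in>UNIV. (\<Sum>i\<in>UNIV. E i (I k) * A k a i j) * T (I(k := j)))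
      = (\<Sum>j\<in>UNIV. E j (I k) * (\<Sum>q\<in>UNIV. A k a j q * T (I(k := q))))"
    by (simp add: sum_distrib_left sum_distrib_right mult.assoc) (rule sum.swap)
  finally have on: "(\<Sum>q\<in>UNIV. B a (I k) q * (\<Sum>j\<in>UNIV. E j q * T (I(k := j))))
    = (\<Sum>j\<in>UNIV. D a (E j (I k)) * T (I(k := j)))
      + (\<Sum>j\<in>UNIV. E j (I k) * (\<Sum>q\<in>UNIV. A k a j q * T (I(k := q))))" .
  have "cov K (A(k := B)) a (\<lambda>I. \<Sum>j\<in>UNIV. E j (I k) * T (I(k := j))) I
    = (\<Sum>j\<in>UNIV. D a (E j (I k) * T (I(k := j))))
      - (\<Sum>q\<in>UNIV. B a (I k) q * (\<Sum>j\<in>UNIV. E j q * T (I(k := j))))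
      - (\<Sum>l\<in>K - {k}. \<Sum>q\<in>UNIV. A l a (I l) q * (\<Sum>j\<in>UNIV. E j (I k) * T (I(l := q, k := j))))"
    unfolding cov_def split by (simp add: D_sum)
  also have "(\<Sum>l\<in>K - {k}. \<Sum>q\<in>UNIV. A l a (I l) q * (\<Sum>j\<in>UNIV. E j (I k) * T (I(l := q, k := j))))
    = (\<Sum>l\<in>K - {k}. \<Sum>j\<in>UNIV. E j (I k) * (\<Sum>q\<in>UNIV. A l a (I l) q * T (I(k := j, l := q))))"
    by (intro sum.cong refl off) auto
  also have "\<dots> = (\<Sum>j\<in>UNIV. E j (I k) * (\<Sum>l\<in>K - {k}. \<Sum>q\<in>UNIV. A l a (I l) q * T (I(k := j, l := q))))"
    by (subst sum.swap) (simp add: sum_distrib_left)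
  finally have lhs: "cov K (A(k := B)) a (\<lambda>I. \<Sum>j\<in>UNIV. E j (I k) * T (I(k := j))) I
    = (\<Sum>j\<in>UNIV. D a (E j (I k) * T (I(k := j))))
      - (\<Sum>q\<in>UNIV. B a (I k) q * (\<Sum>j\<in>UNIV. E j q * T (I(k := j))))
      - (\<Sum>j\<in>UNIV. E j (I k) * (\<Sum>l\<in>K - {k}. \<Sum>q\<in>UNIV. A l a (I l) q * T (I(k := j, l := q))))" .
  have rhs: "cov K A a T (I(k := j)) = D a (T (I(k := j))) - (\<Sum>q\<in>UNIV. A k a j q * T (I(k := q)))
      - (\<Sum>l\<in>K - {k}. \<Sum>q\<in>UNIV. A l a (I l) q * T (I(k := j, l := q)))" for j
    unfolding cov_def split by simp
  show ?thesis
    unfolding lhs rhs on D_mult sum.distrib right_diff_distrib sum_subtractf by simp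
qed

section \<open>Covariant derivatives of fixed rank and the Ricci identities\<close>

definition "nabla1 a T i = D a (T i) - (\<Sum>q\<in>UNIV. \<omega> a i q * T q)"

definition "nabla2 a T i j = D a (T i j) - (\<Sum>q\<in>UNIV. \<omega> a i q * T q j + \<omega> a j q * T i q)"

definition "nabla3 a T i j k =
  D a (T i j k) - (\<Sum>q\<in>UNIV. \<omega> a i q * T q j k + \<omega> a j q * T i q k + \<omega> a k q * T i j q)"

definition "nabla4 a T i j k l =
  D a (T i j k l) - (\<Sum>q\<in>UNIV. \<omega> a i q * T q j k l + \<omega> a j q * T i q k l
                              + \<omega> a k q * T i j q l + \<omega> a l q * T i j k q)"

definition "nabla5 a T h i j k l =
  D a (T h i j k l) - (\<Sum>q\<in>UNIV. \<omega> a h q * T q i j k l + \<omega> a i q * T h q j k l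
     + \<omega> a j q * T h i q k l + \<omega> a k q * T h i j q l + \<omega> a l q * T h i j k q)"

lemma cov_nabla1:
  "cov {0} (\<lambda>_. \<omega>) a (\<lambda>I. T (I 0)) = (\<lambda>I. nabla1 a T (I 0))"
  by (simp add: fun_eq_iff nabla1_def cov_def)

lemma cov_nabla2:
  "cov {0,1} (\<lambda>_. \<omega>) a (\<lambda>I. T (I 0) (I 1)) = (\<lambda>I. nabla2 a T (I 0) (I 1))"
  by (simp add: fun_eq_iff nabla2_def cov_def sum.distrib)

lemma cov_nabla4:
  "cov {0,1,2,3} (\<lambda>_. \<omega>) a (\<lambda>I. T (I 0) (I 1) (I 2) (I 3))
     = (\<lambda>I. nabla4 a T (I 0) (I 1) (I 2) (I 3))"
  by (simp add: fun_eq_iff nabla4_def cov_def sum.distrib add.assoc)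

lemma nabla2_nabla1:
  "nabla2 a (\<lambda>b. S b) b i = nabla1 a (S b) i - (\<Sum>q\<in>UNIV. \<omega> a b q * S q i)"
  by (simp add: nabla1_def nabla2_def sum.distrib)

lemma nabla3_nabla2:
  "nabla3 a (\<lambda>b. S b) b i j = nabla2 a (S b) i j - (\<Sum>q\<in>UNIV. \<omega> a b q * S q i j)"
  by (simp add: nabla2_def nabla3_def sum.distrib)

lemma nabla5_nabla4:
  "nabla5 a (\<lambda>b. S b) b i j k l = nabla4 a (S b) i j k l - (\<Sum>q\<in>UNIV. \<omega> a b q * S q i j k l)"
  by (simp add: nabla5_def nabla4_def sum.distrib)

lemma ricci_identity1:
  "nabla2 a (\<lambda>b. nabla1 b T) b i - nabla2 b (\<lambda>b. nabla1 b T) a i = - (\<Sum>q\<in>UNIV. curv a b q i * T q)"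
  using cov_commute[of "{0}" a b "\<lambda>I. T (I 0)" "\<lambda>_. i"]
  unfolding cov_nabla1 nabla2_nabla1 by simp

lemma ricci_identity2:
  "nabla3 a (\<lambda>b. nabla2 b T) b i j - nabla3 b (\<lambda>b. nabla2 b T) a i j
     = - (\<Sum>q\<in>UNIV. curv a b q i * T q j + curv a b q j * T i q)"
  using cov_commute[of "{0,1}" a b "\<lambda>I. T (I 0) (I 1)" "(\<lambda>_. j)(0 := i)"]
  unfolding cov_nabla2 nabla3_nabla2 by (simp add: sum.distrib)

lemma ricci_identity4:
  "nabla5 a (\<lambda>b. nabla4 b T) b i j k l - nabla5 b (\<lambda>b. nabla4 b T) a i j k l
     = - (\<Sum>q\<in>UNIV. curv a b q i * T q j k l + curv a b q j * T i q k l
                   + curv a b q k * T i j q l + curv a b q l * T i j k q)"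
  using cov_commute[of "{0,1,2,3}" a b "\<lambda>I. T (I 0) (I 1) (I 2) (I 3)" "(\<lambda>_. l)(0 := i, 1 := j, 2 := k)"]
  unfolding cov_nabla4 nabla5_nabla4 by (simp add: sum.distrib add.assoc)

end

text \<open>Applied to functions, the Jacobi identity yields the first Bianchi identity only after
  contraction with the derivatives D c u, and in an abstract ring the D c need not be independent.
  It is therefore an axiom here; \<open>frame_bianchi\<close> obtains it from coordinates, where it
  follows from the symmetry of the Christoffel symbols.\<close>

locale orthonormal_frame = torsion_free_connection D \<omega>
  for D :: "'n::finite \<Rightarrow> 'r::{comm_ring_1,real_algebra_1} \<Rightarrow> 'r" and \<omega> +
  assumes metric: "\<omega> a b c = - \<omega> a c b"
    and first_bianchi: "curv a b c d + curv b d c a + curv d a c b = 0"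
begin

lemma antisym_cancel: "(\<Sum>p\<in>UNIV. \<Sum>q\<in>UNIV. \<omega> a p q * (X q p + X p q)) = 0"
proof -
  have "(\<Sum>p\<in>UNIV. \<Sum>q\<in>UNIV. \<omega> a p q * X q p) = (\<Sum>p\<in>UNIV. \<Sum>q\<in>UNIV. - \<omega> a p q * X p q)"
    by (subst sum.swap, intro sum.cong refl, subst metric) simp
  then show ?thesis by (simp add: distrib_left sum.distrib sum_negf)
qed

lemma antisym_cancel': "(\<Sum>p\<in>UNIV. \<Sum>q\<in>UNIV. \<omega> a p q * X q p) + (\<Sum>p\<in>UNIV. \<Sum>q\<in>UNIV. \<omega> a p q * X p q) = 0"
  using antisym_cancel[of a X] by (simp add: distrib_left sum.distrib)

lemma curv_antisym12: "curv b a c d = - curv a b c d"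
  unfolding curv_def by (simp add: sum_subtractf left_diff_distrib)

lemma curv_antisym34: "curv a b d c = - curv a b c d"
proof -
  have "(\<Sum>q\<in>UNIV. \<omega> b c q * \<omega> a q d - \<omega> a c q * \<omega> b q d)
      = - (\<Sum>q\<in>UNIV. \<omega> b d q * \<omega> a q c - \<omega> a d q * \<omega> b q c)"
    unfolding sum_negf[symmetric]
  proof (rule sum.cong[OF refl])
    fix q
    show "\<omega> b c q * \<omega> a q d - \<omega> a c q * \<omega> b q d = - (\<omega> b d q * \<omega> a q c - \<omega> a d q * \<omega> b q c)"
      using metric[of b c q] metric[of a q d] metric[of a c q] metric[of b q d] by simp
  qed
  moreover have "(\<Sum>q\<in>UNIV. (\<omega> a b q - \<omega> b a q) * \<omega> q c d) = - (\<Sum>q\<in>UNIV. (\<omega> a b q - \<omega> b a q) * \<omega> q d c)"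
    unfolding sum_negf[symmetric] by (intro sum.cong refl) (simp add: metric[of _ c d])
  ultimately show ?thesis
    unfolding curv_def by (simp add: metric[of _ c d] D_minus)
qed

lemma curv_cyclic: "curv a b c d + curv b c a d + curv c a b d = 0"
proof -
  have "curv a b d c + curv b c d a + curv c a d b = 0" by (rule first_bianchi)
  then have "- (curv a b c d + curv b c a d + curv c a b d) = 0"
    unfolding curv_antisym34[of a b d c] curv_antisym34[of b c d a] curv_antisym34[of c a d b]
    by simp
  then show ?thesis by (simp only: neg_equal_0_iff_equal)
qed

text \<open>The ring may have zero divisors, but it is a real algebra, so 2 is invertible.\<close>

lemma half_cancel: "x = y" if "x + x = y + y" for x y :: 'r
proof -
  have "(1/2) *\<^sub>R (x + x) = (1/2) *\<^sub>R (y + y)" using that by simp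
  then show ?thesis by (simp add: scaleR_add_right[symmetric] scaleR_2[symmetric])
qed

text \<open>The octahedron argument: four instances of the cyclic identity, one for each index in
  the last place, are added with signs so that the skew symmetries leave twice the difference of the
  two sides.\<close>

lemma curv_pair: "curv c d a b = curv a b c d"
proof (rule half_cancel)
  have "curv a b c d + curv b c a d + curv c a b d = 0" by (rule curv_cyclic)
  moreover have "- curv b c a d - curv c d a b - curv b d c a = 0"
    using curv_cyclic[of b c d a] curv_antisym34[of b c d a] curv_antisym34[of c d b a]
      curv_antisym12[of d b c a] by simp
  moreover have "curv c d a b + curv a d b c + curv c a b d = 0"
    using curv_cyclic[of c d a b] curv_antisym12[of d a c b] curv_antisym34[of a d c b]
      curv_antisym12[of a c d b] curv_antisym34[of c a d b] by simp
  moreover have "- curv a d b c - curv a b c d - curv b d c a = 0"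
    using curv_cyclic[of d a b c] curv_antisym12[of d a b c] curv_antisym34[of a b d c]
      curv_antisym34[of b d a c] by simp
  moreover have "2 * x2 = 2 * x1" if "x1 + y1 + z1 = 0" "- y1 - x2 - z2 = 0" "x2 + y2 + z1 = 0" "- y2 - x1 - z2 = 0"
    for x1 x2 y1 y2 z1 z2 :: 'r
  proof -
    have "2 * x2 - 2 * x1 = (x2 + y2 + z1) - (- y1 - x2 - z2) - (x1 + y1 + z1) + (- y2 - x1 - z2)"
      by (simp add: algebra_simps)
    then show ?thesis unfolding that by simp
  qed
  ultimately have "2 * curv c d a b = 2 * curv a b c d" by blast
  then show "curv c d a b + curv c d a b = curv a b c d + curv a b c d"
    by (simp only: mult_2)
qed

lemma ricci1:
  "nabla2 a (\<lambda>b. nabla1 b T) b i - nabla2 b (\<lambda>b. nabla1 b T) a i = (\<Sum>q\<in>UNIV. curv a b i q * T q)"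
  unfolding ricci_identity1 by (simp add: sum_negf[symmetric] curv_antisym34[of a b _ i])

lemma ricci2:
  "nabla3 a (\<lambda>b. nabla2 b T) b i j - nabla3 b (\<lambda>b. nabla2 b T) a i j
     = (\<Sum>q\<in>UNIV. curv a b i q * T q j + curv a b j q * T i q)"
  unfolding ricci_identity2
  by (simp add: sum_negf[symmetric] curv_antisym34[of a b _ i] curv_antisym34[of a b _ j] algebra_simps)

lemma ricci4:
  "nabla5 a (\<lambda>b. nabla4 b T) b i j k l - nabla5 b (\<lambda>b. nabla4 b T) a i j k l
     = (\<Sum>q\<in>UNIV. curv a b i q * T q j k l + curv a b j q * T i q k l
                   + curv a b k q * T i j q l + curv a b l q * T i j k q)"
  unfolding ricci_identity4
  by (simp add: sum_negf[symmetric] curv_antisym34[of a b _ i] curv_antisym34[of a b _ j]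
      curv_antisym34[of a b _ k] curv_antisym34[of a b _ l] algebra_simps)

text \<open>The connection corrections for the contracted index cancel because \<omega> is
  skew.\<close>

lemma nabla3_contract:
  "nabla3 a (\<lambda>b c d. \<Sum>q\<in>UNIV. U b c d q * T q) b c d
     = (\<Sum>q\<in>UNIV. nabla4 a U b c d q * T q + U b c d q * nabla1 a T q)"
proof -
  have "nabla3 a (\<lambda>b c d. \<Sum>q\<in>UNIV. U b c d q * T q) b c d
      = (\<Sum>q\<in>UNIV. nabla4 a U b c d q * T q + U b c d q * nabla1 a T q)
        + ((\<Sum>q\<in>UNIV. \<Sum>r\<in>UNIV. \<omega> a q r * (U b c d r * T q)) + (\<Sum>q\<in>UNIV. \<Sum>r\<in>UNIV. \<omega> a q r * (U b c d q * T r)))"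
  proof -
    have swap: "(\<Sum>r\<in>UNIV. \<omega> a i r * (\<Sum>q\<in>UNIV. V r q * T q)) = (\<Sum>q\<in>UNIV. (\<Sum>r\<in>UNIV. \<omega> a i r * V r q) * T q)"
      for i and V :: "'n \<Rightarrow> 'n \<Rightarrow> 'r"
      by (simp add: sum_distrib_left sum_distrib_right mult.assoc) (rule sum.swap)
    show ?thesis
      unfolding nabla3_def nabla4_def nabla1_def
      by (simp add: D_sum D_mult sum.distrib swap left_diff_distrib right_diff_distrib sum_subtractf
          distrib_right sum_distrib_left sum_distrib_right algebra_simps)
         (rule arg_cong2[where f = "(+)", OF sum.swap arg_cong2[where f = "(+)", OF sum.swap sum.swap]])
  qed
  then show ?thesis
    using antisym_cancel'[of a "\<lambda>q p. U b c d q * T p"] by simp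
qed

text \<open>Third covariant derivatives of a covector are antisymmetrised in a, b, c by two
  groupings of the same six terms. Commuting the outer derivatives (F) is the Ricci identity for its
  first derivative \<open>S\<close>; commuting the inner ones (G) differentiates the Ricci identity
  of the covector and so brings in the derivative of the curvature. The remaining terms agree up to
  the first Bianchi identity. The covector with constant component 1 at e reads off one
  component.\<close>

lemma second_bianchi: "nabla4 a curv b c d e + nabla4 b curv c a d e + nabla4 c curv a b d e = 0"
proof -
  define T where "T = (\<lambda>q. if q = e then 1 else 0 :: 'r)"
  define S where "S = (\<lambda>c. nabla1 c T)"
  define P where "P = (\<lambda>a b c. nabla3 a (\<lambda>b. nabla2 b S) b c d)"
  have F: "P a b c - P b a c = (\<Sum>q\<in>UNIV. curv a b c q * S q d + curv a b d q * S c q)" for a b c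
    unfolding P_def by (rule ricci2)
  have G: "P a b c - P a c b = (\<Sum>q\<in>UNIV. nabla4 a curv b c d q * T q + curv b c d q * S a q)" for a b c
  proof -
    have U: "(\<lambda>b c d. nabla2 b S c d - nabla2 c S b d) = (\<lambda>b c d. \<Sum>q\<in>UNIV. curv b c d q * T q)"
      unfolding S_def by (simp add: ricci1)
    have "P a b c - P a c b = nabla3 a (\<lambda>b c d. nabla2 b S c d - nabla2 c S b d) b c d"
      unfolding P_def nabla3_def by (simp add: D_diff sum_subtractf sum.distrib right_diff_distrib algebra_simps)
    then show ?thesis unfolding U nabla3_contract by (simp only: S_def)
  qed
  have T: "(\<Sum>q\<in>UNIV. V q * T q) = V e" for V :: "'n \<Rightarrow> 'r"
    by (simp add: T_def if_distrib cong: if_cong)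
  let ?B = "nabla4 a curv b c d e + nabla4 b curv c a d e + nabla4 c curv a b d e"
  let ?C = "(\<Sum>q\<in>UNIV. curv b c d q * S a q) + (\<Sum>q\<in>UNIV. curv c a d q * S b q) + (\<Sum>q\<in>UNIV. curv a b d q * S c q)"
  have "(P a b c - P a c b) + (P b c a - P b a c) + (P c a b - P c b a) = ?B + ?C"
    unfolding G sum.distrib T by (simp add: algebra_simps)
  moreover have "(P a b c - P b a c) + (P b c a - P c b a) + (P c a b - P a c b)
      = (\<Sum>q\<in>UNIV. (curv a b c q + curv b c a q + curv c a b q) * S q d) + ?C"
    unfolding F by (simp add: sum.distrib algebra_simps)
  moreover have "(\<Sum>q\<in>UNIV. (curv a b c q + curv b c a q + curv c a b q) * S q d) = 0"
    unfolding curv_cyclic by simp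
  ultimately show ?thesis by (simp add: algebra_simps)
qed

end

text \<open>The factor 1/4 of \<open>tensor_inner\<close> is left out, so the squared norm of T in
  an orthonormal frame is a quarter of \<open>pairing T T\<close>.\<close>

definition pairing :: "('n::finite \<Rightarrow> 'n \<Rightarrow> 'n \<Rightarrow> 'n \<Rightarrow> 'r::comm_ring_1) \<Rightarrow> ('n \<Rightarrow> 'n \<Rightarrow> 'n \<Rightarrow> 'n \<Rightarrow> 'r) \<Rightarrow> 'r" where
  "pairing Z T = (\<Sum>i\<in>UNIV. \<Sum>j\<in>UNIV. \<Sum>k\<in>UNIV. \<Sum>l\<in>UNIV. Z i j k l * T i j k l)"

lemma pairing_linear:
  "pairing Z (\<lambda>i j k l. S i j k l + T i j k l) = pairing Z S + pairing Z T"
  "pairing Z (\<lambda>i j k l. S i j k l - T i j k l) = pairing Z S - pairing Z T"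
  "pairing Z (\<lambda>i j k l. - T i j k l) = - pairing Z T"
  "pairing Z (\<lambda>i j k l. c * T i j k l) = c * pairing Z T"
  by (simp_all add: pairing_def distrib_left right_diff_distrib sum.distrib sum_subtractf sum_negf
      sum_distrib_left mult.left_commute)

lemma pairing_scaleR:
  fixes Z T :: "'n::finite \<Rightarrow> 'n \<Rightarrow> 'n \<Rightarrow> 'n \<Rightarrow> 'r::{comm_ring_1,real_algebra_1}"
  shows "pairing Z (\<lambda>i j k l. c *\<^sub>R T i j k l) = c *\<^sub>R pairing Z T"
  by (simp add: pairing_def scaleR_sum_right)

lemma pairing_sum: "pairing Z (\<lambda>i j k l. \<Sum>p\<in>P. T p i j k l) = (\<Sum>p\<in>P. pairing Z (T p))"
proof (induction P rule: infinite_finite_induct)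
  case (insert x F)
  then show ?case by (simp add: pairing_linear)
qed (simp_all add: pairing_def)

lemma pairing_commute: "pairing Z T = pairing T Z"
  by (simp add: pairing_def mult.commute)

text \<open>Rotations bring each slot to the last place, so that a fact about one slot implies the
  same fact about all four.\<close>

lemma pairing_rotate: "pairing Z T = pairing (\<lambda>j k l i. Z i j k l) (\<lambda>j k l i. T i j k l)"
proof -
  have "pairing Z T = (\<Sum>j\<in>UNIV. \<Sum>i\<in>UNIV. \<Sum>k\<in>UNIV. \<Sum>l\<in>UNIV. Z i j k l * T i j k l)"
    unfolding pairing_def by (rule sum.swap)
  also have "\<dots> = (\<Sum>j\<in>UNIV. \<Sum>k\<in>UNIV. \<Sum>i\<in>UNIV. \<Sum>l\<in>UNIV. Z i j k l * T i j k l)"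
    by (rule sum.cong[OF refl], rule sum.swap)
  also have "\<dots> = pairing (\<lambda>j k l i. Z i j k l) (\<lambda>j k l i. T i j k l)"
    unfolding pairing_def by (rule sum.cong[OF refl], rule sum.cong[OF refl], rule sum.swap)
  finally show ?thesis .
qed

lemma pairing_minus_left: "pairing (\<lambda>i j k l. - Z i j k l) T = - pairing Z T"
  by (simp add: pairing_def sum_negf)

lemma pairing_swap12:
  assumes "\<And>i j k l. Z j i k l = - Z i j k l"
  shows "pairing Z (\<lambda>i j k l. T j i k l) = - pairing Z T"
proof -
  have "pairing Z (\<lambda>i j k l. T j i k l) = pairing (\<lambda>i j k l. Z j i k l) T"
    unfolding pairing_def by (rule sum.swap)
  also have "\<dots> = pairing (\<lambda>i j k l. - Z i j k l) T"
    by (rule arg_cong[where f = "\<lambda>X. pairing X T"], intro ext, rule assms)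
  finally show ?thesis unfolding pairing_minus_left .
qed

lemma pairing_swap34:
  assumes "\<And>i j k l. Z i j l k = - Z i j k l"
  shows "pairing Z (\<lambda>i j k l. T i j l k) = - pairing Z T"
proof -
  have "pairing Z (\<lambda>i j k l. T i j l k) = pairing (\<lambda>i j k l. Z i j l k) T"
    unfolding pairing_def by (rule sum.cong[OF refl], rule sum.cong[OF refl], rule sum.swap)
  also have "\<dots> = pairing (\<lambda>i j k l. - Z i j k l) T"
    by (rule arg_cong[where f = "\<lambda>X. pairing X T"], intro ext, rule assms)
  finally show ?thesis unfolding pairing_minus_left .
qed

lemma pairing_swap_pairs:
  assumes "\<And>i j k l. Z k l i j = Z i j k l"
  shows "pairing Z (\<lambda>i j k l. T k l i j) = pairing Z T"
proof -
  have "pairing Z (\<lambda>i j k l. T k l i j) = pairing (\<lambda>k l i j. Z i j k l) T"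
    by (subst pairing_rotate, subst pairing_rotate) (rule refl)
  also have "\<dots> = pairing Z T"
    by (rule arg_cong[where f = "\<lambda>X. pairing X T"], intro ext, rule assms)
  finally show ?thesis .
qed

lemma pairing_symmetric34:
  fixes Z T :: "'n::finite \<Rightarrow> 'n \<Rightarrow> 'n \<Rightarrow> 'n \<Rightarrow> 'r::{comm_ring_1,real_algebra_1}"
  assumes "\<And>i j k l. Z i j l k = - Z i j k l" "\<And>i j k l. T i j l k = T i j k l"
  shows "pairing Z T = 0"
proof -
  have "(\<lambda>i j k l. T i j l k) = T" by (intro ext) (rule assms(2))
  with pairing_swap34[of Z T, OF assms(1)] have "pairing Z T = - pairing Z T" by simp
  then have "pairing Z T + pairing Z T = 0"
    by (metis add.right_inverse)
  then have "(1/2) *\<^sub>R (pairing Z T + pairing Z T) = 0" by simp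
  then show ?thesis by (simp add: scaleR_2[symmetric])
qed

section \<open>Differentiating contractions and tracing the Bianchi identity\<close>

context orthonormal_frame
begin

text \<open>The connection corrections cancel slot by slot because \<omega> is skew. The last slot
  is computed; rotation then gives the first, and from it the second and third.\<close>

lemma D_pairing: "D a (pairing Z T) = pairing (nabla4 a Z) T + pairing Z (nabla4 a T)"
proof -
  define s1 where "s1 = (\<lambda>(X :: 'n \<Rightarrow> 'n \<Rightarrow> 'n \<Rightarrow> 'n \<Rightarrow> 'r) i j k l. \<Sum>q\<in>UNIV. \<omega> a i q * X q j k l)"
  define s2 where "s2 = (\<lambda>(X :: 'n \<Rightarrow> 'n \<Rightarrow> 'n \<Rightarrow> 'n \<Rightarrow> 'r) i j k l. \<Sum>q\<in>UNIV. \<omega> a j q * X i q k l)"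
  define s3 where "s3 = (\<lambda>(X :: 'n \<Rightarrow> 'n \<Rightarrow> 'n \<Rightarrow> 'n \<Rightarrow> 'r) i j k l. \<Sum>q\<in>UNIV. \<omega> a k q * X i j q l)"
  define s4 where "s4 = (\<lambda>(X :: 'n \<Rightarrow> 'n \<Rightarrow> 'n \<Rightarrow> 'n \<Rightarrow> 'r) i j k l. \<Sum>q\<in>UNIV. \<omega> a l q * X i j k q)"
  have 4: "pairing (s4 Z) T + pairing Z (s4 T) = 0" for Z T
  proof -
    have "(\<Sum>l\<in>UNIV. s4 Z i j k l * T i j k l + Z i j k l * s4 T i j k l) = 0" for i j k
      using antisym_cancel[of a "\<lambda>q p. Z i j k q * T i j k p"]
      by (simp add: s4_def sum_distrib_left sum_distrib_right sum.distrib[symmetric] algebra_simps)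
    then show ?thesis
      unfolding pairing_def sum.distrib[symmetric] by simp
  qed
  have 1: "pairing (s1 Z) T + pairing Z (s1 T) = 0" for Z T
    unfolding pairing_rotate[of "s1 Z" T] pairing_rotate[of Z "s1 T"]
    using 4[of "\<lambda>j k l i. Z i j k l" "\<lambda>j k l i. T i j k l"] unfolding s1_def s4_def .
  have 2: "pairing (s2 Z) T + pairing Z (s2 T) = 0" for Z T
    unfolding pairing_rotate[of "s2 Z" T] pairing_rotate[of Z "s2 T"]
    using 1[of "\<lambda>j k l i. Z i j k l" "\<lambda>j k l i. T i j k l"] unfolding s2_def s1_def .
  have 3: "pairing (s3 Z) T + pairing Z (s3 T) = 0" for Z T
    unfolding pairing_rotate[of "s3 Z" T] pairing_rotate[of Z "s3 T"]
    using 2[of "\<lambda>j k l i. Z i j k l" "\<lambda>j k l i. T i j k l"] unfolding s3_def s2_def .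
  have n: "nabla4 a X = (\<lambda>i j k l. D a (X i j k l) - s1 X i j k l - s2 X i j k l - s3 X i j k l - s4 X i j k l)" for X
    by (simp add: fun_eq_iff nabla4_def s1_def s2_def s3_def s4_def sum.distrib diff_diff_add)
  have "pairing (nabla4 a Z) T + pairing Z (nabla4 a T)
     = pairing (\<lambda>i j k l. D a (Z i j k l)) T + pairing Z (\<lambda>i j k l. D a (T i j k l))
       - (pairing (s1 Z) T + pairing Z (s1 T)) - (pairing (s2 Z) T + pairing Z (s2 T))
       - (pairing (s3 Z) T + pairing Z (s3 T)) - (pairing (s4 Z) T + pairing Z (s4 T))"
    unfolding n pairing_commute[of _ T] pairing_linear by (simp add: algebra_simps)
  also have "\<dots> = D a (pairing Z T)"
    unfolding 1 2 3 4 by (simp add: pairing_def D_sum D_mult sum.distrib)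
  finally show ?thesis by simp
qed

lemma divergence_pairing:
  "(\<Sum>a\<in>UNIV. nabla1 a (\<lambda>b. pairing Z (S b)) a)
     = (\<Sum>a\<in>UNIV. pairing (nabla4 a Z) (S a)) + pairing Z (\<lambda>i j k l. \<Sum>a\<in>UNIV. nabla5 a S a i j k l)"
proof -
  have "nabla1 a (\<lambda>b. pairing Z (S b)) a = pairing (nabla4 a Z) (S a) + pairing Z (nabla5 a S a)" for a
  proof -
    have "nabla5 a S a = (\<lambda>i j k l. nabla4 a (S a) i j k l - (\<Sum>q\<in>UNIV. \<omega> a a q * S q i j k l))"
      using nabla5_nabla4[of a S a] by (simp add: fun_eq_iff)
    then show ?thesis
      by (simp add: nabla1_def D_pairing pairing_linear pairing_sum)
  qed
  then show ?thesis
    by (simp add: sum.distrib pairing_sum)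
qed

lemma D_numeral: "D a (numeral k) = 0"
proof -
  have "D a (of_nat n) = 0" for n
    by (induction n) (simp_all add: D_zero D_add D_one)
  from this[of "numeral k"] show ?thesis by simp
qed

abbreviation "grad u \<equiv> (\<lambda>a. D a u)"

definition "hess u a b = nabla1 a (grad u) b"

lemma hess_symmetric: "hess u a b = hess u b a"
proof -
  have "D a (D b u) - D b (D a u) = (\<Sum>c\<in>UNIV. \<omega> a b c * D c u) - (\<Sum>c\<in>UNIV. \<omega> b a c * D c u)"
    unfolding torsion_free by (simp add: left_diff_distrib sum_subtractf)
  moreover have "x - p = y - q" if "x - y = p - q" for x y p q :: 'r
    using that by (simp add: algebra_simps)
  ultimately show ?thesis unfolding hess_def nabla1_def by blast
qed

lemma laplacian_pairing:
  "(\<Sum>a\<in>UNIV. hess (pairing Z Z) a a)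
     = 2 * (\<Sum>a\<in>UNIV. pairing (nabla4 a Z) (nabla4 a Z))
       + 2 * pairing Z (\<lambda>i j k l. \<Sum>a\<in>UNIV. nabla5 a (\<lambda>a. nabla4 a Z) a i j k l)"
proof -
  have "D a (pairing Z Z) = 2 * pairing Z (nabla4 a Z)" for a
    by (simp only: D_pairing pairing_commute[of "nabla4 _ Z" Z] mult_2)
  then have "hess (pairing Z Z) a a = 2 * nabla1 a (\<lambda>b. pairing Z (nabla4 b Z)) a" for a
    unfolding hess_def nabla1_def
    by (simp add: D_mult D_numeral right_diff_distrib sum_distrib_left mult.left_commute)
  then show ?thesis
    by (simp add: sum_distrib_left[symmetric] divergence_pairing[of Z "\<lambda>a. nabla4 a Z"] distrib_left)
qed

lemma nabla4_permute:
  "nabla4 p (\<lambda>i j k l. T j i k l) i j k l = nabla4 p T j i k l"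
  "nabla4 p (\<lambda>i j k l. T i j l k) i j k l = nabla4 p T i j l k"
  "nabla4 p (\<lambda>i j k l. T k l i j) i j k l = nabla4 p T k l i j"
  by (simp_all add: nabla4_def sum.distrib add_ac)

lemma nabla4_minus: "nabla4 p (\<lambda>i j k l. - T i j k l) i j k l = - nabla4 p T i j k l"
  by (simp add: nabla4_def D_minus sum.distrib sum_negf sum_subtractf)

lemma nabla4_skew12:
  assumes "\<And>i j k l. T j i k l = - T i j k l"
  shows "nabla4 p T j i k l = - nabla4 p T i j k l"
proof -
  have "(\<lambda>i j k l. T j i k l) = (\<lambda>i j k l. - T i j k l)" by (intro ext) (rule assms)
  then have "nabla4 p (\<lambda>i j k l. T j i k l) i j k l = nabla4 p (\<lambda>i j k l. - T i j k l) i j k l"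
    by (rule arg_cong[where f = "\<lambda>X. nabla4 p X i j k l"])
  then show ?thesis unfolding nabla4_minus nabla4_permute(1)[of p T i j k l] .
qed

lemma nabla4_skew34:
  assumes "\<And>i j k l. T i j l k = - T i j k l"
  shows "nabla4 p T i j l k = - nabla4 p T i j k l"
proof -
  have "(\<lambda>i j k l. T i j l k) = (\<lambda>i j k l. - T i j k l)" by (intro ext) (rule assms)
  then have "nabla4 p (\<lambda>i j k l. T i j l k) i j k l = nabla4 p (\<lambda>i j k l. - T i j k l) i j k l"
    by (rule arg_cong[where f = "\<lambda>X. nabla4 p X i j k l"])
  then show ?thesis unfolding nabla4_minus nabla4_permute(2)[of p T i j k l] .
qed

lemmas nabla4_antisym12 = nabla4_skew12[of curv, OF curv_antisym12]
lemmas nabla4_antisym34 = nabla4_skew34[of curv, OF curv_antisym34]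

lemma nabla4_pair: "nabla4 p curv k l i j = nabla4 p curv i j k l"
proof -
  have "(\<lambda>i j k l. curv k l i j) = curv" by (intro ext) (rule curv_pair)
  then have "nabla4 p (\<lambda>i j k l. curv k l i j) i j k l = nabla4 p curv i j k l"
    by (rule arg_cong[where f = "\<lambda>X. nabla4 p X i j k l"])
  then show ?thesis unfolding nabla4_permute(3)[of p curv i j k l] .
qed

abbreviation "nR \<equiv> (\<lambda>p. nabla4 p curv)"

lemma nabla5_antisym: "nabla5 a nR p j i k l = - nabla5 a nR p i j k l"
proof -
  have "(\<Sum>q\<in>UNIV. \<omega> a p q * nR q j i k l) = - (\<Sum>q\<in>UNIV. \<omega> a p q * nR q i j k l)"
    unfolding sum_negf[symmetric]
    by (rule sum.cong[OF refl], subst nabla4_antisym12) simp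
  then show ?thesis
    using nabla4_skew12[of "nR p", OF nabla4_antisym12, of a j i k l]
    unfolding nabla5_nabla4 by simp
qed

lemma nabla5_second_bianchi:
  "nabla5 x nR a b c d e + nabla5 x nR b c a d e + nabla5 x nR c a b d e = 0"
proof -
  have "nabla5 x nR a b c d e + nabla5 x nR b c a d e + nabla5 x nR c a b d e
    = nabla5 x (\<lambda>a b c d e. nR a b c d e + nR b c a d e + nR c a b d e) a b c d e"
    by (simp add: nabla5_def D_add sum.distrib distrib_left algebra_simps)
  then show ?thesis
    unfolding second_bianchi by (simp add: nabla5_def D_zero)
qed

text \<open>The second Bianchi identity in p, i, j trades the Laplacian for two terms that become
  derivatives of the divergence of the curvature once the derivatives are commuted.\<close>

lemma laplacian_curv:
  "nabla5 p nR p i j k l = nabla5 p nR i p j k l - nabla5 p nR j p i k l"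
proof -
  have "nabla5 p nR p i j k l + - nabla5 p nR i p j k l + nabla5 p nR j p i k l = 0"
    using nabla5_second_bianchi[of p p i j k l] nabla5_antisym[of p i j p k l] by simp
  then show ?thesis by (simp add: algebra_simps)
qed

definition "ric i k = (\<Sum>j\<in>UNIV. curv i j k j)"

lemma nabla4_trace: "(\<Sum>p\<in>UNIV. nabla4 a T i p k p) = nabla2 a (\<lambda>i k. \<Sum>p\<in>UNIV. T i p k p) i k"
proof -
  have swap: "(\<Sum>r\<in>UNIV. \<omega> a i r * (\<Sum>q\<in>UNIV. V r q)) = (\<Sum>q\<in>UNIV. \<Sum>r\<in>UNIV. \<omega> a i r * V r q)"
    for i and V :: "'n \<Rightarrow> 'n \<Rightarrow> 'r"
    by (simp add: sum_distrib_left) (rule sum.swap)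
  show ?thesis
    using antisym_cancel'[of a "\<lambda>q p. T i q k p"]
    by (simp add: nabla4_def nabla2_def D_sum sum.distrib sum_subtractf swap algebra_simps)
qed

lemma nabla5_trace: "(\<Sum>p\<in>UNIV. nabla5 a S p p j k l) = nabla3 a (\<lambda>j k l. \<Sum>p\<in>UNIV. S p p j k l) j k l"
proof -
  have swap: "(\<Sum>r\<in>UNIV. \<omega> a i r * (\<Sum>q\<in>UNIV. V r q)) = (\<Sum>q\<in>UNIV. \<Sum>r\<in>UNIV. \<omega> a i r * V r q)"
    for i and V :: "'n \<Rightarrow> 'n \<Rightarrow> 'r"
    by (simp add: sum_distrib_left) (rule sum.swap)
  show ?thesis
    using antisym_cancel'[of a "\<lambda>q p. S q p j k l"]
    by (simp add: nabla5_def nabla3_def D_sum sum.distrib sum_subtractf swap algebra_simps)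
qed

text \<open>The contracted second Bianchi identity. It is applied to the directions p, k, l after
  exchanging the index pairs; the two terms that are not the divergence are then traces of the
  curvature.\<close>

lemma div_curv: "(\<Sum>p\<in>UNIV. nR p p j k l) = nabla2 k ric l j - nabla2 l ric k j"
proof -
  have ric: "ric = (\<lambda>i k. \<Sum>p\<in>UNIV. curv i p k p)" by (intro ext) (rule ric_def)
  have "nR p p j k l = nR k l p j p - nR l k p j p" for p
  proof -
    have "nR p k l p j + nR k l p p j + nR l p k p j = 0" by (rule second_bianchi)
    then have "nR p p j k l - nR k l p j p + nR l k p j p = 0"
      using nabla4_pair[of p k l p j] nabla4_antisym34[of k l p p j] nabla4_antisym12[of l p k p j]
        nabla4_antisym34[of l k p p j] by simp
    then show ?thesis by (simp add: algebra_simps)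
  qed
  then show ?thesis unfolding ric nabla4_trace[symmetric] by (simp add: sum_subtractf)
qed

lemma sum_kronecker:
  fixes X :: "'n \<Rightarrow> 'r"
  shows "(\<Sum>q\<in>UNIV. X q * (u * (if q = j then 1 else 0))) = X j * u"
    and "(\<Sum>q\<in>UNIV. X q * (u * (if j = q then 1 else 0))) = X j * u"
proof -
  have 1: "(\<Sum>q\<in>UNIV. X q * (u * (if q = j then 1 else 0))) = (\<Sum>q\<in>UNIV. if q = j then X q * u else 0)"
    by (rule sum.cong) auto
  have 2: "(\<Sum>q\<in>UNIV. X q * (u * (if j = q then 1 else 0))) = (\<Sum>q\<in>UNIV. if q = j then X q * u else 0)"
    by (rule sum.cong) auto
  show "(\<Sum>q\<in>UNIV. X q * (u * (if q = j then 1 else 0))) = X j * u"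
    unfolding 1 by simp
  show "(\<Sum>q\<in>UNIV. X q * (u * (if j = q then 1 else 0))) = X j * u"
    unfolding 2 by simp
qed

lemma nabla_scalar_metric:
  "nabla2 k (\<lambda>l j. u * (if l = j then 1 else 0)) l j = D k u * (if l = j then 1 else 0)"
proof -
  have "(\<Sum>q\<in>UNIV. \<omega> k l q * (u * (if q = j then 1 else 0)) + \<omega> k j q * (u * (if l = q then 1 else 0)))
     = \<omega> k l j * u + \<omega> k j l * u"
    unfolding sum.distrib sum_kronecker ..
  also have "\<dots> = 0" by (simp add: metric[of k l j])
  finally show ?thesis by (simp add: nabla2_def D_mult D_zero D_one)
qed

lemma nabla_vector_metric:
  "nabla3 i (\<lambda>k l j. v k * (if l = j then 1 else 0)) k l j = nabla1 i v k * (if l = j then 1 else 0)"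
proof -
  have "(\<Sum>q\<in>UNIV. \<omega> i l q * (v k * (if q = j then 1 else 0)) + \<omega> i j q * (v k * (if l = q then 1 else 0)))
     = \<omega> i l j * v k + \<omega> i j l * v k"
    unfolding sum.distrib sum_kronecker ..
  also have "\<dots> = 0" by (simp add: metric[of i l j])
  finally show ?thesis
    by (auto simp: nabla3_def nabla1_def D_mult D_zero D_one sum.distrib add.assoc sum_distrib_right)
qed

lemma nabla_products:
  "nabla2 k (\<lambda>l j. v l * w j) l j = nabla1 k v l * w j + v l * nabla1 k w j"
  "nabla3 i (\<lambda>k l j. A k l * w j) k l j = nabla2 i A k l * w j + A k l * nabla1 i w j"
  "nabla3 i (\<lambda>k l j. v l * A k j) k l j = nabla1 i v l * A k j + v l * nabla2 i A k j"
  by (simp_all add: nabla1_def nabla2_def nabla3_def D_mult sum.distrib sum_distrib_left sum_distrib_right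
      algebra_simps)

lemma nabla2_linear:
  "nabla2 k (\<lambda>l j. A l j - B l j + r *\<^sub>R C l j) l j = nabla2 k A l j - nabla2 k B l j + r *\<^sub>R nabla2 k C l j"
  by (simp add: nabla2_def D_simps sum.distrib sum_subtractf scaleR_sum_right scaleR_diff_right
      scaleR_add_right algebra_simps)

lemma nabla3_linear:
  "nabla3 i (\<lambda>k l j. A k l j - B k l j + r *\<^sub>R (C k l j + E k l j)) k l j
     = nabla3 i A k l j - nabla3 i B k l j + r *\<^sub>R (nabla3 i C k l j + nabla3 i E k l j)"
  by (simp add: nabla3_def D_simps sum.distrib sum_subtractf scaleR_sum_right scaleR_diff_right
      scaleR_add_right algebra_simps)

lemma nabla3_permute_diff:
  "nabla3 i (\<lambda>j k l. V k l j - V l k j) j k l = nabla3 i V k l j - nabla3 i V l k j"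
  by (simp add: nabla3_def D_diff sum.distrib sum_subtractf right_diff_distrib algebra_simps)

lemma nabla3_skew:
  "nabla3 i (\<lambda>k l j. V k l j - V l k j) k l j = nabla3 i V k l j - nabla3 i V l k j"
  by (simp add: nabla3_def D_diff sum.distrib sum_subtractf right_diff_distrib algebra_simps)

end

section \<open>The weighted Laplacian of the curvature\<close>

text \<open>Here \<mu> is the real constant 1/m, while \<open>lam\<close> is a ring element: its
  derivatives occur in the derivatives of Ric, but multiplied by the metric, and a trace-free tensor
  annihilates them.\<close>

locale quasi_einstein_frame = orthonormal_frame D \<omega>
  for D :: "'n::finite \<Rightarrow> 'r::{comm_ring_1,real_algebra_1} \<Rightarrow> 'r" and \<omega> +
  fixes f lam :: 'r and \<mu> :: real
  assumes quasi_einstein: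
    "ric a b + hess f a b - \<mu> *\<^sub>R (D a f * D b f) = lam * (if a = b then 1 else 0)"
begin

abbreviation "F \<equiv> grad f"
abbreviation "H \<equiv> hess f"
abbreviation "H3 \<equiv> (\<lambda>k. nabla2 k H)"

lemma hess_eq: "H = (\<lambda>b. nabla1 b F)"
  by (intro ext) (rule hess_def)

lemma ric_eq: "ric = (\<lambda>l j. lam * (if l = j then 1 else 0) - H l j + \<mu> *\<^sub>R (F l * F j))"
proof (intro ext)
  fix l j
  show "ric l j = lam * (if l = j then 1 else 0) - H l j + \<mu> *\<^sub>R (F l * F j)"
    unfolding quasi_einstein[symmetric] by simp
qed

lemma nabla_ric:
  "nabla2 k ric l j
     = D k lam * (if l = j then 1 else 0) - H3 k l j + \<mu> *\<^sub>R (H k l * F j + F l * H k j)"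
  unfolding ric_eq nabla2_linear nabla_scalar_metric nabla_products(1) hess_def ..

lemma nabla_nabla_ric:
  "nabla3 i (\<lambda>k. nabla2 k ric) k l j
     = nabla1 i (grad lam) k * (if l = j then 1 else 0) - nabla3 i H3 k l j
       + \<mu> *\<^sub>R (H3 i k l * F j + H k l * H i j + (H i l * H k j + F l * H3 i k j))"
proof -
  have "(\<lambda>k. nabla2 k ric)
    = (\<lambda>k l j. D k lam * (if l = j then 1 else 0) - H3 k l j + \<mu> *\<^sub>R (H k l * F j + F l * H k j))"
    by (intro ext) (rule nabla_ric)
  then show ?thesis
    using nabla_products(2)[of i H F k l j] nabla_products(3)[of i F H k l j]
    by (simp only: nabla3_linear nabla_vector_metric[of i "grad lam"] hess_def[symmetric])
qed

lemma H3_commute: "H3 k l j - H3 l k j = (\<Sum>q\<in>UNIV. curv k l j q * F q)"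
  unfolding hess_eq by (rule ricci1)

lemma nabla_H3_commute:
  "nabla3 i H3 k l j - nabla3 i H3 l k j = (\<Sum>q\<in>UNIV. nR i k l j q * F q + curv k l j q * H i q)"
proof -
  have "nabla3 i (\<lambda>k l j. H3 k l j - H3 l k j) k l j = nabla3 i (\<lambda>k l j. \<Sum>q\<in>UNIV. curv k l j q * F q) k l j"
    unfolding H3_commute ..
  then show ?thesis
    unfolding nabla3_contract nabla3_skew[of i H3 k l j] hess_def .
qed

lemma H3_symmetric: "H3 i k l = H3 i l k"
proof -
  have "(\<lambda>k l. H l k) = H" by (intro ext) (rule hess_symmetric)
  then have "nabla2 i (\<lambda>k l. H l k) k l = H3 i k l"
    by (rule arg_cong[where f = "\<lambda>X. nabla2 i X k l"])
  then show ?thesis by (simp add: nabla2_def add.commute)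
qed

text \<open>The curvature terms produced by commuting two derivatives of the curvature, except the
  one where the contracted index forms a Ricci tensor.\<close>

definition "quad i j k l = (\<Sum>p\<in>UNIV. \<Sum>q\<in>UNIV.
   curv p i j q * curv p q k l + curv p i k q * curv p j q l + curv p i l q * curv p j k q)"

text \<open>Only algebraic symmetries of the half Weyl tensor enter. Skewness allows any partner of
  Z to be antisymmetrised at the cost of a factor 2, and the vanishing trace removes multiples of
  the metric.\<close>

context
  fixes Z :: "'n \<Rightarrow> 'n \<Rightarrow> 'n \<Rightarrow> 'n \<Rightarrow> 'r"
  assumes Z12: "\<And>i j k l. Z j i k l = - Z i j k l"
    and Z34: "\<And>i j k l. Z i j l k = - Z i j k l"
    and Zpair: "\<And>i j k l. Z k l i j = Z i j k l"
    and Ztrace: "\<And>i k. (\<Sum>j\<in>UNIV. Z i j k j) = 0"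
begin

lemma pairing_skew12: "pairing Z (\<lambda>i j k l. T i j k l - T j i k l) = 2 * pairing Z T"
  using pairing_swap12[of Z T, OF Z12] by (simp only: pairing_linear mult_2) simp

lemma pairing_skew34: "pairing Z (\<lambda>i j k l. T i j k l - T i j l k) = 2 * pairing Z T"
  using pairing_swap34[of Z T, OF Z34] by (simp only: pairing_linear mult_2) simp

lemma pairing_combination:
  "pairing Z (\<lambda>i j k l. A i j k l - B i j k l + r *\<^sub>R C i j k l) = pairing Z A - pairing Z B + r *\<^sub>R pairing Z C"
  by (simp only: pairing_linear pairing_scaleR)

lemma pairing_metric: "pairing Z (\<lambda>i j k l. h i k * (if l = j then 1 else 0)) = 0"
proof -
  have "(\<Sum>j\<in>UNIV. \<Sum>k\<in>UNIV. \<Sum>l\<in>UNIV. Z i j k l * (h i k * (if l = j then 1 else 0)))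
      = (\<Sum>k\<in>UNIV. (\<Sum>j\<in>UNIV. Z i j k j) * h i k)" for i
    unfolding sum_kronecker by (subst sum.swap) (simp add: sum_distrib_right)
  then show ?thesis unfolding pairing_def Ztrace by simp
qed

text \<open>Exchanging the derivatives p and i costs one curvature term per index. The term of the
  contracted index p becomes Ric, the other three are \<open>quad\<close>. In the exchanged order
  stands the derivative of a divergence, which \<open>div_curv\<close> expresses by Ric.\<close>

lemma div_nR:
  "(\<Sum>p\<in>UNIV. nabla5 p nR i p j k l)
     = (nabla3 i (\<lambda>k. nabla2 k ric) k l j - nabla3 i (\<lambda>k. nabla2 k ric) l k j)
       + ((\<Sum>q\<in>UNIV. ric i q * curv q j k l) + quad i j k l)"
proof -
  have "nabla5 p nR i p j k l = nabla5 i nR p p j k l + (\<Sum>q\<in>UNIV. curv p i p q * curv q j k l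
      + (curv p i j q * curv p q k l + curv p i k q * curv p j q l + curv p i l q * curv p j k q))" for p
    using ricci4[of p curv i p j k l] by (simp only: diff_eq_eq add_ac)
  then have "(\<Sum>p\<in>UNIV. nabla5 p nR i p j k l) = (\<Sum>p\<in>UNIV. nabla5 i nR p p j k l)
      + ((\<Sum>p\<in>UNIV. \<Sum>q\<in>UNIV. curv p i p q * curv q j k l) + quad i j k l)"
    unfolding quad_def by (simp only: sum.distrib)
  also have "(\<Sum>p\<in>UNIV. nabla5 i nR p p j k l)
      = nabla3 i (\<lambda>k. nabla2 k ric) k l j - nabla3 i (\<lambda>k. nabla2 k ric) l k j"
    unfolding nabla5_trace div_curv by (rule nabla3_permute_diff)
  also have "(\<Sum>p\<in>UNIV. \<Sum>q\<in>UNIV. curv p i p q * curv q j k l) = (\<Sum>q\<in>UNIV. ric i q * curv q j k l)"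
  proof -
    have "curv p i p q = curv i p q p" for p q
      using curv_antisym12[of p i p q] curv_antisym34[of i p p q] by simp
    then show ?thesis
      by (subst sum.swap) (simp add: ric_def sum_distrib_right)
  qed
  finally show ?thesis .
qed

text \<open>Antisymmetrising in k and l gives the differentiated Ricci identity of df. Its term with
  the derivative of the curvature is antisymmetrised in i and j, and the second Bianchi identity
  turns it into the derivative along the gradient of f. Each antisymmetrisation contributes a factor
  2, hence the 4.\<close>

lemma pairing_nabla_H3:
  "4 * pairing Z (\<lambda>i j k l. nabla3 i H3 k l j)
     = - (\<Sum>q\<in>UNIV. F q * pairing Z (nR q)) - 2 * pairing Z (\<lambda>i j k l. \<Sum>q\<in>UNIV. H i q * curv q j k l)"
proof -
  define V where "V = (\<lambda>i j k l. \<Sum>q\<in>UNIV. nR i k l j q * F q)"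
  have V: "V i j k l - V j i k l = - (\<Sum>q\<in>UNIV. F q * nR q i j k l)" for i j k l
  proof -
    have "nR i k l j q - nR j k l i q = - nR q i j k l" for q
    proof -
      have "nR i k l j q - nR j k l i q = nR i j q k l + nR j q i k l"
        using nabla4_pair[of i k l j q] nabla4_pair[of j k l i q] nabla4_antisym12[of j i q k l] by simp
      then show ?thesis
        using second_bianchi[of q i j k l] by (simp only: eq_neg_iff_add_eq_0 add_ac)
    qed
    then have "nR i k l j q * F q - nR j k l i q * F q = - (F q * nR q i j k l)" for q
      unfolding left_diff_distrib[symmetric] by (simp add: mult.commute)
    then show ?thesis
      unfolding V_def sum_subtractf[symmetric] sum_negf[symmetric] by (intro sum.cong refl)
  qed
  have "2 * pairing Z V = pairing Z (\<lambda>i j k l. - (\<Sum>q\<in>UNIV. F q * nR q i j k l))"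
    using pairing_skew12[of V] unfolding V by simp
  then have pV: "2 * pairing Z V = - (\<Sum>q\<in>UNIV. F q * pairing Z (nR q))"
    unfolding pairing_linear pairing_sum .
  have U: "(\<Sum>q\<in>UNIV. curv k l j q * H i q) = - (\<Sum>q\<in>UNIV. H i q * curv q j k l)" for i j k l
  proof -
    have "curv k l j q = - curv q j k l" for q
      using curv_pair[of k l j q] curv_antisym12[of j q k l] by simp
    then show ?thesis by (simp add: sum_negf[symmetric] mult.commute)
  qed
  have "2 * pairing Z (\<lambda>i j k l. nabla3 i H3 k l j)
      = pairing Z (\<lambda>i j k l. nabla3 i H3 k l j - nabla3 i H3 l k j)"
    by (rule pairing_skew34[symmetric])
  also have "\<dots> = pairing Z V - pairing Z (\<lambda>i j k l. \<Sum>q\<in>UNIV. H i q * curv q j k l)"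
    unfolding nabla_H3_commute sum.distrib U V_def[symmetric] pairing_linear by simp
  finally have "2 * (2 * pairing Z (\<lambda>i j k l. nabla3 i H3 k l j))
      = 2 * pairing Z V - 2 * pairing Z (\<lambda>i j k l. \<Sum>q\<in>UNIV. H i q * curv q j k l)"
    by (simp only: right_diff_distrib)
  then show ?thesis unfolding pV by (simp add: mult.assoc[symmetric])
qed

text \<open>The first two products are symmetric in k and l and vanish. Exchanging k and l turns the
  third into minus the Hessian square. Antisymmetrising the last in i and j leaves a commutator of
  derivatives of df.\<close>

lemma pairing_gradient_terms:
  "4 * pairing Z (\<lambda>i j k l. H3 i k l * F j + H k l * H i j + (H i l * H k j + F l * H3 i k j))
     = 2 * pairing Z (\<lambda>i j k l. \<Sum>q\<in>UNIV. curv i j k q * (F q * F l))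
       - 4 * pairing Z (\<lambda>i j k l. H i k * H j l)"
proof -
  have 1: "pairing Z (\<lambda>i j k l. H3 i k l * F j + H k l * H i j) = 0"
  proof (rule pairing_symmetric34[OF Z34])
    show "H3 i l k * F j + H l k * H i j = H3 i k l * F j + H k l * H i j" for i j k l
      unfolding H3_symmetric[of i l k] hess_symmetric[of f l k] ..
  qed
  have 2: "pairing Z (\<lambda>i j k l. H i l * H k j) = - pairing Z (\<lambda>i j k l. H i k * H j l)"
    using pairing_swap34[of Z "\<lambda>i j k l. H i k * H j l", OF Z34]
    by (simp only: hess_symmetric[of f _ _])
  have "F l * H3 i k j - F l * H3 j k i = (\<Sum>q\<in>UNIV. curv i j k q * (F q * F l))" for i j k l
  proof -
    have "F l * H3 i k j - F l * H3 j k i = F l * (H3 i j k - H3 j i k)"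
      unfolding H3_symmetric[of i k j] H3_symmetric[of j k i] by (simp add: right_diff_distrib)
    then show ?thesis unfolding H3_commute by (simp add: sum_distrib_left ac_simps)
  qed
  then have 3: "2 * pairing Z (\<lambda>i j k l. F l * H3 i k j)
      = pairing Z (\<lambda>i j k l. \<Sum>q\<in>UNIV. curv i j k q * (F q * F l))"
    using pairing_skew12[of "\<lambda>i j k l. F l * H3 i k j"] by simp
  have "pairing Z (\<lambda>i j k l. H3 i k l * F j + H k l * H i j + (H i l * H k j + F l * H3 i k j))
      = pairing Z (\<lambda>i j k l. F l * H3 i k j) - pairing Z (\<lambda>i j k l. H i k * H j l)"
    using 1 2 unfolding pairing_linear by simp
  then have "4 * pairing Z (\<lambda>i j k l. H3 i k l * F j + H k l * H i j + (H i l * H k j + F l * H3 i k j))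
      = 2 * (2 * pairing Z (\<lambda>i j k l. F l * H3 i k j)) - 4 * pairing Z (\<lambda>i j k l. H i k * H j l)"
    by (simp add: right_diff_distrib)
  then show ?thesis unfolding 3 .
qed

text \<open>The quasi-Einstein equation replaces Ric plus the Hessian by a multiple of the metric,
  which reproduces the curvature, and a multiple of df \<otimes> df.\<close>

lemma pairing_ric_hess:
  "pairing Z (\<lambda>i j k l. \<Sum>q\<in>UNIV. H i q * curv q j k l) + pairing Z (\<lambda>i j k l. \<Sum>q\<in>UNIV. ric i q * curv q j k l)
     = lam * pairing Z curv + \<mu> *\<^sub>R pairing Z (\<lambda>i j k l. \<Sum>q\<in>UNIV. curv i j k q * (F q * F l))"
proof -
  let ?G = "\<lambda>i j k l. \<Sum>q\<in>UNIV. F i * F q * curv q j k l"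
  have "(\<Sum>q\<in>UNIV. H i q * curv q j k l) + (\<Sum>q\<in>UNIV. ric i q * curv q j k l)
      = lam * curv i j k l + \<mu> *\<^sub>R ?G i j k l" for i j k l
  proof -
    have "H i q * curv q j k l + ric i q * curv q j k l
        = curv q j k l * (lam * (if i = q then 1 else 0)) + \<mu> *\<^sub>R (F i * F q * curv q j k l)" for q
      unfolding ric_eq by (simp add: algebra_simps)
    then show ?thesis
      by (simp only: sum.distrib[symmetric]) (simp add: sum.distrib sum_kronecker scaleR_sum_right mult.commute)
  qed
  then have "pairing Z (\<lambda>i j k l. \<Sum>q\<in>UNIV. H i q * curv q j k l) + pairing Z (\<lambda>i j k l. \<Sum>q\<in>UNIV. ric i q * curv q j k l)
      = pairing Z (\<lambda>i j k l. lam * curv i j k l + \<mu> *\<^sub>R ?G i j k l)"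
    unfolding pairing_linear(1)[symmetric] by simp
  also have "\<dots> = lam * pairing Z curv + \<mu> *\<^sub>R pairing Z ?G"
    unfolding pairing_linear pairing_scaleR ..
  \<comment> \<open>The pair symmetry of Z and skewness in its last pair move the gradient factors
    to the places they have in \<open>pairing_gradient_terms\<close>.\<close>
  also have "pairing Z ?G = pairing Z (\<lambda>i j k l. ?G k l i j)"
    by (rule pairing_swap_pairs[symmetric, OF Zpair])
  also have "\<dots> = - pairing Z (\<lambda>i j k l. ?G l k i j)"
    using pairing_swap34[of Z "\<lambda>i j k l. ?G k l i j", OF Z34] by simp
  also have "\<dots> = pairing Z (\<lambda>i j k l. - ?G l k i j)"
    unfolding pairing_linear ..
  also have "(\<lambda>i j k l. - ?G l k i j) = (\<lambda>i j k l. \<Sum>q\<in>UNIV. curv i j k q * (F q * F l))"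
  proof (intro ext)
    fix i j k l
    have "- (F l * F q * curv q k i j) = curv i j k q * (F q * F l)" for q
      using curv_pair[of q k i j] curv_antisym34[of i j q k] by (simp add: ac_simps)
    then show "- ?G l k i j = (\<Sum>q\<in>UNIV. curv i j k q * (F q * F l))"
      by (simp add: sum_negf[symmetric])
  qed
  finally show ?thesis .
qed

text \<open>The Ricci terms of the commutator combine with the Hessian terms into \<open>Ric + \<nabla>\<^sup>2f\<close>.\<close>

lemma pairing_laplacian_curv:
  "pairing Z (\<lambda>i j k l. \<Sum>p\<in>UNIV. nabla5 p nR p i j k l)
     = (\<Sum>q\<in>UNIV. F q * pairing Z (nR q)) + 2 * (lam * pairing Z curv) + 2 * pairing Z quad
       + \<mu> *\<^sub>R (4 * pairing Z (\<lambda>i j k l. \<Sum>q\<in>UNIV. curv i j k q * (F q * F l))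
                - 4 * pairing Z (\<lambda>i j k l. H i k * H j l))"
proof -
  let ?M = "\<lambda>i j k l. nabla3 i (\<lambda>k. nabla2 k ric) k l j"
  let ?C = "\<lambda>i j k l. H3 i k l * F j + H k l * H i j + (H i l * H k j + F l * H3 i k j)"
  let ?R = "pairing Z (\<lambda>i j k l. \<Sum>q\<in>UNIV. ric i q * curv q j k l)"
  have "pairing Z (\<lambda>i j k l. \<Sum>p\<in>UNIV. nabla5 p nR p i j k l)
      = 2 * pairing Z (\<lambda>i j k l. \<Sum>p\<in>UNIV. nabla5 p nR i p j k l)"
    unfolding laplacian_curv sum_subtractf by (rule pairing_skew12)
  also have "pairing Z (\<lambda>i j k l. \<Sum>p\<in>UNIV. nabla5 p nR i p j k l) = 2 * pairing Z ?M + (?R + pairing Z quad)"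
    unfolding div_nR pairing_linear(1) pairing_skew34[of ?M] ..
  also have "pairing Z ?M = - pairing Z (\<lambda>i j k l. nabla3 i H3 k l j) + \<mu> *\<^sub>R pairing Z ?C"
    unfolding nabla_nabla_ric pairing_combination pairing_metric by simp
  finally have "pairing Z (\<lambda>i j k l. \<Sum>p\<in>UNIV. nabla5 p nR p i j k l)
      = - (4 * pairing Z (\<lambda>i j k l. nabla3 i H3 k l j)) + \<mu> *\<^sub>R (4 * pairing Z ?C) + 2 * ?R + 2 * pairing Z quad"
    by (simp add: algebra_simps)
  also have "\<dots> = (\<Sum>q\<in>UNIV. F q * pairing Z (nR q))
      + 2 * (pairing Z (\<lambda>i j k l. \<Sum>q\<in>UNIV. H i q * curv q j k l) + ?R) + 2 * pairing Z quad
      + \<mu> *\<^sub>R (2 * pairing Z (\<lambda>i j k l. \<Sum>q\<in>UNIV. curv i j k q * (F q * F l))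
               - 4 * pairing Z (\<lambda>i j k l. H i k * H j l))"
    unfolding pairing_nabla_H3 pairing_gradient_terms by (simp add: algebra_simps)
  finally show ?thesis
    unfolding pairing_ric_hess by (simp add: algebra_simps)
qed

text \<open>By the first hypothesis D a of the squared norm is twice Z paired with the derivative of
  the curvature, so the drift term of the weighted Laplacian cancels the one produced by
  \<open>pairing_laplacian_curv\<close>. The hypotheses express that Z is a parallel projection of
  the curvature, up to terms that Z annihilates.\<close>

theorem weighted_laplacian_pairing:
  assumes "\<And>q. pairing Z (nabla4 q Z) = pairing Z (nR q)"
    and "pairing Z (\<lambda>i j k l. \<Sum>a\<in>UNIV. nabla5 a (\<lambda>a. nabla4 a Z) a i j k l)
      = pairing Z (\<lambda>i j k l. \<Sum>a\<in>UNIV. nabla5 a nR a i j k l)"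
  shows "(\<Sum>a\<in>UNIV. hess (pairing Z Z) a a) - (\<Sum>a\<in>UNIV. F a * D a (pairing Z Z))
     = 2 * (\<Sum>a\<in>UNIV. pairing (nabla4 a Z) (nabla4 a Z)) + 4 * (lam * pairing Z curv) + 4 * pairing Z quad
       + \<mu> *\<^sub>R (8 * pairing Z (\<lambda>i j k l. \<Sum>q\<in>UNIV. curv i j k q * (F q * F l))
                - 8 * pairing Z (\<lambda>i j k l. H i k * H j l))"
proof -
  have "D a (pairing Z Z) = 2 * pairing Z (nR a)" for a
    unfolding D_pairing pairing_commute[of "nabla4 a Z" Z] assms(1) by simp
  then have "(\<Sum>a\<in>UNIV. F a * D a (pairing Z Z)) = 2 * (\<Sum>a\<in>UNIV. F a * pairing Z (nR a))"
    by (simp add: sum_distrib_left mult.left_commute)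
  then show ?thesis
    unfolding laplacian_pairing assms(2) pairing_laplacian_curv by (simp add: algebra_simps)
qed

end

end

section \<open>Self-dual parts in dimension four\<close>

text \<open>
  The values at \<open>e = 1, 2, 3\<close> are the components of \<open>e\<^sub>1 \<and> e\<^sub>2 + s e\<^sub>3 \<and> e\<^sub>4\<close>,
  \<open>e\<^sub>1 \<and> e\<^sub>3 - s e\<^sub>2 \<and> e\<^sub>4\<close> and \<open>e\<^sub>1 \<and> e\<^sub>4 + s e\<^sub>2 \<and> e\<^sub>3\<close>.
\<close>

definition half_basis :: "'r::comm_ring_1 \<Rightarrow> 3 \<Rightarrow> 4 \<Rightarrow> 4 \<Rightarrow> 'r" where
  "half_basis s e i j =
     (if e = 1 then (if i = 1 \<and> j = 2 then 1 else if i = 2 \<and> j = 1 then -1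
                else if i = 3 \<and> j = 4 then s else if i = 4 \<and> j = 3 then -s else 0)
      else if e = 2 then (if i = 1 \<and> j = 3 then 1 else if i = 3 \<and> j = 1 then -1
                else if i = 4 \<and> j = 2 then s else if i = 2 \<and> j = 4 then -s else 0)
      else (if i = 1 \<and> j = 4 then 1 else if i = 4 \<and> j = 1 then -1
                else if i = 2 \<and> j = 3 then s else if i = 3 \<and> j = 2 then -s else 0))"

text \<open>Four times the projection to the s-eigenspace: the basis elements have square 4 when all
  index pairs are summed, so contracting a skew matrix over a and b gives four times its
  s-part.\<close>

definition half_form :: "'r::comm_ring_1 \<Rightarrow> 4 \<Rightarrow> 4 \<Rightarrow> 4 \<Rightarrow> 4 \<Rightarrow> 'r" where
  "half_form s i j a b = (\<Sum>e\<in>UNIV. half_basis s e i j * half_basis s e a b)"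

lemma index_distinct:
  "(1::3) \<noteq> 2" "(1::3) \<noteq> 3" "(2::3) \<noteq> 1" "(2::3) \<noteq> 3" "(3::3) \<noteq> 1" "(3::3) \<noteq> 2"
  "(1::4) \<noteq> 2" "(1::4) \<noteq> 3" "(1::4) \<noteq> 4" "(2::4) \<noteq> 1" "(2::4) \<noteq> 3" "(2::4) \<noteq> 4"
  "(3::4) \<noteq> 1" "(3::4) \<noteq> 2" "(3::4) \<noteq> 4" "(4::4) \<noteq> 1" "(4::4) \<noteq> 2" "(4::4) \<noteq> 3"
  by simp_all

lemma half_basis_values:
  "half_basis s 1 1 1 = 0" "half_basis s 1 1 2 = 1" "half_basis s 1 1 3 = 0" "half_basis s 1 1 4 = 0"
  "half_basis s 1 2 1 = -1" "half_basis s 1 2 2 = 0" "half_basis s 1 2 3 = 0" "half_basis s 1 2 4 = 0"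
  "half_basis s 1 3 1 = 0" "half_basis s 1 3 2 = 0" "half_basis s 1 3 3 = 0" "half_basis s 1 3 4 = s"
  "half_basis s 1 4 1 = 0" "half_basis s 1 4 2 = 0" "half_basis s 1 4 3 = - s" "half_basis s 1 4 4 = 0"
  "half_basis s 2 1 1 = 0" "half_basis s 2 1 2 = 0" "half_basis s 2 1 3 = 1" "half_basis s 2 1 4 = 0"
  "half_basis s 2 2 1 = 0" "half_basis s 2 2 2 = 0" "half_basis s 2 2 3 = 0" "half_basis s 2 2 4 = - s"
  "half_basis s 2 3 1 = -1" "half_basis s 2 3 2 = 0" "half_basis s 2 3 3 = 0" "half_basis s 2 3 4 = 0"
  "half_basis s 2 4 1 = 0" "half_basis s 2 4 2 = s" "half_basis s 2 4 3 = 0" "half_basis s 2 4 4 = 0"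
  "half_basis s 3 1 1 = 0" "half_basis s 3 1 2 = 0" "half_basis s 3 1 3 = 0" "half_basis s 3 1 4 = 1"
  "half_basis s 3 2 1 = 0" "half_basis s 3 2 2 = 0" "half_basis s 3 2 3 = s" "half_basis s 3 2 4 = 0"
  "half_basis s 3 3 1 = 0" "half_basis s 3 3 2 = - s" "half_basis s 3 3 3 = 0" "half_basis s 3 3 4 = 0"
  "half_basis s 3 4 1 = -1" "half_basis s 3 4 2 = 0" "half_basis s 3 4 3 = 0" "half_basis s 3 4 4 = 0"
  unfolding half_basis_def by (simp_all only: index_distinct simp_thms if_True if_False)

lemma half_basis_antisym: "half_basis s e j i = - half_basis s e i j"
proof -
  have "\<forall>e i j. half_basis s e j i = - half_basis s e i j"
    unfolding forall_3 forall_4 half_basis_values by simp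
  then show ?thesis by blast
qed

lemma half_basis_orthogonal:
  assumes "s * s = 1"
  shows "(\<Sum>a\<in>UNIV. \<Sum>b\<in>UNIV. half_basis s e a b * half_basis s f a b) = (if e = f then 4 else 0)"
proof -
  have "\<forall>e f. (\<Sum>a\<in>UNIV. \<Sum>b\<in>UNIV. half_basis s e a b * half_basis s f a b) = (if e = f then 4 else 0)"
    unfolding forall_3 sum_4 half_basis_values by (simp add: assms index_distinct)
  then show ?thesis by blast
qed

text \<open>The quaternion relations: as skew matrices the basis elements square to minus the
  identity and anticommute.\<close>

lemma half_basis_contract:
  assumes "s * s = 1"
  shows "(\<Sum>j\<in>UNIV. half_basis s e i j * half_basis s f k j) + (\<Sum>j\<in>UNIV. half_basis s f i j * half_basis s e k j)
     = (if e = f \<and> i = k then 2 else 0)"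
proof -
  have "\<forall>e f i k. (\<Sum>j\<in>UNIV. half_basis s e i j * half_basis s f k j) + (\<Sum>j\<in>UNIV. half_basis s f i j * half_basis s e k j)
     = (if e = f \<and> i = k then 2 else 0)"
    unfolding forall_3 forall_4 sum_4 half_basis_values by (simp add: assms index_distinct)
  then show ?thesis by blast
qed

text \<open>Infinitesimal rotations act on the half basis by a skew-symmetric matrix.\<close>

definition half_rotation :: "'r::comm_ring_1 \<Rightarrow> (4 \<Rightarrow> 4 \<Rightarrow> 'r) \<Rightarrow> 3 \<Rightarrow> 3 \<Rightarrow> 'r" where
  "half_rotation s w e f =
     (if e = 1 \<and> f = 2 then - (w 2 3 + s * w 1 4) else if e = 2 \<and> f = 1 then w 2 3 + s * w 1 4
      else if e = 1 \<and> f = 3 then s * w 1 3 - w 2 4 else if e = 3 \<and> f = 1 then - (s * w 1 3 - w 2 4)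
      else if e = 2 \<and> f = 3 then - (s * w 1 2 + w 3 4) else if e = 3 \<and> f = 2 then s * w 1 2 + w 3 4
      else 0)"

lemma half_rotation_antisym: "half_rotation s w f e = - half_rotation s w e f"
proof -
  have "\<forall>e f. half_rotation s w f e = - half_rotation s w e f"
    unfolding forall_3 half_rotation_def by (simp add: index_distinct)
  then show ?thesis by blast
qed

lemma half_basis_rotate:
  fixes w :: "4 \<Rightarrow> 4 \<Rightarrow> 'r::comm_ring_1"
  assumes w: "\<And>i j. w i j = - w j i" and d: "\<And>i. w i i = 0" and s: "s * s = 1"
  shows "(\<Sum>q\<in>UNIV. w i q * half_basis s e q j + w j q * half_basis s e i q)
     = (\<Sum>f\<in>UNIV. half_rotation s w e f * half_basis s f i j)"
proof -
  have w': "w 2 1 = - w 1 2" "w 3 1 = - w 1 3" "w 4 1 = - w 1 4" "w 3 2 = - w 2 3" "w 4 2 = - w 2 4" "w 4 3 = - w 3 4"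
    by (rule w)+
  have s': "s * (s * x) = x" for x by (simp add: mult.assoc[symmetric] s)
  have "\<forall>e i j. (\<Sum>q\<in>UNIV. w i q * half_basis s e q j + w j q * half_basis s e i q)
     = (\<Sum>f\<in>UNIV. half_rotation s w e f * half_basis s f i j)"
    unfolding sum_4 forall_4 forall_3 sum_3 half_basis_values half_rotation_def w' d
    by (simp add: index_distinct s s' algebra_simps)
  then show ?thesis by blast
qed

text \<open>Rotations act on the half basis through a skew matrix, so the sum of the squares J_e
  \<otimes> J_e is unchanged. This infinitesimal invariance is what makes the projection
  parallel.\<close>

lemma half_form_invariant:
  fixes w :: "4 \<Rightarrow> 4 \<Rightarrow> 'r::comm_ring_1"
  assumes w: "\<And>i j. w i j = - w j i" and d: "\<And>i. w i i = 0" and s: "s * s = 1"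
  shows "(\<Sum>q\<in>UNIV. w i q * half_form s q j a b + w j q * half_form s i q a b)
       + (\<Sum>q\<in>UNIV. w a q * half_form s i j q b + w b q * half_form s i j a q) = 0"
proof -
  let ?J = "half_basis s" and ?c = "half_rotation s w"
  have l: "(\<Sum>q\<in>UNIV. w i q * half_form s q j a b + w j q * half_form s i q a b)
      = (\<Sum>e\<in>UNIV. \<Sum>f\<in>UNIV. ?c e f * (?J f i j * ?J e a b))" for i j a b
  proof -
    have "(\<Sum>q\<in>UNIV. w i q * half_form s q j a b + w j q * half_form s i q a b)
        = (\<Sum>e\<in>UNIV. (\<Sum>q\<in>UNIV. w i q * ?J e q j + w j q * ?J e i q) * ?J e a b)"
      unfolding half_form_def sum_distrib_left sum.distrib[symmetric] sum_distrib_right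
      by (subst sum.swap) (simp add: distrib_right mult.assoc)
    then show ?thesis
      unfolding half_basis_rotate[where w = w, OF w d s] by (simp add: sum_distrib_right mult.assoc)
  qed
  have sym: "half_form s i j a b = half_form s a b i j" for i j a b :: 4
    unfolding half_form_def by (simp add: mult.commute)
  have "(\<Sum>e\<in>UNIV. \<Sum>f\<in>UNIV. ?c e f * (?J f a b * ?J e i j))
      = (\<Sum>e\<in>UNIV. \<Sum>f\<in>UNIV. - (?c e f * (?J f i j * ?J e a b)))"
    by (subst sum.swap, intro sum.cong refl, subst half_rotation_antisym) (simp add: mult.commute)
  moreover have "(\<Sum>q\<in>UNIV. w a q * half_form s i j q b + w b q * half_form s i j a q)
      = (\<Sum>q\<in>UNIV. w a q * half_form s q b i j + w b q * half_form s a q i j)"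
    by (intro sum.cong refl arg_cong2[where f = "(+)"] arg_cong2[where f = "(*)"] sym)
  ultimately show ?thesis
    unfolding l by (simp add: sum_negf)
qed

text \<open>The blocks of T as a form on two-forms. Since the sums run over all index pairs and
  basis elements have square 4, recovering T from them takes a factor 1/16.\<close>

definition half_coeff :: "'r::comm_ring_1 \<Rightarrow> 'r \<Rightarrow> (4 \<Rightarrow> 4 \<Rightarrow> 4 \<Rightarrow> 4 \<Rightarrow> 'r) \<Rightarrow> 3 \<Rightarrow> 3 \<Rightarrow> 'r" where
  "half_coeff s t T e f = (\<Sum>a\<in>UNIV. \<Sum>b\<in>UNIV. \<Sum>c\<in>UNIV. \<Sum>d\<in>UNIV.
     half_basis s e a b * half_basis t f c d * T a b c d)"

definition half_left :: "'r::comm_ring_1 \<Rightarrow> (4 \<Rightarrow> 4 \<Rightarrow> 4 \<Rightarrow> 4 \<Rightarrow> 'r) \<Rightarrow> 4 \<Rightarrow> 4 \<Rightarrow> 4 \<Rightarrow> 4 \<Rightarrow> 'r" where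
  "half_left s T i j k l = (\<Sum>a\<in>UNIV. \<Sum>b\<in>UNIV. half_form s i j a b * T a b k l)"

text \<open>Each projection is a quarter of a contraction with \<open>half_form\<close>, hence 1/16.
  Projecting one pair at a time, with the pairs exchanged in between, leaves only
  \<open>half_left\<close> to be commuted with covariant derivatives.\<close>

definition half :: "'r::{comm_ring_1,real_algebra_1} \<Rightarrow> (4 \<Rightarrow> 4 \<Rightarrow> 4 \<Rightarrow> 4 \<Rightarrow> 'r) \<Rightarrow> 4 \<Rightarrow> 4 \<Rightarrow> 4 \<Rightarrow> 4 \<Rightarrow> 'r" where
  "half s T i j k l = (1/16) *\<^sub>R half_left s (\<lambda>k l i j. half_left s T i j k l) k l i j"

lemma half_expand:
  "half s T i j k l = (1/16) *\<^sub>R (\<Sum>e\<in>UNIV. \<Sum>f\<in>UNIV. half_basis s e i j * half_basis s f k l * half_coeff s s T e f)"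
proof -
  let ?J = "half_basis s"
  have l: "half_left s T i j k l = (\<Sum>e\<in>UNIV. ?J e i j * (\<Sum>a\<in>UNIV. \<Sum>b\<in>UNIV. ?J e a b * T a b k l))" for T i j k l
  proof -
    have "half_left s T i j k l = (\<Sum>a\<in>UNIV. \<Sum>b\<in>UNIV. \<Sum>e\<in>UNIV. ?J e i j * (?J e a b * T a b k l))"
      unfolding half_left_def half_form_def by (simp add: sum_distrib_right mult.assoc)
    also have "\<dots> = (\<Sum>a\<in>UNIV. \<Sum>e\<in>UNIV. \<Sum>b\<in>UNIV. ?J e i j * (?J e a b * T a b k l))"
      by (rule sum.cong[OF refl], rule sum.swap)
    also have "\<dots> = (\<Sum>e\<in>UNIV. \<Sum>a\<in>UNIV. \<Sum>b\<in>UNIV. ?J e i j * (?J e a b * T a b k l))"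
      by (rule sum.swap)
    finally show ?thesis by (simp only: sum_distrib_left)
  qed
  have swap: "(\<Sum>c\<in>UNIV. \<Sum>d\<in>UNIV. ?J f c d * (\<Sum>e\<in>UNIV. X e * Y e c d)) = (\<Sum>e\<in>UNIV. X e * (\<Sum>c\<in>UNIV. \<Sum>d\<in>UNIV. ?J f c d * Y e c d))"
    for f and X :: "3 \<Rightarrow> 'a" and Y :: "3 \<Rightarrow> 4 \<Rightarrow> 4 \<Rightarrow> 'a"
    by (simp add: sum_3 sum_distrib_left sum.distrib distrib_left mult.left_commute)
  have c: "half_coeff s s T e f = (\<Sum>c\<in>UNIV. \<Sum>d\<in>UNIV. ?J f c d * (\<Sum>a\<in>UNIV. \<Sum>b\<in>UNIV. ?J e a b * T a b c d))" for e f
  proof -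
    have "half_coeff s s T e f = (\<Sum>a\<in>UNIV. \<Sum>c\<in>UNIV. \<Sum>b\<in>UNIV. \<Sum>d\<in>UNIV. ?J e a b * ?J f c d * T a b c d)"
      unfolding half_coeff_def by (rule sum.cong[OF refl], rule sum.swap)
    also have "\<dots> = (\<Sum>c\<in>UNIV. \<Sum>a\<in>UNIV. \<Sum>b\<in>UNIV. \<Sum>d\<in>UNIV. ?J e a b * ?J f c d * T a b c d)"
      by (rule sum.swap)
    also have "\<dots> = (\<Sum>c\<in>UNIV. \<Sum>a\<in>UNIV. \<Sum>d\<in>UNIV. \<Sum>b\<in>UNIV. ?J e a b * ?J f c d * T a b c d)"
      by (rule sum.cong[OF refl], rule sum.cong[OF refl], rule sum.swap)
    also have "\<dots> = (\<Sum>c\<in>UNIV. \<Sum>d\<in>UNIV. \<Sum>a\<in>UNIV. \<Sum>b\<in>UNIV. ?J e a b * ?J f c d * T a b c d)"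
      by (rule sum.cong[OF refl], rule sum.swap)
    finally show ?thesis by (simp add: sum_distrib_left ac_simps)
  qed
  have "half_left s (\<lambda>k l i j. half_left s T i j k l) k l i j
      = (\<Sum>f\<in>UNIV. ?J f k l * (\<Sum>e\<in>UNIV. ?J e i j * half_coeff s s T e f))"
    unfolding l swap c ..
  also have "\<dots> = (\<Sum>e\<in>UNIV. \<Sum>f\<in>UNIV. ?J e i j * ?J f k l * half_coeff s s T e f)"
    unfolding sum_distrib_left by (subst sum.swap) (simp add: ac_simps)
  finally show ?thesis unfolding half_def by simp
qed

lemma half_antisym12: "half s T j i k l = - half s T i j k l"
  unfolding half_expand half_basis_antisym[of s _ j i] by (simp add: sum_negf)

lemma half_antisym34: "half s T i j l k = - half s T i j k l"
  unfolding half_expand half_basis_antisym[of s _ l k] by (simp add: sum_negf)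

lemma half_coeff_commute:
  assumes "\<And>i j k l. T k l i j = T i j k l"
  shows "half_coeff t s T f e = half_coeff s t T e f"
proof -
  have "half_coeff t s T f e = pairing (\<lambda>a b c d. half_basis t f a b * half_basis s e c d) T"
    unfolding half_coeff_def pairing_def ..
  also have "\<dots> = pairing (\<lambda>c d a b. half_basis t f a b * half_basis s e c d) (\<lambda>c d a b. T a b c d)"
    by (subst pairing_rotate, subst pairing_rotate) (rule refl)
  also have "\<dots> = half_coeff s t T e f"
    unfolding half_coeff_def pairing_def by (simp add: assms mult.commute)
  finally show ?thesis .
qed

lemma half_coeff_iterated:
  "half_coeff t u T e f
     = (\<Sum>c\<in>UNIV. \<Sum>d\<in>UNIV. half_basis u f c d * (\<Sum>a\<in>UNIV. \<Sum>b\<in>UNIV. half_basis t e a b * T a b c d))"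
proof -
  have "half_coeff t u T e f = pairing (\<lambda>a b c d. half_basis t e a b * half_basis u f c d) T"
    unfolding half_coeff_def pairing_def ..
  also have "\<dots> = pairing (\<lambda>c d a b. half_basis t e a b * half_basis u f c d) (\<lambda>c d a b. T a b c d)"
    by (subst pairing_rotate, subst pairing_rotate) (rule refl)
  finally show ?thesis
    unfolding pairing_def by (simp add: sum_distrib_left ac_simps)
qed

lemma half_basis_sum:
  assumes M: "\<And>i j. M j i = - M i j"
  shows "(\<Sum>a\<in>UNIV. \<Sum>b\<in>UNIV. half_basis s 1 a b * M a b) = 2 * (M 1 2 + s * M 3 4)"
    and "(\<Sum>a\<in>UNIV. \<Sum>b\<in>UNIV. half_basis s 2 a b * M a b) = 2 * (M 1 3 + s * M 4 2)"
    and "(\<Sum>a\<in>UNIV. \<Sum>b\<in>UNIV. half_basis s 3 a b * M a b) = 2 * (M 1 4 + s * M 2 3)"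
proof -
  have m: "M 2 1 = - M 1 2" "M 3 1 = - M 1 3" "M 4 1 = - M 1 4" "M 3 2 = - M 2 3" "M 2 4 = - M 4 2" "M 4 3 = - M 3 4"
    by (rule M)+
  show "(\<Sum>a\<in>UNIV. \<Sum>b\<in>UNIV. half_basis s 1 a b * M a b) = 2 * (M 1 2 + s * M 3 4)"
    "(\<Sum>a\<in>UNIV. \<Sum>b\<in>UNIV. half_basis s 2 a b * M a b) = 2 * (M 1 3 + s * M 4 2)"
    "(\<Sum>a\<in>UNIV. \<Sum>b\<in>UNIV. half_basis s 3 a b * M a b) = 2 * (M 1 4 + s * M 2 3)"
    unfolding sum_4 half_basis_values m by (simp_all add: algebra_simps)
qed

text \<open>Skewness reduces the 256 summands to four, which keeps the later verifications by
  components small.\<close>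

lemma half_coeff_explicit:
  assumes T12: "\<And>i j k l. T j i k l = - T i j k l" and T34: "\<And>i j k l. T i j l k = - T i j k l"
  shows "half_coeff s t T 1 1 = 4 * (T 1 2 1 2 + t * T 1 2 3 4 + s * (T 3 4 1 2 + t * T 3 4 3 4))"
    "half_coeff s t T 1 2 = 4 * (T 1 2 1 3 + t * T 1 2 4 2 + s * (T 3 4 1 3 + t * T 3 4 4 2))"
    "half_coeff s t T 1 3 = 4 * (T 1 2 1 4 + t * T 1 2 2 3 + s * (T 3 4 1 4 + t * T 3 4 2 3))"
    "half_coeff s t T 2 1 = 4 * (T 1 3 1 2 + t * T 1 3 3 4 + s * (T 4 2 1 2 + t * T 4 2 3 4))"
    "half_coeff s t T 2 2 = 4 * (T 1 3 1 3 + t * T 1 3 4 2 + s * (T 4 2 1 3 + t * T 4 2 4 2))"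
    "half_coeff s t T 2 3 = 4 * (T 1 3 1 4 + t * T 1 3 2 3 + s * (T 4 2 1 4 + t * T 4 2 2 3))"
    "half_coeff s t T 3 1 = 4 * (T 1 4 1 2 + t * T 1 4 3 4 + s * (T 2 3 1 2 + t * T 2 3 3 4))"
    "half_coeff s t T 3 2 = 4 * (T 1 4 1 3 + t * T 1 4 4 2 + s * (T 2 3 1 3 + t * T 2 3 4 2))"
    "half_coeff s t T 3 3 = 4 * (T 1 4 1 4 + t * T 1 4 2 3 + s * (T 2 3 1 4 + t * T 2 3 2 3))"
proof -
  note b = half_basis_sum[of "\<lambda>a b. T a b _ _", OF T12]
  have "2 * (T i j l k + s * T i' j' l k) = - (2 * (T i j k l + s * T i' j' k l))" for i j i' j' k l
    unfolding T34[of _ _ l k] by (simp add: algebra_simps)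
  note c = half_basis_sum[of "\<lambda>c d. 2 * (T _ _ c d + s * T _ _ c d)", OF this]
  show "half_coeff s t T 1 1 = 4 * (T 1 2 1 2 + t * T 1 2 3 4 + s * (T 3 4 1 2 + t * T 3 4 3 4))"
    "half_coeff s t T 1 2 = 4 * (T 1 2 1 3 + t * T 1 2 4 2 + s * (T 3 4 1 3 + t * T 3 4 4 2))"
    "half_coeff s t T 1 3 = 4 * (T 1 2 1 4 + t * T 1 2 2 3 + s * (T 3 4 1 4 + t * T 3 4 2 3))"
    "half_coeff s t T 2 1 = 4 * (T 1 3 1 2 + t * T 1 3 3 4 + s * (T 4 2 1 2 + t * T 4 2 3 4))"
    "half_coeff s t T 2 2 = 4 * (T 1 3 1 3 + t * T 1 3 4 2 + s * (T 4 2 1 3 + t * T 4 2 4 2))"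
    "half_coeff s t T 2 3 = 4 * (T 1 3 1 4 + t * T 1 3 2 3 + s * (T 4 2 1 4 + t * T 4 2 2 3))"
    "half_coeff s t T 3 1 = 4 * (T 1 4 1 2 + t * T 1 4 3 4 + s * (T 2 3 1 2 + t * T 2 3 3 4))"
    "half_coeff s t T 3 2 = 4 * (T 1 4 1 3 + t * T 1 4 4 2 + s * (T 2 3 1 3 + t * T 2 3 4 2))"
    "half_coeff s t T 3 3 = 4 * (T 1 4 1 4 + t * T 1 4 2 3 + s * (T 2 3 1 4 + t * T 2 3 2 3))"
    unfolding half_coeff_iterated b c by (simp_all add: algebra_simps)
qed

lemma half_pair:
  assumes "\<And>i j k l. T k l i j = T i j k l"
  shows "half s T k l i j = half s T i j k l"
  unfolding half_expand
  by (subst sum.swap) (simp add: half_coeff_commute[of T s s, OF assms] ac_simps)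

lemma pairing_half: "pairing (half s Z) T = (1/16) *\<^sub>R (\<Sum>e\<in>UNIV. \<Sum>f\<in>UNIV. half_coeff s s Z e f * half_coeff s s T e f)"
proof -
  have basis: "pairing T (\<lambda>i j k l. half_basis s e i j * half_basis s f k l * c) = c * half_coeff s s T e f" for e f c
    by (simp add: pairing_def half_coeff_def sum_distrib_left ac_simps)
  have "half s Z = (\<lambda>i j k l. (1/16) *\<^sub>R (\<Sum>e\<in>UNIV. \<Sum>f\<in>UNIV. half_basis s e i j * half_basis s f k l * half_coeff s s Z e f))"
    by (intro ext) (rule half_expand)
  then have "pairing T (half s Z) = (1/16) *\<^sub>R (\<Sum>e\<in>UNIV. \<Sum>f\<in>UNIV. half_coeff s s Z e f * half_coeff s s T e f)"
    by (simp only: pairing_scaleR pairing_sum basis)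
  then show ?thesis
    by (simp only: pairing_commute[of "half s Z" T])
qed

lemma sum_if_eq: "(\<Sum>q\<in>UNIV. X q * (if j = q then c else 0)) = X j * c"
  for X :: "'n::finite \<Rightarrow> 'r::comm_ring_1"
proof -
  have "(\<Sum>q\<in>UNIV. X q * (if j = q then c else 0)) = (\<Sum>q\<in>UNIV. if j = q then X q * c else 0)"
    by (rule sum.cong) auto
  then show ?thesis by simp
qed

lemma scaleR_16: "(1/16) *\<^sub>R (16 * x) = x" for x :: "'r::real_algebra_1"
proof -
  have "16 * x = 16 *\<^sub>R x" by (simp add: scaleR_conv_of_real)
  then show ?thesis by simp
qed

lemma half_coeff_half:
  assumes "s * s = 1"
  shows "half_coeff s s (half s T) e f = half_coeff s s T e f"
proof -
  have "half_coeff s s (half s T) e f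
      = pairing (half s T) (\<lambda>a b c d. half_basis s e a b * half_basis s f c d)"
    unfolding half_coeff_def pairing_def by (simp add: mult.commute)
  also have "\<dots> = (1/16) *\<^sub>R (\<Sum>e'\<in>UNIV. \<Sum>f'\<in>UNIV. half_coeff s s T e' f' *
      ((if e = e' then 4 else 0) * (if f = f' then 4 else 0)))"
  proof -
    have "half_coeff s s (\<lambda>a b c d. half_basis s e a b * half_basis s f c d) e' f'
       = (\<Sum>a\<in>UNIV. \<Sum>b\<in>UNIV. half_basis s e a b * half_basis s e' a b) * (\<Sum>a\<in>UNIV. \<Sum>b\<in>UNIV. half_basis s f a b * half_basis s f' a b)" for e' f'
      unfolding half_coeff_def sum_distrib_right unfolding sum_distrib_left by (simp add: ac_simps)
    then show ?thesis unfolding pairing_half half_basis_orthogonal[OF assms] by simp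
  qed
  also have "\<dots> = half_coeff s s T e f"
  proof -
    have "(\<Sum>e'\<in>UNIV. \<Sum>f'\<in>UNIV. half_coeff s s T e' f' * ((if e = e' then 4 else 0) * (if f = f' then 4 else 0)))
       = 16 * half_coeff s s T e f"
      unfolding mult.assoc[symmetric] sum_if_eq unfolding mult.commute[of _ 4] sum_distrib_left[symmetric] sum_if_eq
      by simp
    then show ?thesis
      using scaleR_16[of "half_coeff s s T e f"] by simp
  qed
  finally show ?thesis .
qed

lemma pairing_half_half: "s * s = 1 \<Longrightarrow> pairing (half s Z) (half s T) = pairing (half s Z) T"
  unfolding pairing_half by (simp add: half_coeff_half)

definition kronecker :: "'n \<Rightarrow> 'n \<Rightarrow> 'r::comm_ring_1" where
  "kronecker i j = (if i = j then 1 else 0)"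

definition kn :: "('n \<Rightarrow> 'n \<Rightarrow> 'r) \<Rightarrow> ('n \<Rightarrow> 'n \<Rightarrow> 'r) \<Rightarrow> 'n \<Rightarrow> 'n \<Rightarrow> 'n \<Rightarrow> 'n \<Rightarrow> 'r::comm_ring_1" where
  "kn \<alpha> \<beta> i j k l = \<alpha> i k * \<beta> j l + \<alpha> j l * \<beta> i k - \<alpha> i l * \<beta> j k - \<alpha> j k * \<beta> i l"

text \<open>Invariance of \<open>half_form\<close> moves the rotation from its free indices i, j to
  the contracted ones, and skewness of w then transfers it to U.\<close>

lemma half_left_rotate:
  fixes w :: "4 \<Rightarrow> 4 \<Rightarrow> 'r::comm_ring_1"
  assumes w: "\<And>i j. w i j = - w j i" and d: "\<And>i. w i i = 0" and s: "s * s = 1"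
  shows "(\<Sum>q\<in>UNIV. w i q * (\<Sum>a\<in>UNIV. \<Sum>b\<in>UNIV. half_form s q j a b * U a b)
                 + w j q * (\<Sum>a\<in>UNIV. \<Sum>b\<in>UNIV. half_form s i q a b * U a b))
       = (\<Sum>a\<in>UNIV. \<Sum>b\<in>UNIV. half_form s i j a b * (\<Sum>q\<in>UNIV. w a q * U q b + w b q * U a q))"
proof -
  let ?K = "half_form s"
  have "(\<Sum>q\<in>UNIV. w i q * (\<Sum>a\<in>UNIV. \<Sum>b\<in>UNIV. ?K q j a b * U a b)
                 + w j q * (\<Sum>a\<in>UNIV. \<Sum>b\<in>UNIV. ?K i q a b * U a b))
      = (\<Sum>a\<in>UNIV. \<Sum>q\<in>UNIV. \<Sum>b\<in>UNIV. (w i q * ?K q j a b + w j q * ?K i q a b) * U a b)"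
    by (subst sum.swap) (simp add: sum_distrib_left sum.distrib[symmetric] distrib_right mult.assoc)
  also have "\<dots> = (\<Sum>a\<in>UNIV. \<Sum>b\<in>UNIV. (\<Sum>q\<in>UNIV. w i q * ?K q j a b + w j q * ?K i q a b) * U a b)"
    by (rule sum.cong[OF refl], subst sum.swap) (simp add: sum_distrib_right)
  also have "\<dots> = (\<Sum>a\<in>UNIV. \<Sum>b\<in>UNIV. - (\<Sum>q\<in>UNIV. w a q * ?K i j q b + w b q * ?K i j a q) * U a b)"
    using half_form_invariant[where w = w, OF w d s]
    by (intro sum.cong refl arg_cong2[where f = "(*)"]) (simp add: eq_neg_iff_add_eq_0)
  also have "\<dots> = (\<Sum>a\<in>UNIV. \<Sum>b\<in>UNIV. \<Sum>q\<in>UNIV. w q a * ?K i j q b * U a b)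
                + (\<Sum>a\<in>UNIV. \<Sum>b\<in>UNIV. \<Sum>q\<in>UNIV. w q b * ?K i j a q * U a b)"
  proof -
    have "- (\<Sum>q\<in>UNIV. w a q * x q + w b q * y q) * u = (\<Sum>q\<in>UNIV. w q a * x q * u) + (\<Sum>q\<in>UNIV. w q b * y q * u)"
      for a b u and x y :: "4 \<Rightarrow> 'r"
    proof -
      define v where "v = (\<lambda>a q. w q a)"
      have "w a q = - v a q" "w b q = - v b q" for q unfolding v_def by (rule w)+
      then have "- (\<Sum>q\<in>UNIV. w a q * x q + w b q * y q) * u = (\<Sum>q\<in>UNIV. v a q * x q * u) + (\<Sum>q\<in>UNIV. v b q * y q * u)"
        by (simp add: sum_distrib_right sum_negf sum.distrib sum_subtractf left_diff_distrib distrib_right)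
      then show ?thesis unfolding v_def .
    qed
    then show ?thesis by (simp only: sum.distrib)
  qed
  also have "(\<Sum>a\<in>UNIV. \<Sum>b\<in>UNIV. \<Sum>q\<in>UNIV. w q a * ?K i j q b * U a b)
           = (\<Sum>a\<in>UNIV. \<Sum>b\<in>UNIV. \<Sum>q\<in>UNIV. ?K i j a b * (w a q * U q b))"
  proof -
    have "(\<Sum>a\<in>UNIV. \<Sum>b\<in>UNIV. \<Sum>q\<in>UNIV. w q a * ?K i j q b * U a b)
        = (\<Sum>b\<in>UNIV. \<Sum>a\<in>UNIV. \<Sum>q\<in>UNIV. w q a * ?K i j q b * U a b)" by (rule sum.swap)
    also have "\<dots> = (\<Sum>b\<in>UNIV. \<Sum>q\<in>UNIV. \<Sum>a\<in>UNIV. w q a * ?K i j q b * U a b)"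
      by (rule sum.cong[OF refl], rule sum.swap)
    also have "\<dots> = (\<Sum>q\<in>UNIV. \<Sum>b\<in>UNIV. \<Sum>a\<in>UNIV. w q a * ?K i j q b * U a b)" by (rule sum.swap)
    finally show ?thesis by (simp add: ac_simps)
  qed
  also have "(\<Sum>a\<in>UNIV. \<Sum>b\<in>UNIV. \<Sum>q\<in>UNIV. w q b * ?K i j a q * U a b)
           = (\<Sum>a\<in>UNIV. \<Sum>b\<in>UNIV. \<Sum>q\<in>UNIV. ?K i j a b * (w b q * U a q))"
    by (rule sum.cong[OF refl], subst sum.swap) (simp add: ac_simps)
  finally show ?thesis
    by (simp add: sum.distrib[symmetric] distrib_left sum_distrib_left)
qed

text \<open>The trace of the block is a multiple of the full trace of T plus a multiple of T 1 2 3 4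
  + T 1 3 4 2 + T 1 4 2 3, which vanishes by the first Bianchi identity. For the second claim, a
  symmetric coefficient matrix sees only the symmetric part of the products of basis elements; by
  the quaternion relations this is a multiple of the identity, so the contraction is again that
  trace.\<close>

lemma half_trace:
  fixes T :: "4 \<Rightarrow> 4 \<Rightarrow> 4 \<Rightarrow> 4 \<Rightarrow> 'r::{comm_ring_1,real_algebra_1}"
  assumes T12: "\<And>i j k l. T j i k l = - T i j k l" and T34: "\<And>i j k l. T i j l k = - T i j k l"
    and Tpair: "\<And>i j k l. T k l i j = T i j k l"
    and Tcyc: "\<And>i j k l. T i j k l + T j k i l + T k i j l = 0"
    and Ttrace: "(\<Sum>i\<in>UNIV. \<Sum>j\<in>UNIV. T i j i j) = 0"
    and s: "s * s = 1"
  shows "half_coeff s s T 1 1 + half_coeff s s T 2 2 + half_coeff s s T 3 3 = 0"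
    and "(\<Sum>j\<in>UNIV. half s T i j k j) = 0"
proof -
  have ss: "s * (s * x) = x" for x using s by (simp add: mult.assoc[symmetric])
  have d: "T i i k l = 0" for i k l
  proof -
    have "T i i k l + T i i k l = 0" using T12[of i i k l] by (simp add: eq_neg_iff_add_eq_0)
    then have "(1/2) *\<^sub>R (T i i k l + T i i k l) = 0" by simp
    then show ?thesis by (simp add: scaleR_2[symmetric])
  qed
  have "T j i j i = T i j i j" for i j
    using T12[of i j j i] T34[of i j i j] by simp
  then have "(\<Sum>i\<in>UNIV. \<Sum>j\<in>UNIV. T i j i j)
      = 2 * (T 1 2 1 2 + T 1 3 1 3 + T 1 4 1 4 + T 2 3 2 3 + T 4 2 4 2 + T 3 4 3 4)"
    unfolding sum_4 by (simp add: d algebra_simps)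
  then have t: "2 * (T 1 2 1 2 + T 1 3 1 3 + T 1 4 1 4 + T 2 3 2 3 + T 4 2 4 2 + T 3 4 3 4) = 0"
    using Ttrace by simp
  have cyc: "T 1 2 3 4 + T 1 3 4 2 + T 1 4 2 3 = 0"
  proof -
    have "T 1 2 3 4 + T 1 3 4 2 + T 1 4 2 3 = T 1 2 3 4 + T 2 3 1 4 + T 3 1 2 4"
      unfolding T12[of 3 1 2 4] T34[of 1 3 4 2] Tpair[of 2 3 1 4] by simp
    then show ?thesis
      using Tcyc[of 1 2 3 4] by simp
  qed
  have "half_coeff s s T 1 1 + half_coeff s s T 2 2 + half_coeff s s T 3 3
     = 2 * (2 * (T 1 2 1 2 + T 1 3 1 3 + T 1 4 1 4 + T 2 3 2 3 + T 4 2 4 2 + T 3 4 3 4))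
       + 8 * s * (T 1 2 3 4 + T 1 3 4 2 + T 1 4 2 3)"
    unfolding half_coeff_explicit[OF T12 T34] Tpair[of 1 2 3 4] Tpair[of 1 3 4 2] Tpair[of 1 4 2 3]
    by (simp add: algebra_simps ss)
  then show tr: "half_coeff s s T 1 1 + half_coeff s s T 2 2 + half_coeff s s T 3 3 = 0"
    unfolding t cyc by simp
  let ?c = "half_coeff s s T" and ?J = "half_basis s"
  have e: "half s T i j k l = (1/16) *\<^sub>R (\<Sum>e\<in>UNIV. \<Sum>f\<in>UNIV. ?c e f * (?J e i j * ?J f k l))" for j l
    unfolding half_expand by (simp add: ac_simps)
  let ?S = "\<Sum>e\<in>UNIV. \<Sum>f\<in>UNIV. ?c e f * (\<Sum>j\<in>UNIV. ?J e i j * ?J f k j)"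
  have "?S + ?S = (\<Sum>e\<in>UNIV. \<Sum>f\<in>UNIV. ?c e f * ((\<Sum>j\<in>UNIV. ?J e i j * ?J f k j) + (\<Sum>j\<in>UNIV. ?J f i j * ?J e k j)))"
  proof -
    have "?S = (\<Sum>e\<in>UNIV. \<Sum>f\<in>UNIV. ?c e f * (\<Sum>j\<in>UNIV. ?J f i j * ?J e k j))"
      by (subst sum.swap) (simp only: half_coeff_commute[of T s s, OF Tpair])
    then show ?thesis by (simp add: distrib_left sum.distrib)
  qed
  also have "\<dots> = (if i = k then 2 * (?c 1 1 + ?c 2 2 + ?c 3 3) else 0)"
    unfolding half_basis_contract[OF s] sum_3 by (simp add: index_distinct algebra_simps)
  finally have "?S + ?S = 0" unfolding tr by simp
  then have "(1/2) *\<^sub>R (?S + ?S) = 0" by simp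
  then have "?S = 0" by (simp add: scaleR_2[symmetric])
  moreover have "(\<Sum>j\<in>UNIV. half s T i j k j) = (1/16) *\<^sub>R ?S"
    unfolding e scaleR_sum_right[symmetric]
    by (subst sum.swap, subst sum.swap[of _ _ "UNIV :: 4 set"]) (simp add: sum_distrib_left)
  ultimately show "(\<Sum>j\<in>UNIV. half s T i j k j) = 0" by simp
qed

text \<open>The sign is a ring element because the half basis has components in the ring;
  \<open>D_s\<close> makes those components constant.\<close>

locale orthonormal_frame4 = orthonormal_frame D \<omega>
  for D :: "4 \<Rightarrow> 'r::{comm_ring_1,real_algebra_1} \<Rightarrow> 'r" and \<omega> +
  fixes s :: 'r
  assumes s_squared: "s * s = 1" and D_s: "D a s = 0"
begin

lemma D_half_form: "D p (half_form s i j a b) = 0"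
proof -
  have "\<forall>e i j. D p (half_basis s e i j) = 0"
    unfolding forall_3 forall_4 half_basis_values by (simp add: D_simps D_s)
  then show ?thesis unfolding half_form_def by (simp add: D_simps)
qed

lemma metric_diag: "\<omega> p i i = 0"
proof -
  have "\<omega> p i i + \<omega> p i i = 0 + 0" using metric[of p i i] by (simp add: eq_neg_iff_add_eq_0)
  then show ?thesis by (rule half_cancel)
qed

lemma nabla4_half_left: "nabla4 p (half_left s T) i j k l = half_left s (nabla4 p T) i j k l"
proof -
  let ?K = "half_form s"
  have 1: "(\<Sum>q\<in>UNIV. \<omega> p i q * half_left s T q j k l + \<omega> p j q * half_left s T i q k l)
      = (\<Sum>a\<in>UNIV. \<Sum>b\<in>UNIV. ?K i j a b * (\<Sum>q\<in>UNIV. \<omega> p a q * T q b k l + \<omega> p b q * T a q k l))"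
    unfolding half_left_def by (rule half_left_rotate[OF metric metric_diag s_squared])
  have 2: "(\<Sum>q\<in>UNIV. \<omega> p k q * half_left s T i j q l + \<omega> p l q * half_left s T i j k q)
      = (\<Sum>a\<in>UNIV. \<Sum>b\<in>UNIV. ?K i j a b * (\<Sum>q\<in>UNIV. \<omega> p k q * T a b q l + \<omega> p l q * T a b k q))"
  proof -
    have "(\<Sum>q\<in>UNIV. w q * (\<Sum>a\<in>UNIV. \<Sum>b\<in>UNIV. ?K i j a b * X a b q))
        = (\<Sum>a\<in>UNIV. \<Sum>b\<in>UNIV. ?K i j a b * (\<Sum>q\<in>UNIV. w q * X a b q))" for w and X :: "4 \<Rightarrow> 4 \<Rightarrow> 4 \<Rightarrow> 'r"
    proof -
      have "(\<Sum>q\<in>UNIV. w q * (\<Sum>a\<in>UNIV. \<Sum>b\<in>UNIV. ?K i j a b * X a b q))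
          = (\<Sum>a\<in>UNIV. \<Sum>q\<in>UNIV. \<Sum>b\<in>UNIV. w q * (?K i j a b * X a b q))"
        unfolding sum_distrib_left by (rule sum.swap)
      also have "\<dots> = (\<Sum>a\<in>UNIV. \<Sum>b\<in>UNIV. \<Sum>q\<in>UNIV. w q * (?K i j a b * X a b q))"
        by (rule sum.cong[OF refl], rule sum.swap)
      finally show ?thesis by (simp add: sum_distrib_left mult.left_commute)
    qed
    then show ?thesis
      unfolding half_left_def sum.distrib by (simp add: sum.distrib distrib_left)
  qed
  have "nabla4 p (half_left s T) i j k l = D p (half_left s T i j k l)
      - (\<Sum>q\<in>UNIV. \<omega> p i q * half_left s T q j k l + \<omega> p j q * half_left s T i q k l)
      - (\<Sum>q\<in>UNIV. \<omega> p k q * half_left s T i j q l + \<omega> p l q * half_left s T i j k q)"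
    unfolding nabla4_def by (simp add: sum.distrib)
  also have "D p (half_left s T i j k l) = (\<Sum>a\<in>UNIV. \<Sum>b\<in>UNIV. ?K i j a b * D p (T a b k l))"
    unfolding half_left_def by (simp add: D_simps D_half_form)
  finally show ?thesis
    unfolding 1 2 unfolding half_left_def nabla4_def
    by (simp add: sum.distrib sum_subtractf right_diff_distrib distrib_left)
qed

lemma nabla4_swap: "nabla4 p (\<lambda>k l i j. X i j k l) k l i j = nabla4 p X i j k l"
  by (rule nabla4_permute(3)[of p X k l i j])

lemma nabla4_scaleR: "nabla4 p (\<lambda>i j k l. r *\<^sub>R X i j k l) i j k l = r *\<^sub>R nabla4 p X i j k l"
  by (simp add: nabla4_def D_scaleR scaleR_diff_right scaleR_sum_right scaleR_add_right)

lemma nabla4_half: "nabla4 p (half s T) = half s (nabla4 p T)"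
proof (intro ext)
  fix i j k l
  have "half s T = (\<lambda>i j k l. (1/16) *\<^sub>R half_left s (\<lambda>k l i j. half_left s T i j k l) k l i j)"
    by (intro ext) (rule half_def)
  then have "nabla4 p (half s T) i j k l
      = (1/16) *\<^sub>R nabla4 p (\<lambda>i j k l. half_left s (\<lambda>k l i j. half_left s T i j k l) k l i j) i j k l"
    by (simp only: nabla4_scaleR)
  also have "nabla4 p (\<lambda>i j k l. half_left s (\<lambda>k l i j. half_left s T i j k l) k l i j) i j k l
      = nabla4 p (half_left s (\<lambda>k l i j. half_left s T i j k l)) k l i j"
    by (rule nabla4_permute(3))
  also have "\<dots> = half_left s (nabla4 p (\<lambda>k l i j. half_left s T i j k l)) k l i j"
    by (rule nabla4_half_left)
  also have "nabla4 p (\<lambda>k l i j. half_left s T i j k l) = (\<lambda>k l i j. half_left s (nabla4 p T) i j k l)"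
    by (intro ext) (rule trans[OF nabla4_swap nabla4_half_left])
  finally show "nabla4 p (half s T) i j k l = half s (nabla4 p T) i j k l"
    unfolding half_def .
qed

lemma nabla4_product_metric:
  "nabla4 p (\<lambda>i j k l. \<alpha> i k * kronecker j l) i j k l = nabla2 p \<alpha> i k * kronecker j l"
proof -
  have k: "(\<Sum>q\<in>UNIV. X q * (u * kronecker q j)) = X j * u" "(\<Sum>q\<in>UNIV. X q * (u * kronecker j q)) = X j * u"
    for X and u :: 'r and j :: 4 unfolding kronecker_def by (rule sum_kronecker)+
  have "D p (kronecker j l) = 0" by (simp add: kronecker_def D_simps)
  then have "nabla4 p (\<lambda>i j k l. \<alpha> i k * kronecker j l) i j k l
      = nabla2 p \<alpha> i k * kronecker j l - (\<omega> p j l + \<omega> p l j) * \<alpha> i k"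
    unfolding nabla4_def nabla2_def sum.distrib k
    by (simp add: D_mult sum_distrib_left sum_distrib_right algebra_simps)
  then show ?thesis using metric[of p j l] by simp
qed

lemma nabla4_kn: "nabla4 p (kn \<alpha> kronecker) = kn (nabla2 p \<alpha>) kronecker"
proof (intro ext)
  fix i j k l
  let ?T = "\<lambda>i j k l. \<alpha> i k * kronecker j l"
  have "nabla4 p (kn \<alpha> kronecker) i j k l
      = nabla4 p ?T i j k l + nabla4 p ?T j i l k - nabla4 p ?T i j l k - nabla4 p ?T j i k l"
    unfolding nabla4_def kn_def
    by (simp add: D_add D_diff sum.distrib sum_subtractf algebra_simps)
  then show "nabla4 p (kn \<alpha> kronecker) i j k l = kn (nabla2 p \<alpha>) kronecker i j k l"
    unfolding nabla4_product_metric kn_def by simp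
qed

text \<open>In dimension four the coefficients of the Weyl decomposition are 1/2 and R/12. With the
  scalar part moved into the first factor, Rm - W is a single product with the metric.\<close>

definition "schouten i k = (1/2) *\<^sub>R ric i k - (1/12) *\<^sub>R ((\<Sum>a\<in>UNIV. ric a a) * kronecker i k)"

definition "weyl4 i j k l = curv i j k l - kn schouten kronecker i j k l"

definition "half_weyl = half s weyl4"

end

section \<open>Algebraic curvature tensors in dimension four\<close>

locale algebraic_curvature4 =
  fixes R :: "4 \<Rightarrow> 4 \<Rightarrow> 4 \<Rightarrow> 4 \<Rightarrow> real" and s :: real
  assumes R12: "\<And>i j k l. R j i k l = - R i j k l"
    and R34: "\<And>i j k l. R i j l k = - R i j k l"
    and Rpair: "\<And>i j k l. R k l i j = R i j k l"
    and Rcyc: "\<And>i j k l. R i j k l + R j k i l + R k i j l = 0"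
    and s: "s = 1 \<or> s = -1"
begin

text \<open>
  \<open>cJJ\<close>, \<open>cJK\<close> and \<open>cKK\<close> are the blocks of the curvature operator for the splitting of the
  two-forms into the \<open>s\<close>- and \<open>-s\<close>-eigenspaces of the Hodge star.
\<close>

definition "J = half_basis s"
definition "K = half_basis (- s)"
definition "cJJ e f = half_coeff s s R e f / 16"
definition "cJK e f = half_coeff s (- s) R e f / 16"
definition "cKK e f = half_coeff (- s) (- s) R e f / 16"

lemma JK_sums: "s * s = 1" "- s * - s = 1"
  using s by auto

lemma s_cancel: "s * (s * x) = x"
  using s by auto

lemma bivector_decompose:
  fixes M :: "4 \<Rightarrow> 4 \<Rightarrow> real"
  assumes M: "\<And>i j. M j i = - M i j"
  shows "M i j = (\<Sum>c\<in>UNIV. J c i j * ((\<Sum>a\<in>UNIV. \<Sum>b\<in>UNIV. J c a b * M a b) / 4)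
                        + K c i j * ((\<Sum>a\<in>UNIV. \<Sum>b\<in>UNIV. K c a b * M a b) / 4))"
proof -
  have d: "M i i = 0" for i using M[of i i] by simp
  have m: "M 2 1 = - M 1 2" "M 3 1 = - M 1 3" "M 4 1 = - M 1 4" "M 3 2 = - M 2 3" "M 4 2 = - M 2 4" "M 4 3 = - M 3 4"
    by (rule M)+
  have "\<forall>i j. M i j = (\<Sum>c\<in>UNIV. J c i j * ((\<Sum>a\<in>UNIV. \<Sum>b\<in>UNIV. J c a b * M a b) / 4)
                        + K c i j * ((\<Sum>a\<in>UNIV. \<Sum>b\<in>UNIV. K c a b * M a b) / 4))"
    unfolding forall_4 sum_3 sum_4 J_def K_def half_basis_values m d
    using s by (elim disjE) (simp_all add: field_simps)
  then show ?thesis by blast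
qed

text \<open>R is expanded in its first index pair only: the coefficients along \<open>J c\<close>
  and \<open>K c\<close> are two-forms in the remaining pair.\<close>

definition "X c k l = (\<Sum>a\<in>UNIV. \<Sum>b\<in>UNIV. J c a b * R a b k l) / 4"
definition "Y c k l = (\<Sum>a\<in>UNIV. \<Sum>b\<in>UNIV. K c a b * R a b k l) / 4"

lemma R_XY: "R i j k l = (\<Sum>c\<in>UNIV. J c i j * X c k l + K c i j * Y c k l)"
  unfolding X_def Y_def by (rule bivector_decompose[of "\<lambda>i j. R i j k l"]) (rule R12)

lemma X_antisym: "X c l k = - X c k l"
  unfolding X_def R34[of _ _ l k] by (simp add: sum_negf)

lemma Y_antisym: "Y c l k = - Y c k l"
  unfolding Y_def R34[of _ _ l k] by (simp add: sum_negf)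

lemma X_JK: "X c k l = (\<Sum>d\<in>UNIV. J d k l * cJJ c d + K d k l * cJK c d)"
proof -
  have "(\<Sum>a\<in>UNIV. \<Sum>b\<in>UNIV. J d a b * X c a b) / 4 = cJJ c d"
       "(\<Sum>a\<in>UNIV. \<Sum>b\<in>UNIV. K d a b * X c a b) / 4 = cJK c d" for d
    unfolding X_def cJJ_def cJK_def half_coeff_iterated J_def K_def by (simp_all add: sum_divide_distrib[symmetric])
  then show ?thesis using bivector_decompose[of "X c" k l, OF X_antisym] by simp
qed

lemma Y_JK: "Y c k l = (\<Sum>d\<in>UNIV. J d k l * cJK d c + K d k l * cKK c d)"
proof -
  have c: "half_coeff s (- s) R d c = half_coeff (- s) s R c d" for d c
    by (rule half_coeff_commute[OF Rpair])
  have "(\<Sum>a\<in>UNIV. \<Sum>b\<in>UNIV. J d a b * Y c a b) / 4 = cJK d c"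
       "(\<Sum>a\<in>UNIV. \<Sum>b\<in>UNIV. K d a b * Y c a b) / 4 = cKK c d" for d
    unfolding Y_def cKK_def cJK_def c unfolding half_coeff_iterated J_def K_def by (simp_all add: sum_divide_distrib[symmetric])
  then show ?thesis
    using bivector_decompose[of "Y c" k l, OF Y_antisym] by simp
qed

lemma cJJ_symmetric: "cJJ f e = cJJ e f"
  unfolding cJJ_def half_coeff_commute[of R s s e f, OF Rpair] ..

text \<open>\<open>J\<close> and \<open>K\<close> generate two commuting copies of the quaternions.
  The trace of \<open>J e\<close> against a product of two skew matrices therefore sees only the
  product of their J-parts, whose imaginary part is the cross product of the coefficient
  vectors.\<close>

lemma triple_product:
  fixes x y x' y' :: "3 \<Rightarrow> real"
  defines "S \<equiv> \<lambda>e. \<Sum>i\<in>UNIV. \<Sum>j\<in>UNIV. \<Sum>p\<in>UNIV. J e i j * (\<Sum>c\<in>UNIV. J c p i * x c + K c p i * y c)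
                                                    * (\<Sum>d\<in>UNIV. J d p j * x' d + K d p j * y' d)"
  shows "S 1 = 4 * s * (x 2 * x' 3 - x 3 * x' 2)"
    and "S 2 = 4 * s * (x 3 * x' 1 - x 1 * x' 3)"
    and "S 3 = 4 * s * (x 1 * x' 2 - x 2 * x' 1)"
  unfolding S_def sum_3 sum_4 J_def K_def half_basis_values
  using s by (elim disjE; simp add: algebra_simps)+

lemma inner_products:
  fixes x y x' y' :: "3 \<Rightarrow> real"
  shows "(\<Sum>p\<in>UNIV. \<Sum>q\<in>UNIV. (\<Sum>c\<in>UNIV. J c p q * x c + K c p q * y c) * (\<Sum>d\<in>UNIV. J d p q * x' d + K d p q * y' d))
     = 4 * (\<Sum>d\<in>UNIV. x d * x' d + y d * y' d)"
  unfolding sum_3 sum_4 J_def K_def half_basis_values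
  using s by (elim disjE; simp add: algebra_simps)

definition "Ric i k = (\<Sum>j\<in>UNIV. R i j k j)"

text \<open>The products of a \<open>J c\<close> with a \<open>K d\<close> span the trace-free
  symmetric matrices, so the off-diagonal block determines a trace-free symmetric tensor; by
  \<open>Ric_E\<close> it is the trace-free Ricci tensor.\<close>

definition "E i k = - 2 * (\<Sum>c\<in>UNIV. \<Sum>d\<in>UNIV. cJK c d * (\<Sum>j\<in>UNIV. J c i j * K d j k))"

lemma E_values:
    "E 1 1 = 2 * cJK 1 1 + 2 * cJK 2 2 + 2 * cJK 3 3"
    "E 1 2 = s * (- 2 * cJK 2 3 + 2 * cJK 3 2)"
    "E 1 3 = s * (2 * cJK 1 3 - 2 * cJK 3 1)"
    "E 1 4 = s * (- 2 * cJK 1 2 + 2 * cJK 2 1)"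
    "E 2 1 = s * (- 2 * cJK 2 3 + 2 * cJK 3 2)"
    "E 2 2 = 2 * cJK 1 1 - 2 * cJK 2 2 - 2 * cJK 3 3"
    "E 2 3 = 2 * cJK 1 2 + 2 * cJK 2 1"
    "E 2 4 = 2 * cJK 1 3 + 2 * cJK 3 1"
    "E 3 1 = s * (2 * cJK 1 3 - 2 * cJK 3 1)"
    "E 3 2 = 2 * cJK 1 2 + 2 * cJK 2 1"
    "E 3 3 = - 2 * cJK 1 1 + 2 * cJK 2 2 - 2 * cJK 3 3"
    "E 3 4 = 2 * cJK 2 3 + 2 * cJK 3 2"
    "E 4 1 = s * (- 2 * cJK 1 2 + 2 * cJK 2 1)"
    "E 4 2 = 2 * cJK 1 3 + 2 * cJK 3 1"
    "E 4 3 = 2 * cJK 2 3 + 2 * cJK 3 2"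
    "E 4 4 = - 2 * cJK 1 1 - 2 * cJK 2 2 + 2 * cJK 3 3"
  unfolding E_def sum_3 sum_4 J_def K_def half_basis_values
  using s by (elim disjE; simp add: algebra_simps)+

lemma X_values:
    "X c 1 1 = 0" "X c 1 2 = (cJJ c 1 + cJK c 1)" "X c 1 3 = (cJJ c 2 + cJK c 2)" "X c 1 4 = (cJJ c 3 + cJK c 3)"
    "X c 2 1 = - ((cJJ c 1 + cJK c 1))" "X c 2 2 = 0" "X c 2 3 = s * (cJJ c 3 - cJK c 3)" "X c 2 4 = - (s * (cJJ c 2 - cJK c 2))"
    "X c 3 1 = - ((cJJ c 2 + cJK c 2))" "X c 3 2 = - (s * (cJJ c 3 - cJK c 3))" "X c 3 3 = 0" "X c 3 4 = s * (cJJ c 1 - cJK c 1)"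
    "X c 4 1 = - ((cJJ c 3 + cJK c 3))" "X c 4 2 = s * (cJJ c 2 - cJK c 2)" "X c 4 3 = - (s * (cJJ c 1 - cJK c 1))" "X c 4 4 = 0"
  unfolding X_JK sum_3 J_def K_def half_basis_values by (simp_all add: algebra_simps)

lemma Y_values:
    "Y c 1 1 = 0" "Y c 1 2 = (cJK 1 c + cKK c 1)" "Y c 1 3 = (cJK 2 c + cKK c 2)" "Y c 1 4 = (cJK 3 c + cKK c 3)"
    "Y c 2 1 = - ((cJK 1 c + cKK c 1))" "Y c 2 2 = 0" "Y c 2 3 = s * (cJK 3 c - cKK c 3)" "Y c 2 4 = - (s * (cJK 2 c - cKK c 2))"
    "Y c 3 1 = - ((cJK 2 c + cKK c 2))" "Y c 3 2 = - (s * (cJK 3 c - cKK c 3))" "Y c 3 3 = 0" "Y c 3 4 = s * (cJK 1 c - cKK c 1)"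
    "Y c 4 1 = - ((cJK 3 c + cKK c 3))" "Y c 4 2 = s * (cJK 2 c - cKK c 2)" "Y c 4 3 = - (s * (cJK 1 c - cKK c 1))" "Y c 4 4 = 0"
  unfolding Y_JK sum_3 J_def K_def half_basis_values by (simp_all add: algebra_simps)

text \<open>The diagonal blocks are symmetric, so by the quaternion relations they contribute only
  their traces times the metric.\<close>

lemma Ric_E: "Ric i k = (cJJ 1 1 + cJJ 2 2 + cJJ 3 3 + cKK 1 1 + cKK 2 2 + cKK 3 3) * (if i = k then 1 else 0) + E i k"
proof -
  have "cKK f e = cKK e f" for e f
    unfolding cKK_def half_coeff_commute[of R "- s" "- s" e f, OF Rpair] ..
  then have k: "cKK 2 1 = cKK 1 2" "cKK 3 1 = cKK 1 3" "cKK 3 2 = cKK 2 3" by simp_all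
  have j: "cJJ 2 1 = cJJ 1 2" "cJJ 3 1 = cJJ 1 3" "cJJ 3 2 = cJJ 2 3" by (rule cJJ_symmetric)+
  have a: "Ric i k = (\<Sum>j\<in>UNIV. \<Sum>c\<in>UNIV. J c i j * X c k j + K c i j * Y c k j)" for i k
    unfolding Ric_def by (intro sum.cong refl R_XY)
  have "\<forall>i k. Ric i k = (cJJ 1 1 + cJJ 2 2 + cJJ 3 3 + cKK 1 1 + cKK 2 2 + cKK 3 3) * (if i = k then 1 else 0) + E i k"
    unfolding a forall_4 sum_3 sum_4 J_def K_def half_basis_values
    by (simp add: index_distinct) (simp add: X_values Y_values E_values j k s_cancel algebra_simps)
  then show ?thesis by blast
qed

text \<open>Pairing with a trace-free matrix removes the multiple of the identity. What is left is
  the square of the off-diagonal block, the expression that also occurs in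
  \<open>coeff_quad1\<close>.\<close>

lemma E_square:
  "(\<Sum>i\<in>UNIV. \<Sum>j\<in>UNIV. \<Sum>k\<in>UNIV. \<Sum>l\<in>UNIV. J e i j * J f k l * ((u * (if i = k then 1 else 0) + E i k) * (u * (if j = l then 1 else 0) + E j l)))
    = 32 * (\<Sum>d\<in>UNIV. cJK e d * cJK f d) + (if e = f then 4 * u\<^sup>2 - 16 * (\<Sum>c\<in>UNIV. \<Sum>d\<in>UNIV. (cJK c d)\<^sup>2) else 0)"
proof -
  have "\<forall>e f. (\<Sum>i\<in>UNIV. \<Sum>j\<in>UNIV. \<Sum>k\<in>UNIV. \<Sum>l\<in>UNIV. J e i j * J f k l * ((u * (if i = k then 1 else 0) + E i k) * (u * (if j = l then 1 else 0) + E j l)))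
    = 32 * (\<Sum>d\<in>UNIV. cJK e d * cJK f d) + (if e = f then 4 * u\<^sup>2 - 16 * (\<Sum>c\<in>UNIV. \<Sum>d\<in>UNIV. (cJK c d)\<^sup>2) else 0)"
    unfolding forall_3 sum_3 sum_4 J_def K_def half_basis_values
    by (simp add: index_distinct) (simp add: E_values s_cancel JK_sums algebra_simps power2_eq_square)
  then show ?thesis by blast
qed

text \<open>The right-hand side uses the products of \<open>cJK\<close> with \<kappa> that arise
  when the curvature is contracted with v twice. Adding the transpose makes it symmetric; against
  the symmetric \<open>A0\<close> both halves give the same.\<close>

lemma E_vector:
  fixes v :: "4 \<Rightarrow> real"
  defines "\<kappa> \<equiv> \<lambda>f d. \<Sum>k\<in>UNIV. \<Sum>l\<in>UNIV. \<Sum>q\<in>UNIV. J f k l * K d k q * (v l * v q)"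
    and "G \<equiv> \<lambda>e f. \<Sum>i\<in>UNIV. \<Sum>j\<in>UNIV. \<Sum>k\<in>UNIV. \<Sum>l\<in>UNIV. J e i j * J f k l * (E i k * (v j * v l))"
  shows "G e f + G f e = 4 * (\<Sum>d\<in>UNIV. cJK e d * \<kappa> f d + cJK f d * \<kappa> e d)
     - (if e = f then 4 * (\<Sum>c\<in>UNIV. \<Sum>d\<in>UNIV. cJK c d * \<kappa> c d) else 0)"
proof -
  have "\<forall>e f. G e f + G f e = 4 * (\<Sum>d\<in>UNIV. cJK e d * \<kappa> f d + cJK f d * \<kappa> e d)
     - (if e = f then 4 * (\<Sum>c\<in>UNIV. \<Sum>d\<in>UNIV. cJK c d * \<kappa> c d) else 0)"
    unfolding G_def \<kappa>_def forall_3 sum_3 sum_4 J_def K_def half_basis_values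
    by (simp add: index_distinct) (simp add: E_values s_cancel JK_sums algebra_simps power2_eq_square)
  then show ?thesis by blast
qed

end

section \<open>Products with the metric\<close>

lemma kn_antisym:
  "kn \<alpha> \<beta> j i k l = - kn \<alpha> \<beta> i j k l" "kn \<alpha> \<beta> i j l k = - kn \<alpha> \<beta> i j k l"
  by (simp_all add: kn_def algebra_simps)

lemma kn_kronecker_symmetric:
  assumes "\<And>i j. \<alpha> i j = \<alpha> j i"
  shows "kn \<alpha> kronecker k l i j = kn \<alpha> kronecker i j k l"
    and "kn \<alpha> kronecker i j k l + kn \<alpha> kronecker j k i l + kn \<alpha> kronecker k i j l = 0"
proof -
  have k: "kronecker i j = kronecker j i" for i j :: 'n by (simp add: kronecker_def)
  show "kn \<alpha> kronecker k l i j = kn \<alpha> kronecker i j k l"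
    unfolding kn_def assms[of k i] assms[of l j] assms[of l i] assms[of k j] k[of k i] k[of l j] k[of l i] k[of k j]
    by (simp add: algebra_simps)
  show "kn \<alpha> kronecker i j k l + kn \<alpha> kronecker j k i l + kn \<alpha> kronecker k i j l = 0"
    unfolding kn_def assms[of j i] assms[of k i] assms[of k j] k[of j i] k[of k i] k[of k j]
    by (simp add: algebra_simps)
qed

lemma kn_kronecker_trace:
  fixes \<alpha> :: "4 \<Rightarrow> 4 \<Rightarrow> 'r::comm_ring_1"
  shows "(\<Sum>i\<in>UNIV. \<Sum>j\<in>UNIV. kn \<alpha> kronecker i j i j) = 6 * (\<Sum>i\<in>UNIV. \<alpha> i i)"
  unfolding kn_def kronecker_def sum_4 by (simp add: index_distinct algebra_simps)

text \<open>The product is a signed sum of index permutations of \<alpha> i k \<delta> j l. Skewness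
  of Z reduces them all to this one, whose pairing is a trace of Z.\<close>

lemma pairing_kn:
  fixes Z :: "'n::finite \<Rightarrow> 'n \<Rightarrow> 'n \<Rightarrow> 'n \<Rightarrow> 'r::comm_ring_1"
  assumes Z12: "\<And>i j k l. Z j i k l = - Z i j k l" and Z34: "\<And>i j k l. Z i j l k = - Z i j k l"
    and Ztrace: "\<And>i k. (\<Sum>j\<in>UNIV. Z i j k j) = 0"
  shows "pairing Z (kn \<alpha> kronecker) = 0"
proof -
  let ?T = "\<lambda>i j k l. \<alpha> i k * kronecker j l"
  have "(\<Sum>j\<in>UNIV. \<Sum>k\<in>UNIV. \<Sum>l\<in>UNIV. Z i j k l * ?T i j k l) = (\<Sum>k\<in>UNIV. \<alpha> i k * (\<Sum>j\<in>UNIV. Z i j k j))" for i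
  proof -
    have "(\<Sum>l\<in>UNIV. Z i j k l * (\<alpha> i k * kronecker j l)) = Z i j k j * \<alpha> i k" for j k
      using sum_if_eq[of "\<lambda>l. Z i j k l * \<alpha> i k" j 1] by (simp add: kronecker_def mult.assoc)
    then show ?thesis by (subst sum.swap) (simp add: sum_distrib_left mult.commute)
  qed
  then have T: "pairing Z ?T = 0"
    unfolding pairing_def Ztrace by simp
  have T2: "pairing Z (\<lambda>i j k l. ?T j i k l) = 0" "pairing Z (\<lambda>i j k l. ?T i j l k) = 0"
    using pairing_swap12[of Z ?T, OF Z12] pairing_swap34[of Z ?T, OF Z34] T by simp_all
  have T3: "pairing Z (\<lambda>i j k l. ?T j i l k) = 0"
    using pairing_swap12[of Z "\<lambda>i j k l. ?T i j l k", OF Z12] T2(2) by simp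
  have "pairing Z (kn \<alpha> kronecker) = pairing Z ?T + pairing Z (\<lambda>i j k l. ?T j i l k)
      - pairing Z (\<lambda>i j k l. ?T i j l k) - pairing Z (\<lambda>i j k l. ?T j i k l)"
    unfolding kn_def pairing_linear[symmetric] ..
  then show ?thesis unfolding T T2 T3 by simp
qed

lemma half_coeff_diff:
  "half_coeff s t (\<lambda>i j k l. A i j k l - B i j k l) e f = half_coeff s t A e f - half_coeff s t B e f"
  unfolding half_coeff_def by (simp add: right_diff_distrib sum_subtractf)

lemma half_coeff_product:
  "half_coeff s t (\<lambda>i j k l. u i j * w k l) e f
     = (\<Sum>a\<in>UNIV. \<Sum>b\<in>UNIV. half_basis s e a b * u a b) * (\<Sum>c\<in>UNIV. \<Sum>d\<in>UNIV. half_basis t f c d * w c d)"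
proof -
  have "(\<Sum>a\<in>UNIV. \<Sum>b\<in>UNIV. half_basis s e a b * (u a b * x))
      = (\<Sum>a\<in>UNIV. \<Sum>b\<in>UNIV. half_basis s e a b * u a b) * x" for x
    by (simp add: sum_distrib_right mult.assoc)
  then show ?thesis
    unfolding half_coeff_iterated by (simp add: sum_distrib_left mult.left_commute)
qed

text \<open>The trace-free part of \<alpha> contributes to the off-diagonal block only, so a
  diagonal block contains just the trace.\<close>

lemma half_coeff_kn:
  fixes \<alpha> :: "4 \<Rightarrow> 4 \<Rightarrow> 'r::comm_ring_1"
  assumes \<alpha>: "\<And>i j. \<alpha> i j = \<alpha> j i" and s: "s * s = 1"
  shows "half_coeff s s (kn \<alpha> kronecker) e f = (if e = f then 4 * (\<Sum>i\<in>UNIV. \<alpha> i i) else 0)"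
proof -
  have a: "\<alpha> 2 1 = \<alpha> 1 2" "\<alpha> 3 1 = \<alpha> 1 3" "\<alpha> 4 1 = \<alpha> 1 4" "\<alpha> 3 2 = \<alpha> 2 3" "\<alpha> 4 2 = \<alpha> 2 4" "\<alpha> 4 3 = \<alpha> 3 4"
    by (rule \<alpha>)+
  have ss: "s * (s * x) = x" for x using s by (simp add: mult.assoc[symmetric])
  have "\<forall>e f. half_coeff s s (kn \<alpha> kronecker) e f = (if e = f then 4 * (\<Sum>i\<in>UNIV. \<alpha> i i) else 0)"
    unfolding forall_3 half_coeff_explicit[of "kn \<alpha> kronecker", OF kn_antisym] kn_def kronecker_def sum_4
    by (simp add: index_distinct) (simp add: a ss algebra_simps)
  then show ?thesis by blast
qed

context orthonormal_frame4
begin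

lemma ric_symmetric: "ric i k = ric k i"
  unfolding ric_def by (rule sum.cong[OF refl], rule curv_pair[THEN trans])
    (simp add: curv_antisym12[of _ k] curv_antisym34[of i])

end

section \<open>The Weyl block and the quadratic curvature terms\<close>

context algebraic_curvature4
begin

definition "sch i k = Ric i k / 2 - (\<Sum>a\<in>UNIV. Ric a a) / 12 * kronecker i k"

definition "W i j k l = R i j k l - kn sch kronecker i j k l"

lemma Ric_symmetric: "Ric i k = Ric k i"
proof -
  have "R i j k j = R k j i j" for j by (rule Rpair[symmetric])
  then show ?thesis unfolding Ric_def by simp
qed

lemma sch_symmetric: "sch i k = sch k i"
  unfolding sch_def kronecker_def by (simp add: Ric_symmetric[of i k] eq_commute[of i k])

lemma W_symmetries:
  "W j i k l = - W i j k l" "W i j l k = - W i j k l" "W k l i j = W i j k l"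
  "W i j k l + W j k i l + W k i j l = 0"
proof -
  note kn = kn_antisym[of sch kronecker] kn_kronecker_symmetric[of sch, OF sch_symmetric]
  show "W j i k l = - W i j k l" unfolding W_def R12[of j i] kn(1)[of j i] by simp
  show "W i j l k = - W i j k l" unfolding W_def R34[of i j l k] kn(2)[of i j l k] by simp
  show "W k l i j = W i j k l" unfolding W_def Rpair[of k l i j] kn(3)[of k l i j] ..
  show "W i j k l + W j k i l + W k i j l = 0"
    using Rcyc[of i j k l] kn(4)[of i j k l] unfolding W_def by linarith
qed

lemma W_trace: "(\<Sum>i\<in>UNIV. \<Sum>j\<in>UNIV. W i j i j) = 0"
proof -
  have "(\<Sum>i\<in>UNIV. sch i i) = (\<Sum>a\<in>UNIV. Ric a a) / 6"
    unfolding sch_def kronecker_def sum_4 by (simp add: field_simps)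
  then show ?thesis
    unfolding W_def sum_subtractf kn_kronecker_trace by (simp add: Ric_def)
qed

text \<open>The half Weyl tensor is the sum of \<open>A0 e f\<close> times J_e \<otimes> J_f. As an
  operator it has twice this matrix in the basis J, up to transposition.\<close>

definition "A0 e f = half_coeff s s W e f / 16"

lemma A0_symmetric: "A0 f e = A0 e f"
  unfolding A0_def half_coeff_commute[of W s s e f, OF W_symmetries(3)] ..

lemma A0_trace: "A0 1 1 + A0 2 2 + A0 3 3 = 0"
  using half_trace(1)[of W s, OF W_symmetries(1,2,3,4) W_trace JK_sums(1)] unfolding A0_def by linarith

lemma cJJ_A0: "cJJ e f = A0 e f + (if e = f then (\<Sum>i\<in>UNIV. sch i i) / 4 else 0)"
proof -
  have "half_coeff s s W e f = half_coeff s s R e f - (if e = f then 4 * (\<Sum>i\<in>UNIV. sch i i) else 0)"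
    unfolding W_def half_coeff_diff half_coeff_kn[of sch, OF sch_symmetric JK_sums(1)] ..
  then show ?thesis unfolding A0_def cJJ_def by (cases "e = f") (simp_all add: field_simps)
qed

abbreviation "Z \<equiv> half s W"

lemma pairing_Z: "pairing Z T = (\<Sum>e\<in>UNIV. \<Sum>f\<in>UNIV. A0 e f * half_coeff s s T e f)"
  unfolding pairing_half A0_def by (simp add: sum_divide_distrib)

lemma pairing_Z_Z: "pairing Z Z = 16 * (\<Sum>e\<in>UNIV. \<Sum>f\<in>UNIV. (A0 e f)\<^sup>2)"
  unfolding pairing_Z half_coeff_half[OF JK_sums(1)] A0_def
  by (simp add: sum_distrib_left power2_eq_square)

lemma coeff_Ric_Ric:
  "half_coeff s s (\<lambda>i j k l. Ric i k * Ric j l) e f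
     = 32 * (\<Sum>d\<in>UNIV. cJK e d * cJK f d)
       + (if e = f then 4 * (cJJ 1 1 + cJJ 2 2 + cJJ 3 3 + cKK 1 1 + cKK 2 2 + cKK 3 3)\<^sup>2
           - 16 * (\<Sum>c\<in>UNIV. \<Sum>d\<in>UNIV. (cJK c d)\<^sup>2) else 0)"
  unfolding half_coeff_def Ric_E J_def[symmetric] by (rule E_square)

lemma trace_free_sum: "(\<Sum>e\<in>UNIV. \<Sum>f\<in>UNIV. A0 e f * (if e = f then u else 0)) = 0"
proof -
  have "(\<Sum>e\<in>UNIV. \<Sum>f\<in>UNIV. A0 e f * (if e = f then u else 0)) = (A0 1 1 + A0 2 2 + A0 3 3) * u"
    unfolding sum_if_eq sum_3 by (simp add: algebra_simps)
  then show ?thesis unfolding A0_trace by simp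
qed

lemma pairing_Ric_Ric:
  "pairing Z (\<lambda>i j k l. Ric i k * Ric j l) = 32 * (\<Sum>e\<in>UNIV. \<Sum>f\<in>UNIV. A0 e f * (\<Sum>d\<in>UNIV. cJK e d * cJK f d))"
  unfolding pairing_Z coeff_Ric_Ric distrib_left sum.distrib trace_free_sum
  by (simp add: sum_distrib_left mult.left_commute)

text \<open>By the first Bianchi identity the skew part of R p i j q in p and q is minus half of R p
  q i j. The term is therefore minus half the square of the curvature operator, and the block of a
  square is the sum of the squares of two blocks.\<close>

lemma coeff_quad1:
  "half_coeff s s (\<lambda>i j k l. \<Sum>p\<in>UNIV. \<Sum>q\<in>UNIV. R p i j q * R p q k l) e f
     = - 32 * (\<Sum>d\<in>UNIV. cJJ e d * cJJ f d + cJK e d * cJK f d)"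
proof -
  have skew: "R p i j q - R q i j p = - R p q i j" for p i j q
    using Rcyc[of p i j q] Rpair[of i j p q] R12[of j p i q] Rpair[of q i j p] R12[of j p q i] R34[of p j q i]
    by linarith
  have 1: "(\<Sum>p\<in>UNIV. \<Sum>q\<in>UNIV. R p i j q * R p q k l) = - (1/2) * (\<Sum>p\<in>UNIV. \<Sum>q\<in>UNIV. R p q i j * R p q k l)" for i j k l
  proof -
    have "(\<Sum>p\<in>UNIV. \<Sum>q\<in>UNIV. R p i j q * R p q k l) = (\<Sum>p\<in>UNIV. \<Sum>q\<in>UNIV. - R q i j p * R p q k l)"
      by (subst sum.swap, intro sum.cong refl, subst R12) simp
    then have "2 * (\<Sum>p\<in>UNIV. \<Sum>q\<in>UNIV. R p i j q * R p q k l) = (\<Sum>p\<in>UNIV. \<Sum>q\<in>UNIV. (R p i j q - R q i j p) * R p q k l)"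
      by (simp add: left_diff_distrib sum_subtractf sum_negf)
    also have "\<dots> = (\<Sum>p\<in>UNIV. \<Sum>q\<in>UNIV. - (R p q i j * R p q k l))"
      unfolding skew by simp
    finally show ?thesis by (simp add: sum_negf)
  qed
  have r: "(\<Sum>a\<in>UNIV. \<Sum>b\<in>UNIV. half_basis s e a b * R p q a b) = 4 * X e p q" for e p q
    unfolding X_def J_def Rpair[of p q] by simp
  have "half_coeff s s (\<lambda>i j k l. \<Sum>p\<in>UNIV. \<Sum>q\<in>UNIV. R p q i j * R p q k l) e f
      = (\<Sum>p\<in>UNIV. \<Sum>q\<in>UNIV. half_coeff s s (\<lambda>i j k l. R p q i j * R p q k l) e f)"
    unfolding half_coeff_def pairing_def[symmetric, where Z = "\<lambda>a b c d. half_basis s e a b * half_basis s f c d"] pairing_sum ..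
  also have "\<dots> = (\<Sum>p\<in>UNIV. \<Sum>q\<in>UNIV. (4 * X e p q) * (4 * X f p q))"
  proof -
    have "half_coeff s s (\<lambda>i j k l. R p q i j * R p q k l) e f = (4 * X e p q) * (4 * X f p q)" for p q
      unfolding half_coeff_product r ..
    then show ?thesis by simp
  qed
  also have "\<dots> = 16 * (\<Sum>p\<in>UNIV. \<Sum>q\<in>UNIV. X e p q * X f p q)"
    by (simp add: sum_distrib_left)
  also have "\<dots> = 64 * (\<Sum>d\<in>UNIV. cJJ e d * cJJ f d + cJK e d * cJK f d)"
    unfolding X_JK inner_products by simp
  finally have 2: "half_coeff s s (\<lambda>i j k l. \<Sum>p\<in>UNIV. \<Sum>q\<in>UNIV. R p q i j * R p q k l) e f
      = 64 * (\<Sum>d\<in>UNIV. cJJ e d * cJJ f d + cJK e d * cJK f d)" .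
  have 3: "half_coeff s s (\<lambda>i j k l. c * T i j k l) e f = c * half_coeff s s T e f" for c and T :: "4 \<Rightarrow> 4 \<Rightarrow> 4 \<Rightarrow> 4 \<Rightarrow> real"
    unfolding half_coeff_def by (simp add: sum_distrib_left mult.left_commute)
  show ?thesis unfolding 1 3 2 by simp
qed

text \<open>The cofactor matrix of \<open>cJJ\<close>, arranged as cross products of its
  rows.\<close>

definition "cof e f =
  (if e = 1 then (if f = 1 then cJJ 2 2 * cJJ 3 3 - cJJ 2 3 * cJJ 3 2
                  else if f = 2 then cJJ 2 3 * cJJ 3 1 - cJJ 2 1 * cJJ 3 3
                  else cJJ 2 1 * cJJ 3 2 - cJJ 2 2 * cJJ 3 1)
   else if e = 2 then (if f = 1 then cJJ 3 2 * cJJ 1 3 - cJJ 3 3 * cJJ 1 2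
                  else if f = 2 then cJJ 3 3 * cJJ 1 1 - cJJ 3 1 * cJJ 1 3
                  else cJJ 3 1 * cJJ 1 2 - cJJ 3 2 * cJJ 1 1)
   else (if f = 1 then cJJ 1 2 * cJJ 2 3 - cJJ 1 3 * cJJ 2 2
                  else if f = 2 then cJJ 1 3 * cJJ 2 1 - cJJ 1 1 * cJJ 2 3
                  else cJJ 1 1 * cJJ 2 2 - cJJ 1 2 * cJJ 2 1))"

text \<open>\<open>triple_product\<close> is applied in the first index pair and then in the second.
  Each application gives a cross product and removes the K-parts, so the outcome consists of the
  two-by-two minors of \<open>cJJ\<close>. The factors 4 s and - 4 s and the two equal halves of
  each minor give -32.\<close>

lemma coeff_quad2:
  "half_coeff s s (\<lambda>i j k l. \<Sum>p\<in>UNIV. \<Sum>q\<in>UNIV. R p i k q * R p j q l) e f = - 32 * cof e f"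
proof -
  define S where "S = (\<lambda>e k l q. \<Sum>i\<in>UNIV. \<Sum>j\<in>UNIV. \<Sum>p\<in>UNIV.
    J e i j * (\<Sum>c\<in>UNIV. J c p i * X c k q + K c p i * Y c k q) * (\<Sum>d\<in>UNIV. J d p j * X d q l + K d p j * Y d q l))"
  define P where "P = (\<lambda>f c d. \<Sum>k\<in>UNIV. \<Sum>l\<in>UNIV. \<Sum>q\<in>UNIV. J f k l * (X c k q * X d q l))"
  have c: "half_coeff s s (\<lambda>i j k l. \<Sum>p\<in>UNIV. \<Sum>q\<in>UNIV. R p i k q * R p j q l) e f
      = (\<Sum>k\<in>UNIV. \<Sum>l\<in>UNIV. \<Sum>q\<in>UNIV. J f k l * S e k l q)"
  proof -
    have "(\<Sum>a\<in>UNIV. \<Sum>b\<in>UNIV. J e a b * (\<Sum>p\<in>UNIV. \<Sum>q\<in>UNIV. R p a k q * R p b q l)) = (\<Sum>q\<in>UNIV. S e k l q)" for k l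
    proof -
      have "S e k l q = (\<Sum>i\<in>UNIV. \<Sum>j\<in>UNIV. \<Sum>p\<in>UNIV. J e i j * R p i k q * R p j q l)" for q
        unfolding S_def R_XY[symmetric] ..
      then have "(\<Sum>q\<in>UNIV. S e k l q) = (\<Sum>q\<in>UNIV. \<Sum>i\<in>UNIV. \<Sum>j\<in>UNIV. \<Sum>p\<in>UNIV. J e i j * R p i k q * R p j q l)"
        by simp
      also have "\<dots> = (\<Sum>i\<in>UNIV. \<Sum>q\<in>UNIV. \<Sum>j\<in>UNIV. \<Sum>p\<in>UNIV. J e i j * R p i k q * R p j q l)"
        by (rule sum.swap)
      also have "\<dots> = (\<Sum>i\<in>UNIV. \<Sum>j\<in>UNIV. \<Sum>q\<in>UNIV. \<Sum>p\<in>UNIV. J e i j * R p i k q * R p j q l)"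
        by (rule sum.cong[OF refl], rule sum.swap)
      also have "\<dots> = (\<Sum>i\<in>UNIV. \<Sum>j\<in>UNIV. \<Sum>p\<in>UNIV. \<Sum>q\<in>UNIV. J e i j * R p i k q * R p j q l)"
        by (rule sum.cong[OF refl], rule sum.cong[OF refl], rule sum.swap)
      finally show ?thesis by (simp add: sum_distrib_left mult.assoc)
    qed
    then show ?thesis
      unfolding half_coeff_iterated J_def[symmetric] by (simp add: sum_distrib_left)
  qed
  have S: "S 1 k l q = 4 * s * (X 2 k q * X 3 q l - X 3 k q * X 2 q l)"
    "S 2 k l q = 4 * s * (X 3 k q * X 1 q l - X 1 k q * X 3 q l)"
    "S 3 k l q = 4 * s * (X 1 k q * X 2 q l - X 2 k q * X 1 q l)" for k l q
    unfolding S_def by (rule triple_product)+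
  have P: "P 1 c d = - 4 * s * (cJJ c 2 * cJJ d 3 - cJJ c 3 * cJJ d 2)"
    "P 2 c d = - 4 * s * (cJJ c 3 * cJJ d 1 - cJJ c 1 * cJJ d 3)"
    "P 3 c d = - 4 * s * (cJJ c 1 * cJJ d 2 - cJJ c 2 * cJJ d 1)" for c d
  proof -
    have p: "P f c d = - (\<Sum>k\<in>UNIV. \<Sum>l\<in>UNIV. \<Sum>q\<in>UNIV.
        J f k l * (\<Sum>a\<in>UNIV. J a q k * cJJ c a + K a q k * cJK c a) * (\<Sum>a\<in>UNIV. J a q l * cJJ d a + K a q l * cJK d a))" for f
      unfolding P_def X_JK[symmetric] sum_negf[symmetric]
      by (intro sum.cong refl, subst X_antisym) simp
    show "P 1 c d = - 4 * s * (cJJ c 2 * cJJ d 3 - cJJ c 3 * cJJ d 2)"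
      "P 2 c d = - 4 * s * (cJJ c 3 * cJJ d 1 - cJJ c 1 * cJJ d 3)"
      "P 3 c d = - 4 * s * (cJJ c 1 * cJJ d 2 - cJJ c 2 * cJJ d 1)"
      unfolding p triple_product by simp_all
  qed
  have SP: "(\<Sum>k\<in>UNIV. \<Sum>l\<in>UNIV. \<Sum>q\<in>UNIV. J f k l * (4 * s * (X c k q * X d q l - X d k q * X c q l))) = 4 * s * (P f c d - P f d c)" for f c d
    unfolding P_def by (simp add: right_diff_distrib sum_subtractf sum_distrib_left mult.left_commute)
  have "\<forall>e f. (\<Sum>k\<in>UNIV. \<Sum>l\<in>UNIV. \<Sum>q\<in>UNIV. J f k l * S e k l q) = - 32 * cof e f"
    unfolding forall_3 S SP P cof_def by (simp add: index_distinct) (simp add: algebra_simps s_cancel JK_sums(1))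
  then show ?thesis unfolding c by blast
qed

text \<open>Exchanging k and l and using skewness of the second curvature factor gives minus the
  previous term; skewness of the basis element restores the sign.\<close>

lemma coeff_quad3:
  "half_coeff s s (\<lambda>i j k l. \<Sum>p\<in>UNIV. \<Sum>q\<in>UNIV. R p i l q * R p j k q) e f = - 32 * cof e f"
proof -
  let ?T = "\<lambda>i j k l. \<Sum>p\<in>UNIV. \<Sum>q\<in>UNIV. R p i k q * R p j q l"
  have "(\<Sum>p\<in>UNIV. \<Sum>q\<in>UNIV. R p i l q * R p j k q) = - ?T i j l k" for i j k l
    by (simp add: R34[of _ j k] sum_negf)
  then have "half_coeff s s (\<lambda>i j k l. \<Sum>p\<in>UNIV. \<Sum>q\<in>UNIV. R p i l q * R p j k q) e f
      = half_coeff s s (\<lambda>i j k l. - ?T i j l k) e f" by simp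
  also have "\<dots> = half_coeff s s ?T e f"
  proof -
    have "(\<Sum>c\<in>UNIV. \<Sum>d\<in>UNIV. half_basis s f c d * - u d c) = (\<Sum>c\<in>UNIV. \<Sum>d\<in>UNIV. half_basis s f c d * u c d)" for u :: "4 \<Rightarrow> 4 \<Rightarrow> real"
      by (subst sum.swap, intro sum.cong refl, subst half_basis_antisym) simp
    from this[of "\<lambda>c d. \<Sum>a\<in>UNIV. \<Sum>b\<in>UNIV. half_basis s e a b * ?T a b c d"]
    show ?thesis
      unfolding half_coeff_iterated mult_minus_right sum_negf .
  qed
  finally show ?thesis unfolding coeff_quad2 .
qed

definition "detA = A0 1 1 * A0 2 2 * A0 3 3 + A0 1 2 * A0 2 3 * A0 3 1 + A0 1 3 * A0 2 1 * A0 3 2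
  - A0 1 1 * A0 2 3 * A0 3 2 - A0 1 2 * A0 2 1 * A0 3 3 - A0 1 3 * A0 2 2 * A0 3 1"

lemma pairing_quad:
  "pairing Z (\<lambda>i j k l. \<Sum>p\<in>UNIV. \<Sum>q\<in>UNIV. R p i j q * R p q k l + R p i k q * R p j q l + R p i l q * R p j k q)
     = - 288 * detA - pairing Z (\<lambda>i j k l. Ric i k * Ric j l)"
proof -
  have "pairing Z (\<lambda>i j k l. \<Sum>p\<in>UNIV. \<Sum>q\<in>UNIV. R p i j q * R p q k l + R p i k q * R p j q l + R p i l q * R p j k q)
    = (\<Sum>e\<in>UNIV. \<Sum>f\<in>UNIV. A0 e f * (- 32 * (\<Sum>d\<in>UNIV. cJJ e d * cJJ f d + cJK e d * cJK f d)))
      + (\<Sum>e\<in>UNIV. \<Sum>f\<in>UNIV. A0 e f * (- 32 * cof e f)) + (\<Sum>e\<in>UNIV. \<Sum>f\<in>UNIV. A0 e f * (- 32 * cof e f))"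
    unfolding sum.distrib pairing_linear pairing_Z coeff_quad1 coeff_quad2 coeff_quad3 by simp
  also have "\<dots> = - 32 * (\<Sum>e\<in>UNIV. \<Sum>f\<in>UNIV. A0 e f * ((\<Sum>d\<in>UNIV. cJJ e d * cJJ f d) + 2 * cof e f))
      - 32 * (\<Sum>e\<in>UNIV. \<Sum>f\<in>UNIV. A0 e f * (\<Sum>d\<in>UNIV. cJK e d * cJK f d))"
    by (simp add: sum_distrib_left sum.distrib distrib_left sum_negf sum_subtractf mult.left_commute algebra_simps)
  \<comment> \<open>With cJJ = A0 + \<tau> and A0 trace-free, the square contributes tr A0^3 + 2
    \<tau> tr A0^2 and twice the cofactors contribute 6 det A0 - 2 \<tau> tr A0^2. Since tr A0^3 = 3
    det A0, the sum is 9 det A0, and 32 times 9 is 288.\<close>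
  also have "(\<Sum>e\<in>UNIV. \<Sum>f\<in>UNIV. A0 e f * ((\<Sum>d\<in>UNIV. cJJ e d * cJJ f d) + 2 * cof e f)) = 9 * detA"
  proof -
    have t: "A0 3 3 = - A0 1 1 - A0 2 2" using A0_trace by simp
    have y: "A0 2 1 = A0 1 2" "A0 3 1 = A0 1 3" "A0 3 2 = A0 2 3" by (rule A0_symmetric)+
    define \<tau> where "\<tau> = (\<Sum>i\<in>UNIV. sch i i) / 4"
    show ?thesis
      unfolding cof_def detA_def cJJ_A0[folded \<tau>_def] sum_3
      by (simp only: index_distinct if_True if_False simp_thms y t) (simp add: algebra_simps)
  qed
  finally show ?thesis unfolding pairing_Ric_Ric by simp
qed

text \<open>In the second index pair the J-part contracted with v twice gives the squared length of
  v by the quaternion relations, hence \<open>cJJ\<close> and after pairing the squared norm. The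
  K-part is the off-diagonal block, which \<open>E_vector\<close> identifies with the term of the
  trace-free Ricci tensor.\<close>

lemma pairing_Riem_vector:
  fixes v :: "4 \<Rightarrow> real"
  shows "pairing Z (\<lambda>i j k l. \<Sum>q\<in>UNIV. R i j k q * (v q * v l))
     = (\<Sum>a\<in>UNIV. (v a)\<^sup>2) * pairing Z Z / 4 + pairing Z (\<lambda>i j k l. Ric i k * (v j * v l))"
proof -
  let ?n = "\<Sum>a\<in>UNIV. (v a)\<^sup>2"
  define \<kappa> where "\<kappa> = (\<lambda>f d. \<Sum>k\<in>UNIV. \<Sum>l\<in>UNIV. \<Sum>q\<in>UNIV. J f k l * K d k q * (v l * v q))"
  define G where "G = (\<lambda>e f. \<Sum>i\<in>UNIV. \<Sum>j\<in>UNIV. \<Sum>k\<in>UNIV. \<Sum>l\<in>UNIV. J e i j * J f k l * (E i k * (v j * v l)))"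
  have JJ: "(\<Sum>k\<in>UNIV. \<Sum>l\<in>UNIV. \<Sum>q\<in>UNIV. J f k l * J d k q * (v l * v q)) = (if f = d then ?n else 0)" for f d
  proof -
    have "\<forall>f d. (\<Sum>k\<in>UNIV. \<Sum>l\<in>UNIV. \<Sum>q\<in>UNIV. J f k l * J d k q * (v l * v q)) = (if f = d then ?n else 0)"
      unfolding forall_3 sum_4 J_def half_basis_values
      by (simp add: index_distinct) (simp add: s_cancel JK_sums(1) algebra_simps power2_eq_square)
    then show ?thesis by blast
  qed
  have 1: "half_coeff s s (\<lambda>i j k l. \<Sum>q\<in>UNIV. R i j k q * (v q * v l)) e f = 4 * (cJJ e f * ?n) + 4 * (\<Sum>d\<in>UNIV. cJK e d * \<kappa> f d)" for e f
  proof -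
    have X4: "4 * X e k q = (\<Sum>a\<in>UNIV. \<Sum>b\<in>UNIV. J e a b * R a b k q)" for k q
      by (simp add: X_def)
    have "(\<Sum>a\<in>UNIV. \<Sum>b\<in>UNIV. J e a b * (\<Sum>q\<in>UNIV. R a b k q * (v q * v l))) = (\<Sum>q\<in>UNIV. 4 * X e k q * (v l * v q))" for k l
    proof -
      have "(\<Sum>a\<in>UNIV. \<Sum>b\<in>UNIV. J e a b * (\<Sum>q\<in>UNIV. R a b k q * (v q * v l)))
          = (\<Sum>a\<in>UNIV. \<Sum>q\<in>UNIV. \<Sum>b\<in>UNIV. J e a b * (R a b k q * (v q * v l)))"
        unfolding sum_distrib_left by (rule sum.cong[OF refl], rule sum.swap)
      also have "\<dots> = (\<Sum>q\<in>UNIV. \<Sum>a\<in>UNIV. \<Sum>b\<in>UNIV. J e a b * (R a b k q * (v q * v l)))"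
        by (rule sum.swap)
      also have "\<dots> = (\<Sum>q\<in>UNIV. 4 * X e k q * (v l * v q))"
        unfolding X4 by (simp add: sum_distrib_left ac_simps)
      finally show ?thesis .
    qed
    then have "half_coeff s s (\<lambda>i j k l. \<Sum>q\<in>UNIV. R i j k q * (v q * v l)) e f
        = (\<Sum>k\<in>UNIV. \<Sum>l\<in>UNIV. \<Sum>q\<in>UNIV. J f k l * (4 * X e k q * (v l * v q)))"
      unfolding half_coeff_iterated J_def[symmetric] by (simp add: sum_distrib_left)
    also have "\<dots> = 4 * ((\<Sum>d\<in>UNIV. cJJ e d * (\<Sum>k\<in>UNIV. \<Sum>l\<in>UNIV. \<Sum>q\<in>UNIV. J f k l * J d k q * (v l * v q))) + (\<Sum>d\<in>UNIV. cJK e d * \<kappa> f d))"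
      unfolding X_JK \<kappa>_def sum_3 by (simp add: sum_distrib_left sum.distrib distrib_left distrib_right algebra_simps)
    also have "(\<Sum>d\<in>UNIV. cJJ e d * (\<Sum>k\<in>UNIV. \<Sum>l\<in>UNIV. \<Sum>q\<in>UNIV. J f k l * J d k q * (v l * v q))) = cJJ e f * ?n"
      unfolding JJ sum_if_eq ..
    finally show ?thesis by simp
  qed
  have 2: "half_coeff s s (\<lambda>i j k l. Ric i k * (v j * v l)) e f
      = (if e = f then (cJJ 1 1 + cJJ 2 2 + cJJ 3 3 + cKK 1 1 + cKK 2 2 + cKK 3 3) * ?n else 0) + G e f" for e f
  proof -
    let ?u = "cJJ 1 1 + cJJ 2 2 + cJJ 3 3 + cKK 1 1 + cKK 2 2 + cKK 3 3"
    have split: "J e i j * J f k l * (Ric i k * (v j * v l))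
      = J e i j * J f k l * (v j * v l) * (if i = k then ?u else 0) + J e i j * J f k l * (E i k * (v j * v l))" for i j k l
      unfolding Ric_E by (cases "i = k") (simp_all add: algebra_simps)
    have "half_coeff s s (\<lambda>i j k l. Ric i k * (v j * v l)) e f
       = (\<Sum>i\<in>UNIV. \<Sum>j\<in>UNIV. \<Sum>k\<in>UNIV. \<Sum>l\<in>UNIV. J e i j * J f k l * (v j * v l) * (if i = k then ?u else 0)) + G e f"
      unfolding half_coeff_def J_def[symmetric] split sum.distrib G_def ..
    also have "(\<Sum>i\<in>UNIV. \<Sum>j\<in>UNIV. \<Sum>k\<in>UNIV. \<Sum>l\<in>UNIV. J e i j * J f k l * (v j * v l) * (if i = k then ?u else 0))
       = (\<Sum>i\<in>UNIV. \<Sum>j\<in>UNIV. \<Sum>l\<in>UNIV. J e i j * J f i l * (v j * v l) * ?u)"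
    proof -
      have "(\<Sum>k\<in>UNIV. \<Sum>l\<in>UNIV. J e i j * J f k l * (v j * v l) * (if i = k then ?u else 0))
          = (\<Sum>l\<in>UNIV. J e i j * J f i l * (v j * v l) * ?u)" for i j
        by (subst sum.swap) (simp only: sum_if_eq)
      then show ?thesis by simp
    qed
    also have "\<dots> = (\<Sum>i\<in>UNIV. \<Sum>j\<in>UNIV. \<Sum>l\<in>UNIV. J e i j * J f i l * (v j * v l)) * ?u"
      by (simp only: sum_distrib_right)
    finally show ?thesis unfolding JJ by simp
  qed
  have G: "(\<Sum>e\<in>UNIV. \<Sum>f\<in>UNIV. A0 e f * G e f) = 4 * (\<Sum>e\<in>UNIV. \<Sum>f\<in>UNIV. A0 e f * (\<Sum>d\<in>UNIV. cJK e d * \<kappa> f d))"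
  proof -
    have sw: "(\<Sum>e\<in>UNIV. \<Sum>f\<in>UNIV. A0 e f * h f e) = (\<Sum>e\<in>UNIV. \<Sum>f\<in>UNIV. A0 e f * h e f)" for h :: "3 \<Rightarrow> 3 \<Rightarrow> real"
      by (subst sum.swap) (simp only: A0_symmetric)
    have "2 * (\<Sum>e\<in>UNIV. \<Sum>f\<in>UNIV. A0 e f * G e f) = (\<Sum>e\<in>UNIV. \<Sum>f\<in>UNIV. A0 e f * (G e f + G f e))"
      using sw[of G] by (simp add: distrib_left sum.distrib)
    also have "\<dots> = (\<Sum>e\<in>UNIV. \<Sum>f\<in>UNIV. A0 e f * (4 * (\<Sum>d\<in>UNIV. cJK e d * \<kappa> f d + cJK f d * \<kappa> e d)))"
      unfolding G_def \<kappa>_def E_vector right_diff_distrib sum_subtractf trace_free_sum by simp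
    also have "\<dots> = 4 * (2 * (\<Sum>e\<in>UNIV. \<Sum>f\<in>UNIV. A0 e f * (\<Sum>d\<in>UNIV. cJK e d * \<kappa> f d)))"
      using sw[of "\<lambda>e f. \<Sum>d\<in>UNIV. cJK e d * \<kappa> f d"]
      by (simp add: distrib_left sum.distrib sum_distrib_left[symmetric] mult.left_commute[of _ 4])
    finally show ?thesis by simp
  qed
  have "(\<Sum>e\<in>UNIV. \<Sum>f\<in>UNIV. A0 e f * cJJ e f) = (\<Sum>e\<in>UNIV. \<Sum>f\<in>UNIV. (A0 e f)\<^sup>2)"
    unfolding cJJ_A0 distrib_left sum.distrib trace_free_sum by (simp add: power2_eq_square)
  moreover have "(\<Sum>e\<in>UNIV. \<Sum>f\<in>UNIV. A0 e f * (4 * (cJJ e f * n))) = 4 * n * (\<Sum>e\<in>UNIV. \<Sum>f\<in>UNIV. A0 e f * cJJ e f)" for n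
    by (simp add: sum_distrib_left ac_simps)
  ultimately have 3: "(\<Sum>e\<in>UNIV. \<Sum>f\<in>UNIV. A0 e f * (4 * (cJJ e f * ?n))) = 4 * ?n * (\<Sum>e\<in>UNIV. \<Sum>f\<in>UNIV. (A0 e f)\<^sup>2)"
    by simp
  have 4: "(\<Sum>e\<in>UNIV. \<Sum>f\<in>UNIV. A0 e f * (4 * (\<Sum>d\<in>UNIV. cJK e d * \<kappa> f d))) = (\<Sum>e\<in>UNIV. \<Sum>f\<in>UNIV. A0 e f * G e f)"
    unfolding G by (simp add: sum_distrib_left mult.left_commute)
  show ?thesis
    unfolding pairing_Z_Z unfolding pairing_Z 1 2 distrib_left sum.distrib trace_free_sum 3 4 by simp
qed

end

lemma pairing_trace:
  fixes Z :: "'n::finite \<Rightarrow> 'n \<Rightarrow> 'n \<Rightarrow> 'n \<Rightarrow> 'r::comm_ring_1"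
  assumes Ztrace: "\<And>i k. (\<Sum>j\<in>UNIV. Z i j k j) = 0"
  shows "pairing Z (\<lambda>i j k l. \<alpha> i k * kronecker j l) = 0"
proof -
  have "(\<Sum>j\<in>UNIV. \<Sum>k\<in>UNIV. \<Sum>l\<in>UNIV. Z i j k l * (\<alpha> i k * kronecker j l)) = (\<Sum>k\<in>UNIV. \<alpha> i k * (\<Sum>j\<in>UNIV. Z i j k j))" for i
  proof -
    have "(\<Sum>l\<in>UNIV. Z i j k l * (\<alpha> i k * kronecker j l)) = Z i j k j * \<alpha> i k" for j k
      using sum_if_eq[of "\<lambda>l. Z i j k l * \<alpha> i k" j 1] by (simp add: kronecker_def mult.assoc)
    then show ?thesis by (subst sum.swap) (simp add: sum_distrib_left mult.commute)
  qed
  then show ?thesis unfolding pairing_def Ztrace by simp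
qed

lemma pairing_swap_both:
  assumes Z12: "\<And>i j k l. Z j i k l = - Z i j k l" and Z34: "\<And>i j k l. Z i j l k = - Z i j k l"
  shows "pairing Z (\<lambda>i j k l. T j i l k) = pairing Z T"
  using pairing_swap12[of Z "\<lambda>i j k l. T i j l k", OF Z12] pairing_swap34[of Z T, OF Z34] by simp

section \<open>The quasi-Einstein equation at a point\<close>

context algebraic_curvature4
begin

lemma Z_symmetries: "Z j i k l = - Z i j k l" "Z i j l k = - Z i j k l" "(\<Sum>j\<in>UNIV. Z i j k j) = 0"
  using half_antisym12[of s W i j k l] half_antisym34[of s W i j k l]
    half_trace(2)[of W s, OF W_symmetries W_trace JK_sums(1)] by simp_all

text \<open>The terms mixing the Hessian with the gradient cancel.\<close>

lemma quasi_einstein_algebra: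
  fixes H :: "4 \<Rightarrow> 4 \<Rightarrow> real" and v :: "4 \<Rightarrow> real" and lam \<mu> :: real
  assumes Ric: "\<And>i k. Ric i k = lam * kronecker i k - H i k + \<mu> * (v i * v k)"
  shows "pairing Z (\<lambda>i j k l. \<Sum>p\<in>UNIV. \<Sum>q\<in>UNIV. R p i j q * R p q k l + R p i k q * R p j q l + R p i l q * R p j k q)
      + 2 * \<mu> * pairing Z (\<lambda>i j k l. \<Sum>q\<in>UNIV. R i j k q * (v q * v l))
    = - 288 * detA - pairing Z (\<lambda>i j k l. H i k * H j l) + \<mu> * (\<Sum>a\<in>UNIV. (v a)\<^sup>2) * pairing Z Z / 2"
proof -
  have tr: "pairing Z (\<lambda>i j k l. \<alpha> i k * kronecker j l) = 0" for \<alpha>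
    by (rule pairing_trace[of Z, OF Z_symmetries(3)])
  have both: "pairing Z (\<lambda>i j k l. T j i l k) = pairing Z T" for T
    by (rule pairing_swap_both[of Z, OF Z_symmetries(1,2)])
  have tr': "pairing Z (\<lambda>i j k l. kronecker i k * \<beta> j l) = 0" for \<beta>
    using both[of "\<lambda>i j k l. \<beta> i k * kronecker j l"] tr[of \<beta>] by (simp add: mult.commute)
  have vv: "pairing Z (\<lambda>i j k l. v i * v k * (v j * v l)) = 0"
    by (rule pairing_symmetric34[OF Z_symmetries(2)]) simp
  define hv where "hv = pairing Z (\<lambda>i j k l. H i k * (v j * v l))"
  have vh: "pairing Z (\<lambda>i j k l. v i * v k * H j l) = hv"
    using both[of "\<lambda>i j k l. H i k * (v j * v l)"] unfolding hv_def by (simp add: mult.commute)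
  have R2: "pairing Z (\<lambda>i j k l. Ric i k * (v j * v l)) = - hv"
  proof -
    have "pairing Z (\<lambda>i j k l. Ric i k * (v j * v l))
      = pairing Z (\<lambda>i j k l. lam * (kronecker i k * (v j * v l)) - H i k * (v j * v l) + \<mu> * (v i * v k * (v j * v l)))"
      unfolding Ric by (simp add: algebra_simps)
    also have "\<dots> = lam * pairing Z (\<lambda>i j k l. kronecker i k * (v j * v l)) - hv + \<mu> * pairing Z (\<lambda>i j k l. v i * v k * (v j * v l))"
      unfolding pairing_linear hv_def ..
    finally show ?thesis unfolding tr' vv by simp
  qed
  have RR: "pairing Z (\<lambda>i j k l. Ric i k * Ric j l) = pairing Z (\<lambda>i j k l. H i k * H j l) - 2 * \<mu> * hv"
  proof -
    let ?P = "\<lambda>i k. \<mu> * (v i * v k) - H i k"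
    have "pairing Z (\<lambda>i j k l. Ric i k * Ric j l)
      = pairing Z (\<lambda>i j k l. lam * (kronecker i k * Ric j l) + lam * (?P i k * kronecker j l) + ?P i k * ?P j l)"
      unfolding Ric by (simp add: algebra_simps)
    also have "\<dots> = pairing Z (\<lambda>i j k l. ?P i k * ?P j l)"
      unfolding pairing_linear tr' tr by simp
    also have "\<dots> = pairing Z (\<lambda>i j k l. H i k * H j l - \<mu> * (H i k * (v j * v l)) - \<mu> * (v i * v k * H j l)
        + \<mu> * (\<mu> * (v i * v k * (v j * v l))))"
      by (simp add: algebra_simps)
    also have "\<dots> = pairing Z (\<lambda>i j k l. H i k * H j l) - \<mu> * hv - \<mu> * hv + \<mu> * (\<mu> * pairing Z (\<lambda>i j k l. v i * v k * (v j * v l)))"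
      unfolding pairing_linear vh hv_def ..
    finally show ?thesis unfolding vv by simp
  qed
  show ?thesis unfolding pairing_quad pairing_Riem_vector R2 RR by (simp add: algebra_simps)
qed

lemma pairing_kn_square:
  "pairing Z (kn H H) = 4 * pairing Z (\<lambda>i j k l. H i k * H j l)"
proof -
  let ?T = "\<lambda>i j k l. H i k * H j l"
  have "kn H H = (\<lambda>i j k l. 2 * ?T i j k l - 2 * ?T i j l k)"
    by (intro ext) (simp add: kn_def algebra_simps)
  then have "pairing Z (kn H H) = 2 * pairing Z ?T - 2 * pairing Z (\<lambda>i j k l. ?T i j l k)"
    by (simp only: pairing_linear)
  then show ?thesis
    using pairing_swap34[of Z ?T, OF Z_symmetries(2)] by simp
qed

end

section \<open>The half Weyl tensor in an orthonormal frame\<close>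

context orthonormal_frame4
begin

lemma schouten_symmetric: "schouten i k = schouten k i"
  unfolding schouten_def kronecker_def by (simp add: ric_symmetric[of i k] eq_commute[of i k])

lemma weyl4_symmetries:
  "weyl4 j i k l = - weyl4 i j k l" "weyl4 i j l k = - weyl4 i j k l" "weyl4 k l i j = weyl4 i j k l"
  "weyl4 i j k l + weyl4 j k i l + weyl4 k i j l = 0"
proof -
  note kn = kn_antisym[of schouten kronecker] kn_kronecker_symmetric[of schouten, OF schouten_symmetric]
  show "weyl4 j i k l = - weyl4 i j k l" unfolding weyl4_def curv_antisym12[of j i] kn(1)[of j i] by simp
  show "weyl4 i j l k = - weyl4 i j k l" unfolding weyl4_def curv_antisym34[of i j l k] kn(2)[of i j l k] by simp
  show "weyl4 k l i j = weyl4 i j k l" unfolding weyl4_def curv_pair[of k l i j] kn(3)[of k l i j] ..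
  have "weyl4 i j k l + weyl4 j k i l + weyl4 k i j l = (curv i j k l + curv j k i l + curv k i j l)
      - (kn schouten kronecker i j k l + kn schouten kronecker j k i l + kn schouten kronecker k i j l)"
    unfolding weyl4_def by (simp add: algebra_simps)
  then show "weyl4 i j k l + weyl4 j k i l + weyl4 k i j l = 0"
    unfolding curv_cyclic kn(4) by simp
qed

lemma weyl4_trace: "(\<Sum>i\<in>UNIV. \<Sum>j\<in>UNIV. weyl4 i j i j) = 0"
proof -
  let ?S = "\<Sum>a\<in>UNIV. ric a a"
  have "(\<Sum>i\<in>UNIV. schouten i i) = (1/2) *\<^sub>R ?S - (1/12) *\<^sub>R (4 * ?S)"
    unfolding schouten_def sum_subtractf scaleR_sum_right[symmetric] kronecker_def by simp
  also have "4 * ?S = 4 *\<^sub>R ?S" by (simp add: scaleR_conv_of_real)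
  also have "(1/2) *\<^sub>R ?S - (1/12) *\<^sub>R (4 *\<^sub>R ?S) = (1/6) *\<^sub>R ?S"
    by (simp add: scaleR_diff_left[symmetric])
  finally have "6 * (\<Sum>i\<in>UNIV. schouten i i) = 6 * ((1/6) *\<^sub>R (\<Sum>a\<in>UNIV. ric a a))" by simp
  also have "\<dots> = 6 *\<^sub>R ((1/6) *\<^sub>R ?S)" by (simp only: scaleR_conv_of_real of_real_numeral)
  also have "\<dots> = ?S" by simp
  finally show ?thesis
    unfolding weyl4_def sum_subtractf kn_kronecker_trace by (simp add: ric_def)
qed

lemma half_weyl_symmetries:
  "half_weyl j i k l = - half_weyl i j k l" "half_weyl i j l k = - half_weyl i j k l"
  "half_weyl k l i j = half_weyl i j k l" "(\<Sum>j\<in>UNIV. half_weyl i j k j) = 0"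
  unfolding half_weyl_def
  by (rule half_antisym12 half_antisym34 half_pair[of weyl4 s, OF weyl4_symmetries(3)]
      half_trace(2)[of weyl4 s, OF weyl4_symmetries weyl4_trace s_squared])+

lemma pairing_half_weyl: "pairing half_weyl (half s T) = pairing half_weyl T"
  unfolding half_weyl_def by (rule pairing_half_half[OF s_squared])

lemma pairing_half_weyl_kn: "pairing half_weyl (kn \<alpha> kronecker) = 0"
  by (rule pairing_kn[OF half_weyl_symmetries(1,2,4)])

lemma nabla4_weyl: "nabla4 p weyl4 = (\<lambda>i j k l. nR p i j k l - kn (nabla2 p schouten) kronecker i j k l)"
proof (intro ext)
  fix i j k l
  have "nabla4 p weyl4 i j k l = nR p i j k l - nabla4 p (kn schouten kronecker) i j k l"
    unfolding nabla4_def weyl4_def by (simp add: D_diff sum.distrib sum_subtractf right_diff_distrib algebra_simps)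
  then show "nabla4 p weyl4 i j k l = nR p i j k l - kn (nabla2 p schouten) kronecker i j k l"
    unfolding nabla4_kn .
qed

lemma nabla4_half_weyl: "nabla4 p half_weyl = half s (nabla4 p weyl4)"
  unfolding half_weyl_def by (rule nabla4_half)

text \<open>The derivative of the half Weyl tensor is the projection of the derivative of the
  curvature minus a product with the metric. Pairing with the half Weyl tensor absorbs the
  projection and annihilates the product.\<close>

lemma pairing_nabla_half_weyl: "pairing half_weyl (nabla4 q half_weyl) = pairing half_weyl (nR q)"
  unfolding nabla4_half_weyl pairing_half_weyl nabla4_weyl pairing_linear pairing_half_weyl_kn by simp

text \<open>The product with the metric stays one under a second derivative, so it drops out again;
  the connection term of the inner direction is covered by the first-order case.\<close>

lemma pairing_laplacian_half_weyl:
  "pairing half_weyl (\<lambda>i j k l. \<Sum>a\<in>UNIV. nabla5 a (\<lambda>a. nabla4 a half_weyl) a i j k l)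
     = pairing half_weyl (\<lambda>i j k l. \<Sum>a\<in>UNIV. nabla5 a nR a i j k l)"
proof -
  have "pairing half_weyl (nabla5 a (\<lambda>a. nabla4 a half_weyl) a) = pairing half_weyl (nabla5 a nR a)" for a
  proof -
    let ?A = "\<lambda>q. nabla2 q schouten"
    have n4: "nabla4 a (nabla4 b weyl4) i j k l = nabla4 a (nR b) i j k l - kn (nabla2 a (?A b)) kronecker i j k l" for b i j k l
    proof -
      have "nabla4 a (nabla4 b weyl4) i j k l = nabla4 a (nR b) i j k l - nabla4 a (kn (?A b) kronecker) i j k l"
        unfolding nabla4_weyl nabla4_def[of a] by (simp add: D_diff sum.distrib sum_subtractf right_diff_distrib algebra_simps)
      then show ?thesis unfolding nabla4_kn .
    qed
    have 5: "nabla5 a S b = (\<lambda>i j k l. nabla4 a (S b) i j k l - (\<Sum>q\<in>UNIV. \<omega> a b q * S q i j k l))" for S b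
      using nabla5_nabla4[of a S b] by (simp add: fun_eq_iff)
    have "pairing half_weyl (nabla5 a (\<lambda>a. nabla4 a half_weyl) a)
        = pairing half_weyl (nabla4 a (nabla4 a half_weyl)) - (\<Sum>q\<in>UNIV. \<omega> a a q * pairing half_weyl (nabla4 q half_weyl))"
      unfolding 5 pairing_linear pairing_sum ..
    also have "pairing half_weyl (nabla4 a (nabla4 a half_weyl)) = pairing half_weyl (nabla4 a (nR a))"
      unfolding nabla4_half_weyl nabla4_half pairing_half_weyl
      using pairing_linear(2)[of half_weyl "nabla4 a (nR a)" "kn (nabla2 a (?A a)) kronecker"]
      by (simp add: n4[symmetric] pairing_half_weyl_kn)
    finally show ?thesis
      unfolding 5[of nR] pairing_linear pairing_sum pairing_nabla_half_weyl .
  qed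
  then show ?thesis unfolding pairing_sum by simp
qed

lemma pairing_half_weyl_curv: "pairing half_weyl curv = pairing half_weyl half_weyl"
proof -
  have "pairing half_weyl half_weyl = pairing half_weyl weyl4"
    using pairing_half_weyl[of weyl4] by (simp add: half_weyl_def)
  also have "weyl4 = (\<lambda>i j k l. curv i j k l - kn schouten kronecker i j k l)"
    by (intro ext) (rule weyl4_def)
  finally show ?thesis unfolding pairing_linear pairing_half_weyl_kn by simp
qed

end

locale quasi_einstein_frame4 = orthonormal_frame4 D \<omega> s + quasi_einstein_frame D \<omega> f lam \<mu>
  for D :: "4 \<Rightarrow> 'r::{comm_ring_1,real_algebra_1} \<Rightarrow> 'r" and \<omega> s f lam \<mu>
begin

theorem weighted_laplacian_half_weyl:
  "(\<Sum>a\<in>UNIV. hess (pairing half_weyl half_weyl) a a) - (\<Sum>a\<in>UNIV. F a * D a (pairing half_weyl half_weyl))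
     = 2 * (\<Sum>a\<in>UNIV. pairing (nabla4 a half_weyl) (nabla4 a half_weyl))
       + 4 * (lam * pairing half_weyl half_weyl) + 4 * pairing half_weyl quad
       + \<mu> *\<^sub>R (8 * pairing half_weyl (\<lambda>i j k l. \<Sum>q\<in>UNIV. curv i j k q * (F q * F l))
                - 8 * pairing half_weyl (\<lambda>i j k l. H i k * H j l))"
  using weighted_laplacian_pairing[of half_weyl, OF half_weyl_symmetries pairing_nabla_half_weyl pairing_laplacian_half_weyl]
  unfolding pairing_half_weyl_curv .

end

section \<open>Change of frame\<close>

text \<open>
  A holonomic frame with metric \<open>\<gamma>\<close> and Levi-Civita connection \<open>\<omega>\<close>, together with a frame
  \<open>E\<close> that is orthonormal for \<open>\<gamma>\<close>; \<open>E i a\<close> is the \<open>i\<close>-th coordinate of the \<open>a\<close>-th frame vector.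
\<close>

locale frame_change = torsion_free_connection D \<omega>
  for D :: "'n::finite \<Rightarrow> 'r::{comm_ring_1,real_algebra_1} \<Rightarrow> 'r" and \<omega> +
  fixes \<gamma> E :: "'n \<Rightarrow> 'n \<Rightarrow> 'r"
  assumes symmetric: "\<omega> i j k = \<omega> j i k"
    and \<gamma>_symmetric: "\<gamma> i j = \<gamma> j i"
    and \<gamma>_parallel: "D p (\<gamma> i j) = (\<Sum>q\<in>UNIV. \<omega> p i q * \<gamma> q j + \<omega> p j q * \<gamma> i q)"
    and orthonormal: "(\<Sum>i\<in>UNIV. (\<Sum>j\<in>UNIV. \<gamma> i j * E j a) * E i b) = (if a = b then 1 else 0)"
    and complete: "(\<Sum>a\<in>UNIV. E i a * (\<Sum>j\<in>UNIV. \<gamma> k j * E j a)) = (if i = k then 1 else 0)"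
begin

text \<open>The frame vectors lowered by \<gamma>; by orthonormality they form the dual
  coframe.\<close>

definition "\<theta> a i = (\<Sum>j\<in>UNIV. \<gamma> i j * E j a)"

definition "\<nu> i b k = D i (E k b) + (\<Sum>j\<in>UNIV. E j b * \<omega> i j k)"

text \<open>Connection coefficients of the frame E for a direction that is still holonomic.
  \<open>cov_change_frame\<close> changes index slots but not the direction of differentiation; the
  latter is converted afterwards in \<open>\<omega>f\<close>.\<close>

definition "\<beta> i b c = (\<Sum>k\<in>UNIV. \<nu> i b k * \<theta> c k)"

definition "Df a u = (\<Sum>i\<in>UNIV. E i a * D i u)"

definition "\<omega>f a b c = (\<Sum>i\<in>UNIV. E i a * \<beta> i b c)"

lemma sum_if: "(\<Sum>q\<in>UNIV. X q * (if q = j then 1 else 0)) = X j" "(\<Sum>q\<in>UNIV. X q * (if j = q then 1 else 0)) = X j"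
  for X :: "'n \<Rightarrow> 'r"
proof -
  have "(\<Sum>q\<in>UNIV. X q * (if q = j then 1 else 0)) = (\<Sum>q\<in>UNIV. if q = j then X q else 0)"
    by (rule sum.cong) auto
  then show "(\<Sum>q\<in>UNIV. X q * (if q = j then 1 else 0)) = X j" by simp
  have "(\<Sum>q\<in>UNIV. X q * (if j = q then 1 else 0)) = (\<Sum>q\<in>UNIV. if q = j then X q else 0)"
    by (rule sum.cong) auto
  then show "(\<Sum>q\<in>UNIV. X q * (if j = q then 1 else 0)) = X j" by simp
qed

lemma compat: "D i (E k b) + (\<Sum>j\<in>UNIV. E j b * \<omega> i j k) = (\<Sum>c\<in>UNIV. \<beta> i b c * E k c)"
proof -
  have "(\<Sum>c\<in>UNIV. \<beta> i b c * E k c) = (\<Sum>c\<in>UNIV. \<Sum>l\<in>UNIV. \<nu> i b l * (E k c * \<theta> c l))"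
    unfolding \<beta>_def sum_distrib_right by (simp add: ac_simps)
  also have "\<dots> = (\<Sum>l\<in>UNIV. \<nu> i b l * (\<Sum>c\<in>UNIV. E k c * \<theta> c l))"
    by (subst sum.swap) (simp add: sum_distrib_left)
  also have "\<dots> = \<nu> i b k"
    unfolding \<theta>_def complete by (rule sum_if(2))
  finally show ?thesis unfolding \<nu>_def by simp
qed

text \<open>Differentiate the orthonormality relation: since \<gamma> is parallel, the derivatives
  of \<gamma> complete those of the frame vectors to covariant ones.\<close>

lemma \<beta>_antisym: "\<beta> i b c = - \<beta> i c b"
proof -
  have e: "D i (E k b) = \<nu> i b k - (\<Sum>j\<in>UNIV. E j b * \<omega> i j k)" for k b
    unfolding \<nu>_def by simp
  have "0 = D i (\<Sum>k\<in>UNIV. (\<Sum>l\<in>UNIV. \<gamma> k l * E l c) * E k b)"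
    unfolding orthonormal by (simp add: D_simps)
  also have "\<dots> = (\<Sum>k\<in>UNIV. \<theta> c k * D i (E k b))
      + (\<Sum>k\<in>UNIV. (\<Sum>l\<in>UNIV. \<gamma> k l * D i (E l c)) * E k b)
      + (\<Sum>k\<in>UNIV. \<Sum>l\<in>UNIV. D i (\<gamma> k l) * E l c * E k b)"
    unfolding \<theta>_def by (simp add: D_simps sum.distrib distrib_right sum_distrib_right sum_distrib_left algebra_simps)
  also have "(\<Sum>k\<in>UNIV. (\<Sum>l\<in>UNIV. \<gamma> k l * D i (E l c)) * E k b) = (\<Sum>l\<in>UNIV. \<theta> b l * D i (E l c))"
    unfolding \<theta>_def sum_distrib_right
    by (subst sum.swap) (simp add: ac_simps \<gamma>_symmetric)
  also have "(\<Sum>k\<in>UNIV. \<Sum>l\<in>UNIV. D i (\<gamma> k l) * E l c * E k b)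
     = (\<Sum>q\<in>UNIV. \<theta> c q * (\<Sum>j\<in>UNIV. E j b * \<omega> i j q)) + (\<Sum>q\<in>UNIV. \<theta> b q * (\<Sum>j\<in>UNIV. E j c * \<omega> i j q))"
  proof -
    have "(\<Sum>k\<in>UNIV. \<Sum>l\<in>UNIV. D i (\<gamma> k l) * E l c * E k b)
       = (\<Sum>k\<in>UNIV. \<Sum>l\<in>UNIV. \<Sum>q\<in>UNIV. \<omega> i k q * \<gamma> q l * E l c * E k b)
         + (\<Sum>k\<in>UNIV. \<Sum>l\<in>UNIV. \<Sum>q\<in>UNIV. \<omega> i l q * \<gamma> k q * E l c * E k b)"
      unfolding \<gamma>_parallel by (simp add: sum_distrib_right sum.distrib distrib_right)
    also have "(\<Sum>k\<in>UNIV. \<Sum>l\<in>UNIV. \<Sum>q\<in>UNIV. \<omega> i k q * \<gamma> q l * E l c * E k b)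
       = (\<Sum>q\<in>UNIV. \<theta> c q * (\<Sum>j\<in>UNIV. E j b * \<omega> i j q))"
    proof -
      have "(\<Sum>k\<in>UNIV. \<Sum>l\<in>UNIV. \<Sum>q\<in>UNIV. \<omega> i k q * \<gamma> q l * E l c * E k b)
          = (\<Sum>k\<in>UNIV. \<Sum>q\<in>UNIV. \<Sum>l\<in>UNIV. \<omega> i k q * \<gamma> q l * E l c * E k b)"
        by (rule sum.cong[OF refl], rule sum.swap)
      also have "\<dots> = (\<Sum>q\<in>UNIV. \<Sum>k\<in>UNIV. \<Sum>l\<in>UNIV. \<omega> i k q * \<gamma> q l * E l c * E k b)" by (rule sum.swap)
      also have "\<dots> = (\<Sum>q\<in>UNIV. \<Sum>k\<in>UNIV. (\<Sum>l\<in>UNIV. \<gamma> q l * E l c) * (E k b * \<omega> i k q))"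
        by (simp add: sum_distrib_left ac_simps)
      finally show ?thesis unfolding \<theta>_def by (simp add: sum_distrib_left)
    qed
    also have "(\<Sum>k\<in>UNIV. \<Sum>l\<in>UNIV. \<Sum>q\<in>UNIV. \<omega> i l q * \<gamma> k q * E l c * E k b)
       = (\<Sum>q\<in>UNIV. \<theta> b q * (\<Sum>j\<in>UNIV. E j c * \<omega> i j q))"
    proof -
      have "(\<Sum>k\<in>UNIV. \<Sum>l\<in>UNIV. \<Sum>q\<in>UNIV. \<omega> i l q * \<gamma> k q * E l c * E k b)
          = (\<Sum>l\<in>UNIV. \<Sum>k\<in>UNIV. \<Sum>q\<in>UNIV. \<omega> i l q * \<gamma> k q * E l c * E k b)" by (rule sum.swap)
      also have "\<dots> = (\<Sum>l\<in>UNIV. \<Sum>q\<in>UNIV. \<Sum>k\<in>UNIV. \<omega> i l q * \<gamma> k q * E l c * E k b)"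
        by (rule sum.cong[OF refl], rule sum.swap)
      also have "\<dots> = (\<Sum>q\<in>UNIV. \<Sum>l\<in>UNIV. \<Sum>k\<in>UNIV. \<omega> i l q * \<gamma> k q * E l c * E k b)" by (rule sum.swap)
      also have "\<dots> = (\<Sum>q\<in>UNIV. \<Sum>l\<in>UNIV. (\<Sum>k\<in>UNIV. \<gamma> k q * E k b) * (E l c * \<omega> i l q))"
        by (simp add: sum_distrib_left ac_simps)
      also have "\<dots> = (\<Sum>q\<in>UNIV. \<Sum>l\<in>UNIV. \<theta> b q * (E l c * \<omega> i l q))"
        unfolding \<theta>_def by (subst \<gamma>_symmetric) (rule refl)
      finally show ?thesis by (simp add: sum_distrib_left)
    qed
    finally show ?thesis .
  qed
  finally have "0 = (\<Sum>k\<in>UNIV. \<theta> c k * \<nu> i b k) + (\<Sum>k\<in>UNIV. \<theta> b k * \<nu> i c k)"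
    unfolding e by (simp add: right_diff_distrib sum_subtractf)
  then have "\<beta> i b c + \<beta> i c b = 0"
    unfolding \<beta>_def by (simp add: mult.commute)
  then show ?thesis by (simp add: eq_neg_iff_add_eq_0)
qed

lemma D_commute: "D a (D b u) = D b (D a u)"
  using torsion_free[of a b u] symmetric[of a b] by simp

lemma Df_connection: "torsion_free_connection Df \<omega>f"
proof
  fix a b :: 'n and u v :: 'r and r :: real
  show "Df a (u + v) = Df a u + Df a v"
    unfolding Df_def by (simp add: D_add distrib_left sum.distrib)
  show "Df a (u * v) = u * Df a v + Df a u * v"
    unfolding Df_def by (simp add: D_mult distrib_left sum.distrib sum_distrib_left sum_distrib_right ac_simps)
  show "Df a (r *\<^sub>R u) = r *\<^sub>R Df a u"
    unfolding Df_def by (simp add: D_scaleR scaleR_sum_right)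
  have 1: "Df a (Df b u) = (\<Sum>i\<in>UNIV. \<Sum>k\<in>UNIV. E i a * (E k b * D i (D k u))) + (\<Sum>i\<in>UNIV. \<Sum>k\<in>UNIV. E i a * (D i (E k b) * D k u))" for a b
    unfolding Df_def by (simp add: D_simps sum.distrib distrib_left sum_distrib_left)
  have 2: "(\<Sum>c\<in>UNIV. \<omega>f a b c * Df c u)
      = (\<Sum>i\<in>UNIV. \<Sum>k\<in>UNIV. E i a * (D i (E k b) * D k u)) + (\<Sum>i\<in>UNIV. \<Sum>k\<in>UNIV. E i a * ((\<Sum>j\<in>UNIV. E j b * \<omega> i j k) * D k u))" for a b
  proof -
    have "(\<Sum>c\<in>UNIV. \<omega>f a b c * Df c u) = (\<Sum>c\<in>UNIV. \<Sum>i\<in>UNIV. \<Sum>k\<in>UNIV. E i a * (\<beta> i b c * E k c * D k u))"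
      unfolding Df_def \<omega>f_def sum_distrib_right unfolding sum_distrib_left by (simp add: ac_simps)
    also have "\<dots> = (\<Sum>i\<in>UNIV. \<Sum>c\<in>UNIV. \<Sum>k\<in>UNIV. E i a * (\<beta> i b c * E k c * D k u))" by (rule sum.swap)
    also have "\<dots> = (\<Sum>i\<in>UNIV. \<Sum>k\<in>UNIV. \<Sum>c\<in>UNIV. E i a * (\<beta> i b c * E k c * D k u))"
      by (rule sum.cong[OF refl], rule sum.swap)
    also have "\<dots> = (\<Sum>i\<in>UNIV. \<Sum>k\<in>UNIV. E i a * ((\<Sum>c\<in>UNIV. \<beta> i b c * E k c) * D k u))"
      by (simp add: sum_distrib_left sum_distrib_right)
    finally show ?thesis
      unfolding compat[symmetric] by (simp add: distrib_left distrib_right sum.distrib)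
  qed
  have 3: "(\<Sum>i\<in>UNIV. \<Sum>k\<in>UNIV. E i a * (E k b * D i (D k u))) = (\<Sum>i\<in>UNIV. \<Sum>k\<in>UNIV. E i b * (E k a * D i (D k u)))"
    by (subst sum.swap) (simp add: D_commute mult.left_commute)
  have 4: "(\<Sum>i\<in>UNIV. \<Sum>k\<in>UNIV. E i a * ((\<Sum>j\<in>UNIV. E j b * \<omega> i j k) * D k u)) = (\<Sum>i\<in>UNIV. \<Sum>k\<in>UNIV. E i b * ((\<Sum>j\<in>UNIV. E j a * \<omega> i j k) * D k u))"
  proof -
    have e: "(\<Sum>i\<in>UNIV. \<Sum>k\<in>UNIV. E i a * ((\<Sum>j\<in>UNIV. E j b * \<omega> i j k) * D k u)) = (\<Sum>k\<in>UNIV. (\<Sum>i\<in>UNIV. \<Sum>j\<in>UNIV. E i a * E j b * \<omega> i j k) * D k u)" for a b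
      by (subst sum.swap) (simp add: sum_distrib_left sum_distrib_right ac_simps)
    have "(\<Sum>i\<in>UNIV. \<Sum>j\<in>UNIV. E i a * E j b * \<omega> i j k) = (\<Sum>i\<in>UNIV. \<Sum>j\<in>UNIV. E i b * E j a * \<omega> i j k)" for k
      by (subst sum.swap) (simp add: symmetric mult.commute)
    then show ?thesis unfolding e by simp
  qed
  show "Df a (Df b u) - Df b (Df a u) = (\<Sum>c\<in>UNIV. (\<omega>f a b c - \<omega>f b a c) * Df c u)"
    unfolding left_diff_distrib sum_subtractf 1 2 3 4 by simp
qed

sublocale frame: torsion_free_connection Df \<omega>f
  by (rule Df_connection)

definition "fr1 T a = (\<Sum>i\<in>UNIV. E i a * T i)"
definition "fr2 T a b = (\<Sum>i\<in>UNIV. E i a * (\<Sum>j\<in>UNIV. E j b * T i j))"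
definition "fr4 T a b c d = (\<Sum>i\<in>UNIV. E i a * (\<Sum>j\<in>UNIV. E j b * (\<Sum>k\<in>UNIV. E k c * (\<Sum>l\<in>UNIV. E l d * T i j k l))))"

lemma frame_nabla1: "frame.nabla1 a (fr1 T) b = (\<Sum>i\<in>UNIV. E i a * (\<Sum>j\<in>UNIV. E j b * nabla1 i T j))"
proof -
  have "D i (fr1 T b) - (\<Sum>q\<in>UNIV. \<beta> i b q * fr1 T q) = (\<Sum>j\<in>UNIV. E j b * nabla1 i T j)" for i
    using cov_change_frame[of i E "\<lambda>_. \<omega>" 0 \<beta> "{0}" "\<lambda>I. T (I 0)" "\<lambda>_. b"] compat
    by (simp add: cov_def fr1_def nabla1_def)
  moreover have "frame.nabla1 a (fr1 T) b = (\<Sum>i\<in>UNIV. E i a * (D i (fr1 T b) - (\<Sum>q\<in>UNIV. \<beta> i b q * fr1 T q)))"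
  proof -
    have "(\<Sum>q\<in>UNIV. \<omega>f a b q * fr1 T q) = (\<Sum>i\<in>UNIV. E i a * (\<Sum>q\<in>UNIV. \<beta> i b q * fr1 T q))"
      unfolding \<omega>f_def sum_distrib_right by (subst sum.swap) (simp add: sum_distrib_left mult.assoc)
    then show ?thesis
      unfolding frame.nabla1_def Df_def by (simp add: right_diff_distrib sum_subtractf)
  qed
  ultimately show ?thesis by simp
qed

lemma frame_connection_sum:
  "(\<Sum>q\<in>UNIV. \<omega>f a b q * X q) = (\<Sum>i\<in>UNIV. E i a * (\<Sum>q\<in>UNIV. \<beta> i b q * X q))"
  unfolding \<omega>f_def sum_distrib_right by (subst sum.swap) (simp add: sum_distrib_left mult.assoc)

lemma frame_nabla2: "frame.nabla2 a (fr2 T) b c = (\<Sum>i\<in>UNIV. E i a * (\<Sum>j\<in>UNIV. E j b * (\<Sum>k\<in>UNIV. E k c * nabla2 i T j k)))"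
proof -
  have "D i (fr2 T b c) - (\<Sum>q\<in>UNIV. \<beta> i b q * fr2 T q c) - (\<Sum>q\<in>UNIV. \<beta> i c q * fr2 T b q)
      = (\<Sum>j\<in>UNIV. E j b * (\<Sum>k\<in>UNIV. E k c * nabla2 i T j k))" for i
  proof -
    let ?K = "{0,1} :: nat set" and ?A = "\<lambda>_::nat. \<omega>" and ?I = "(\<lambda>_. c)(0::nat := b)"
    let ?T = "\<lambda>I. T (I 0) (I 1)"
    \<comment> \<open>The last slot is converted first; each step switches the connection of one
      slot from \<omega> to \<beta>.\<close>
    let ?T1 = "\<lambda>I. \<Sum>k\<in>UNIV. E k (I 1) * ?T (I(1 := k))"
    let ?T2 = "\<lambda>I. \<Sum>j\<in>UNIV. E j (I 0) * ?T1 (I(0 := j))"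
    have 1: "cov ?K (?A(1 := \<beta>)) i ?T1 I = (\<Sum>k\<in>UNIV. E k (I 1) * cov ?K ?A i ?T (I(1 := k)))" for I
      by (rule cov_change_frame[where k = 1 and A = ?A and T = ?T]) (use compat in simp_all)
    have 2: "cov ?K (?A(1 := \<beta>, 0 := \<beta>)) i ?T2 ?I
        = (\<Sum>j\<in>UNIV. E j (?I 0) * cov ?K (?A(1 := \<beta>)) i ?T1 (?I(0 := j)))"
      by (rule cov_change_frame[where k = 0 and A = "?A(1 := \<beta>)" and T = ?T1]) (use compat in simp_all)
    have "cov ?K ?A i ?T = (\<lambda>I. nabla2 i T (I 0) (I 1))" by (rule cov_nabla2)
    then have "cov ?K (?A(1 := \<beta>, 0 := \<beta>)) i ?T2 ?I
      = (\<Sum>j\<in>UNIV. E j b * (\<Sum>k\<in>UNIV. E k c * nabla2 i T j k))"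
      unfolding 2 1 by simp
    then show ?thesis
      by (simp add: cov_def fr2_def diff_diff_add)
  qed
  then show ?thesis
    unfolding frame.nabla2_def Df_def sum.distrib frame_connection_sum
    by (simp add: right_diff_distrib[symmetric] sum_subtractf[symmetric] diff_diff_add[symmetric])
qed

lemma frame_nabla4:
  "frame.nabla4 a (fr4 T) b c d e
     = (\<Sum>i\<in>UNIV. E i a * fr4 (nabla4 i T) b c d e)"
proof -
  have "D i (fr4 T b c d e) - (\<Sum>q\<in>UNIV. \<beta> i b q * fr4 T q c d e) - (\<Sum>q\<in>UNIV. \<beta> i c q * fr4 T b q d e)
      - (\<Sum>q\<in>UNIV. \<beta> i d q * fr4 T b c q e) - (\<Sum>q\<in>UNIV. \<beta> i e q * fr4 T b c d q)
      = fr4 (nabla4 i T) b c d e" for i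
  proof -
    let ?K = "{0,1,2,3} :: nat set" and ?A = "\<lambda>_::nat. \<omega>" and ?I = "(\<lambda>_. e)(0::nat := b, 1 := c, 2 := d)"
    let ?T = "\<lambda>I. T (I 0) (I 1) (I 2) (I 3)"
    let ?T1 = "\<lambda>I. \<Sum>k\<in>UNIV. E k (I 3) * ?T (I(3 := k))"
    let ?T2 = "\<lambda>I. \<Sum>k\<in>UNIV. E k (I 2) * ?T1 (I(2 := k))"
    let ?T3 = "\<lambda>I. \<Sum>k\<in>UNIV. E k (I 1) * ?T2 (I(1 := k))"
    let ?T4 = "\<lambda>I. \<Sum>k\<in>UNIV. E k (I 0) * ?T3 (I(0 := k))"
    have 1: "cov ?K (?A(3 := \<beta>)) i ?T1 I = (\<Sum>k\<in>UNIV. E k (I 3) * cov ?K ?A i ?T (I(3 := k)))" for I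
      by (rule cov_change_frame[where k = 3 and A = ?A and T = ?T]) (use compat in simp_all)
    have 2: "cov ?K (?A(3 := \<beta>, 2 := \<beta>)) i ?T2 I = (\<Sum>k\<in>UNIV. E k (I 2) * cov ?K (?A(3 := \<beta>)) i ?T1 (I(2 := k)))" for I
      by (rule cov_change_frame[where k = 2 and A = "?A(3 := \<beta>)" and T = ?T1]) (use compat in simp_all)
    have 3: "cov ?K (?A(3 := \<beta>, 2 := \<beta>, 1 := \<beta>)) i ?T3 I = (\<Sum>k\<in>UNIV. E k (I 1) * cov ?K (?A(3 := \<beta>, 2 := \<beta>)) i ?T2 (I(1 := k)))" for I
      by (rule cov_change_frame[where k = 1 and A = "?A(3 := \<beta>, 2 := \<beta>)" and T = ?T2]) (use compat in simp_all)
    have 4: "cov ?K (?A(3 := \<beta>, 2 := \<beta>, 1 := \<beta>, 0 := \<beta>)) i ?T4 ?I = (\<Sum>k\<in>UNIV. E k (?I 0) * cov ?K (?A(3 := \<beta>, 2 := \<beta>, 1 := \<beta>)) i ?T3 (?I(0 := k)))"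
      by (rule cov_change_frame[where k = 0 and A = "?A(3 := \<beta>, 2 := \<beta>, 1 := \<beta>)" and T = ?T3]) (use compat in simp_all)
    have "cov ?K ?A i ?T = (\<lambda>I. nabla4 i T (I 0) (I 1) (I 2) (I 3))" by (rule cov_nabla4)
    then have "cov ?K (?A(3 := \<beta>, 2 := \<beta>, 1 := \<beta>, 0 := \<beta>)) i ?T4 ?I = fr4 (nabla4 i T) b c d e"
      unfolding 4 3 2 1 fr4_def by simp
    then show ?thesis
      by (simp add: cov_def fr4_def diff_diff_add add.assoc)
  qed
  then show ?thesis
    unfolding frame.nabla4_def Df_def sum.distrib frame_connection_sum
    by (simp add: right_diff_distrib[symmetric] sum_subtractf[symmetric] diff_diff_add[symmetric])
qed

definition "lowered i j k l = (\<Sum>p\<in>UNIV. \<gamma> k p * curv i j p l)"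

text \<open>Both frames satisfy the Ricci identity for the m-th coordinate covector, whose
  components in the new frame are E m q. Second covariant derivatives are tensorial, so comparing
  the two identities yields the transformation of the curvature without differentiating that of the
  connection.\<close>

lemma frame_curv_mixed:
  "(\<Sum>q\<in>UNIV. frame.curv a b q c * E m q) = (\<Sum>i\<in>UNIV. E i a * (\<Sum>j\<in>UNIV. E j b * (\<Sum>k\<in>UNIV. E k c * curv i j m k)))"
proof -
  define T where "T = (\<lambda>k. if k = m then 1 else 0 :: 'r)"
  have T: "fr1 T = (\<lambda>q. E m q)" "(\<Sum>q\<in>UNIV. X q * T q) = X m" for X :: "'n \<Rightarrow> 'r"
    unfolding fr1_def T_def by (simp_all add: sum_if fun_eq_iff)
  have f1: "(\<lambda>b. frame.nabla1 b (fr1 T)) = fr2 (\<lambda>j. nabla1 j T)"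
    by (intro ext) (simp add: frame_nabla1 fr2_def)
  have f2: "frame.nabla2 a (\<lambda>b. frame.nabla1 b (fr1 T)) b c
      = (\<Sum>i\<in>UNIV. E i a * (\<Sum>j\<in>UNIV. E j b * (\<Sum>k\<in>UNIV. E k c * nabla2 i (\<lambda>j. nabla1 j T) j k)))" for a b c
    unfolding f1 by (rule frame_nabla2)
  have sw: "(\<Sum>i\<in>UNIV. E i b * (\<Sum>j\<in>UNIV. E j a * (\<Sum>k\<in>UNIV. E k c * V i j k)))
      = (\<Sum>i\<in>UNIV. E i a * (\<Sum>j\<in>UNIV. E j b * (\<Sum>k\<in>UNIV. E k c * V j i k)))" for V a b
    by (simp add: sum_distrib_left) (subst sum.swap, simp add: ac_simps)
  have "- (\<Sum>q\<in>UNIV. frame.curv a b q c * E m q)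
      = frame.nabla2 a (\<lambda>b. frame.nabla1 b (fr1 T)) b c - frame.nabla2 b (\<lambda>b. frame.nabla1 b (fr1 T)) a c"
    unfolding frame.ricci_identity1 T(1) ..
  also have "\<dots> = (\<Sum>i\<in>UNIV. E i a * (\<Sum>j\<in>UNIV. E j b * (\<Sum>k\<in>UNIV. E k c *
      (nabla2 i (\<lambda>j. nabla1 j T) j k - nabla2 j (\<lambda>j. nabla1 j T) i k))))"
    unfolding f2 sw[of b a] by (simp only: right_diff_distrib sum_subtractf)
  also have "\<dots> = - (\<Sum>i\<in>UNIV. E i a * (\<Sum>j\<in>UNIV. E j b * (\<Sum>k\<in>UNIV. E k c * curv i j m k)))"
    unfolding ricci_identity1 T(2) by (simp add: sum_negf)
  finally show ?thesis by simp
qed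

lemma frame_curv: "frame.curv a b c d = fr4 lowered a b c d"
proof -
  have "frame.curv a b c d = (\<Sum>q\<in>UNIV. frame.curv a b q d * (\<Sum>m\<in>UNIV. \<theta> c m * E m q))"
    unfolding \<theta>_def orthonormal sum_if ..
  also have "\<dots> = (\<Sum>m\<in>UNIV. \<theta> c m * (\<Sum>q\<in>UNIV. frame.curv a b q d * E m q))"
    unfolding sum_distrib_left by (subst sum.swap) (simp add: ac_simps)
  also have "\<dots> = (\<Sum>m\<in>UNIV. \<theta> c m * (\<Sum>i\<in>UNIV. E i a * (\<Sum>j\<in>UNIV. E j b * (\<Sum>k\<in>UNIV. E k d * curv i j m k))))"
    unfolding frame_curv_mixed ..
  also have "\<dots> = (\<Sum>i\<in>UNIV. E i a * (\<Sum>j\<in>UNIV. E j b * (\<Sum>k\<in>UNIV. E k d * (\<Sum>m\<in>UNIV. \<theta> c m * curv i j m k))))"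
  proof -
    have mv: "(\<Sum>m\<in>UNIV. X m * (\<Sum>i\<in>UNIV. Y i * V m i)) = (\<Sum>i\<in>UNIV. Y i * (\<Sum>m\<in>UNIV. X m * V m i))"
      for X Y :: "'n \<Rightarrow> 'r" and V
      unfolding sum_distrib_left by (subst sum.swap) (simp add: ac_simps)
    show ?thesis
      by (rule trans[OF mv], rule sum.cong[OF refl], rule arg_cong[where f = "(*) _"], rule trans[OF mv],
          rule sum.cong[OF refl], rule arg_cong[where f = "(*) _"], rule mv)
  qed
  also have "\<dots> = (\<Sum>i\<in>UNIV. E i a * (\<Sum>j\<in>UNIV. E j b * (\<Sum>k\<in>UNIV. E k d * (\<Sum>l\<in>UNIV. E l c * lowered i j l k))))"
  proof -
    have "(\<Sum>m\<in>UNIV. \<theta> c m * curv i j m k) = (\<Sum>l\<in>UNIV. E l c * lowered i j l k)" for i j k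
      unfolding \<theta>_def lowered_def sum_distrib_right unfolding sum_distrib_left
      by (subst sum.swap) (simp add: ac_simps \<gamma>_symmetric)
    then show ?thesis by simp
  qed
  also have "\<dots> = (\<Sum>i\<in>UNIV. E i a * (\<Sum>j\<in>UNIV. E j b * (\<Sum>l\<in>UNIV. E l c * (\<Sum>k\<in>UNIV. E k d * lowered i j l k))))"
  proof -
    have "(\<Sum>k\<in>UNIV. E k d * (\<Sum>l\<in>UNIV. E l c * lowered i j l k)) = (\<Sum>l\<in>UNIV. E l c * (\<Sum>k\<in>UNIV. E k d * lowered i j l k))" for i j
      unfolding sum_distrib_left by (subst sum.swap) (simp add: ac_simps)
    then show ?thesis by simp
  qed
  finally show ?thesis unfolding fr4_def .
qed

lemma curv_bianchi: "curv i j m k + curv j k m i + curv k i m j = 0"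
proof -
  have c: "curv i j m k = D i (\<omega> j k m) - D j (\<omega> i k m) + ((\<Sum>q\<in>UNIV. \<omega> j k q * \<omega> i q m) - (\<Sum>q\<in>UNIV. \<omega> i k q * \<omega> j q m))" for i j m k
    unfolding curv_def by (simp add: symmetric[of i j] sum_subtractf)
  show ?thesis
    unfolding c symmetric[of k i] symmetric[of k j] symmetric[of j i] by (simp add: algebra_simps)
qed

lemma frame_bianchi: "frame.curv a b c d + frame.curv b d c a + frame.curv d a c b = 0"
proof -
  let ?L = "\<lambda>i j k l. E i a * (E j b * (E k c * (E l d * lowered i j k l)))"
  let ?L1 = "\<lambda>i j k l. E i a * (E j b * (E k c * (E l d * lowered j l k i)))"
  let ?L2 = "\<lambda>i j k l. E i a * (E j b * (E k c * (E l d * lowered l i k j)))"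
  have "lowered i j k l + lowered j l k i + lowered l i k j = 0" for i j k l
  proof -
    have "lowered i j k l + lowered j l k i + lowered l i k j = (\<Sum>p\<in>UNIV. \<gamma> k p * (curv i j p l + curv j l p i + curv l i p j))"
      unfolding lowered_def by (simp add: sum.distrib distrib_left)
    then show ?thesis unfolding curv_bianchi by simp
  qed
  then have 0: "?L i j k l + ?L1 i j k l + ?L2 i j k l = 0" for i j k l
    by (simp only: distrib_left[symmetric] mult_zero_right)
  have f: "frame.curv a' b' c' d' = (\<Sum>i\<in>UNIV. \<Sum>j\<in>UNIV. \<Sum>k\<in>UNIV. \<Sum>l\<in>UNIV. E i a' * (E j b' * (E k c' * (E l d' * lowered i j k l))))" for a' b' c' d'
    unfolding frame_curv fr4_def by (simp add: sum_distrib_left)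
  have 1: "frame.curv b d c a = (\<Sum>i\<in>UNIV. \<Sum>j\<in>UNIV. \<Sum>k\<in>UNIV. \<Sum>l\<in>UNIV. ?L1 i j k l)"
  proof -
    have "frame.curv b d c a = (\<Sum>j\<in>UNIV. \<Sum>l\<in>UNIV. \<Sum>i\<in>UNIV. \<Sum>k\<in>UNIV. E j b * (E l d * (E k c * (E i a * lowered j l k i))))"
      unfolding f by (rule sum.cong[OF refl], rule sum.cong[OF refl], rule sum.swap)
    also have "\<dots> = (\<Sum>j\<in>UNIV. \<Sum>i\<in>UNIV. \<Sum>l\<in>UNIV. \<Sum>k\<in>UNIV. E j b * (E l d * (E k c * (E i a * lowered j l k i))))"
      by (rule sum.cong[OF refl], rule sum.swap)
    also have "\<dots> = (\<Sum>i\<in>UNIV. \<Sum>j\<in>UNIV. \<Sum>l\<in>UNIV. \<Sum>k\<in>UNIV. E j b * (E l d * (E k c * (E i a * lowered j l k i))))"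
      by (rule sum.swap)
    also have "\<dots> = (\<Sum>i\<in>UNIV. \<Sum>j\<in>UNIV. \<Sum>k\<in>UNIV. \<Sum>l\<in>UNIV. E j b * (E l d * (E k c * (E i a * lowered j l k i))))"
      by (rule sum.cong[OF refl], rule sum.cong[OF refl], rule sum.swap)
    finally show ?thesis by (simp add: ac_simps)
  qed
  have 2: "frame.curv d a c b = (\<Sum>i\<in>UNIV. \<Sum>j\<in>UNIV. \<Sum>k\<in>UNIV. \<Sum>l\<in>UNIV. ?L2 i j k l)"
  proof -
    have "frame.curv d a c b = (\<Sum>i\<in>UNIV. \<Sum>l\<in>UNIV. \<Sum>k\<in>UNIV. \<Sum>j\<in>UNIV. E l d * (E i a * (E k c * (E j b * lowered l i k j))))"
      unfolding f by (rule sum.swap)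
    also have "\<dots> = (\<Sum>i\<in>UNIV. \<Sum>l\<in>UNIV. \<Sum>j\<in>UNIV. \<Sum>k\<in>UNIV. E l d * (E i a * (E k c * (E j b * lowered l i k j))))"
      by (rule sum.cong[OF refl], rule sum.cong[OF refl], rule sum.swap)
    also have "\<dots> = (\<Sum>i\<in>UNIV. \<Sum>j\<in>UNIV. \<Sum>l\<in>UNIV. \<Sum>k\<in>UNIV. E l d * (E i a * (E k c * (E j b * lowered l i k j))))"
      by (rule sum.cong[OF refl], rule sum.swap)
    also have "\<dots> = (\<Sum>i\<in>UNIV. \<Sum>j\<in>UNIV. \<Sum>k\<in>UNIV. \<Sum>l\<in>UNIV. E l d * (E i a * (E k c * (E j b * lowered l i k j))))"
      by (rule sum.cong[OF refl], rule sum.cong[OF refl], rule sum.swap)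
    finally show ?thesis by (simp add: ac_simps)
  qed
  show ?thesis
    unfolding 1 2 f[of a b c d] sum.distrib[symmetric] 0 by simp
qed

lemma \<omega>f_antisym: "\<omega>f a b c = - \<omega>f a c b"
  unfolding \<omega>f_def by (subst \<beta>_antisym) (simp add: sum_negf)

sublocale frame: orthonormal_frame Df \<omega>f
  by unfold_locales (rule \<omega>f_antisym, rule frame_bianchi)

lemma frame_grad: "(\<lambda>a. Df a u) = fr1 (\<lambda>i. D i u)"
  by (simp add: fun_eq_iff Df_def fr1_def)

lemma frame_hess: "frame.hess u = fr2 (\<lambda>i. nabla1 i (\<lambda>j. D j u))"
  by (intro ext) (simp add: frame.hess_def frame_grad frame_nabla1 fr2_def)

end

section \<open>The permutation symbol and determinants of order four\<close>

lemma det_4: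
  fixes A :: "'a::comm_ring_1^4^4"
  shows "det A = A$1$1 * A$2$2 * A$3$3 * A$4$4
     + A$1$1 * A$2$3 * A$3$4 * A$4$2
     + A$1$1 * A$2$4 * A$3$2 * A$4$3
     + A$1$2 * A$2$1 * A$3$4 * A$4$3
     + A$1$2 * A$2$3 * A$3$1 * A$4$4
     + A$1$2 * A$2$4 * A$3$3 * A$4$1
     + A$1$3 * A$2$1 * A$3$2 * A$4$4
     + A$1$3 * A$2$2 * A$3$4 * A$4$1
     + A$1$3 * A$2$4 * A$3$1 * A$4$2
     + A$1$4 * A$2$1 * A$3$3 * A$4$2
     + A$1$4 * A$2$2 * A$3$1 * A$4$3
     + A$1$4 * A$2$3 * A$3$2 * A$4$1
     - A$1$1 * A$2$2 * A$3$4 * A$4$3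
     - A$1$1 * A$2$3 * A$3$2 * A$4$4
     - A$1$1 * A$2$4 * A$3$3 * A$4$2
     - A$1$2 * A$2$1 * A$3$3 * A$4$4
     - A$1$2 * A$2$3 * A$3$4 * A$4$1
     - A$1$2 * A$2$4 * A$3$1 * A$4$3
     - A$1$3 * A$2$1 * A$3$4 * A$4$2
     - A$1$3 * A$2$2 * A$3$1 * A$4$4
     - A$1$3 * A$2$4 * A$3$2 * A$4$1
     - A$1$4 * A$2$1 * A$3$2 * A$4$3
     - A$1$4 * A$2$2 * A$3$3 * A$4$1
     - A$1$4 * A$2$3 * A$3$1 * A$4$2"
proof -
  have f1234: "finite {2::4, 3, 4}" "1 \<notin> {2::4, 3, 4}" by (auto simp: index_distinct)
  have f234: "finite {3::4, 4}" "2 \<notin> {3::4, 4}" by (auto simp: index_distinct)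
  have f34: "finite {4::4}" "3 \<notin> {4::4}" by (auto simp: index_distinct)
  show ?thesis
    unfolding det_def UNIV_4
    unfolding sum_over_permutations_insert[OF f1234]
    unfolding sum_over_permutations_insert[OF f234]
    unfolding sum_over_permutations_insert[OF f34]
    unfolding permutes_sing
    by (simp add: sign_swap_id permutation_swap_id sign_compose sign_id swap_id_eq permutation_compose index_distinct)
qed

definition kron4 :: "4 \<Rightarrow> 4 \<Rightarrow> 4 \<Rightarrow> 4 \<Rightarrow> 4 \<Rightarrow> 4 \<Rightarrow> 4 \<Rightarrow> 4 \<Rightarrow> real" where
  "kron4 i j k l a b c d = kronecker i a * kronecker j b * kronecker k c * kronecker l d"

lemma vector_4:
  "(vector [a, b, c, d] :: 'a::zero^4) $ 1 = a" "(vector [a, b, c, d] :: 'a::zero^4) $ 2 = b"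
  "(vector [a, b, c, d] :: 'a::zero^4) $ 3 = c" "(vector [a, b, c, d] :: 'a::zero^4) $ 4 = d"
  unfolding vector_def by (simp_all add: index_distinct)

lemma axis_kronecker: "axis i (1::real) $ k = kronecker i k"
  by (auto simp: axis_def kronecker_def)

text \<open>As a signed sum of 24 products of Kronecker symbols, the permutation symbol can be
  contracted term by term.\<close>

lemma levi_civita_kron4:
  "levi_civita i j k l = kron4 i j k l 1 2 3 4
     + kron4 i j k l 1 3 4 2
     + kron4 i j k l 1 4 2 3
     + kron4 i j k l 2 1 4 3
     + kron4 i j k l 2 3 1 4
     + kron4 i j k l 2 4 3 1
     + kron4 i j k l 3 1 2 4
     + kron4 i j k l 3 2 4 1
     + kron4 i j k l 3 4 1 2
     + kron4 i j k l 4 1 3 2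
     + kron4 i j k l 4 2 1 3
     + kron4 i j k l 4 3 2 1
     - kron4 i j k l 1 2 4 3
     - kron4 i j k l 1 3 2 4
     - kron4 i j k l 1 4 3 2
     - kron4 i j k l 2 1 3 4
     - kron4 i j k l 2 3 4 1
     - kron4 i j k l 2 4 1 3
     - kron4 i j k l 3 1 4 2
     - kron4 i j k l 3 2 1 4
     - kron4 i j k l 3 4 2 1
     - kron4 i j k l 4 1 2 3
     - kron4 i j k l 4 2 3 1
     - kron4 i j k l 4 3 1 2"
  unfolding levi_civita_def det_4 vector_4 kron4_def axis_kronecker by (rule refl)

lemma sum_kron4:
  "(\<Sum>i\<in>UNIV. \<Sum>j\<in>UNIV. \<Sum>k\<in>UNIV. \<Sum>l\<in>UNIV. kron4 i j k l a b c d * (u i * v j * w k * z l)) = u a * v b * w c * z d"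
proof -
  have k: "(\<Sum>q\<in>UNIV. kronecker q p * X q) = X p" for p :: 4 and X :: "4 \<Rightarrow> real"
  proof -
    have "(\<Sum>q\<in>UNIV. kronecker q p * X q) = (\<Sum>q\<in>UNIV. if q = p then X q else 0)"
      by (rule sum.cong) (auto simp: kronecker_def)
    then show ?thesis by simp
  qed
  have "(\<Sum>i\<in>UNIV. \<Sum>j\<in>UNIV. \<Sum>k\<in>UNIV. \<Sum>l\<in>UNIV. kron4 i j k l a b c d * (u i * v j * w k * z l))
     = (\<Sum>i\<in>UNIV. kronecker i a * (\<Sum>j\<in>UNIV. kronecker j b * (\<Sum>k\<in>UNIV. kronecker k c * (\<Sum>l\<in>UNIV. kronecker l d * (u i * v j * w k * z l)))))"
    unfolding kron4_def by (simp add: sum_distrib_left ac_simps)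
  then show ?thesis unfolding k .
qed

lemma sum_levi_civita:
  "(\<Sum>i\<in>UNIV. \<Sum>j\<in>UNIV. \<Sum>k\<in>UNIV. \<Sum>l\<in>UNIV. levi_civita i j k l * (u i * v j * w k * z l))
     = det (vector [\<chi> i. u i, \<chi> i. v i, \<chi> i. w i, \<chi> i. z i])"
  unfolding levi_civita_kron4 left_diff_distrib distrib_right sum.distrib sum_subtractf sum_kron4
  by (simp add: det_4 vector_4)

lemma sum_levi_civita_matrix:
  fixes M :: "real^4^4"
  shows "(\<Sum>i\<in>UNIV. \<Sum>j\<in>UNIV. \<Sum>k\<in>UNIV. \<Sum>l\<in>UNIV. levi_civita i j k l * (M$p$i * M$q$j * M$r$k * M$t$l))
     = det M * levi_civita p q r t"
proof -
  have "vector [\<chi> i. M$p$i, \<chi> i. M$q$i, \<chi> i. M$r$i, \<chi> i. M$t$i]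
      = (vector [axis p 1, axis q 1, axis r 1, axis t 1] :: real^4^4) ** M" (is "?L = ?P ** M")
  proof -
    have a: "(\<Sum>k\<in>UNIV. axis p 1 $ k * X k) = X p" for p :: 4 and X :: "4 \<Rightarrow> real"
    proof -
      have "(\<Sum>k\<in>UNIV. axis p 1 $ k * X k) = (\<Sum>k\<in>UNIV. if k = p then X k else 0)"
        by (rule sum.cong) (auto simp: axis_def)
      then show ?thesis by simp
    qed
    have "\<forall>m n. ?L $ m $ n = (?P ** M) $ m $ n"
      unfolding forall_4[of "\<lambda>m. \<forall>n. _ m n"] matrix_matrix_mult_def by (simp add: vector_4 a)
    then show ?thesis by (simp add: vec_eq_iff)
  qed
  then show ?thesis
    unfolding sum_levi_civita unfolding levi_civita_def by (simp add: det_mul mult.commute)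
qed

text \<open>This ties the explicit basis to the Hodge star: on skew matrices, contraction with the
  right-hand side is twice the sum of the identity and s times the star.\<close>

lemma half_form_levi_civita:
  assumes "s = 1 \<or> s = -1"
  shows "half_form s i j k l = kronecker i k * kronecker j l - kronecker i l * kronecker j k + s * levi_civita i j k l"
proof -
  have ss: "s * s = 1" using assms by auto
  have "\<forall>i j k l. half_form s i j k l = kronecker i k * kronecker j l - kronecker i l * kronecker j k + s * levi_civita i j k l"
    unfolding levi_civita_kron4 forall_4 half_form_def sum_3 half_basis_values kron4_def kronecker_def
    by (simp only: index_distinct if_True if_False simp_thms mult_zero_left mult_zero_right mult_1_left mult_1_right
        add_0_left add_0_right diff_0_right diff_0 minus_mult_minus mult_minus_left mult_minus_right minus_zero minus_minus ss)
  then show ?thesis by blast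
qed

section \<open>Gram--Schmidt for germs\<close>

text \<open>Each new vector starts as a constant vector outside the span of the values of the
  previous ones. Its component orthogonal to them is then nonzero at the base point, so its squared
  length has a positive value there and \<open>germ_rsqrt\<close> normalises it.\<close>

lemma germ_gram_schmidt:
  fixes \<gamma> :: "'n::finite \<Rightarrow> 'n \<Rightarrow> 'm::finite germ"
  assumes sym: "\<And>i j. \<gamma> i j = \<gamma> j i"
    and pos: "\<And>v :: real^'n. v \<noteq> 0 \<Longrightarrow> (\<Sum>i\<in>UNIV. \<Sum>j\<in>UNIV. v $ i * germ_value (\<gamma> i j) * v $ j) > 0"
  shows "\<exists>E :: 'n \<Rightarrow> 'n \<Rightarrow> 'm germ. \<forall>a\<in>S. \<forall>b\<in>S.
     (\<Sum>i\<in>UNIV. (\<Sum>j\<in>UNIV. \<gamma> i j * E j a) * E i b) = (if a = b then 1 else 0)"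
proof -
  define ip where "ip = (\<lambda>u v. \<Sum>i\<in>UNIV. (\<Sum>j\<in>UNIV. \<gamma> i j * u j) * v i)"
  have ip_commute: "ip u v = ip v u" for u v
    unfolding ip_def sum_distrib_right by (subst sum.swap) (simp add: sym ac_simps)
  have ip_diff: "ip (\<lambda>i. u i - u' i) v = ip u v - ip u' v" for u u' v
    unfolding ip_def by (simp add: right_diff_distrib left_diff_distrib sum_subtractf)
  have ip_scale: "ip (\<lambda>i. c * u i) v = c * ip u v" for c u v
    unfolding ip_def by (simp add: sum_distrib_left sum_distrib_right ac_simps)
  have ip_zero: "ip (\<lambda>i. 0) v = 0" for v
    unfolding ip_def by simp
  have ip_add: "ip (\<lambda>i. u i + u' i) v = ip u v + ip u' v" for u u' v
    unfolding ip_def by (simp add: distrib_left distrib_right sum.distrib)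
  have ip_sum: "ip (\<lambda>i. \<Sum>b\<in>B. u b i) v = (\<Sum>b\<in>B. ip (u b) v)" for B :: "'n set" and u v
    by (induction B rule: infinite_finite_induct) (simp_all add: ip_zero ip_add)
  have "finite S" by simp
  then have "\<exists>E. \<forall>a\<in>S. \<forall>b\<in>S. ip (\<lambda>i. E i a) (\<lambda>i. E i b) = (if a = b then 1 else 0)"
  proof (induction S)
    case empty
    then show ?case by simp
  next
    case (insert c S)
    then obtain E where E: "\<And>a b. a \<in> S \<Longrightarrow> b \<in> S \<Longrightarrow> ip (\<lambda>i. E i a) (\<lambda>i. E i b) = (if a = b then 1 else 0)"
      by blast
    let ?V = "(\<lambda>b. \<chi> i. germ_value (E i b)) ` S"
    \<comment> \<open>Because the index c is not yet used, fewer than n vectors have been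
      constructed and their values cannot span.\<close>
    have "dim (span ?V) \<le> card ?V" using insert.hyps by (simp add: dim_le_card')
    also have "\<dots> \<le> card S" by (simp add: card_image_le insert.hyps)
    also have "\<dots> < card (insert c S)" using insert.hyps by simp
    also have "\<dots> \<le> CARD('n)" by (rule card_mono) simp_all
    finally have "dim (span ?V) < DIM(real^'n)" by simp
    then have "span ?V \<noteq> UNIV" by (metis dim_UNIV less_irrefl)
    then obtain v where v: "v \<notin> span ?V" by blast
    define w0 where "w0 = (\<lambda>i. (v $ i) *\<^sub>R (1 :: 'm germ))"
    define w where "w = (\<lambda>i. w0 i - (\<Sum>b\<in>S. ip w0 (\<lambda>i. E i b) * E i b))"
    have wE: "ip w (\<lambda>i. E i a) = 0" if "a \<in> S" for a
    proof -
      have "ip w (\<lambda>i. E i a) = ip w0 (\<lambda>i. E i a) - (\<Sum>b\<in>S. ip w0 (\<lambda>i. E i b) * ip (\<lambda>i. E i b) (\<lambda>i. E i a))"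
        unfolding w_def ip_diff ip_sum ip_scale ..
      also have "(\<Sum>b\<in>S. ip w0 (\<lambda>i. E i b) * ip (\<lambda>i. E i b) (\<lambda>i. E i a))
          = (\<Sum>b\<in>S. if b = a then ip w0 (\<lambda>i. E i b) else 0)"
        by (rule sum.cong) (auto simp: E that)
      also have "\<dots> = ip w0 (\<lambda>i. E i a)" using that insert.hyps by simp
      finally show ?thesis by simp
    qed
    let ?w = "\<chi> i. germ_value (w i)"
    have "?w = v - (\<Sum>b\<in>S. germ_value (ip w0 (\<lambda>i. E i b)) *\<^sub>R (\<chi> i. germ_value (E i b)))"
      by (simp add: vec_eq_iff w_def w0_def)
    moreover have "(\<Sum>b\<in>S. germ_value (ip w0 (\<lambda>i. E i b)) *\<^sub>R (\<chi> i. germ_value (E i b))) \<in> span ?V"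
      by (intro span_sum span_scale span_base) auto
    ultimately have "?w \<noteq> 0" using v by auto
    from pos[OF this] have "germ_value (ip w w) > 0"
      unfolding ip_def by (simp add: sum_distrib_left sum_distrib_right ac_simps)
    then obtain r where r: "r * r * ip w w = 1" by (rule germ_rsqrt)
    define E' where "E' = (\<lambda>i a. if a = c then r * w i else E i a)"
    have "ip (\<lambda>i. E' i a) (\<lambda>i. E' i b) = (if a = b then 1 else 0)" if ab: "a \<in> insert c S" "b \<in> insert c S" for a b
    proof -
      have cS: "c \<notin> S" by (rule insert.hyps)
      have rw: "ip (\<lambda>i. r * w i) (\<lambda>i. E i b) = 0" if "b \<in> S" for b
        unfolding ip_scale wE[OF that] by simp
      have ww: "ip (\<lambda>i. r * w i) (\<lambda>i. r * w i) = 1"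
        unfolding ip_scale ip_commute[of w "\<lambda>i. r * w i"] using r by (simp add: mult.assoc)
      consider "a = c" "b = c" | "a = c" "b \<in> S" | "a \<in> S" "b = c" | "a \<in> S" "b \<in> S" using ab by blast
      then show ?thesis
      proof cases
        case 1 then show ?thesis by (simp add: E'_def ww)
      next
        case 2 then show ?thesis using cS by (auto simp: E'_def rw)
      next
        case 3 then show ?thesis using cS rw[of a] by (auto simp: E'_def ip_commute[of "\<lambda>i. E i a"])
      next
        case 4
        then have "a \<noteq> c" "b \<noteq> c" using cS by auto
        then show ?thesis using E[OF 4] by (simp add: E'_def)
      qed
    qed
    then show ?case by blast
  qed
  then show ?thesis unfolding ip_def .
qed

section \<open>Contraction with an orthonormal frame\<close>

text \<open>The counterpart of \<open>fr2\<close> for the values of a frame at a point, as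
  \<open>contract4\<close> is for \<open>fr4\<close>.\<close>

definition contract2 :: "('i::finite \<Rightarrow> 'a \<Rightarrow> 'r::comm_ring_1) \<Rightarrow> ('i \<Rightarrow> 'i \<Rightarrow> 'r) \<Rightarrow> 'a \<Rightarrow> 'a \<Rightarrow> 'r" where
  "contract2 e T a b = (\<Sum>i\<in>UNIV. e i a * (\<Sum>j\<in>UNIV. e j b * T i j))"

definition contract4 ::
    "('i::finite \<Rightarrow> 'a \<Rightarrow> 'r::comm_ring_1) \<Rightarrow> ('i \<Rightarrow> 'i \<Rightarrow> 'i \<Rightarrow> 'i \<Rightarrow> 'r) \<Rightarrow> 'a \<Rightarrow> 'a \<Rightarrow> 'a \<Rightarrow> 'a \<Rightarrow> 'r" where
  "contract4 e T a b c d = (\<Sum>i\<in>UNIV. e i a * (\<Sum>j\<in>UNIV. e j b *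
     (\<Sum>k\<in>UNIV. e k c * (\<Sum>l\<in>UNIV. e l d * T i j k l))))"

text \<open>A one-sided inverse of a square matrix is two-sided.\<close>

lemma orthonormal_imp_complete:
  fixes \<gamma> e :: "'n::finite \<Rightarrow> 'n \<Rightarrow> real"
  assumes "\<And>a b. (\<Sum>i\<in>UNIV. (\<Sum>j\<in>UNIV. \<gamma> i j * e j a) * e i b) = (if a = b then 1 else 0)"
  shows "(\<Sum>a\<in>UNIV. e i a * (\<Sum>j\<in>UNIV. \<gamma> k j * e j a)) = (if i = k then 1 else 0)"
proof -
  let ?\<Theta> = "(\<chi> a i. \<Sum>j\<in>UNIV. \<gamma> i j * e j a) :: real^'n^'n" and ?E = "(\<chi> i a. e i a) :: real^'n^'n"
  have "?\<Theta> ** ?E = mat 1"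
    by (simp add: vec_eq_iff matrix_matrix_mult_def mat_def assms)
  then have "?E ** ?\<Theta> = mat 1" by (simp add: matrix_left_right_inverse)
  then show ?thesis by (simp add: vec_eq_iff matrix_matrix_mult_def mat_def)
qed

lemma sum_swap_outward3:
  "(\<Sum>j\<in>A. \<Sum>k\<in>B. \<Sum>l\<in>C. \<Sum>a\<in>S. F j k l a) = (\<Sum>a\<in>S. \<Sum>j\<in>A. \<Sum>k\<in>B. \<Sum>l\<in>C. F j k l a)"
  by (rule trans[OF sum.cong[OF refl trans[OF sum.cong[OF refl sum.swap] sum.swap]] sum.swap])

lemma sum_swap_outward2:
  "(\<Sum>k\<in>B. \<Sum>l\<in>C. \<Sum>a\<in>S. F k l a) = (\<Sum>a\<in>S. \<Sum>k\<in>B. \<Sum>l\<in>C. F k l a)"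
  by (rule trans[OF sum.cong[OF refl sum.swap] sum.swap])

locale metric_frame =
  fixes G :: "'n::finite metric" and y :: "real^'n" and e :: "'n \<Rightarrow> 'n \<Rightarrow> real"
  assumes G_symmetric: "G y $ i $ j = G y $ j $ i"
    and orthonormal: "(\<Sum>i\<in>UNIV. (\<Sum>j\<in>UNIV. G y $ i $ j * e j a) * e i b) = (if a = b then 1 else 0)"
begin

definition "\<theta> a i = (\<Sum>j\<in>UNIV. G y $ i $ j * e j a)"

lemma \<theta>_e: "(\<Sum>i\<in>UNIV. \<theta> a i * e i b) = (if a = b then 1 else 0)"
  unfolding \<theta>_def by (rule orthonormal)

lemma e_\<theta>: "(\<Sum>a\<in>UNIV. e i a * \<theta> a k) = (if i = k then 1 else 0)"
  unfolding \<theta>_def by (rule orthonormal_imp_complete[OF orthonormal])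

lemma ginv_frame: "ginv G y i j = (\<Sum>a\<in>UNIV. e i a * e j a)"
proof -
  let ?B = "(\<chi> i j. \<Sum>a\<in>UNIV. e i a * e j a) :: real^'n^'n"
  have "(\<Sum>k\<in>UNIV. G y $ i $ k * (\<Sum>a\<in>UNIV. e k a * e j a)) = (if i = j then 1 else 0)" for i j
  proof -
    have "(\<Sum>k\<in>UNIV. G y $ i $ k * (\<Sum>a\<in>UNIV. e k a * e j a)) = (\<Sum>a\<in>UNIV. e j a * \<theta> a i)"
      unfolding \<theta>_def sum_distrib_left by (subst sum.swap) (simp add: ac_simps)
    then show ?thesis unfolding e_\<theta> by auto
  qed
  then have GB: "G y ** ?B = mat 1" by (simp add: vec_eq_iff matrix_matrix_mult_def mat_def)
  then have BG: "?B ** G y = mat 1" by (simp add: matrix_left_right_inverse)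
  have inv: "G y ** matrix_inv (G y) = mat 1 \<and> matrix_inv (G y) ** G y = mat 1"
    unfolding matrix_inv_def by (rule someI[of _ ?B]) (use GB BG in blast)
  have "matrix_inv (G y) = (?B ** G y) ** matrix_inv (G y)" by (simp add: BG)
  also have "\<dots> = ?B" unfolding matrix_mul_assoc[symmetric] using inv by simp
  finally show ?thesis unfolding ginv_def by simp
qed

lemma ginv_contract:
  "(\<Sum>i\<in>UNIV. \<Sum>j\<in>UNIV. ginv G y i j * X i j) = (\<Sum>a\<in>UNIV. \<Sum>i\<in>UNIV. e i a * (\<Sum>j\<in>UNIV. e j a * X i j))"
proof -
  have "(\<Sum>i\<in>UNIV. \<Sum>j\<in>UNIV. ginv G y i j * X i j) = (\<Sum>i\<in>UNIV. \<Sum>j\<in>UNIV. \<Sum>a\<in>UNIV. e i a * (e j a * X i j))"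
    unfolding ginv_frame sum_distrib_right by (simp add: ac_simps)
  also have "\<dots> = (\<Sum>a\<in>UNIV. \<Sum>i\<in>UNIV. \<Sum>j\<in>UNIV. e i a * (e j a * X i j))"
    by (rule sum_swap_outward2)
  finally show ?thesis by (simp add: sum_distrib_left)
qed

lemma ginv_contract_product:
  "(\<Sum>i\<in>UNIV. \<Sum>j\<in>UNIV. ginv G y i j * (X i * Y j))
     = (\<Sum>a\<in>UNIV. (\<Sum>i\<in>UNIV. e i a * X i) * (\<Sum>j\<in>UNIV. e j a * Y j))"
  unfolding ginv_contract sum_product by (simp add: sum_distrib_left ac_simps)

lemma ginv_contract_trace: "(\<Sum>i\<in>UNIV. \<Sum>j\<in>UNIV. ginv G y i j * X i j) = (\<Sum>a\<in>UNIV. contract2 e X a a)"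
  unfolding ginv_contract contract2_def ..

lemma ginv_contract_sum:
  "(\<Sum>i\<in>UNIV. \<Sum>j\<in>UNIV. ginv G y i j * (\<Sum>r\<in>R. X r i j)) = (\<Sum>r\<in>R. \<Sum>i\<in>UNIV. \<Sum>j\<in>UNIV. ginv G y i j * X r i j)"
  unfolding sum_distrib_left by (rule sum_swap_outward2)

lemma tensor_inner_frame: "tensor_inner G y S T = (1/4) * pairing (contract4 e S) (contract4 e T)"
proof -
  let ?g = "ginv G y"
  let ?F = "\<lambda>i j k l a b c d. S i j k l * ?g i a * ?g j b * ?g k c * ?g l d * T a b c d"
  have "(\<Sum>i\<in>UNIV. \<Sum>j\<in>UNIV. \<Sum>k\<in>UNIV. \<Sum>l\<in>UNIV. \<Sum>a\<in>UNIV. \<Sum>b\<in>UNIV. \<Sum>c\<in>UNIV. \<Sum>d\<in>UNIV. ?F i j k l a b c d)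
    = (\<Sum>i\<in>UNIV. \<Sum>a\<in>UNIV. \<Sum>j\<in>UNIV. \<Sum>k\<in>UNIV. \<Sum>l\<in>UNIV. \<Sum>b\<in>UNIV. \<Sum>c\<in>UNIV. \<Sum>d\<in>UNIV. ?F i j k l a b c d)"
    by (rule sum.cong[OF refl], rule sum_swap_outward3)
  also have "\<dots> = (\<Sum>i\<in>UNIV. \<Sum>a\<in>UNIV. \<Sum>j\<in>UNIV. \<Sum>b\<in>UNIV. \<Sum>k\<in>UNIV. \<Sum>l\<in>UNIV. \<Sum>c\<in>UNIV. \<Sum>d\<in>UNIV. ?F i j k l a b c d)"
    by (rule sum.cong[OF refl], rule sum.cong[OF refl], rule sum.cong[OF refl], rule sum_swap_outward2)
  also have "\<dots> = (\<Sum>i\<in>UNIV. \<Sum>a\<in>UNIV. \<Sum>j\<in>UNIV. \<Sum>b\<in>UNIV. \<Sum>k\<in>UNIV. \<Sum>c\<in>UNIV. \<Sum>l\<in>UNIV. \<Sum>d\<in>UNIV. ?F i j k l a b c d)"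
    by (rule sum.cong[OF refl], rule sum.cong[OF refl], rule sum.cong[OF refl], rule sum.cong[OF refl],
        rule sum.cong[OF refl], rule sum.swap)
  also have "\<dots> = (\<Sum>i\<in>UNIV. \<Sum>a\<in>UNIV. ?g i a * (\<Sum>j\<in>UNIV. \<Sum>b\<in>UNIV. ?g j b * (\<Sum>k\<in>UNIV. \<Sum>c\<in>UNIV. ?g k c *
      (\<Sum>l\<in>UNIV. \<Sum>d\<in>UNIV. ?g l d * (S i j k l * T a b c d)))))"
    by (simp add: sum_distrib_left ac_simps)
  also have "\<dots> = (\<Sum>d\<in>UNIV. \<Sum>c\<in>UNIV. \<Sum>b\<in>UNIV. \<Sum>a\<in>UNIV. contract4 e S a b c d * contract4 e T a b c d)"
    unfolding contract4_def by (simp only: ginv_contract_sum ginv_contract_product)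
  also have "\<dots> = (\<Sum>c\<in>UNIV. \<Sum>b\<in>UNIV. \<Sum>a\<in>UNIV. \<Sum>d\<in>UNIV. contract4 e S a b c d * contract4 e T a b c d)"
    by (rule sum_swap_outward3[symmetric])
  also have "\<dots> = (\<Sum>b\<in>UNIV. \<Sum>a\<in>UNIV. \<Sum>c\<in>UNIV. \<Sum>d\<in>UNIV. contract4 e S a b c d * contract4 e T a b c d)"
    by (rule sum_swap_outward2[symmetric])
  also have "\<dots> = pairing (contract4 e S) (contract4 e T)"
    unfolding pairing_def by (rule sum.swap)
  finally show ?thesis unfolding tensor_inner_def by simp
qed

lemma contract2_metric: "contract2 e (\<lambda>i j. G y $ i $ j) = kronecker"
proof (intro ext)
  fix a b
  have "contract2 e (\<lambda>i j. G y $ i $ j) a b = (\<Sum>i\<in>UNIV. \<theta> b i * e i a)"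
    unfolding contract2_def \<theta>_def by (simp add: ac_simps)
  then show "contract2 e (\<lambda>i j. G y $ i $ j) a b = kronecker a b" unfolding \<theta>_e kronecker_def by auto
qed

lemma contract2_ricci: "contract2 e (ricci G y) a c = (\<Sum>b\<in>UNIV. contract4 e (riemann G y) a b c b)"
proof -
  have "contract2 e (ricci G y) a c
     = (\<Sum>i\<in>UNIV. \<Sum>k\<in>UNIV. \<Sum>b\<in>UNIV. \<Sum>j\<in>UNIV. \<Sum>l\<in>UNIV. e i a * (e k c * (e j b * (e l b * riemann G y i j k l))))"
    unfolding contract2_def ricci_def ginv_contract by (simp add: sum_distrib_left)
  also have "\<dots> = (\<Sum>b\<in>UNIV. \<Sum>i\<in>UNIV. \<Sum>k\<in>UNIV. \<Sum>j\<in>UNIV. \<Sum>l\<in>UNIV. e i a * (e k c * (e j b * (e l b * riemann G y i j k l))))"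
    by (rule sum_swap_outward2)
  also have "\<dots> = (\<Sum>b\<in>UNIV. \<Sum>i\<in>UNIV. \<Sum>j\<in>UNIV. \<Sum>k\<in>UNIV. \<Sum>l\<in>UNIV. e i a * (e k c * (e j b * (e l b * riemann G y i j k l))))"
    by (rule sum.cong[OF refl], rule sum.cong[OF refl], rule sum.swap)
  also have "\<dots> = (\<Sum>b\<in>UNIV. contract4 e (riemann G y) a b c b)"
    unfolding contract4_def by (simp add: sum_distrib_left ac_simps)
  finally show ?thesis .
qed

lemma scalar_curvature_frame: "scalar_curvature G y = (\<Sum>a\<in>UNIV. contract2 e (ricci G y) a a)"
  unfolding scalar_curvature_def by (rule ginv_contract_trace)

end

lemma contract4_diff: "contract4 e (\<lambda>i j k l. S i j k l - T i j k l) a b c d = contract4 e S a b c d - contract4 e T a b c d"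
  unfolding contract4_def by (simp add: right_diff_distrib sum_subtractf)

lemma contract4_add: "contract4 e (\<lambda>i j k l. S i j k l + T i j k l) a b c d = contract4 e S a b c d + contract4 e T a b c d"
  unfolding contract4_def by (simp add: distrib_left sum.distrib)

lemma contract4_scale: "contract4 e (\<lambda>i j k l. r * T i j k l) a b c d = r * contract4 e T a b c d"
  unfolding contract4_def by (simp add: sum_distrib_left ac_simps)

lemma contract4_product:
  "contract4 e (\<lambda>i j k l. \<alpha> i k * \<beta> j l) a b c d = contract2 e \<alpha> a c * contract2 e \<beta> b d"
proof -
  have "contract4 e (\<lambda>i j k l. \<alpha> i k * \<beta> j l) a b c d
     = (\<Sum>i\<in>UNIV. \<Sum>j\<in>UNIV. \<Sum>k\<in>UNIV. \<Sum>l\<in>UNIV. e i a * (e k c * \<alpha> i k) * (e j b * (e l d * \<beta> j l)))"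
    unfolding contract4_def by (simp add: sum_distrib_left ac_simps)
  also have "\<dots> = (\<Sum>i\<in>UNIV. \<Sum>k\<in>UNIV. \<Sum>j\<in>UNIV. \<Sum>l\<in>UNIV. e i a * (e k c * \<alpha> i k) * (e j b * (e l d * \<beta> j l)))"
    by (rule sum.cong[OF refl], rule sum.swap)
  also have "\<dots> = contract2 e \<alpha> a c * contract2 e \<beta> b d"
  proof -
    have "contract2 e X p q = (\<Sum>i\<in>UNIV. \<Sum>k\<in>UNIV. e i p * (e k q * X i k))" for X p q
      unfolding contract2_def sum_distrib_left ..
    then show ?thesis by (simp add: sum_distrib_right) (simp add: sum_distrib_left)
  qed
  finally show ?thesis .
qed

lemma contract4_swap12: "contract4 e (\<lambda>i j k l. T j i k l) a b c d = contract4 e T b a c d"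
  unfolding contract4_def sum_distrib_left by (subst sum.swap) (simp add: ac_simps)

lemma contract4_swap34: "contract4 e (\<lambda>i j k l. T i j l k) a b c d = contract4 e T a b d c"
proof -
  have "(\<Sum>k\<in>UNIV. e k c * (\<Sum>l\<in>UNIV. e l d * T i j l k)) = (\<Sum>k\<in>UNIV. e k d * (\<Sum>l\<in>UNIV. e l c * T i j k l))" for i j
    unfolding sum_distrib_left by (subst sum.swap) (simp add: ac_simps)
  then show ?thesis unfolding contract4_def by simp
qed

lemma contract4_kn:
  fixes e :: "'i::finite \<Rightarrow> 'a \<Rightarrow> real"
  shows "contract4 e (kulkarni_nomizu \<alpha> \<beta>) = kn (contract2 e \<alpha>) (contract2 e \<beta>)"
proof (intro ext)
  fix a b c d
  have eq: "kulkarni_nomizu \<alpha> \<beta> = (\<lambda>i j k l. \<alpha> i k * \<beta> j l + \<alpha> j l * \<beta> i k - \<alpha> i l * \<beta> j k - \<alpha> j k * \<beta> i l)"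
    by (intro ext) (simp add: kulkarni_nomizu_def)
  let ?P = "\<lambda>i j k l. \<alpha> i k * \<beta> j l"
  have "contract4 e (\<lambda>i j k l. \<alpha> j l * \<beta> i k) a b c d = contract2 e \<alpha> b d * contract2 e \<beta> a c"
    using contract4_product[of e \<beta> \<alpha> a b c d] by (simp add: mult.commute)
  moreover have "contract4 e (\<lambda>i j k l. \<alpha> i l * \<beta> j k) a b c d = contract2 e \<alpha> a d * contract2 e \<beta> b c"
    using contract4_swap34[of e ?P a b c d] unfolding contract4_product .
  moreover have "contract4 e (\<lambda>i j k l. \<alpha> j k * \<beta> i l) a b c d = contract2 e \<alpha> b c * contract2 e \<beta> a d"
    using contract4_swap12[of e ?P a b c d] unfolding contract4_product .
  ultimately show "contract4 e (kulkarni_nomizu \<alpha> \<beta>) a b c d = kn (contract2 e \<alpha>) (contract2 e \<beta>) a b c d"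
    unfolding eq contract4_diff contract4_add contract4_product kn_def by simp
qed

locale metric_frame4 = metric_frame G y e for G :: "4 metric" and y e
begin

lemma contract4_weyl:
  "contract4 e (weyl G y) a b c d = contract4 e (riemann G y) a b c d
     - kn (\<lambda>i k. contract2 e (ricci G y) i k / 2 - (\<Sum>a\<in>UNIV. contract2 e (ricci G y) a a) / 12 * kronecker i k) kronecker a b c d"
proof -
  let ?\<gamma> = "\<lambda>i j. G y $ i $ j"
  have "weyl G y = (\<lambda>i j k l. riemann G y i j k l - (1/2) * kulkarni_nomizu (ricci G y) ?\<gamma> i j k l
      + (scalar_curvature G y / 12) * kulkarni_nomizu ?\<gamma> ?\<gamma> i j k l)"
    by (intro ext) (simp add: weyl_def Let_def)
  then have "contract4 e (weyl G y) a b c d = contract4 e (riemann G y) a b c d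
      - (1/2) * kn (contract2 e (ricci G y)) kronecker a b c d
      + (\<Sum>a\<in>UNIV. contract2 e (ricci G y) a a) / 12 * kn kronecker kronecker a b c d"
    by (simp only: contract4_add contract4_diff contract4_scale contract4_kn contract2_metric scalar_curvature_frame)
  then show ?thesis by (simp add: kn_def field_simps)
qed

end

section \<open>The Hodge star in an orthonormal frame\<close>

lemma sum_swap_outward4:
  "(\<Sum>i\<in>D. \<Sum>j\<in>A. \<Sum>k\<in>B. \<Sum>l\<in>C. \<Sum>a\<in>S. F i j k l a) = (\<Sum>a\<in>S. \<Sum>i\<in>D. \<Sum>j\<in>A. \<Sum>k\<in>B. \<Sum>l\<in>C. F i j k l a)"
  by (rule trans[OF sum.cong[OF refl sum_swap_outward3] sum.swap])

context metric_frame4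
begin

text \<open>Gram--Schmidt does not control the orientation of its frame. The sign is recorded here
  and multiplied into s wherever the Hodge star is compared with the half basis.\<close>

definition "orient = sgn (det ((\<chi> i a. e i a) :: real^4^4))"

text \<open>The metric is the transpose of \<Theta> times \<Theta>, so the root of its determinant
  is the absolute value of det \<Theta>; and \<Theta> is inverse to the frame matrix, hence has a
  determinant of the same sign.\<close>

lemma det_frame:
  defines "\<Theta> \<equiv> (\<chi> a i. \<theta> a i) :: real^4^4"
  shows "det \<Theta> / sqrt (det (G y)) = orient" "orient = 1 \<or> orient = -1"
proof -
  let ?E = "(\<chi> i a. e i a) :: real^4^4"
  have "\<Theta> ** ?E = mat 1" by (simp add: \<Theta>_def vec_eq_iff matrix_matrix_mult_def mat_def \<theta>_e)
  then have d: "det \<Theta> * det ?E = 1" by (metis det_mul det_I)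
  have "G y = transpose \<Theta> ** \<Theta>"
  proof -
    have "(\<Sum>a\<in>UNIV. \<theta> a i * \<theta> a k) = G y $ i $ k" for i k
    proof -
      have "(\<Sum>a\<in>UNIV. \<theta> a i * \<theta> a k) = (\<Sum>j\<in>UNIV. G y $ i $ j * (\<Sum>a\<in>UNIV. e j a * \<theta> a k))"
        unfolding \<theta>_def[of _ i] sum_distrib_right sum_distrib_left by (subst sum.swap) (simp add: ac_simps)
      then show ?thesis unfolding e_\<theta> using sum_if_eq[of "\<lambda>j. G y $ i $ j" k 1] by (simp add: eq_commute)
    qed
    then show ?thesis by (simp add: vec_eq_iff \<Theta>_def matrix_matrix_mult_def transpose_def)
  qed
  then have "det (G y) = (det \<Theta>)\<^sup>2" by (simp add: det_mul power2_eq_square)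
  then have "sqrt (det (G y)) = \<bar>det \<Theta>\<bar>" by simp
  moreover have "det \<Theta> \<noteq> 0" "det ?E \<noteq> 0" using d by auto
  moreover have "sgn (det \<Theta>) = sgn (det ?E)"
  proof -
    have "0 < det \<Theta> * det ?E" using d by simp
    then show ?thesis by (auto simp: zero_less_mult_iff)
  qed
  moreover have "x / \<bar>x\<bar> = sgn x" "sgn x = 1 \<or> sgn x = -1" if "x \<noteq> 0" for x :: real
    using that by (simp_all add: sgn_if abs_if)
  ultimately show "det \<Theta> / sqrt (det (G y)) = orient" "orient = 1 \<or> orient = -1"
    unfolding orient_def by metis+
qed

lemma sum_delta: "(\<Sum>i\<in>UNIV. (if m = i then 1 else 0) * h i) = h m" for h :: "4 \<Rightarrow> real"
proof -
  have "(\<Sum>i\<in>UNIV. (if m = i then 1 else 0) * h i) = (\<Sum>i\<in>UNIV. if i = m then h i else 0)"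
    by (rule sum.cong) auto
  then show ?thesis by simp
qed

lemma e_\<theta>_sum: "(\<Sum>p\<in>UNIV. e m p * (\<Sum>i\<in>UNIV. \<theta> p i * h i)) = h m"
proof -
  have "(\<Sum>p\<in>UNIV. e m p * (\<Sum>i\<in>UNIV. \<theta> p i * h i)) = (\<Sum>i\<in>UNIV. (\<Sum>p\<in>UNIV. e m p * \<theta> p i) * h i)"
    unfolding sum_distrib_left sum_distrib_right by (subst sum.swap) (simp add: ac_simps)
  then show ?thesis unfolding e_\<theta> sum_delta .
qed

lemma \<theta>_e_sum: "(\<Sum>i\<in>UNIV. \<theta> a i * (\<Sum>p\<in>UNIV. e i p * h p)) = h a"
proof -
  have "(\<Sum>i\<in>UNIV. \<theta> a i * (\<Sum>p\<in>UNIV. e i p * h p)) = (\<Sum>p\<in>UNIV. (\<Sum>i\<in>UNIV. \<theta> a i * e i p) * h p)"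
    unfolding sum_distrib_left sum_distrib_right by (subst sum.swap) (simp add: ac_simps)
  then show ?thesis unfolding \<theta>_e sum_delta .
qed

lemma contract4_inverse: "contract4 e (contract4 \<theta> U) = U"
proof -
  have e_sum: "(\<Sum>i\<in>UNIV. e i a * (\<Sum>p\<in>UNIV. \<theta> p i * h p)) = h a" for a h
    unfolding sum_distrib_left
  proof (subst sum.swap)
    have "(\<Sum>p\<in>UNIV. \<Sum>i\<in>UNIV. e i a * (\<theta> p i * h p)) = (\<Sum>p\<in>UNIV. (\<Sum>i\<in>UNIV. \<theta> p i * e i a) * h p)"
      unfolding sum_distrib_right by (simp add: ac_simps)
    also have "\<dots> = (\<Sum>p\<in>UNIV. (if a = p then 1 else 0) * h p)" unfolding \<theta>_e by (simp add: eq_commute)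
    finally show "(\<Sum>p\<in>UNIV. \<Sum>i\<in>UNIV. e i a * (\<theta> p i * h p)) = h a" unfolding sum_delta .
  qed
  have pull: "(\<Sum>i\<in>UNIV. e i a * (\<Sum>p\<in>UNIV. c p * h p i)) = (\<Sum>p\<in>UNIV. c p * (\<Sum>i\<in>UNIV. e i a * h p i))"
    for a c and h :: "4 \<Rightarrow> 4 \<Rightarrow> real"
    unfolding sum_distrib_left by (subst sum.swap) (simp add: ac_simps)
  have "contract4 e (contract4 \<theta> U) a b c d = U a b c d" for a b c d
  proof -
    have l: "(\<Sum>l\<in>UNIV. e l d * contract4 \<theta> U i j k l)
       = (\<Sum>p\<in>UNIV. \<theta> p i * (\<Sum>q\<in>UNIV. \<theta> q j * (\<Sum>r\<in>UNIV. \<theta> r k * U p q r d)))" for i j k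
      unfolding contract4_def pull[where c = "\<lambda>p. \<theta> p i"] pull[where c = "\<lambda>p. \<theta> p j"] pull[where c = "\<lambda>p. \<theta> p k"] e_sum ..
    have k: "(\<Sum>k\<in>UNIV. e k c * (\<Sum>l\<in>UNIV. e l d * contract4 \<theta> U i j k l))
       = (\<Sum>p\<in>UNIV. \<theta> p i * (\<Sum>q\<in>UNIV. \<theta> q j * U p q c d))" for i j
      unfolding l pull[where c = "\<lambda>p. \<theta> p i"] pull[where c = "\<lambda>p. \<theta> p j"] e_sum ..
    show ?thesis
      unfolding contract4_def[of e] k pull[where c = "\<lambda>p. \<theta> p i" for i] e_sum ..
  qed
  then show ?thesis by (intro ext)
qed

definition frame_bivector :: "(4 \<Rightarrow> 4 \<Rightarrow> real) \<Rightarrow> bivector" where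
  "frame_bivector X = (\<chi> m n. \<Sum>p\<in>UNIV. e m p * (\<Sum>q\<in>UNIV. e n q * X p q))"

text \<open>Contracting all four slots of the permutation symbol with \<Theta> multiplies it by det
  \<Theta>. Two of these contractions are undone by the frame vectors.\<close>

lemma levi_civita_frame:
  "(\<Sum>k\<in>UNIV. \<Sum>l\<in>UNIV. levi_civita m n k l * (\<theta> a k * \<theta> b l))
     = det ((\<chi> a i. \<theta> a i) :: real^4^4) * (\<Sum>p\<in>UNIV. e m p * (\<Sum>q\<in>UNIV. e n q * levi_civita p q a b))"
proof -
  define H where "H i j = (\<Sum>k\<in>UNIV. \<Sum>l\<in>UNIV. levi_civita i j k l * (\<theta> a k * \<theta> b l))" for i j
  have l: "det ((\<chi> a i. \<theta> a i) :: real^4^4) * levi_civita p q a b = (\<Sum>i\<in>UNIV. \<theta> p i * (\<Sum>j\<in>UNIV. \<theta> q j * H i j))" for p q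
    unfolding H_def sum_levi_civita_matrix[of "\<chi> a i. \<theta> a i", symmetric] by (simp add: sum_distrib_left ac_simps)
  have "det ((\<chi> a i. \<theta> a i) :: real^4^4) * (\<Sum>p\<in>UNIV. e m p * (\<Sum>q\<in>UNIV. e n q * levi_civita p q a b))
      = (\<Sum>p\<in>UNIV. e m p * (\<Sum>q\<in>UNIV. e n q * (det ((\<chi> a i. \<theta> a i) :: real^4^4) * levi_civita p q a b)))"
    by (simp add: sum_distrib_left ac_simps)
  also have "\<dots> = (\<Sum>p\<in>UNIV. e m p * (\<Sum>i\<in>UNIV. \<theta> p i * (\<Sum>q\<in>UNIV. e n q * (\<Sum>j\<in>UNIV. \<theta> q j * H i j))))"
  proof -
    have "(\<Sum>q\<in>UNIV. e n q * (\<Sum>i\<in>UNIV. \<theta> p i * K q i)) = (\<Sum>i\<in>UNIV. \<theta> p i * (\<Sum>q\<in>UNIV. e n q * K q i))" for p and K :: "4 \<Rightarrow> 4 \<Rightarrow> real"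
      unfolding sum_distrib_left by (subst sum.swap) (simp add: ac_simps)
    then show ?thesis unfolding l by simp
  qed
  also have "\<dots> = H m n" unfolding e_\<theta>_sum ..
  finally show ?thesis unfolding H_def by simp
qed

lemma hodge_frame:
  "hodge G y (frame_bivector X) $ m $ n
     = (orient / 2) * frame_bivector (\<lambda>p q. \<Sum>a\<in>UNIV. \<Sum>b\<in>UNIV. levi_civita p q a b * X a b) $ m $ n"
proof -
  let ?d = "det ((\<chi> a i. \<theta> a i) :: real^4^4)"
  have lower: "(\<Sum>x\<in>UNIV. \<Sum>z\<in>UNIV. c * G y $ k $ x * G y $ l $ z * frame_bivector X $ x $ z)
     = (\<Sum>a\<in>UNIV. \<Sum>b\<in>UNIV. X a b * (c * (\<theta> a k * \<theta> b l)))" for c k l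
  proof -
    have "(\<Sum>x\<in>UNIV. \<Sum>z\<in>UNIV. c * G y $ k $ x * G y $ l $ z * frame_bivector X $ x $ z)
       = (\<Sum>x\<in>UNIV. \<Sum>z\<in>UNIV. \<Sum>a\<in>UNIV. \<Sum>b\<in>UNIV. c * G y $ k $ x * G y $ l $ z * (e x a * (e z b * X a b)))"
      unfolding frame_bivector_def by (simp add: sum_distrib_left)
    also have "\<dots> = (\<Sum>a\<in>UNIV. \<Sum>x\<in>UNIV. \<Sum>z\<in>UNIV. \<Sum>b\<in>UNIV. c * G y $ k $ x * G y $ l $ z * (e x a * (e z b * X a b)))"
      by (rule sum_swap_outward2)
    also have "\<dots> = (\<Sum>a\<in>UNIV. \<Sum>b\<in>UNIV. \<Sum>x\<in>UNIV. \<Sum>z\<in>UNIV. c * G y $ k $ x * G y $ l $ z * (e x a * (e z b * X a b)))"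
      by (rule sum.cong[OF refl], rule sum_swap_outward2)
    also have "\<dots> = (\<Sum>a\<in>UNIV. \<Sum>b\<in>UNIV. X a b * (c * (\<theta> a k * \<theta> b l)))"
      unfolding \<theta>_def sum_product by (simp add: sum_distrib_left ac_simps)
    finally show ?thesis .
  qed
  have "(\<Sum>k\<in>UNIV. \<Sum>l\<in>UNIV. \<Sum>x\<in>UNIV. \<Sum>z\<in>UNIV. levi_civita m n k l * G y $ k $ x * G y $ l $ z * frame_bivector X $ x $ z)
     = (\<Sum>k\<in>UNIV. \<Sum>l\<in>UNIV. \<Sum>a\<in>UNIV. \<Sum>b\<in>UNIV. X a b * (levi_civita m n k l * (\<theta> a k * \<theta> b l)))"
    unfolding lower ..
  also have "\<dots> = (\<Sum>a\<in>UNIV. \<Sum>k\<in>UNIV. \<Sum>l\<in>UNIV. \<Sum>b\<in>UNIV. X a b * (levi_civita m n k l * (\<theta> a k * \<theta> b l)))"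
    by (rule sum_swap_outward2)
  also have "\<dots> = (\<Sum>a\<in>UNIV. \<Sum>b\<in>UNIV. \<Sum>k\<in>UNIV. \<Sum>l\<in>UNIV. X a b * (levi_civita m n k l * (\<theta> a k * \<theta> b l)))"
    by (rule sum.cong[OF refl], rule sum_swap_outward2)
  also have "\<dots> = (\<Sum>a\<in>UNIV. \<Sum>b\<in>UNIV. X a b * (?d * (\<Sum>p\<in>UNIV. e m p * (\<Sum>q\<in>UNIV. e n q * levi_civita p q a b))))"
    unfolding sum_distrib_left[symmetric] levi_civita_frame ..
  also have "\<dots> = (\<Sum>a\<in>UNIV. \<Sum>b\<in>UNIV. \<Sum>p\<in>UNIV. \<Sum>q\<in>UNIV. ?d * (e m p * (e n q * (levi_civita p q a b * X a b))))"
    by (simp add: sum_distrib_left ac_simps)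
  also have "\<dots> = (\<Sum>p\<in>UNIV. \<Sum>a\<in>UNIV. \<Sum>b\<in>UNIV. \<Sum>q\<in>UNIV. ?d * (e m p * (e n q * (levi_civita p q a b * X a b))))"
    by (rule sum_swap_outward2)
  also have "\<dots> = (\<Sum>p\<in>UNIV. \<Sum>q\<in>UNIV. \<Sum>a\<in>UNIV. \<Sum>b\<in>UNIV. ?d * (e m p * (e n q * (levi_civita p q a b * X a b))))"
    by (rule sum.cong[OF refl], rule sum_swap_outward2)
  also have "\<dots> = ?d * frame_bivector (\<lambda>p q. \<Sum>a\<in>UNIV. \<Sum>b\<in>UNIV. levi_civita p q a b * X a b) $ m $ n"
    unfolding frame_bivector_def by (simp add: sum_distrib_left)
  finally have sum: "(\<Sum>k\<in>UNIV. \<Sum>l\<in>UNIV. \<Sum>x\<in>UNIV. \<Sum>z\<in>UNIV. levi_civita m n k l * G y $ k $ x * G y $ l $ z * frame_bivector X $ x $ z)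
     = ?d * frame_bivector (\<lambda>p q. \<Sum>a\<in>UNIV. \<Sum>b\<in>UNIV. levi_civita p q a b * X a b) $ m $ n" .
  have "L / (2 * r) = (c / 2) * F" if "d / r = c" "L = d * F" for d r c L F :: real
    using that by auto
  from this[OF det_frame(1) sum] show ?thesis unfolding hodge_def vec_lambda_beta .
qed

lemma frame_bivector_add: "frame_bivector (\<lambda>p q. X p q + Y p q) = frame_bivector X + frame_bivector Y"
  unfolding frame_bivector_def by (simp add: vec_eq_iff distrib_left sum.distrib)

lemma frame_bivector_scale: "frame_bivector (\<lambda>p q. c * X p q) = c *\<^sub>R frame_bivector X"
  unfolding frame_bivector_def by (simp add: vec_eq_iff sum_distrib_left ac_simps)

lemma frame_bivector_sum: "frame_bivector (\<lambda>p q. \<Sum>r\<in>R. X r p q) = (\<Sum>r\<in>R. frame_bivector (X r))"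
proof (induction R rule: infinite_finite_induct)
  case (insert r R)
  then show ?case by (simp add: frame_bivector_add)
qed (simp_all add: frame_bivector_def vec_eq_iff)

lemma frame_bivector_components: "frame_bivector (\<lambda>p q. \<Sum>m\<in>UNIV. \<theta> p m * (\<Sum>n\<in>UNIV. \<theta> q n * \<alpha> $ m $ n)) = \<alpha>"
proof -
  have "(\<Sum>q\<in>UNIV. e n q * (\<Sum>i\<in>UNIV. \<theta> p i * K q i)) = (\<Sum>i\<in>UNIV. \<theta> p i * (\<Sum>q\<in>UNIV. e n q * K q i))" for n p and K :: "4 \<Rightarrow> 4 \<Rightarrow> real"
    unfolding sum_distrib_left by (subst sum.swap) (simp add: ac_simps)
  then show ?thesis unfolding frame_bivector_def by (simp add: vec_eq_iff e_\<theta>_sum)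
qed

lemma components_frame_bivector: "(\<Sum>m\<in>UNIV. \<theta> p m * (\<Sum>n\<in>UNIV. \<theta> q n * frame_bivector X $ m $ n)) = X p q"
proof -
  have "(\<Sum>n\<in>UNIV. \<theta> q n * (\<Sum>a\<in>UNIV. e m a * K a n)) = (\<Sum>a\<in>UNIV. e m a * (\<Sum>n\<in>UNIV. \<theta> q n * K a n))" for m q and K :: "4 \<Rightarrow> 4 \<Rightarrow> real"
    unfolding sum_distrib_left by (subst sum.swap) (simp add: ac_simps)
  then show ?thesis unfolding frame_bivector_def by (simp add: \<theta>_e_sum)
qed

text \<open>In frame components the star is half the contraction with the permutation symbol, times
  \<open>orient\<close>. The projection is therefore a quarter of the contraction with
  \<open>half_form\<close> for the sign s times \<open>orient\<close>.\<close>

lemma half_part_frame: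
  assumes s: "s = 1 \<or> s = -1" and X: "\<And>p q. X q p = - X p q"
  shows "half_part s G y (frame_bivector X)
     = frame_bivector (\<lambda>p q. \<Sum>r\<in>UNIV. (1/4 * (\<Sum>a\<in>UNIV. \<Sum>b\<in>UNIV. half_basis (s * orient) r a b * X a b)) * half_basis (s * orient) r p q)"
proof -
  let ?s = "s * orient"
  have s': "?s = 1 \<or> ?s = -1" using s det_frame(2) by auto
  let ?\<epsilon> = "\<lambda>p q. \<Sum>a\<in>UNIV. \<Sum>b\<in>UNIV. levi_civita p q a b * X a b"
  have h: "hodge G y (frame_bivector X) = (orient / 2) *\<^sub>R frame_bivector ?\<epsilon>"
    by (simp add: vec_eq_iff hodge_frame)
  have "half_part s G y (frame_bivector X) = (1/2) *\<^sub>R frame_bivector X + (?s / 4) *\<^sub>R frame_bivector ?\<epsilon>"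
    unfolding half_part_def h by (simp add: scaleR_add_right)
  also have "\<dots> = frame_bivector (\<lambda>p q. 1/2 * X p q + ?s / 4 * ?\<epsilon> p q)"
    by (simp only: frame_bivector_add frame_bivector_scale)
  also have "(\<lambda>p q. 1/2 * X p q + ?s / 4 * ?\<epsilon> p q)
      = (\<lambda>p q. \<Sum>r\<in>UNIV. (1/4 * (\<Sum>a\<in>UNIV. \<Sum>b\<in>UNIV. half_basis ?s r a b * X a b)) * half_basis ?s r p q)"
  proof (intro ext)
    fix p q
    have "(\<Sum>r\<in>UNIV. (1/4 * (\<Sum>a\<in>UNIV. \<Sum>b\<in>UNIV. half_basis ?s r a b * X a b)) * half_basis ?s r p q)
        = (\<Sum>r\<in>UNIV. \<Sum>a\<in>UNIV. \<Sum>b\<in>UNIV. 1/4 * (half_basis ?s r p q * half_basis ?s r a b * X a b))"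
      by (simp add: sum_distrib_left sum_distrib_right ac_simps)
    also have "\<dots> = (\<Sum>a\<in>UNIV. \<Sum>b\<in>UNIV. \<Sum>r\<in>UNIV. 1/4 * (half_basis ?s r p q * half_basis ?s r a b * X a b))"
      by (rule sum_swap_outward2[symmetric])
    also have "\<dots> = (\<Sum>a\<in>UNIV. \<Sum>b\<in>UNIV. 1/4 * (half_form ?s p q a b * X a b))"
      unfolding half_form_def by (simp add: sum_distrib_right sum_distrib_left)
    also have "\<dots> = 1/4 * ((\<Sum>a\<in>UNIV. \<Sum>b\<in>UNIV. kronecker p a * (kronecker q b * X a b)) - (\<Sum>a\<in>UNIV. \<Sum>b\<in>UNIV. kronecker p b * (kronecker q a * X a b)))
        + ?s / 4 * ?\<epsilon> p q"
      unfolding half_form_levi_civita[OF s']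
      by (simp add: sum_distrib_left sum.distrib sum_subtractf algebra_simps)
    also have "(\<Sum>a\<in>UNIV. \<Sum>b\<in>UNIV. kronecker p a * (kronecker q b * X a b)) = X p q"
      unfolding kronecker_def sum_distrib_left[symmetric] sum_delta ..
    also have "(\<Sum>a\<in>UNIV. \<Sum>b\<in>UNIV. kronecker p b * (kronecker q a * X a b)) = X q p"
      unfolding kronecker_def by (subst sum.swap) (simp only: sum_distrib_left[symmetric] sum_delta)
    finally show "1/2 * X p q + ?s / 4 * ?\<epsilon> p q
        = (\<Sum>r\<in>UNIV. (1/4 * (\<Sum>a\<in>UNIV. \<Sum>b\<in>UNIV. half_basis ?s r a b * X a b)) * half_basis ?s r p q)"
      unfolding X[of p q] by simp
  qed
  finally show ?thesis .
qed

lemma bivector_form_frame: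
  "bivector_form T (frame_bivector X) (frame_bivector Y)
     = (1/4) * (\<Sum>a\<in>UNIV. \<Sum>b\<in>UNIV. \<Sum>c\<in>UNIV. \<Sum>d\<in>UNIV. X a b * Y c d * contract4 e T a b c d)"
proof -
  let ?F = "\<lambda>i j k l a b c d. X a b * Y c d * (e i a * (e j b * (e k c * (e l d * T i j k l))))"
  have "(\<Sum>i\<in>UNIV. \<Sum>j\<in>UNIV. \<Sum>k\<in>UNIV. \<Sum>l\<in>UNIV. T i j k l * frame_bivector X $ i $ j * frame_bivector Y $ k $ l)
      = (\<Sum>i\<in>UNIV. \<Sum>j\<in>UNIV. \<Sum>k\<in>UNIV. \<Sum>l\<in>UNIV. \<Sum>a\<in>UNIV. \<Sum>b\<in>UNIV. \<Sum>c\<in>UNIV. \<Sum>d\<in>UNIV. ?F i j k l a b c d)"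
    (is "?L = ?R")
  proof -
    have "T i j k l * frame_bivector X $ i $ j * frame_bivector Y $ k $ l
       = (\<Sum>a\<in>UNIV. \<Sum>b\<in>UNIV. \<Sum>c\<in>UNIV. \<Sum>d\<in>UNIV. ?F i j k l a b c d)" for i j k l
    proof -
      have f: "frame_bivector Z $ m $ n = (\<Sum>p\<in>UNIV. \<Sum>q\<in>UNIV. e m p * (e n q * Z p q))" for Z m n
        unfolding frame_bivector_def by (simp add: sum_distrib_left)
      have "T i j k l * frame_bivector X $ i $ j * frame_bivector Y $ k $ l
          = (\<Sum>a\<in>UNIV. \<Sum>b\<in>UNIV. (T i j k l * (e i a * (e j b * X a b))) * (\<Sum>c\<in>UNIV. \<Sum>d\<in>UNIV. e k c * (e l d * Y c d)))"
      proof -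
        have "T i j k l * frame_bivector X $ i $ j = (\<Sum>a\<in>UNIV. \<Sum>b\<in>UNIV. T i j k l * (e i a * (e j b * X a b)))"
          unfolding f by (simp only: sum_distrib_left)
        then show ?thesis unfolding f[of Y] by (simp only: sum_distrib_right)
      qed
      then show ?thesis by (simp add: sum_distrib_left ac_simps)
    qed
    then show ?thesis by simp
  qed
  also have "\<dots> = (\<Sum>a\<in>UNIV. \<Sum>i\<in>UNIV. \<Sum>j\<in>UNIV. \<Sum>k\<in>UNIV. \<Sum>l\<in>UNIV. \<Sum>b\<in>UNIV. \<Sum>c\<in>UNIV. \<Sum>d\<in>UNIV. ?F i j k l a b c d)"
    by (rule sum_swap_outward4)
  also have "\<dots> = (\<Sum>a\<in>UNIV. \<Sum>b\<in>UNIV. \<Sum>i\<in>UNIV. \<Sum>j\<in>UNIV. \<Sum>k\<in>UNIV. \<Sum>l\<in>UNIV. \<Sum>c\<in>UNIV. \<Sum>d\<in>UNIV. ?F i j k l a b c d)"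
    by (rule sum.cong[OF refl], rule sum_swap_outward4)
  also have "\<dots> = (\<Sum>a\<in>UNIV. \<Sum>b\<in>UNIV. \<Sum>c\<in>UNIV. \<Sum>i\<in>UNIV. \<Sum>j\<in>UNIV. \<Sum>k\<in>UNIV. \<Sum>l\<in>UNIV. \<Sum>d\<in>UNIV. ?F i j k l a b c d)"
    by (rule sum.cong[OF refl], rule sum.cong[OF refl], rule sum_swap_outward4)
  also have "\<dots> = (\<Sum>a\<in>UNIV. \<Sum>b\<in>UNIV. \<Sum>c\<in>UNIV. \<Sum>d\<in>UNIV. \<Sum>i\<in>UNIV. \<Sum>j\<in>UNIV. \<Sum>k\<in>UNIV. \<Sum>l\<in>UNIV. ?F i j k l a b c d)"
    by (rule sum.cong[OF refl], rule sum.cong[OF refl], rule sum.cong[OF refl], rule sum_swap_outward4)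
  also have "\<dots> = (\<Sum>a\<in>UNIV. \<Sum>b\<in>UNIV. \<Sum>c\<in>UNIV. \<Sum>d\<in>UNIV. X a b * Y c d * contract4 e T a b c d)"
    unfolding contract4_def by (simp only: sum_distrib_left)
  finally show ?thesis unfolding bivector_form_def by simp
qed

lemma bivector_form_half_basis:
  "bivector_form T (frame_bivector (\<lambda>p q. \<Sum>r\<in>UNIV. x r * half_basis t r p q)) (frame_bivector (\<lambda>p q. \<Sum>r\<in>UNIV. z r * half_basis t r p q))
     = (1/4) * (\<Sum>r\<in>UNIV. \<Sum>r'\<in>UNIV. x r * (z r' * half_coeff t t (contract4 e T) r r'))"
proof -
  let ?F = "\<lambda>a b c d r r'. x r * (z r' * (half_basis t r a b * half_basis t r' c d * contract4 e T a b c d))"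
  have "(\<Sum>a\<in>UNIV. \<Sum>b\<in>UNIV. \<Sum>c\<in>UNIV. \<Sum>d\<in>UNIV. (\<Sum>r\<in>UNIV. x r * half_basis t r a b) * (\<Sum>r\<in>UNIV. z r * half_basis t r c d) * contract4 e T a b c d)
      = (\<Sum>a\<in>UNIV. \<Sum>b\<in>UNIV. \<Sum>c\<in>UNIV. \<Sum>d\<in>UNIV. \<Sum>r\<in>UNIV. \<Sum>r'\<in>UNIV. ?F a b c d r r')"
    unfolding sum_product unfolding sum_distrib_right by (simp add: ac_simps)
  also have "\<dots> = (\<Sum>r\<in>UNIV. \<Sum>a\<in>UNIV. \<Sum>b\<in>UNIV. \<Sum>c\<in>UNIV. \<Sum>d\<in>UNIV. \<Sum>r'\<in>UNIV. ?F a b c d r r')"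
    by (rule sum_swap_outward4)
  also have "\<dots> = (\<Sum>r\<in>UNIV. \<Sum>r'\<in>UNIV. \<Sum>a\<in>UNIV. \<Sum>b\<in>UNIV. \<Sum>c\<in>UNIV. \<Sum>d\<in>UNIV. ?F a b c d r r')"
    by (rule sum.cong[OF refl], rule sum_swap_outward4)
  finally show ?thesis unfolding bivector_form_frame half_coeff_def by (simp only: sum_distrib_left)
qed

lemma tensor_half_frame:
  assumes s: "s = 1 \<or> s = -1"
  shows "tensor_half s G y T = contract4 \<theta> (half (s * orient) (contract4 e T))"
proof (intro ext)
  fix i j k l
  let ?J = "half_basis (s * orient)"
  let ?j = "\<lambda>r i j. \<Sum>a\<in>UNIV. \<Sum>b\<in>UNIV. ?J r a b * (\<theta> a i * \<theta> b j)"
  have p: "half_part s G y (wedge (axis i 1) (axis j 1)) = frame_bivector (\<lambda>p q. \<Sum>r\<in>UNIV. (1/2 * ?j r i j) * ?J r p q)" for i j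
  proof -
    let ?X = "\<lambda>p q. \<theta> p i * \<theta> q j - \<theta> p j * \<theta> q i"
    have "wedge (axis i 1) (axis j 1) = frame_bivector (\<lambda>p q. \<Sum>m\<in>UNIV. \<theta> p m * (\<Sum>n\<in>UNIV. \<theta> q n * wedge (axis i 1) (axis j 1) $ m $ n))"
      by (rule frame_bivector_components[symmetric])
    also have "(\<lambda>p q. \<Sum>m\<in>UNIV. \<theta> p m * (\<Sum>n\<in>UNIV. \<theta> q n * wedge (axis i 1) (axis j 1) $ m $ n)) = ?X"
    proof (intro ext)
      fix p q
      have ax: "(\<Sum>m\<in>UNIV. K m * axis i 1 $ m) = K i" for i and K :: "4 \<Rightarrow> real"
      proof -
        have "(\<Sum>m\<in>UNIV. K m * axis i 1 $ m) = (\<Sum>m\<in>UNIV. if m = i then K m else 0)"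
          by (rule sum.cong) (auto simp: axis_def)
        then show ?thesis by simp
      qed
      have "(\<Sum>m\<in>UNIV. \<theta> p m * (\<Sum>n\<in>UNIV. \<theta> q n * wedge (axis i 1) (axis j 1) $ m $ n))
          = (\<Sum>m\<in>UNIV. \<theta> p m * axis i 1 $ m) * (\<Sum>n\<in>UNIV. \<theta> q n * axis j 1 $ n)
           - (\<Sum>m\<in>UNIV. \<theta> p m * axis j 1 $ m) * (\<Sum>n\<in>UNIV. \<theta> q n * axis i 1 $ n)"
        unfolding wedge_def sum_product by (simp add: right_diff_distrib sum_subtractf sum_distrib_left ac_simps)
      then show "(\<Sum>m\<in>UNIV. \<theta> p m * (\<Sum>n\<in>UNIV. \<theta> q n * wedge (axis i 1) (axis j 1) $ m $ n)) = ?X p q"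
        unfolding ax .
    qed
    finally have w: "wedge (axis i 1) (axis j 1) = frame_bivector ?X" .
    have "(\<Sum>a\<in>UNIV. \<Sum>b\<in>UNIV. ?J r a b * ?X a b) = 2 * ?j r i j" for r
    proof -
      have "(\<Sum>a\<in>UNIV. \<Sum>b\<in>UNIV. ?J r a b * (\<theta> a j * \<theta> b i)) = (\<Sum>a\<in>UNIV. \<Sum>b\<in>UNIV. ?J r b a * (\<theta> b j * \<theta> a i))"
        by (rule sum.swap)
      also have "\<dots> = - ?j r i j"
      proof -
        have "?J r b a * (\<theta> b j * \<theta> a i) = - (?J r a b * (\<theta> a i * \<theta> b j))" for a b
          by (subst half_basis_antisym) (simp add: ac_simps)
        then show ?thesis by (simp only: sum_negf)
      qed
      finally show ?thesis by (simp add: right_diff_distrib sum_subtractf)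
    qed
    then show ?thesis unfolding w by (subst half_part_frame[OF s]) simp_all
  qed
  let ?h = "half_coeff (s * orient) (s * orient) (contract4 e T)"
  have "contract4 \<theta> (half (s * orient) (contract4 e T)) i j k l
      = (\<Sum>a\<in>UNIV. \<Sum>b\<in>UNIV. \<Sum>c\<in>UNIV. \<Sum>d\<in>UNIV. \<Sum>r\<in>UNIV. \<Sum>r'\<in>UNIV. 1/16 * (\<theta> a i * (\<theta> b j * (\<theta> c k * (\<theta> d l * (?J r a b * ?J r' c d * ?h r r'))))))"
    unfolding contract4_def half_expand by (simp add: sum_distrib_left ac_simps)
  also have "\<dots> = (\<Sum>r\<in>UNIV. \<Sum>a\<in>UNIV. \<Sum>b\<in>UNIV. \<Sum>c\<in>UNIV. \<Sum>d\<in>UNIV. \<Sum>r'\<in>UNIV. 1/16 * (\<theta> a i * (\<theta> b j * (\<theta> c k * (\<theta> d l * (?J r a b * ?J r' c d * ?h r r'))))))"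
    by (rule sum_swap_outward4)
  also have "\<dots> = (\<Sum>r\<in>UNIV. \<Sum>r'\<in>UNIV. \<Sum>a\<in>UNIV. \<Sum>b\<in>UNIV. \<Sum>c\<in>UNIV. \<Sum>d\<in>UNIV. 1/16 * (\<theta> a i * (\<theta> b j * (\<theta> c k * (\<theta> d l * (?J r a b * ?J r' c d * ?h r r'))))))"
    by (rule sum.cong[OF refl], rule sum_swap_outward4)
  also have "\<dots> = 1/4 * (\<Sum>r\<in>UNIV. \<Sum>r'\<in>UNIV. (1/2 * ?j r i j) * ((1/2 * ?j r' k l) * ?h r r'))"
  proof -
    have pull: "(\<Sum>r\<in>UNIV. \<Sum>r'\<in>UNIV. c * Q r r') = c * (\<Sum>r\<in>UNIV. \<Sum>r'\<in>UNIV. Q r r')" for c :: real and Q :: "3 \<Rightarrow> 3 \<Rightarrow> real"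
      by (simp add: sum_distrib_left)
    have "(\<Sum>a\<in>UNIV. \<Sum>b\<in>UNIV. \<Sum>c\<in>UNIV. \<Sum>d\<in>UNIV. 1/16 * (\<theta> a i * (\<theta> b j * (\<theta> c k * (\<theta> d l * (?J r a b * ?J r' c d * ?h r r'))))))
       = 1/4 * ((1/2 * ?j r i j) * ((1/2 * ?j r' k l) * ?h r r'))" for r r'
    proof -
      have "?j r i j * (?j r' k l * ?h r r') = (\<Sum>a\<in>UNIV. \<Sum>b\<in>UNIV. (?J r a b * (\<theta> a i * \<theta> b j)) * (\<Sum>c\<in>UNIV. \<Sum>d\<in>UNIV. ?J r' c d * (\<theta> c k * \<theta> d l) * ?h r r'))"
        unfolding sum_distrib_right ..
      then have "?j r i j * (?j r' k l * ?h r r') = (\<Sum>a\<in>UNIV. \<Sum>b\<in>UNIV. \<Sum>c\<in>UNIV. \<Sum>d\<in>UNIV. \<theta> a i * (\<theta> b j * (\<theta> c k * (\<theta> d l * (?J r a b * ?J r' c d * ?h r r')))))"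
        by (simp add: sum_distrib_left ac_simps)
      then show ?thesis by (simp only: sum_distrib_left[symmetric])
    qed
    then show ?thesis by (simp only: pull)
  qed
  also have "\<dots> = tensor_half s G y T i j k l"
    unfolding tensor_half_def p bivector_form_half_basis ..
  finally show "tensor_half s G y T i j k l = contract4 \<theta> (half (s * orient) (contract4 e T)) i j k l" by simp
qed

lemma contract4_tensor_half:
  assumes "s = 1 \<or> s = -1"
  shows "contract4 e (tensor_half s G y T) = half (s * orient) (contract4 e T)"
  unfolding tensor_half_frame[OF assms] by (rule contract4_inverse)

end

section \<open>The determinant on the half two-vectors\<close>

text \<open>The functionals \<open>L\<close> read off coordinates in b, which gives independence.
  For any other admissible basis their values form an invertible matrix P with M P = P M', so both
  matrices have the same determinant and the description defines a unique number.\<close>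

lemma endo_det3_dual_basis:
  fixes b :: "3 \<Rightarrow> 'v::real_vector" and L :: "3 \<Rightarrow> 'v \<Rightarrow> real" and \<Phi> :: "'v \<Rightarrow> 'v" and M :: "real^3^3"
  assumes L: "\<And>i. linear (L i)" and dual: "\<And>i j. L i (b j) = (if i = j then 1 else 0)"
    and V: "span (range b) = V" and \<Phi>: "linear \<Phi>"
    and M: "\<And>j. \<Phi> (b j) = (\<Sum>i\<in>UNIV. M $ i $ j *\<^sub>R b i)"
  shows "endo_det3 V \<Phi> = det M"
proof -
  have Lsum: "L k (\<Sum>i\<in>UNIV. c i *\<^sub>R b i) = c k" for k c
  proof -
    have "L k (\<Sum>i\<in>UNIV. c i *\<^sub>R b i) = (\<Sum>i\<in>UNIV. c i * (if k = i then 1 else 0))"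
      by (simp add: linear_sum[OF L] linear_scale[OF L] dual)
    then show ?thesis using sum_if_eq[of c k 1] by simp
  qed
  have inj_b: "inj b"
  proof (rule injI)
    fix i j assume "b i = b j"
    then have "L i (b i) = L i (b j)" by simp
    then show "i = j" by (simp add: dual split: if_splits)
  qed
  have span_range: "\<exists>c. v = (\<Sum>i\<in>UNIV. c i *\<^sub>R b' i)" if v: "v \<in> span (range b')" and inj: "inj b'" for v and b' :: "3 \<Rightarrow> 'v"
  proof -
    from v obtain u where "v = (\<Sum>w\<in>range b'. u w *\<^sub>R w)"
      by (auto simp: span_finite)
    also have "\<dots> = (\<Sum>i\<in>UNIV. u (b' i) *\<^sub>R b' i)"
      by (simp add: sum.reindex[OF inj])
    finally show ?thesis by (intro exI[of _ "\<lambda>i. u (b' i)"])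
  qed
  have expand: "v = (\<Sum>i\<in>UNIV. L i v *\<^sub>R b i)" if v: "v \<in> V" for v
  proof -
    obtain c where c: "v = (\<Sum>i\<in>UNIV. c i *\<^sub>R b i)" using span_range[OF _ inj_b] v V by blast
    then have "L i v = c i" for i by (simp add: Lsum)
    then show ?thesis using c by simp
  qed
  have indep: "independent (range b)"
    unfolding dependent_finite[OF finite_imageI[OF finite_class.finite_UNIV]]
  proof (clarsimp)
    fix u i assume "(\<Sum>v\<in>range b. u v *\<^sub>R v) = 0" and "u (b i) \<noteq> 0"
    then have "(\<Sum>i\<in>UNIV. u (b i) *\<^sub>R b i) = 0" by (simp add: sum.reindex[OF inj_b])
    then have "L i (\<Sum>i\<in>UNIV. u (b i) *\<^sub>R b i) = 0" by (simp add: linear_0[OF L])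
    then have "u (b i) = 0" unfolding Lsum .
    then show False using \<open>u (b i) \<noteq> 0\<close> by simp
  qed
  have unique: "d = det M"
    if b': "inj b'" "span (range b') = V" and M': "\<And>j. \<Phi> (b' j) = (\<Sum>i\<in>UNIV. M' $ i $ j *\<^sub>R b' i)" and d: "d = det M'"
    for d and b' :: "3 \<Rightarrow> 'v" and M' :: "real^3^3"
  proof -
    have "b' j \<in> V" for j using b'(2) by (metis rangeI span_base)
    note eb' = expand[OF this]
    have "\<forall>i. \<exists>c. b i = (\<Sum>j\<in>UNIV. c j *\<^sub>R b' j)"
      using span_range[OF _ b'(1)] unfolding b'(2) V[symmetric] by (meson rangeI span_base)
    then obtain Q where Q: "\<And>i. b i = (\<Sum>j\<in>UNIV. Q i j *\<^sub>R b' j)" by metis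
    let ?P = "(\<chi> i j. L i (b' j)) :: real^3^3" and ?Q = "(\<chi> j i. Q i j) :: real^3^3"
    have "(\<Sum>j\<in>UNIV. L k (b' j) * Q i j) = (if k = i then 1 else 0)" for k i
    proof -
      have "L k (b i) = (\<Sum>j\<in>UNIV. Q i j * L k (b' j))"
        by (subst Q) (simp add: linear_sum[OF L] linear_scale[OF L])
      then show ?thesis by (simp add: dual mult.commute)
    qed
    then have "?P ** ?Q = mat 1" by (simp add: vec_eq_iff matrix_matrix_mult_def mat_def)
    then have "det ?P * det ?Q = 1" by (metis det_mul det_I)
    then have P: "det ?P \<noteq> 0" by auto
    have "L k (\<Phi> (b' j)) = (\<Sum>i\<in>UNIV. M $ k $ i * L i (b' j))" for k j
    proof -
      have "\<Phi> (b' j) = (\<Sum>i\<in>UNIV. L i (b' j) *\<^sub>R (\<Sum>l\<in>UNIV. M $ l $ i *\<^sub>R b l))"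
        by (subst eb') (simp add: linear_sum[OF \<Phi>] linear_scale[OF \<Phi>] M)
      then have "L k (\<Phi> (b' j)) = (\<Sum>i\<in>UNIV. L i (b' j) * L k (\<Sum>l\<in>UNIV. M $ l $ i *\<^sub>R b l))"
        by (simp only: linear_sum[OF L] linear_scale[OF L] real_scaleR_def)
      then show ?thesis unfolding Lsum by (simp only: mult.commute)
    qed
    moreover have "L k (\<Phi> (b' j)) = (\<Sum>i\<in>UNIV. L k (b' i) * M' $ i $ j)" for k j
      by (simp add: M' linear_sum[OF L] linear_scale[OF L] mult.commute)
    ultimately have "M ** ?P = ?P ** M'" by (simp add: vec_eq_iff matrix_matrix_mult_def)
    then have "det M * det ?P = det ?P * det M'" by (metis det_mul)
    then show ?thesis using P d by simp
  qed
  show ?thesis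
    unfolding endo_det3_def
  proof (rule the_equality)
    show "\<exists>(b :: 3 \<Rightarrow> 'v) (M' :: real^3^3). inj b \<and> independent (range b) \<and> span (range b) = V \<and>
     (\<forall>j. \<Phi> (b j) = (\<Sum>i\<in>UNIV. M' $ i $ j *\<^sub>R b i)) \<and> det M = det M'"
      using inj_b indep V M by blast
  next
    fix d assume "\<exists>(b :: 3 \<Rightarrow> 'v) (M' :: real^3^3). inj b \<and> independent (range b) \<and> span (range b) = V \<and>
     (\<forall>j. \<Phi> (b j) = (\<Sum>i\<in>UNIV. M' $ i $ j *\<^sub>R b i)) \<and> d = det M'"
    then show "d = det M" using unique by blast
  qed
qed

context metric_frame4
begin

text \<open>The factor 2 is the 1/2 of \<open>bivector_op\<close> times the square 4 of a basis
  element. The image of the r-th basis element is expanded in the second index of A, hence the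
  transposed matrix.\<close>

lemma endo_det3_half:
  assumes s: "s = 1 \<or> s = -1"
    and T: "\<And>a b c d. contract4 e T a b c d = (\<Sum>r\<in>UNIV. \<Sum>r'\<in>UNIV. half_basis (s * orient) r a b * half_basis (s * orient) r' c d * A r r')"
  shows "endo_det3 (half_bivectors s G y) (bivector_op G y T) = det (\<chi> i j. 2 * A j i)"
proof -
  let ?s = "s * orient"
  let ?J = "half_basis ?s"
  have ss: "s * s = 1" "?s * ?s = 1" using s det_frame(2) by auto
  let ?b = "\<lambda>r. frame_bivector (?J r)"
  let ?hat = "\<lambda>\<alpha> p q. \<Sum>m\<in>UNIV. \<theta> p m * (\<Sum>n\<in>UNIV. \<theta> q n * \<alpha> $ m $ n)"
  let ?L = "\<lambda>r \<alpha>. 1/4 * (\<Sum>p\<in>UNIV. \<Sum>q\<in>UNIV. ?J r p q * ?hat \<alpha> p q)"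
  have L: "linear (?L r)" for r
    by (rule linearI) (simp_all add: distrib_left sum.distrib sum_distrib_left ac_simps)
  have dual: "?L r (?b r') = (if r = r' then 1 else 0)" for r r'
    unfolding components_frame_bivector half_basis_orthogonal[OF ss(2)] by simp
  have part: "half_part s G y (frame_bivector X) = (\<Sum>r\<in>UNIV. (1/4 * (\<Sum>a\<in>UNIV. \<Sum>b\<in>UNIV. ?J r a b * X a b)) *\<^sub>R ?b r)"
    if X: "\<And>p q. X q p = - X p q" for X
    unfolding half_part_frame[OF s X] frame_bivector_sum frame_bivector_scale ..
  have antisym: "transpose (frame_bivector X) = - frame_bivector X" if X: "\<And>p q. X q p = - X p q" for X
  proof -
    have "(\<Sum>p\<in>UNIV. e n p * (\<Sum>q\<in>UNIV. e m q * X p q)) = - (\<Sum>p\<in>UNIV. e m p * (\<Sum>q\<in>UNIV. e n q * X p q))" for m n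
    proof -
      have "(\<Sum>p\<in>UNIV. e n p * (\<Sum>q\<in>UNIV. e m q * X p q)) = (\<Sum>q\<in>UNIV. \<Sum>p\<in>UNIV. e n p * (e m q * X p q))"
        unfolding sum_distrib_left by (rule sum.swap)
      also have "\<dots> = (\<Sum>q\<in>UNIV. \<Sum>p\<in>UNIV. - (e m q * (e n p * X q p)))"
      proof -
        have "e n p * (e m q * X p q) = - (e m q * (e n p * X q p))" for p q
          by (subst X) simp
        then show ?thesis by (intro sum.cong refl)
      qed
      finally show ?thesis by (simp add: sum_negf sum_distrib_left)
    qed
    then show ?thesis unfolding vec_eq_iff transpose_def frame_bivector_def vec_lambda_beta vector_uminus_component
      by (intro allI)
  qed
  \<comment> \<open>\<open>half_part\<close> fixes each basis element, and as s * s = 1 this is the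
    eigenvalue equation for the star.\<close>
  have bV: "?b r \<in> half_bivectors s G y" for r
  proof -
    have "half_part s G y (?b r) = (\<Sum>r'\<in>UNIV. (if r' = r then 1 else 0) *\<^sub>R ?b r')"
      by (subst part, rule half_basis_antisym, unfold half_basis_orthogonal[OF ss(2)], rule sum.cong) simp_all
    also have "\<dots> = (\<Sum>r'\<in>UNIV. if r' = r then ?b r' else 0)" by (rule sum.cong) auto
    also have "\<dots> = ?b r" by simp
    finally have "2 *\<^sub>R half_part s G y (?b r) = 2 *\<^sub>R ?b r" by simp
    then have "?b r + s *\<^sub>R hodge G y (?b r) = 2 *\<^sub>R ?b r"
      unfolding half_part_def by simp
    then have "s *\<^sub>R hodge G y (?b r) = ?b r" by (simp add: scaleR_2)
    then have "s *\<^sub>R (s *\<^sub>R hodge G y (?b r)) = s *\<^sub>R ?b r" by simp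
    then have "hodge G y (?b r) = s *\<^sub>R ?b r" using ss by simp
    moreover have "transpose (?b r) = - ?b r" by (rule antisym) (rule half_basis_antisym)
    ultimately show ?thesis unfolding half_bivectors_def by simp
  qed
  have Vb: "\<alpha> \<in> span (range ?b)" if \<alpha>: "\<alpha> \<in> half_bivectors s G y" for \<alpha>
  proof -
    from \<alpha> have t: "transpose \<alpha> = - \<alpha>" and h: "hodge G y \<alpha> = s *\<^sub>R \<alpha>" unfolding half_bivectors_def by auto
    have "\<alpha> = half_part s G y \<alpha>" unfolding half_part_def h using ss by (simp add: scaleR_2[symmetric])
    also have "\<dots> = half_part s G y (frame_bivector (?hat \<alpha>))" unfolding frame_bivector_components ..
    also have "\<dots> \<in> span (range ?b)"
    proof (subst part)
      fix p q
      have t': "\<alpha> $ n $ m = - \<alpha> $ m $ n" for m n using arg_cong[OF t, of "\<lambda>z. z $ m $ n"] by (simp add: transpose_def)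
      have "?hat \<alpha> q p = (\<Sum>n\<in>UNIV. \<Sum>m\<in>UNIV. \<theta> q m * (\<theta> p n * \<alpha> $ m $ n))"
        unfolding sum_distrib_left by (rule sum.swap)
      also have "\<dots> = (\<Sum>n\<in>UNIV. \<Sum>m\<in>UNIV. - (\<theta> p n * (\<theta> q m * \<alpha> $ n $ m)))"
      proof -
        have "\<theta> q m * (\<theta> p n * \<alpha> $ m $ n) = - (\<theta> p n * (\<theta> q m * \<alpha> $ n $ m))" for m n
          by (subst t') simp
        then show ?thesis by (intro sum.cong refl)
      qed
      finally show "?hat \<alpha> q p = - ?hat \<alpha> p q" by (simp add: sum_negf sum_distrib_left)
    next
      show "(\<Sum>r\<in>UNIV. (1/4 * (\<Sum>a\<in>UNIV. \<Sum>b\<in>UNIV. ?J r a b * ?hat \<alpha> a b)) *\<^sub>R ?b r) \<in> span (range ?b)"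
        by (intro span_sum span_scale span_base) auto
    qed
    finally show ?thesis .
  qed
  have subspace: "subspace (half_bivectors s G y)"
  proof -
    have add: "hodge G y (\<alpha> + \<beta>) = hodge G y \<alpha> + hodge G y \<beta>" for \<alpha> \<beta>
      by (simp add: hodge_def vec_eq_iff distrib_left sum.distrib add_divide_distrib)
    have scale: "hodge G y (c *\<^sub>R \<alpha>) = c *\<^sub>R hodge G y \<alpha>" for c \<alpha>
      by (simp add: hodge_def vec_eq_iff sum_distrib_left ac_simps)
    have tr: "transpose (\<alpha> + \<beta>) = transpose \<alpha> + transpose \<beta>" "transpose (c *\<^sub>R \<alpha>) = c *\<^sub>R transpose \<alpha>" for c and \<alpha> \<beta> :: bivector
      by (simp_all add: vec_eq_iff transpose_def)
    show ?thesis
      unfolding half_bivectors_def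
      by (rule subspaceI) (simp_all add: add scale tr scaleR_add_right,
          simp_all add: hodge_def vec_eq_iff transpose_def mult.commute)
  qed
  have V: "span (range ?b) = half_bivectors s G y"
    by (rule span_unique) (use bV Vb subspace in \<open>auto intro: span_minimal[THEN subsetD]\<close>)
  show ?thesis
  proof (rule endo_det3_dual_basis[of ?L ?b, OF L dual V])
    show "linear (bivector_op G y T)"
      by (rule linearI) (simp_all add: bivector_op_def vec_eq_iff distrib_left distrib_right sum.distrib add_divide_distrib
          sum_distrib_left ac_simps)
  next
    fix r
    show "bivector_op G y T (?b r) = (\<Sum>i\<in>UNIV. (\<chi> i j. 2 * A j i) $ i $ r *\<^sub>R ?b i)"
    proof -
      have "bivector_op G y T (?b r) $ k $ l = (\<Sum>i\<in>UNIV. 2 * A r i * ?b i $ k $ l)" for k l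
      proof -
        have g: "ginv G y a k * ginv G y b l = frame_bivector (\<lambda>x z. e k x * e l z) $ a $ b" for a b
          unfolding ginv_frame sum_product frame_bivector_def by (simp add: sum_distrib_left ac_simps)
        have "bivector_op G y T (?b r) $ k $ l = 2 * bivector_form T (?b r) (frame_bivector (\<lambda>x z. e k x * e l z))"
          unfolding bivector_op_def bivector_form_def vec_lambda_beta g[symmetric] by (simp add: ac_simps)
        also have "\<dots> = 1/2 * (\<Sum>a\<in>UNIV. \<Sum>b\<in>UNIV. \<Sum>c\<in>UNIV. \<Sum>d\<in>UNIV. ?J r a b * (e k c * e l d) * contract4 e T a b c d)"
          unfolding bivector_form_frame by simp
        also have "(\<Sum>a\<in>UNIV. \<Sum>b\<in>UNIV. \<Sum>c\<in>UNIV. \<Sum>d\<in>UNIV. ?J r a b * (e k c * e l d) * contract4 e T a b c d)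
          = (\<Sum>a\<in>UNIV. \<Sum>b\<in>UNIV. \<Sum>c\<in>UNIV. \<Sum>d\<in>UNIV. \<Sum>r1\<in>UNIV. \<Sum>r2\<in>UNIV. (?J r a b * ?J r1 a b) * (A r1 r2 * (e k c * (e l d * ?J r2 c d))))"
          unfolding T by (simp add: sum_distrib_left ac_simps)
        also have "\<dots> = (\<Sum>r1\<in>UNIV. \<Sum>a\<in>UNIV. \<Sum>b\<in>UNIV. \<Sum>c\<in>UNIV. \<Sum>d\<in>UNIV. \<Sum>r2\<in>UNIV. (?J r a b * ?J r1 a b) * (A r1 r2 * (e k c * (e l d * ?J r2 c d))))"
          by (rule sum_swap_outward4)
        also have "\<dots> = (\<Sum>r1\<in>UNIV. \<Sum>r2\<in>UNIV. \<Sum>a\<in>UNIV. \<Sum>b\<in>UNIV. \<Sum>c\<in>UNIV. \<Sum>d\<in>UNIV. (?J r a b * ?J r1 a b) * (A r1 r2 * (e k c * (e l d * ?J r2 c d))))"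
          by (rule sum.cong[OF refl], rule sum_swap_outward4)
        also have "\<dots> = (\<Sum>r1\<in>UNIV. \<Sum>r2\<in>UNIV. (\<Sum>a\<in>UNIV. \<Sum>b\<in>UNIV. ?J r a b * ?J r1 a b) * (A r1 r2 * ?b r2 $ k $ l))"
          unfolding frame_bivector_def sum_distrib_left[symmetric] sum_distrib_right[symmetric] vec_lambda_beta ..
        also have "\<dots> = (\<Sum>r1\<in>UNIV. (\<Sum>r2\<in>UNIV. A r1 r2 * ?b r2 $ k $ l) * (if r = r1 then 4 else 0))"
          unfolding half_basis_orthogonal[OF ss(2)] sum_distrib_right by (intro sum.cong refl mult.commute)
        also have "\<dots> = (\<Sum>r2\<in>UNIV. A r r2 * ?b r2 $ k $ l) * 4"
          by (rule sum_if_eq)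
        finally show ?thesis by (simp add: sum_distrib_left ac_simps)
      qed
      then show ?thesis by (simp add: vec_eq_iff)
    qed
  qed
qed

end

section \<open>Orthonormal frames in a chart\<close>

locale smooth_frame =
  fixes G :: "'n::finite metric" and V :: "(real^'n) set" and e :: "'n \<Rightarrow> 'n \<Rightarrow> real^'n \<Rightarrow> real"
  assumes V_open: "open V"
    and G_smooth: "y \<in> V \<Longrightarrow> smooth_at y (\<lambda>z. G z $ i $ j)"
    and e_smooth: "y \<in> V \<Longrightarrow> smooth_at y (e i a)"
    and frame: "y \<in> V \<Longrightarrow> metric_frame G y (\<lambda>i a. e i a y)"
begin

lemma eventually_in_V: "y \<in> V \<Longrightarrow> (\<And>z. z \<in> V \<Longrightarrow> P z) \<Longrightarrow> \<forall>\<^sub>F z in nhds y. P z"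
  using eventually_nhds_in_open[OF V_open] by (rule eventually_mono) auto

lemma G_sym: "y \<in> V \<Longrightarrow> G y $ i $ j = G y $ j $ i"
  using frame by (simp add: metric_frame_def)

lemma G_partial_smooth: "y \<in> V \<Longrightarrow> smooth_at y (\<lambda>z. partial k (\<lambda>y. G y $ i $ j) z)"
  using smooth_at_partial[OF G_smooth] by simp

text \<open>\<open>matrix_inv\<close> is defined by choice, but in a smooth orthonormal frame its
  entries are polynomials in the frame components.\<close>

lemma ginv_smooth: "y \<in> V \<Longrightarrow> smooth_at y (\<lambda>z. ginv G z i j)"
proof -
  assume y: "y \<in> V"
  have "smooth_at y (\<lambda>z. \<Sum>a\<in>UNIV. e i a z * e j a z)" using e_smooth[OF y] by simp
  then show ?thesis
    by (rule smooth_at_cong) (rule eventually_in_V[OF y], simp add: metric_frame.ginv_frame[OF frame])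
qed

lemma christoffel_smooth: "y \<in> V \<Longrightarrow> smooth_at y (\<lambda>z. christoffel G z k i j)"
  unfolding christoffel_def by (simp add: ginv_smooth G_partial_smooth)

lemma curvature_op_smooth: "y \<in> V \<Longrightarrow> smooth_at y (\<lambda>z. curvature_op G z p i j l)"
  unfolding curvature_op_def using smooth_at_partial[OF christoffel_smooth] by (simp add: christoffel_smooth)

lemma riemann_smooth: "y \<in> V \<Longrightarrow> smooth_at y (\<lambda>z. riemann G z i j k l)"
  unfolding riemann_def by (simp add: G_smooth curvature_op_smooth)

lemma ricci_smooth: "y \<in> V \<Longrightarrow> smooth_at y (\<lambda>z. ricci G z i j)"
  unfolding ricci_def by (simp add: ginv_smooth riemann_smooth)

lemma scalar_curvature_smooth: "y \<in> V \<Longrightarrow> smooth_at y (\<lambda>z. scalar_curvature G z)"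
  unfolding scalar_curvature_def by (simp add: ginv_smooth ricci_smooth)

lemma weyl_smooth: "y \<in> V \<Longrightarrow> smooth_at y (\<lambda>z. weyl G z i j k l)"
  unfolding weyl_def Let_def kulkarni_nomizu_def
  by (simp add: G_smooth riemann_smooth ricci_smooth scalar_curvature_smooth)

lemma G_partial_sym: "y \<in> V \<Longrightarrow> partial k (\<lambda>y. G y $ i $ j) y = partial k (\<lambda>y. G y $ j $ i) y"
  by (rule partial_cong[OF G_smooth]) (auto intro: eventually_in_V G_sym)

lemma christoffel_sym: "y \<in> V \<Longrightarrow> christoffel G y k i j = christoffel G y k j i"
  unfolding christoffel_def using G_partial_sym[of y _ i j] by (simp add: add.commute)

lemma ginv_G: "y \<in> V \<Longrightarrow> (\<Sum>q\<in>UNIV. ginv G y q l * G y $ q $ j) = (if l = j then 1 else 0)"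
proof -
  assume y: "y \<in> V"
  interpret metric_frame G y "\<lambda>i a. e i a y" by (rule frame[OF y])
  have "(\<Sum>q\<in>UNIV. ginv G y q l * G y $ q $ j) = (\<Sum>a\<in>UNIV. e l a y * \<theta> a j)"
    unfolding ginv_frame \<theta>_def sum_distrib_left sum_distrib_right
    by (subst sum.swap) (simp add: G_symmetric[of _ j] ac_simps)
  then show ?thesis unfolding e_\<theta> .
qed

lemma christoffel_lower:
  assumes y: "y \<in> V"
  shows "(\<Sum>q\<in>UNIV. christoffel G y q p i * G y $ q $ j)
     = (partial p (\<lambda>y. G y $ i $ j) y + partial i (\<lambda>y. G y $ p $ j) y - partial j (\<lambda>y. G y $ p $ i) y) / 2"
proof -
  let ?d = "\<lambda>l. partial p (\<lambda>y. G y $ i $ l) y + partial i (\<lambda>y. G y $ p $ l) y - partial l (\<lambda>y. G y $ p $ i) y"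
  have "(\<Sum>q\<in>UNIV. christoffel G y q p i * G y $ q $ j)
      = (\<Sum>q\<in>UNIV. \<Sum>l\<in>UNIV. (1/2 * ?d l) * (ginv G y q l * G y $ q $ j))"
    unfolding christoffel_def by (simp add: sum_distrib_left sum_distrib_right sum_divide_distrib ac_simps)
  also have "\<dots> = (\<Sum>l\<in>UNIV. (1/2 * ?d l) * (\<Sum>q\<in>UNIV. ginv G y q l * G y $ q $ j))"
    by (subst sum.swap) (simp add: sum_distrib_left)
  also have "\<dots> = (\<Sum>l\<in>UNIV. if l = j then 1/2 * ?d l else 0)"
    unfolding ginv_G[OF y] by (rule sum.cong) auto
  finally show ?thesis by simp
qed

lemma metric_parallel:
  assumes y: "y \<in> V"
  shows "partial p (\<lambda>y. G y $ i $ j) y = (\<Sum>q\<in>UNIV. christoffel G y q p i * G y $ q $ j + christoffel G y q p j * G y $ i $ q)"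
proof -
  have "(\<Sum>q\<in>UNIV. christoffel G y q p i * G y $ q $ j + christoffel G y q p j * G y $ i $ q)
     = (\<Sum>q\<in>UNIV. christoffel G y q p i * G y $ q $ j) + (\<Sum>q\<in>UNIV. christoffel G y q p j * G y $ q $ i)"
    using G_sym[OF y, of i] by (simp add: sum.distrib)
  then show ?thesis
    unfolding christoffel_lower[OF y] using G_partial_sym[OF y, of _ j i] by (simp add: field_simps)
qed

end

locale smooth_frame_at = smooth_frame +
  fixes x assumes x: "x \<in> V"
begin

abbreviation "germ \<equiv> germ_at x"

lemma germ_eq: "smooth_at x u \<Longrightarrow> (\<And>y. y \<in> V \<Longrightarrow> u y = v y) \<Longrightarrow> germ u = germ v"
  by (rule germ_at_cong) (auto intro: eventually_in_V[OF x])

lemmas smooths = G_smooth[OF x] e_smooth[OF x] ginv_smooth[OF x] christoffel_smooth[OF x] curvature_op_smooth[OF x]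
  riemann_smooth[OF x] ricci_smooth[OF x] weyl_smooth[OF x] G_partial_smooth[OF x]

lemmas germ_rules = germ_at_sum germ_at_mult germ_at_add germ_at_diff

text \<open>Identities valid throughout V become equations between germs at x, which supplies the
  Levi-Civita connection and the frame over the ring of germs.\<close>

sublocale frame_change germ_deriv "\<lambda>i j k. germ (\<lambda>y. christoffel G y k i j)" "\<lambda>i j. germ (\<lambda>y. G y $ i $ j)" "\<lambda>i a. germ (e i a)"
proof
  have sym: "germ (\<lambda>y. christoffel G y k i j) = germ (\<lambda>y. christoffel G y k j i)" for i j k
    by (rule germ_eq) (auto simp: smooths intro: christoffel_sym)
  then show "germ (\<lambda>y. christoffel G y k i j) = germ (\<lambda>y. christoffel G y k j i)" for i j k .
  show "germ_deriv a (germ_deriv b u) - germ_deriv b (germ_deriv a u)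
      = (\<Sum>c\<in>UNIV. (germ (\<lambda>y. christoffel G y c a b) - germ (\<lambda>y. christoffel G y c b a)) * germ_deriv c u)" for a b u
    using sym[of _ a b] germ_deriv_commute[of a b u] by simp
  show "germ_deriv a (u + v) = germ_deriv a u + germ_deriv a v" for a u v by (rule germ_deriv_add)
  show "germ_deriv a (u * v) = u * germ_deriv a v + germ_deriv a u * v" for a u v by (rule germ_deriv_mult)
  show "germ_deriv a (r *\<^sub>R u) = r *\<^sub>R germ_deriv a u" for a r u by (rule germ_deriv_scaleR)
  show "germ (\<lambda>y. G y $ i $ j) = germ (\<lambda>y. G y $ j $ i)" for i j
    by (rule germ_eq) (auto simp: smooths intro: G_sym)
  show "germ_deriv p (germ (\<lambda>y. G y $ i $ j)) = (\<Sum>q\<in>UNIV. germ (\<lambda>y. christoffel G y q p i) * germ (\<lambda>y. G y $ q $ j)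
      + germ (\<lambda>y. christoffel G y q p j) * germ (\<lambda>y. G y $ i $ q))" for p i j
  proof -
    have "germ_deriv p (germ (\<lambda>y. G y $ i $ j)) = germ (\<lambda>y. partial p (\<lambda>y. G y $ i $ j) y)"
      using germ_at_partial[OF G_smooth[OF x]] by simp
    also have "\<dots> = germ (\<lambda>y. \<Sum>q\<in>UNIV. christoffel G y q p i * G y $ q $ j + christoffel G y q p j * G y $ i $ q)"
      by (rule germ_eq) (auto simp: smooths intro: metric_parallel)
    finally show ?thesis by (simp add: germ_rules smooths)
  qed
  show "(\<Sum>i\<in>UNIV. (\<Sum>j\<in>UNIV. germ (\<lambda>y. G y $ i $ j) * germ (e j a)) * germ (e i b)) = (if a = b then 1 else 0)" for a b
  proof -
    have "(\<Sum>i\<in>UNIV. (\<Sum>j\<in>UNIV. germ (\<lambda>y. G y $ i $ j) * germ (e j a)) * germ (e i b))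
        = germ (\<lambda>y. \<Sum>i\<in>UNIV. (\<Sum>j\<in>UNIV. G y $ i $ j * e j a y) * e i b y)"
      by (simp add: germ_rules smooths)
    also have "\<dots> = germ (\<lambda>y. if a = b then 1 else 0)"
      by (rule germ_eq) (auto simp: smooths metric_frame.orthonormal[OF frame])
    finally show ?thesis by (simp add: germ_at_const)
  qed
  show "(\<Sum>a\<in>UNIV. germ (e i a) * (\<Sum>j\<in>UNIV. germ (\<lambda>y. G y $ k $ j) * germ (e j a))) = (if i = k then 1 else 0)" for i k
  proof -
    have "(\<Sum>a\<in>UNIV. germ (e i a) * (\<Sum>j\<in>UNIV. germ (\<lambda>y. G y $ k $ j) * germ (e j a)))
        = germ (\<lambda>y. \<Sum>a\<in>UNIV. e i a y * (\<Sum>j\<in>UNIV. G y $ k $ j * e j a y))"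
      by (simp add: germ_rules smooths)
    also have "\<dots> = germ (\<lambda>y. if i = k then 1 else 0)"
      by (rule germ_eq) (auto simp: smooths orthonormal_imp_complete[OF metric_frame.orthonormal[OF frame]])
    finally show ?thesis by (simp add: germ_at_const)
  qed
qed

lemma contract2_smooth:
  "(\<And>i j. smooth_at x (\<lambda>y. T y i j)) \<Longrightarrow> smooth_at x (\<lambda>y. contract2 (\<lambda>i a. e i a y) (T y) a b)"
  unfolding contract2_def by (simp add: smooths)

lemma contract4_smooth:
  "(\<And>i j k l. smooth_at x (\<lambda>y. T y i j k l)) \<Longrightarrow> smooth_at x (\<lambda>y. contract4 (\<lambda>i a. e i a y) (T y) a b c d)"
  unfolding contract4_def by (simp add: smooths)

lemma fr2_germ:
  assumes "\<And>i j. smooth_at x (\<lambda>y. T y i j)"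
  shows "fr2 (\<lambda>i j. germ (\<lambda>y. T y i j)) a b = germ (\<lambda>y. contract2 (\<lambda>i a. e i a y) (T y) a b)"
  unfolding fr2_def contract2_def by (simp add: germ_rules smooths assms)

lemma fr4_germ:
  assumes "\<And>i j k l. smooth_at x (\<lambda>y. T y i j k l)"
  shows "fr4 (\<lambda>i j k l. germ (\<lambda>y. T y i j k l)) a b c d = germ (\<lambda>y. contract4 (\<lambda>i a. e i a y) (T y) a b c d)"
  unfolding fr4_def contract4_def by (simp add: germ_rules smooths assms)

lemma lowered_germ: "lowered i j k l = germ (\<lambda>y. riemann G y i j k l)"
proof -
  have "curv i j p l = germ (\<lambda>y. curvature_op G y p i j l)" for p
  proof -
    have sym: "germ (\<lambda>y. christoffel G y k i j) = germ (\<lambda>y. christoffel G y k j i)" for i j k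
      by (rule symmetric)
    have d: "germ_deriv i (germ (\<lambda>y. christoffel G y k j l)) = germ (\<lambda>y. partial i (\<lambda>y. christoffel G y k j l) y)" for i j k l
      using germ_at_partial[OF christoffel_smooth[OF x]] by simp
    have sm: "smooth_at x (\<lambda>y. partial i (\<lambda>y. christoffel G y k j l) y)" for i j k l
      using smooth_at_partial[OF christoffel_smooth[OF x]] by simp
    show ?thesis
      unfolding curv_def curvature_op_def sym[of _ j i] d
      by (simp add: germ_rules smooths sm mult.commute)
  qed
  then show ?thesis unfolding lowered_def riemann_def by (simp add: germ_rules smooths)
qed

lemma frame_curv_germ: "frame.curv a b c d = germ (\<lambda>y. contract4 (\<lambda>i a. e i a y) (riemann G y) a b c d)"
  unfolding frame_curv lowered_germ by (rule fr4_germ) (rule smooths)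

lemma frame_ric_germ: "frame.ric a c = germ (\<lambda>y. contract2 (\<lambda>i a. e i a y) (ricci G y) a c)"
proof -
  have "frame.ric a c = germ (\<lambda>y. \<Sum>b\<in>UNIV. contract4 (\<lambda>i a. e i a y) (riemann G y) a b c b)"
    unfolding frame.ric_def frame_curv_germ by (simp add: germ_at_sum contract4_smooth smooths)
  also have "\<dots> = germ (\<lambda>y. contract2 (\<lambda>i a. e i a y) (ricci G y) a c)"
    by (rule germ_eq) (auto simp: contract4_smooth smooths metric_frame.contract2_ricci[OF frame])
  finally show ?thesis .
qed

lemma frame_grad_germ:
  assumes "smooth_at x u"
  shows "Df a (germ u) = germ (\<lambda>y. \<Sum>i\<in>UNIV. e i a y * partial i u y)"
  unfolding Df_def using germ_at_partial[OF assms] smooth_at_partial[OF assms]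
  by (simp add: germ_rules smooths)

lemma hessian_smooth: "smooth_at x u \<Longrightarrow> smooth_at x (\<lambda>y. hessian G u y i j)"
  unfolding hessian_def using smooth_at_partial[of x u] smooth_at_partial[OF smooth_at_partial, of x u]
  by (simp add: smooths)

lemma frame_hess_germ:
  assumes u: "smooth_at x u"
  shows "frame.hess (germ u) a b = germ (\<lambda>y. contract2 (\<lambda>i a. e i a y) (hessian G u y) a b)"
proof -
  have "(\<lambda>i. nabla1 i (\<lambda>j. germ_deriv j (germ u))) = (\<lambda>i j. germ (\<lambda>y. hessian G u y i j))"
    unfolding nabla1_def hessian_def germ_at_partial[OF u, symmetric] germ_at_partial[OF smooth_at_partial[OF u], symmetric]
    using smooth_at_partial[OF u] smooth_at_partial[OF smooth_at_partial[OF u]]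
    by (intro ext) (simp add: germ_rules smooths)
  then show ?thesis unfolding frame_hess using fr2_germ[OF hessian_smooth[OF u]] by simp
qed

lemma frame_nabla4_germ:
  assumes T: "\<And>i j k l. smooth_at x (\<lambda>y. T y i j k l)"
  shows "germ_value (frame.nabla4 a (\<lambda>b c d f. germ (\<lambda>y. contract4 (\<lambda>i a. e i a y) (T y) b c d f)) b c d f)
     = (\<Sum>p\<in>UNIV. e p a x * contract4 (\<lambda>i a. e i a x) (cov_deriv G T x p) b c d f)"
proof -
  let ?T = "\<lambda>i j k l. germ (\<lambda>y. T y i j k l)"
  have "(\<lambda>b c d f. germ (\<lambda>y. contract4 (\<lambda>i a. e i a y) (T y) b c d f)) = fr4 ?T"
    by (intro ext) (rule fr4_germ[OF T, symmetric])
  then have "frame.nabla4 a (\<lambda>b c d f. germ (\<lambda>y. contract4 (\<lambda>i a. e i a y) (T y) b c d f)) b c d f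
      = (\<Sum>p\<in>UNIV. germ (e p a) * fr4 (nabla4 p ?T) b c d f)"
    by (simp only: frame_nabla4)
  moreover have "germ_value (nabla4 p ?T i j k l) = cov_deriv G T x p i j k l" for p i j k l
    unfolding nabla4_def cov_deriv_def
    using smooth_at_partial[OF T] by (simp add: smooths T germ_at_partial[OF T, symmetric])
  ultimately show ?thesis
    by (simp add: fr4_def contract4_def smooths)
qed

end

lemma smooth_on_component: "open S \<Longrightarrow> smooth_on S G \<Longrightarrow> smooth_on S (\<lambda>y. G y $ i $ j)"
  for G :: "'n::finite metric"
  unfolding smooth_on_def
  by (auto intro!: C_k_on_bounded_linear[of S "\<lambda>A. A $ i $ j"] bounded_linear_compose[OF bounded_linear_vec_nth bounded_linear_vec_nth])

text \<open>Gram--Schmidt is carried out with germs. Representatives of these finitely many germs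
  are smooth and satisfy the finitely many orthonormality relations on a common
  neighbourhood.\<close>

lemma smooth_frame_exists:
  fixes G :: "'n::finite metric"
  assumes U: "open U" "x \<in> U" and G: "smooth_on U G"
    and sym: "\<And>y. y \<in> U \<Longrightarrow> transpose (G y) = G y"
    and pos: "\<And>y v. y \<in> U \<Longrightarrow> v \<noteq> 0 \<Longrightarrow> v \<bullet> (G y *v v) > 0"
  obtains V e where "x \<in> V" "V \<subseteq> U" "smooth_frame G V e"
proof -
  have Gs: "smooth_at y (\<lambda>z. G z $ i $ j)" if "y \<in> U" for y i j
    unfolding smooth_at_def using U that smooth_on_component[OF U(1) G] by blast
  have Gsym: "G y $ i $ j = G y $ j $ i" if "y \<in> U" for y i j
    using sym[OF that] by (metis transpose_def vec_lambda_beta)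
  have "\<exists>E :: 'n \<Rightarrow> 'n \<Rightarrow> 'n germ. \<forall>a\<in>UNIV. \<forall>b\<in>UNIV.
     (\<Sum>i\<in>UNIV. (\<Sum>j\<in>UNIV. germ_at x (\<lambda>y. G y $ i $ j) * E j a) * E i b) = (if a = b then 1 else 0)"
  proof (rule germ_gram_schmidt)
    show "germ_at x (\<lambda>y. G y $ i $ j) = germ_at x (\<lambda>y. G y $ j $ i)" for i j
      by (rule germ_at_cong[OF Gs[OF U(2)]])
        (use eventually_nhds_in_open[OF U] in \<open>rule eventually_mono\<close>, rule Gsym)
    fix v :: "real^'n" assume "v \<noteq> 0"
    from pos[OF U(2) this] show "0 < (\<Sum>i\<in>UNIV. \<Sum>j\<in>UNIV. v $ i * germ_value (germ_at x (\<lambda>y. G y $ i $ j)) * v $ j)"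
      by (simp add: Gs[OF U(2)] inner_vec_def matrix_vector_mult_def sum_distrib_left mult.assoc)
  qed
  then obtain E :: "'n \<Rightarrow> 'n \<Rightarrow> 'n germ" where E: "\<And>a b. (\<Sum>i\<in>UNIV. (\<Sum>j\<in>UNIV. germ_at x (\<lambda>y. G y $ i $ j) * E j a) * E i b) = (if a = b then 1 else 0)"
    by blast
  have "\<forall>i a. \<exists>u. smooth_at x u \<and> E i a = germ_at x u" using germ_at_surj by blast
  then obtain e where e: "\<And>i a. smooth_at x (e i a)" "\<And>i a. E i a = germ_at x (e i a)" by metis
  have "\<forall>\<^sub>F y in nhds x. (\<Sum>i\<in>UNIV. (\<Sum>j\<in>UNIV. G y $ i $ j * e j a y) * e i b y) = (if a = b then 1 else 0)" for a b
  proof -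
    have "germ_at x (\<lambda>y. \<Sum>i\<in>UNIV. (\<Sum>j\<in>UNIV. G y $ i $ j * e j a y) * e i b y) = germ_at x (\<lambda>y. if a = b then 1 else 0)"
      using E[of a b] unfolding e(2) by (simp add: germ_at_sum germ_at_mult germ_at_const Gs[OF U(2)] e(1))
    then show ?thesis by (subst (asm) germ_at_eq_iff) (simp_all add: Gs[OF U(2)] e(1))
  qed
  then have "\<forall>\<^sub>F y in nhds x. \<forall>a b. (\<Sum>i\<in>UNIV. (\<Sum>j\<in>UNIV. G y $ i $ j * e j a y) * e i b y) = (if a = b then 1 else 0)"
    by (intro eventually_all_finite)
  moreover have "\<forall>\<^sub>F y in nhds x. \<forall>i a. smooth_at y (e i a)"
    by (intro eventually_all_finite smooth_at_nhds e(1))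
  ultimately have "\<forall>\<^sub>F y in nhds x. y \<in> U \<and> (\<forall>i a. smooth_at y (e i a))
      \<and> (\<forall>a b. (\<Sum>i\<in>UNIV. (\<Sum>j\<in>UNIV. G y $ i $ j * e j a y) * e i b y) = (if a = b then 1 else 0))"
    using eventually_nhds_in_open[OF U] by eventually_elim blast
  then obtain V where V: "open V" "x \<in> V" and *: "\<forall>y\<in>V. y \<in> U \<and> (\<forall>i a. smooth_at y (e i a))
      \<and> (\<forall>a b. (\<Sum>i\<in>UNIV. (\<Sum>j\<in>UNIV. G y $ i $ j * e j a y) * e i b y) = (if a = b then 1 else 0))"
    unfolding eventually_nhds by (elim exE conjE)
  have VU: "y \<in> U" if "y \<in> V" for y using * that by blast
  have es: "smooth_at y (e i a)" if "y \<in> V" for y i a using * that by blast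
  have on: "(\<Sum>i\<in>UNIV. (\<Sum>j\<in>UNIV. G y $ i $ j * e j a y) * e i b y) = (if a = b then 1 else 0)" if "y \<in> V" for y a b
    using * that by blast
  have "smooth_frame G V e"
  proof (rule smooth_frame.intro)
    show "open V" by fact
    show "smooth_at y (\<lambda>z. G z $ i $ j)" if "y \<in> V" for y i j by (rule Gs[OF VU[OF that]])
    show "smooth_at y (e i a)" if "y \<in> V" for y i a by (rule es[OF that])
    show "metric_frame G y (\<lambda>i a. e i a y)" if "y \<in> V" for y
    proof
      show "G y $ i $ j = G y $ j $ i" for i j by (rule Gsym[OF VU[OF that]])
      show "(\<Sum>i\<in>UNIV. (\<Sum>j\<in>UNIV. G y $ i $ j * e j a y) * e i b y) = (if a = b then 1 else 0)" for a b
        by (rule on[OF that])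
    qed
  qed
  moreover have "V \<subseteq> U" using VU by blast
  ultimately show thesis using that V(2) by blast
qed

section \<open>The half Weyl tensor as a tensor of germs\<close>

lemma half_basis_scaleR: "half_basis (r *\<^sub>R 1) q i j = half_basis r q i j *\<^sub>R (1 :: 'r::{comm_ring_1,real_algebra_1})"
proof -
  have "\<forall>q i j. half_basis (r *\<^sub>R 1) q i j = half_basis r q i j *\<^sub>R (1 :: 'r)"
    unfolding forall_3 forall_4 half_basis_values by simp
  then show ?thesis by blast
qed

lemma germ_half_coeff:
  assumes "\<And>i j k l. smooth_at x (\<lambda>y. T y i j k l)"
  shows "half_coeff (r *\<^sub>R 1) (r *\<^sub>R 1) (\<lambda>i j k l. germ_at x (\<lambda>y. T y i j k l)) q q'
     = germ_at x (\<lambda>y. half_coeff r r (T y) q q')"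
  unfolding half_coeff_def half_basis_scaleR by (simp add: germ_at_sum germ_at_scaleR assms) (simp add: mult.commute)

lemma smooth_half_coeff:
  "(\<And>i j k l. smooth_at x (\<lambda>y. T y i j k l)) \<Longrightarrow> smooth_at x (\<lambda>y. half_coeff r r (T y) q q')"
  unfolding half_coeff_def by simp

lemma smooth_half:
  "(\<And>i j k l. smooth_at x (\<lambda>y. T y i j k l)) \<Longrightarrow> smooth_at x (\<lambda>y. half r (T y) i j k l)"
  unfolding half_expand real_scaleR_def by (simp add: smooth_half_coeff)

lemma germ_half:
  assumes "\<And>i j k l. smooth_at x (\<lambda>y. T y i j k l)"
  shows "half (r *\<^sub>R 1) (\<lambda>i j k l. germ_at x (\<lambda>y. T y i j k l)) i j k l = germ_at x (\<lambda>y. half r (T y) i j k l)"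
proof -
  have "germ_at x (\<lambda>y. half r (T y) i j k l)
     = (1/16) *\<^sub>R germ_at x (\<lambda>y. \<Sum>q\<in>UNIV. \<Sum>q'\<in>UNIV. (half_basis r q i j * half_basis r q' k l) * half_coeff r r (T y) q q')"
    unfolding half_expand real_scaleR_def by (rule germ_at_scaleR) (simp add: smooth_half_coeff assms)
  also have "germ_at x (\<lambda>y. \<Sum>q\<in>UNIV. \<Sum>q'\<in>UNIV. (half_basis r q i j * half_basis r q' k l) * half_coeff r r (T y) q q')
     = (\<Sum>q\<in>UNIV. \<Sum>q'\<in>UNIV. (half_basis r q i j * half_basis r q' k l) *\<^sub>R germ_at x (\<lambda>y. half_coeff r r (T y) q q'))"
    by (simp add: germ_at_sum germ_at_scaleR smooth_half_coeff assms)
  finally show ?thesis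
    unfolding half_expand half_basis_scaleR germ_half_coeff[where T = T, OF assms] by (simp add: ac_simps)
qed

lemma (in orthonormal_frame) hess_scaleR: "hess (r *\<^sub>R u) a b = r *\<^sub>R hess u a b"
  unfolding hess_def nabla1_def by (simp add: D_scaleR scaleR_diff_right scaleR_sum_right)

locale smooth_frame4 = smooth_frame_at G V e x for G :: "4 metric" and V e x +
  fixes s :: real
  assumes s: "s = 1 \<or> s = -1"
begin

lemma frame4: "y \<in> V \<Longrightarrow> metric_frame4 G y (\<lambda>i a. e i a y)"
  unfolding metric_frame4_def by (rule frame)

definition "orient_at y = metric_frame4.orient (\<lambda>i a. e i a y)"

lemma orient_at_eq: "y \<in> V \<Longrightarrow> orient_at y = sgn (det ((\<chi> i a. e i a y) :: real^4^4))"
  unfolding orient_at_def by (rule metric_frame4.orient_def[OF frame4])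

text \<open>A negatively oriented frame exchanges self-dual and anti-self-dual forms.\<close>

definition "t = s * orient_at x"

lemma t: "t = 1 \<or> t = -1"
  unfolding t_def orient_at_def using s metric_frame4.det_frame(2)[OF frame4[OF x]] by auto

lemma near_V: "\<forall>\<^sub>F y in nhds x. y \<in> V"
  using eventually_nhds_in_open[OF V_open x] .

text \<open>The determinant of the frame is continuous and nonzero at x, so its sign is constant
  nearby. Thus \<open>t\<close> can serve as a constant germ with vanishing derivatives.\<close>

lemma orient_locally_constant: "\<forall>\<^sub>F y in nhds x. s * orient_at y = t"
proof -
  let ?d = "\<lambda>y. det ((\<chi> i a. e i a y) :: real^4^4)"
  have "smooth_at x ?d" unfolding det_4 by (simp add: smooths)
  then have "isCont ?d x" by (intro differentiable_imp_continuous_within smooth_at_differentiable)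
  then have lim: "(?d \<longlongrightarrow> ?d x) (nhds x)"
    unfolding isCont_def using tendsto_at_iff_tendsto_nhds[of ?d x] by blast
  have "orient_at x \<noteq> 0" using t s unfolding t_def by auto
  then have nz: "?d x \<noteq> 0" unfolding orient_at_eq[OF x] by auto
  have "\<forall>\<^sub>F y in nhds x. sgn (?d y) = sgn (?d x)"
  proof (cases "?d x > 0")
    case True
    from order_tendstoD(1)[OF lim True] show ?thesis by (rule eventually_mono) (use True in simp)
  next
    case False
    then have "?d x < 0" using nz by simp
    from order_tendstoD(2)[OF lim this] show ?thesis by (rule eventually_mono) (use \<open>?d x < 0\<close> in simp)
  qed
  then show ?thesis using near_V by eventually_elim (simp add: t_def orient_at_eq x)
qed

abbreviation "c2 y \<equiv> contract2 (\<lambda>i a. e i a y)"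
abbreviation "c4 y \<equiv> contract4 (\<lambda>i a. e i a y)"

lemma contract4_tensor_half_near: "\<forall>\<^sub>F y in nhds x. \<forall>T. c4 y (tensor_half s G y T) = half t (c4 y T)"
  using orient_locally_constant near_V
proof eventually_elim
  case (elim y)
  then show ?case
    using metric_frame4.contract4_tensor_half[OF frame4[of y] s] unfolding orient_at_def by simp
qed

text \<open>In frame components the projection is \<open>half t\<close>, which has constant
  coefficients near x. The half Weyl tensor becomes polynomial in smooth functions, and the root of
  the determinant in \<open>hodge\<close> no longer appears.\<close>

lemma weyl_half_smooth: "smooth_at x (\<lambda>y. weyl_half s G y i j k l)"
proof -
  define \<theta> where "\<theta> y a i = (\<Sum>j\<in>UNIV. G y $ i $ j * e j a y)" for y a i
  have "smooth_at x (\<lambda>y. half t (c4 y (weyl G y)) a b c d)" for a b c d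
    by (rule smooth_half) (rule contract4_smooth, rule smooths)
  then have "smooth_at x (\<lambda>y. contract4 (\<theta> y) (half t (c4 y (weyl G y))) i j k l)"
    unfolding contract4_def[of "\<theta> y" for y] \<theta>_def by (simp add: smooths)
  then show ?thesis
  proof (rule smooth_at_cong)
    show "\<forall>\<^sub>F y in nhds x. contract4 (\<theta> y) (half t (c4 y (weyl G y))) i j k l = weyl_half s G y i j k l"
      using orient_locally_constant near_V
    proof eventually_elim
      case (elim y)
      interpret F: metric_frame4 G y "\<lambda>i a. e i a y" by (rule frame4) fact
      have "F.\<theta> = \<theta> y" by (intro ext) (simp add: F.\<theta>_def \<theta>_def)
      then show ?case
        unfolding weyl_half_def F.tensor_half_frame[OF s] using elim(1) unfolding orient_at_def by simp
    qed
  qed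
qed

abbreviation "sg \<equiv> t *\<^sub>R (1 :: 4 germ)"

sublocale g4: orthonormal_frame4 Df \<omega>f sg
proof
  show "sg * sg = 1" using t by auto
  show "Df a sg = 0" for a
  proof -
    have "Df a (1 * 1) = 1 * Df a 1 + Df a 1 * 1" by (rule frame.D_mult)
    then show ?thesis by (simp add: frame.D_scaleR)
  qed
qed

lemma weyl4_germ: "g4.weyl4 = (\<lambda>a b c d. germ (\<lambda>y. c4 y (weyl G y) a b c d))"
proof (intro ext)
  fix a b c d
  let ?S = "\<lambda>y i k. c2 y (ricci G y) i k / 2 - (\<Sum>a\<in>UNIV. c2 y (ricci G y) a a) / 12 * kronecker i k"
  have S_smooth: "smooth_at x (\<lambda>y. ?S y i k)" for i k by (simp add: contract2_smooth smooths)
  have S: "g4.schouten i k = germ (\<lambda>y. ?S y i k)" for i k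
  proof -
    have k: "germ (\<lambda>y. kronecker i k) = kronecker i k" unfolding kronecker_def by (simp add: germ_at_const)
    show ?thesis
      unfolding g4.schouten_def frame_ric_germ k[symmetric]
      by (simp add: germ_rules germ_at_divide contract2_smooth smooths)
  qed
  have "germ (\<lambda>y. c4 y (weyl G y) a b c d) = germ (\<lambda>y. c4 y (riemann G y) a b c d - kn (?S y) kronecker a b c d)"
    by (rule germ_eq) (auto simp: contract4_smooth smooths metric_frame4.contract4_weyl[OF frame4])
  also have "\<dots> = g4.weyl4 a b c d"
  proof -
    have k: "germ (\<lambda>y. kronecker i k) = kronecker i k" for i k unfolding kronecker_def by (simp add: germ_at_const)
    show ?thesis
      unfolding g4.weyl4_def frame_curv_germ kn_def S k[symmetric]
      by (simp add: germ_rules contract4_smooth contract2_smooth smooths S_smooth)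
  qed
  finally show "g4.weyl4 a b c d = germ (\<lambda>y. c4 y (weyl G y) a b c d)" by simp
qed

lemma half_weyl_germ: "g4.half_weyl = (\<lambda>a b c d. germ (\<lambda>y. c4 y (weyl_half s G y) a b c d))"
proof (intro ext)
  fix a b c d
  have "g4.half_weyl a b c d = germ (\<lambda>y. half t (c4 y (weyl G y)) a b c d)"
    unfolding g4.half_weyl_def weyl4_germ
    by (rule germ_half[where T = "\<lambda>y. c4 y (weyl G y)"]) (rule contract4_smooth, rule smooths)
  also have "\<dots> = germ (\<lambda>y. c4 y (weyl_half s G y) a b c d)"
  proof (rule germ_at_cong)
    show "smooth_at x (\<lambda>y. half t (c4 y (weyl G y)) a b c d)"
      by (rule smooth_half) (rule contract4_smooth, rule smooths)
    show "\<forall>\<^sub>F y in nhds x. half t (c4 y (weyl G y)) a b c d = c4 y (weyl_half s G y) a b c d"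
      using contract4_tensor_half_near by (rule eventually_mono) (simp add: weyl_half_def)
  qed
  finally show "g4.half_weyl a b c d = germ (\<lambda>y. c4 y (weyl_half s G y) a b c d)" .
qed

abbreviation "u \<equiv> \<lambda>y. tensor_norm2 G y (weyl_half s G y)"

lemma norm_smooth: "smooth_at x u"
  unfolding tensor_norm2_def tensor_inner_def by (simp add: weyl_half_smooth smooths)

lemma pairing_half_weyl_germ: "pairing g4.half_weyl g4.half_weyl = 4 *\<^sub>R germ u"
proof -
  have sm: "smooth_at x (\<lambda>y. c4 y (weyl_half s G y) a b c d)" for a b c d
    by (rule contract4_smooth) (rule weyl_half_smooth)
  have "germ u = germ (\<lambda>y. (1/4) * pairing (c4 y (weyl_half s G y)) (c4 y (weyl_half s G y)))"
    by (rule germ_eq[OF norm_smooth]) (simp add: tensor_norm2_def metric_frame.tensor_inner_frame[OF frame])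
  also have "\<dots> = (1/4) *\<^sub>R germ (\<lambda>y. pairing (c4 y (weyl_half s G y)) (c4 y (weyl_half s G y)))"
    by (rule germ_at_scaleR) (simp add: pairing_def sm)
  also have "germ (\<lambda>y. pairing (c4 y (weyl_half s G y)) (c4 y (weyl_half s G y))) = pairing g4.half_weyl g4.half_weyl"
    unfolding half_weyl_germ pairing_def by (simp add: germ_rules sm)
  finally show ?thesis by simp
qed

end

section \<open>The weighted Laplacian of the half Weyl tensor\<close>

context smooth_frame4
begin

text \<open>The identity of germs from \<open>weighted_laplacian_half_weyl\<close> is evaluated at
  x, where \<open>algebraic_curvature4\<close> applies to the values of the frame components of the
  curvature.\<close>

lemma weighted_laplacian_chart:
  fixes f lam :: "real^4 \<Rightarrow> real" and \<mu> :: real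
  assumes f: "smooth_at x f" and lam: "smooth_at x lam"
    and quasi_einstein: "\<And>y i j. y \<in> V \<Longrightarrow>
      ricci G y i j + hessian G f y i j - \<mu> * partial i f y * partial j f y = lam y * G y $ i $ j"
  shows "weighted_laplacian G f u x
     = 2 * cov_deriv_norm2 G (weyl_half s G) x
       + (4 * lam x + 2 * \<mu> * grad_inner G f f x) * u x
       - 36 * det_weyl_half s G x
       - (1 + 2 * \<mu>) * tensor_inner G x
           (tensor_half s G x (kulkarni_nomizu (hessian G f x) (hessian G f x))) (weyl_half s G x)"
proof -
  interpret F: metric_frame4 G x "\<lambda>i a. e i a x" by (rule frame4[OF x])
  have orient: "s * F.orient = t" unfolding t_def orient_at_def ..
  let ?v = "\<lambda>y a. \<Sum>i\<in>UNIV. e i a y * partial i f y"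
  have f': "smooth_at x (\<lambda>y. partial i f y)" for i using smooth_at_partial[OF f] by simp
  have qe: "c2 y (ricci G y) a b + c2 y (hessian G f y) a b - \<mu> * (?v y a * ?v y b) = lam y * (if a = b then 1 else 0)"
    if y: "y \<in> V" for y a b
  proof -
    have "c2 y (ricci G y) a b + c2 y (hessian G f y) a b - \<mu> * (?v y a * ?v y b)
       = c2 y (\<lambda>i j. ricci G y i j + hessian G f y i j - \<mu> * partial i f y * partial j f y) a b"
      unfolding contract2_def sum_product
      by (simp add: distrib_left right_diff_distrib sum.distrib sum_subtractf sum_distrib_left ac_simps)
    also have "\<dots> = c2 y (\<lambda>i j. lam y * G y $ i $ j) a b" by (simp only: quasi_einstein[OF y])
    also have "\<dots> = lam y * c2 y (\<lambda>i j. G y $ i $ j) a b"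
      unfolding contract2_def by (simp add: sum_distrib_left ac_simps)
    finally show ?thesis unfolding metric_frame.contract2_metric[OF frame[OF y]] kronecker_def .
  qed
  interpret q: quasi_einstein_frame4 Df \<omega>f sg "germ f" "germ lam" \<mu>
  proof
    fix a b
    have sm: "smooth_at x (\<lambda>y. c2 y (ricci G y) a b)" "smooth_at x (\<lambda>y. c2 y (hessian G f y) a b)"
        "smooth_at x (\<lambda>y. ?v y a)" for a b
      by (simp_all add: contract2_smooth smooths hessian_smooth f f')
    have "frame.ric a b + frame.hess (germ f) a b - \<mu> *\<^sub>R (Df a (germ f) * Df b (germ f))
       = germ (\<lambda>y. c2 y (ricci G y) a b + c2 y (hessian G f y) a b - \<mu> * (?v y a * ?v y b))"
      unfolding frame_ric_germ frame_hess_germ[OF f] frame_grad_germ[OF f]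
      using sm by (simp add: germ_at_add germ_at_diff germ_at_scaleR germ_at_mult)
    also have "\<dots> = germ (\<lambda>y. lam y * (if a = b then 1 else 0))"
      by (rule germ_eq) (use sm qe in simp_all)
    also have "\<dots> = germ lam * (if a = b then 1 else 0)" by (simp add: germ_at_const)
    finally show "frame.ric a b + frame.hess (germ f) a b - \<mu> *\<^sub>R (Df a (germ f) * Df b (germ f))
       = germ lam * (if a = b then 1 else 0)" .
  qed
  define R where "R a b c d = germ_value (frame.curv a b c d)" for a b c d
  have R: "R = c4 x (riemann G x)"
    unfolding R_def frame_curv_germ by (intro ext germ_value_at contract4_smooth smooths)
  interpret a: algebraic_curvature4 R t
  proof
    show "R j i k l = - R i j k l" for i j k l
      unfolding R_def by (subst frame.curv_antisym12) simp
    show "R i j l k = - R i j k l" for i j k l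
      unfolding R_def by (subst frame.curv_antisym34) simp
    show "R k l i j = R i j k l" for i j k l
      unfolding R_def by (subst frame.curv_pair) simp
    show "R i j k l + R j k i l + R k i j l = 0" for i j k l
      using arg_cong[OF frame.curv_cyclic[of i j k l], of germ_value] unfolding R_def by simp
    show "t = 1 \<or> t = -1" by (rule t)
  qed
  have Ric: "a.Ric = c2 x (ricci G x)"
    by (intro ext) (simp only: a.Ric_def F.contract2_ricci R[symmetric])
  have W: "a.W = c4 x (weyl G x)"
  proof -
    have "a.sch = (\<lambda>i k. c2 x (ricci G x) i k / 2 - (\<Sum>a\<in>UNIV. c2 x (ricci G x) a a) / 12 * kronecker i k)"
      by (intro ext) (simp only: a.sch_def Ric)
    then show ?thesis by (intro ext) (simp only: a.W_def F.contract4_weyl R[symmetric])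
  qed
  have half_x: "c4 x (tensor_half s G x T) = half t (c4 x T)" for T
    using F.contract4_tensor_half[OF s] unfolding orient .
  have Z: "a.Z = c4 x (weyl_half s G x)"
    unfolding W weyl_half_def half_x ..
  have Wh: "germ_value (g4.half_weyl i j k l) = a.Z i j k l" for i j k l
    unfolding half_weyl_germ Z by (rule germ_value_at) (rule contract4_smooth, rule weyl_half_smooth)
  define H where "H = c2 x (hessian G f x)"
  have Hv: "germ_value (frame.hess (germ f) i j) = H i j" for i j
    unfolding frame_hess_germ[OF f] H_def by (simp add: contract2_smooth hessian_smooth f)
  have Fv: "germ_value (Df i (germ w)) = (\<Sum>j\<in>UNIV. e j i x * partial j w x)" if "smooth_at x w" for i w
    unfolding frame_grad_germ[OF that] using smooth_at_partial[OF that] by (simp add: smooths)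
  have grad_inner: "grad_inner G w w' x = (\<Sum>a\<in>UNIV. (\<Sum>j\<in>UNIV. e j a x * partial j w x) * (\<Sum>j\<in>UNIV. e j a x * partial j w' x))" for w w'
    unfolding grad_inner_def by (simp only: mult.assoc F.ginv_contract_product)
  have u: "4 * u x = pairing a.Z a.Z"
    unfolding tensor_norm2_def F.tensor_inner_frame Z by simp
  \<comment> \<open>\<open>T1\<close> to \<open>T7\<close> evaluate the terms of the germ identity,
    \<open>T8\<close> and \<open>T9\<close> rewrite those of the claim. Every factor 4 in
    \<open>T1\<close> to \<open>T4\<close> comes from the missing 1/4 in
    \<open>pairing\<close>.\<close>
  have T1: "germ_value (\<Sum>a\<in>UNIV. frame.hess (pairing g4.half_weyl g4.half_weyl) a a) = 4 * laplacian G u x"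
    unfolding pairing_half_weyl_germ frame.hess_scaleR frame_hess_germ[OF norm_smooth] laplacian_def F.ginv_contract_trace
    by (simp add: contract2_smooth hessian_smooth norm_smooth sum_distrib_left)
  have T2: "germ_value (\<Sum>a\<in>UNIV. Df a (germ f) * Df a (pairing g4.half_weyl g4.half_weyl)) = 4 * grad_inner G f u x"
    unfolding pairing_half_weyl_germ grad_inner
    by (simp add: frame.D_scaleR Fv f norm_smooth sum_distrib_left mult.left_commute)
  have T3: "germ_value (\<Sum>a\<in>UNIV. pairing (frame.nabla4 a g4.half_weyl) (frame.nabla4 a g4.half_weyl))
      = 4 * cov_deriv_norm2 G (weyl_half s G) x"
  proof -
    let ?C = "\<lambda>p. c4 x (cov_deriv G (weyl_half s G) x p)"
    have n: "germ_value (frame.nabla4 a g4.half_weyl i j k l) = (\<Sum>p\<in>UNIV. e p a x * ?C p i j k l)" for a i j k l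
      unfolding half_weyl_germ by (rule frame_nabla4_germ) (rule weyl_half_smooth)
    have "cov_deriv_norm2 G (weyl_half s G) x
        = (\<Sum>a\<in>UNIV. \<Sum>p\<in>UNIV. e p a x * (\<Sum>q\<in>UNIV. e q a x * ((1/4) * pairing (?C p) (?C q))))"
      unfolding cov_deriv_norm2_def F.tensor_inner_frame F.ginv_contract ..
    also have "\<dots> = (1/4) * (\<Sum>a\<in>UNIV. pairing (\<lambda>i j k l. \<Sum>p\<in>UNIV. e p a x * ?C p i j k l) (\<lambda>i j k l. \<Sum>p\<in>UNIV. e p a x * ?C p i j k l))"
    proof -
      have "(\<Sum>p\<in>UNIV. e p a x * (\<Sum>q\<in>UNIV. e q a x * ((1/4) * pairing (?C p) (?C q))))
         = (1/4) * pairing (\<lambda>i j k l. \<Sum>p\<in>UNIV. e p a x * ?C p i j k l) (\<lambda>i j k l. \<Sum>p\<in>UNIV. e p a x * ?C p i j k l)" for a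
      proof -
        let ?P = "\<lambda>i j k l p q. 1/4 * ((e p a x * ?C p i j k l) * (e q a x * ?C q i j k l))"
        have "(1/4) * pairing (\<lambda>i j k l. \<Sum>p\<in>UNIV. e p a x * ?C p i j k l) (\<lambda>i j k l. \<Sum>p\<in>UNIV. e p a x * ?C p i j k l)
            = (\<Sum>i\<in>UNIV. \<Sum>j\<in>UNIV. \<Sum>k\<in>UNIV. \<Sum>l\<in>UNIV. \<Sum>p\<in>UNIV. \<Sum>q\<in>UNIV. ?P i j k l p q)"
          unfolding pairing_def sum_product by (simp only: sum_distrib_left)
        also have "\<dots> = (\<Sum>p\<in>UNIV. \<Sum>i\<in>UNIV. \<Sum>j\<in>UNIV. \<Sum>k\<in>UNIV. \<Sum>l\<in>UNIV. \<Sum>q\<in>UNIV. ?P i j k l p q)"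
          by (rule sum_swap_outward4)
        also have "\<dots> = (\<Sum>p\<in>UNIV. \<Sum>q\<in>UNIV. \<Sum>i\<in>UNIV. \<Sum>j\<in>UNIV. \<Sum>k\<in>UNIV. \<Sum>l\<in>UNIV. ?P i j k l p q)"
          by (rule sum.cong[OF refl], rule sum_swap_outward4)
        also have "\<dots> = (\<Sum>p\<in>UNIV. e p a x * (\<Sum>q\<in>UNIV. e q a x * ((1/4) * pairing (?C p) (?C q))))"
          unfolding pairing_def by (simp add: sum_distrib_left ac_simps)
        finally show ?thesis ..
      qed
      then show ?thesis by (simp only: sum_distrib_left)
    qed
    finally show ?thesis by (simp add: pairing_def n)
  qed
  have T4: "germ_value (germ lam * pairing g4.half_weyl g4.half_weyl) = lam x * (4 * u x)"
    unfolding pairing_half_weyl_germ by (simp add: lam norm_smooth)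
  have T5: "germ_value (pairing g4.half_weyl q.quad)
      = pairing a.Z (\<lambda>i j k l. \<Sum>p\<in>UNIV. \<Sum>q\<in>UNIV. R p i j q * R p q k l + R p i k q * R p j q l + R p i l q * R p j k q)"
    unfolding pairing_def by (simp add: Wh R_def q.quad_def)
  have T6: "germ_value (pairing g4.half_weyl (\<lambda>i j k l. \<Sum>q\<in>UNIV. frame.curv i j k q * (Df q (germ f) * Df l (germ f))))
      = pairing a.Z (\<lambda>i j k l. \<Sum>q\<in>UNIV. R i j k q * (?v x q * ?v x l))"
    unfolding pairing_def by (simp add: Wh R_def Fv[OF f])
  have T7: "germ_value (pairing g4.half_weyl (\<lambda>i j k l. frame.hess (germ f) i k * frame.hess (germ f) j l))
      = pairing a.Z (\<lambda>i j k l. H i k * H j l)"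
    unfolding pairing_def by (simp add: Wh Hv)
  have T8: "tensor_inner G x (tensor_half s G x (kulkarni_nomizu (hessian G f x) (hessian G f x))) (weyl_half s G x)
      = pairing a.Z (\<lambda>i j k l. H i k * H j l)"
  proof -
    have "tensor_inner G x (tensor_half s G x (kulkarni_nomizu (hessian G f x) (hessian G f x))) (weyl_half s G x)
      = 1/4 * pairing (half t (kn H H)) a.Z"
      unfolding F.tensor_inner_frame half_x contract4_kn H_def[symmetric] Z[symmetric] ..
    also have "pairing (half t (kn H H)) a.Z = pairing a.Z (half t (kn H H))" by (rule pairing_commute)
    also have "\<dots> = pairing a.Z (kn H H)" using t by (intro pairing_half_half) auto
    finally show ?thesis unfolding a.pairing_kn_square by simp
  qed
  \<comment> \<open>The operator has twice the transpose of \<open>A0\<close> as matrix, and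
    doubling a matrix of order three multiplies its determinant by 8.\<close>
  have T9: "det_weyl_half s G x = 8 * a.detA"
  proof -
    have "det_weyl_half s G x = det ((\<chi> i j. 2 * a.A0 j i) :: real^3^3)"
      unfolding det_weyl_half_def
    proof (rule F.endo_det3_half[OF s])
      fix i j k l
      show "c4 x (weyl_half s G x) i j k l
        = (\<Sum>r\<in>UNIV. \<Sum>r'\<in>UNIV. half_basis (s * F.orient) r i j * half_basis (s * F.orient) r' k l * a.A0 r r')"
        unfolding Z[symmetric] orient half_expand a.A0_def by (simp add: sum_divide_distrib)
    qed
    then show ?thesis unfolding det_3 a.detA_def by (simp add: algebra_simps)
  qed
  have "a.Ric i k = lam x * kronecker i k - H i k + \<mu> * (?v x i * ?v x k)" for i k
    using qe[OF x, of i k] unfolding Ric H_def kronecker_def by (simp add: algebra_simps)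
  \<comment> \<open>The germ identity contains the curvature terms exactly as four times the
    combination treated here.\<close>
  from a.quasi_einstein_algebra[of "lam x" H \<mu> "?v x", OF this]
  have alg: "pairing a.Z (\<lambda>i j k l. \<Sum>p\<in>UNIV. \<Sum>q\<in>UNIV. R p i j q * R p q k l + R p i k q * R p j q l + R p i l q * R p j k q)
      + 2 * \<mu> * pairing a.Z (\<lambda>i j k l. \<Sum>q\<in>UNIV. R i j k q * (?v x q * ?v x l))
    = - 288 * a.detA - pairing a.Z (\<lambda>i j k l. H i k * H j l) + \<mu> * grad_inner G f f x * (4 * u x) / 2"
    unfolding u grad_inner power2_eq_square .
  have "germ_value ((\<Sum>a\<in>UNIV. frame.hess (pairing g4.half_weyl g4.half_weyl) a a)
        - (\<Sum>a\<in>UNIV. Df a (germ f) * Df a (pairing g4.half_weyl g4.half_weyl)))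
     = germ_value (2 * (\<Sum>a\<in>UNIV. pairing (frame.nabla4 a g4.half_weyl) (frame.nabla4 a g4.half_weyl))
       + 4 * (germ lam * pairing g4.half_weyl g4.half_weyl) + 4 * pairing g4.half_weyl q.quad
       + \<mu> *\<^sub>R (8 * pairing g4.half_weyl (\<lambda>i j k l. \<Sum>q\<in>UNIV. frame.curv i j k q * (Df q (germ f) * Df l (germ f)))
                - 8 * pairing g4.half_weyl (\<lambda>i j k l. frame.hess (germ f) i k * frame.hess (germ f) j l)))"
    by (rule arg_cong[OF q.weighted_laplacian_half_weyl])
  then have "4 * laplacian G u x - 4 * grad_inner G f u x
     = 2 * (4 * cov_deriv_norm2 G (weyl_half s G) x) + 4 * (lam x * (4 * u x))
       + 4 * pairing a.Z (\<lambda>i j k l. \<Sum>p\<in>UNIV. \<Sum>q\<in>UNIV. R p i j q * R p q k l + R p i k q * R p j q l + R p i l q * R p j k q)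
       + \<mu> * (8 * pairing a.Z (\<lambda>i j k l. \<Sum>q\<in>UNIV. R i j k q * (?v x q * ?v x l))
              - 8 * pairing a.Z (\<lambda>i j k l. H i k * H j l))"
    unfolding germ_value_simps(3,4,7) germ_value_simps(5)[of "numeral k" for k] germ_value_numeral T1 T2 T3 T4 T5 T6 T7 .
  with alg show ?thesis
    unfolding weighted_laplacian_def T8 T9 by (simp add: algebra_simps)
qed

end

theorem theorem1p3:
  fixes X :: "'a topology"
    and A :: "('a, 4) chart set"
    and g :: "('a, 4) chart \<Rightarrow> 4 metric"
    and f lam :: "'a \<Rightarrow> real"
    and m :: ereal
    and s :: real
  assumes "oriented_riemannian_manifold X A g"
    and "generalized_quasi_einstein A g m f lam"
    and "s = 1 \<or> s = -1"
    and "c \<in> A" and "p \<in> fst c"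
  shows
    "weighted_laplacian (g c) (coord_rep c f)
       (\<lambda>y. tensor_norm2 (g c) y (weyl_half s (g c) y)) (snd c p)
     = 2 * cov_deriv_norm2 (g c) (weyl_half s (g c)) (snd c p)
       + (4 * lam p + 2 * recip m * grad_inner (g c) (coord_rep c f) (coord_rep c f) (snd c p))
         * tensor_norm2 (g c) (snd c p) (weyl_half s (g c) (snd c p))
       - 36 * det_weyl_half s (g c) (snd c p)
       - (1 + 2 * recip m)
         * tensor_inner (g c) (snd c p)
             (tensor_half s (g c) (snd c p)
                (kulkarni_nomizu (hessian (g c) (coord_rep c f) (snd c p))
                                 (hessian (g c) (coord_rep c f) (snd c p))))
             (weyl_half s (g c) (snd c p))"
proof -
  interpret oriented_riemannian_manifold X A g by fact
  let ?U = "chart_image c"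
  have qe: "smooth_fun A f" "smooth_fun A lam"
    "\<And>q i j. q \<in> fst c \<Longrightarrow> ricci (g c) (snd c q) i j + hessian (g c) (coord_rep c f) (snd c q) i j
        - recip m * partial i (coord_rep c f) (snd c q) * partial j (coord_rep c f) (snd c q)
        = lam q * g c (snd c q) $ i $ j"
    using assms(2,4) unfolding generalized_quasi_einstein_def by blast+
  have open_U: "open ?U" by (rule chart_image_open[OF assms(4)])
  have in_U: "snd c p \<in> ?U" using assms(5) by blast
  have sub: "fst c \<subseteq> topspace X" using chart_domain_open[OF assms(4)] by (rule openin_subset)
  have "inj_on (snd c) (topspace (subtopology X (fst c)))"
    by (rule homeomorphic_imp_injective_map[OF chart_homeomorphic[OF assms(4)]])
  then have inj: "inj_on (snd c) (fst c)" using sub by (simp add: Int_absorb1)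
  \<comment> \<open>\<open>coord_rep\<close> goes back to the manifold by \<open>inv_into\<close>,
    which undoes the chart because the chart is injective on its domain.\<close>
  have rep: "coord_rep c w (snd c q) = w q" if "q \<in> fst c" for w :: "'a \<Rightarrow> real" and q
    unfolding coord_rep_def using inv_into_f_f[OF inj that] by simp
  obtain V e where V: "snd c p \<in> V" "V \<subseteq> ?U" and e: "smooth_frame (g c) V e"
    by (rule smooth_frame_exists[OF open_U in_U metric_smooth[OF assms(4)] metric_symmetric[OF assms(4)] metric_positive[OF assms(4)]])
  interpret smooth_frame4 "g c" V e "snd c p" s
    by (rule smooth_frame4.intro[OF smooth_frame_at.intro[OF e smooth_frame_at_axioms.intro[OF V(1)]] smooth_frame4_axioms.intro[OF assms(3)]])
  have smooth: "smooth_at (snd c p) (coord_rep c w)" if "smooth_fun A w" for w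
    unfolding smooth_at_def by (rule exI[of _ ?U]) (use that assms(4) open_U in_U in \<open>auto simp: smooth_fun_def\<close>)
  have "weighted_laplacian (g c) (coord_rep c f)
       (\<lambda>y. tensor_norm2 (g c) y (weyl_half s (g c) y)) (snd c p)
     = 2 * cov_deriv_norm2 (g c) (weyl_half s (g c)) (snd c p)
       + (4 * coord_rep c lam (snd c p) + 2 * recip m * grad_inner (g c) (coord_rep c f) (coord_rep c f) (snd c p))
         * tensor_norm2 (g c) (snd c p) (weyl_half s (g c) (snd c p))
       - 36 * det_weyl_half s (g c) (snd c p)
       - (1 + 2 * recip m)
         * tensor_inner (g c) (snd c p)
             (tensor_half s (g c) (snd c p)
                (kulkarni_nomizu (hessian (g c) (coord_rep c f) (snd c p))
                                 (hessian (g c) (coord_rep c f) (snd c p))))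
             (weyl_half s (g c) (snd c p))"
  proof (rule weighted_laplacian_chart[OF smooth[OF qe(1)] smooth[OF qe(2)]])
    fix y i j assume "y \<in> V"
    then obtain q where q: "q \<in> fst c" "y = snd c q" using V(2) by blast
    show "ricci (g c) y i j + hessian (g c) (coord_rep c f) y i j
        - recip m * partial i (coord_rep c f) y * partial j (coord_rep c f) y = coord_rep c lam y * g c y $ i $ j"
      unfolding q(2) rep[OF q(1)] by (rule qe(3)[OF q(1)])
  qed
  then show ?thesis unfolding rep[OF assms(5)] .
qed

end
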